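(* Let $(M,\omega)$ be a closed symplectic manifold equipped with a Riemannian metric $g$, and let $\Phi=\phi_{(U,\mathcal H)}$ be a symplectic isotopy with generator $(U,\mathcal H)$. Then there exists a Hamiltonian loop $\phi_{(r,0)}$ which is close to the constant loop identity (in the $C^\infty$-sense), and whose generating function $r$ is in particular arbitrarily small in the $L^{(1,\infty)}$ version of Hofer's norm, such that $\mathrm{osc}(-r_t+U_t)\neq0$ for all $t\in[0,1]$. Moreover, setting $$(V,\mathcal K)=\overline{(r,0)}\Join(U,\mathcal H)=\big(-r\circ\phi_{(r,0)}+U\circ\phi_{(r,0)}+\widetilde\Delta(\mathcal H,\phi_{(r,0)}),\ \mathcal H\big),$$ the symplectic isotopy generated by $(V,\mathcal K)$ is regular.
   Context: $M$ has dimension $2n$. A symplectic isotopy is a smooth path $\Phi=\{\phi_t\}_{t\in[0,1]}$ of diffeomorphisms with $\phi_0=\mathrm{id}$ such that for each $t$ the vector field $\dot\phi_t:=\frac{d\phi_t}{dt}\circ\phi_t^{-1}$ satisfies $d(\iota(\dot\phi_t)\omega)=0$. By Hodge theory $\iota(\dot\phi_t)\omega=dU_t+\mathcal H_t$ with $\mathcal H_t$ a $g$-harmonic $1$-form and $U_t$ a smooth function normalized by $\int_MU_t\,\omega^n=0$; the pair $(U,\mathcal H)$ is called the generator of $\Phi$, and one writes $\Phi=\phi_{(U,\mathcal H)}$, with $\phi_{(U,\mathcal H)}^t=\phi_t$. The correspondence between symplectic isotopies and generators is a bijection; $\Join$ and the bar denote the product and the inverse on generators corresponding to pointwise (in $t$)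 composition and inversion of isotopies. Compositions such as $U\circ\phi_{(r,0)}$ are taken at each time $t$: $U_t\circ\phi_{(r,0)}^t$. For a smooth family $\mathcal H=(\mathcal H_t)$ of harmonic $1$-forms and an isotopy $\Theta=\{\theta_t\}$, $\widetilde\Delta_t(\mathcal H,\Theta)$ is the function $\Delta_t(\mathcal H,\Theta)=\int_0^t\mathcal H_t(\dot\theta_s)\circ\theta_s\,ds$ normalized to have zero integral against $\omega^n$. A Hamiltonian loop $\phi_{(r,0)}$ is a symplectic isotopy with zero harmonic part whose time-one map is the identity. $\mathrm{osc}(f)=\max_Mf-\min_Mf$, and the $L^{(1,\infty)}$ Hofer norm of $r$ is $\int_0^1\mathrm{osc}(r_t)\,dt$. A symplectic isotopy $\{\phi_t\}$ is regular if for every $t$ the tangent vector $\dot\phi_t$ to the path does not vanish, i.e. the vector field $\dot\phi_t$ is not identically zero. *)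

theory Defs
  imports "HOL-Analysis.Analysis" "HOL-Combinatorics.Permutations"
begin

section \<open>Smoothness in Euclidean space\<close>

text \<open>
  \<open>nder f S [v\<^sub>k, ..., v\<^sub>1]\<close> is the iterated directional derivative of \<open>f\<close>, first along \<open>v\<^sub>1\<close>,
  last along \<open>v\<^sub>k\<close>. All derivatives are taken within \<open>S\<close>. The sets used below are relatively open
  subsets of \<open>W\<close> or of \<open>{0..1} \<times> W\<close> with \<open>W\<close> open, where derivatives within \<open>S\<close> are unique;
  at the times 0 and 1 they are one-sided in the time direction.
\<close>

primrec nder :: "('a::euclidean_space \<Rightarrow> 'b::euclidean_space) \<Rightarrow> 'a set \<Rightarrow> 'a list \<Rightarrow> 'a \<Rightarrow> 'b" where
  "nder f S [] = f"
| "nder f S (v # vs) = (\<lambda>x. frechet_derivative (nder f S vs) (at x within S) v)"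

definition smooth_on :: "'a::euclidean_space set \<Rightarrow> ('a \<Rightarrow> 'b::euclidean_space) \<Rightarrow> bool" where
  "smooth_on S f \<longleftrightarrow> (\<forall>vs. nder f S vs differentiable_on S)"

abbreviation partial :: "'n::finite \<Rightarrow> (real^'n \<Rightarrow> real) \<Rightarrow> real^'n \<Rightarrow> real" where
  "partial i f x \<equiv> frechet_derivative f (at x) (axis i 1)"


section \<open>Manifolds\<close>

text \<open>
  A manifold is a whole Hausdorff, second countable type \<open>'m\<close> with a (not necessarily maximal)
  smooth atlas. A chart is a pair of its domain and its coordinate map.
\<close>

type_synonym ('m, 'n) chart = "'m set \<times> ('m \<Rightarrow> real^'n)"

definition cdom :: "('m, 'n::finite) chart \<Rightarrow> 'm set" where
  "cdom c = fst c"

definition cmap :: "('m, 'n::finite) chart \<Rightarrow> 'm \<Rightarrow> real^'n" where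
  "cmap c = snd c"

definition cimg :: "('m, 'n::finite) chart \<Rightarrow> (real^'n) set" where
  "cimg c = cmap c ` cdom c"

definition cinv :: "('m, 'n::finite) chart \<Rightarrow> real^'n \<Rightarrow> 'm" where
  "cinv c = inv_into (cdom c) (cmap c)"

definition smooth_atlas ::
  "('m::{t2_space, second_countable_topology}, 'n::finite) chart set \<Rightarrow> bool" where
  "smooth_atlas A \<longleftrightarrow>
     (\<Union>c\<in>A. cdom c) = UNIV \<and>
     (\<forall>c\<in>A. open (cdom c) \<and> open (cimg c) \<and> homeomorphism (cdom c) (cimg c) (cmap c) (cinv c)) \<and>
     (\<forall>c\<in>A. \<forall>c'\<in>A. smooth_on (cmap c ` (cdom c \<inter> cdom c')) (cmap c' \<circ> cinv c))"

definition closed_manifold ::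
  "('m::{t2_space, second_countable_topology}, 'n::finite) chart set \<Rightarrow> bool" where
  "closed_manifold A \<longleftrightarrow> smooth_atlas A \<and> compact (UNIV :: 'm set)"

definition transition_deriv ::
  "('m, 'n::finite) chart \<Rightarrow> ('m, 'n) chart \<Rightarrow> 'm \<Rightarrow> real^'n \<Rightarrow> real^'n" where
  "transition_deriv c c' p = frechet_derivative (cmap c' \<circ> cinv c) (at (cmap c p))"

definition some_chart :: "('m, 'n::finite) chart set \<Rightarrow> 'm \<Rightarrow> ('m, 'n) chart" where
  "some_chart A p = (SOME c. c \<in> A \<and> p \<in> cdom c)"

definition smooth_map ::
  "('m::{t2_space, second_countable_topology}, 'n::finite) chart set \<Rightarrow> ('m \<Rightarrow> 'm) \<Rightarrow> bool" where
  "smooth_map A f \<longleftrightarrow> continuous_on UNIV f \<and>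
     (\<forall>c\<in>A. \<forall>c'\<in>A. smooth_on {x \<in> cimg c. f (cinv c x) \<in> cdom c'} (\<lambda>x. cmap c' (f (cinv c x))))"

definition diffeomorphism ::
  "('m::{t2_space, second_countable_topology}, 'n::finite) chart set \<Rightarrow> ('m \<Rightarrow> 'm) \<Rightarrow> bool" where
  "diffeomorphism A f \<longleftrightarrow> bij f \<and> smooth_map A f \<and> smooth_map A (inv f)"


section \<open>Tensor fields\<close>

text \<open>
  A tensor field is given by its components in every chart of the atlas, as functions of the
  coordinates, subject to the usual transformation law. Values at arguments outside the atlas or
  outside the image of a chart carry no meaning.
\<close>

type_synonym ('m, 'n) scalar = "('m, 'n) chart \<Rightarrow> real^'n \<Rightarrow> real"
type_synonym ('m, 'n) vfield = "('m, 'n) chart \<Rightarrow> real^'n \<Rightarrow> real^'n"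
type_synonym ('m, 'n) form1 = "('m, 'n) chart \<Rightarrow> real^'n \<Rightarrow> real^'n \<Rightarrow> real"
type_synonym ('m, 'n) form2 = "('m, 'n) chart \<Rightarrow> real^'n \<Rightarrow> real^'n \<Rightarrow> real^'n \<Rightarrow> real"

definition scalar_rep :: "('m \<Rightarrow> real) \<Rightarrow> ('m, 'n::finite) scalar" where
  "scalar_rep f c x = f (cinv c x)"

definition one_form :: "('m, 'n::finite) chart set \<Rightarrow> ('m, 'n) form1 \<Rightarrow> bool" where
  "one_form A \<alpha> \<longleftrightarrow>
     (\<forall>c\<in>A. \<forall>x\<in>cimg c. linear (\<alpha> c x)) \<and>
     (\<forall>c\<in>A. \<forall>v. smooth_on (cimg c) (\<lambda>x. \<alpha> c x v)) \<and>
     (\<forall>c\<in>A. \<forall>c'\<in>A. \<forall>p\<in>cdom c \<inter> cdom c'. \<forall>v.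
        \<alpha> c (cmap c p) v = \<alpha> c' (cmap c' p) (transition_deriv c c' p v))"

definition bilinear_field :: "('m, 'n::finite) chart set \<Rightarrow> ('m, 'n) form2 \<Rightarrow> bool" where
  "bilinear_field A \<beta> \<longleftrightarrow>
     (\<forall>c\<in>A. \<forall>x\<in>cimg c. bilinear (\<beta> c x)) \<and>
     (\<forall>c\<in>A. \<forall>u v. smooth_on (cimg c) (\<lambda>x. \<beta> c x u v)) \<and>
     (\<forall>c\<in>A. \<forall>c'\<in>A. \<forall>p\<in>cdom c \<inter> cdom c'. \<forall>u v.
        \<beta> c (cmap c p) u v =
        \<beta> c' (cmap c' p) (transition_deriv c c' p u) (transition_deriv c c' p v))"

definition ext_d0 :: "('m, 'n::finite) scalar \<Rightarrow> ('m, 'n) form1" where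
  "ext_d0 f c x v = frechet_derivative (f c) (at x) v"

definition ext_d1 :: "('m, 'n::finite) form1 \<Rightarrow> ('m, 'n) form2" where
  "ext_d1 \<alpha> c x u v =
     frechet_derivative (\<lambda>y. \<alpha> c y v) (at x) u - frechet_derivative (\<lambda>y. \<alpha> c y u) (at x) v"

definition ext_d2 ::
  "('m, 'n::finite) form2 \<Rightarrow> ('m, 'n) chart \<Rightarrow> real^'n \<Rightarrow> real^'n \<Rightarrow> real^'n \<Rightarrow> real^'n \<Rightarrow> real" where
  "ext_d2 \<beta> c x u v w =
     frechet_derivative (\<lambda>y. \<beta> c y v w) (at x) u
     - frechet_derivative (\<lambda>y. \<beta> c y u w) (at x) v
     + frechet_derivative (\<lambda>y. \<beta> c y u v) (at x) w"

definition interior_prod :: "('m, 'n::finite) vfield \<Rightarrow> ('m, 'n) form2 \<Rightarrow> ('m, 'n) form1" where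
  "interior_prod X \<beta> c x v = \<beta> c x (X c x) v"

text \<open>The function \<open>\<alpha>(X)\<close> at a point; for genuine tensor fields the choice of chart is irrelevant.\<close>

definition pairing :: "('m, 'n::finite) chart set \<Rightarrow> ('m, 'n) form1 \<Rightarrow> ('m, 'n) vfield \<Rightarrow> 'm \<Rightarrow> real" where
  "pairing A \<alpha> X p = (let c = some_chart A p; x = cmap c p in \<alpha> c x (X c x))"

definition symplectic_form :: "('m, 'n::finite) chart set \<Rightarrow> ('m, 'n) form2 \<Rightarrow> bool" where
  "symplectic_form A \<omega> \<longleftrightarrow> bilinear_field A \<omega> \<and>
     (\<forall>c\<in>A. \<forall>x\<in>cimg c.
        (\<forall>v. \<omega> c x v v = 0) \<and>
        (\<forall>u. u \<noteq> 0 \<longrightarrow> (\<exists>v. \<omega> c x u v \<noteq> 0)) \<and>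
        (\<forall>u v w. ext_d2 \<omega> c x u v w = 0))"

definition closed_symplectic_manifold ::
  "('m::{t2_space, second_countable_topology}, 'n::finite) chart set \<Rightarrow> ('m, 'n) form2 \<Rightarrow> bool" where
  "closed_symplectic_manifold A \<omega> \<longleftrightarrow> closed_manifold A \<and> symplectic_form A \<omega>"

definition riemannian_metric :: "('m, 'n::finite) chart set \<Rightarrow> ('m, 'n) form2 \<Rightarrow> bool" where
  "riemannian_metric A g \<longleftrightarrow> bilinear_field A g \<and>
     (\<forall>c\<in>A. \<forall>x\<in>cimg c. (\<forall>u v. g c x u v = g c x v u) \<and> (\<forall>v. v \<noteq> 0 \<longrightarrow> g c x v v > 0))"


section \<open>Harmonic 1-forms\<close>

definition metric_matrix :: "('m, 'n::finite) form2 \<Rightarrow> ('m, 'n) chart \<Rightarrow> real^'n \<Rightarrow> real^'n^'n" where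
  "metric_matrix g c x = (\<chi> i j. g c x (axis i 1) (axis j 1))"

definition metric_inverse :: "('m, 'n::finite) form2 \<Rightarrow> ('m, 'n) chart \<Rightarrow> real^'n \<Rightarrow> real^'n^'n" where
  "metric_inverse g c x = matrix_inv (metric_matrix g c x)"

definition metric_density :: "('m, 'n::finite) form2 \<Rightarrow> ('m, 'n) chart \<Rightarrow> real^'n \<Rightarrow> real" where
  "metric_density g c x = sqrt (det (metric_matrix g c x))"

text \<open>
  Codifferentials in coordinates, with \<open>\<rho> = sqrt (det g)\<close>:
  \<open>\<delta>\<alpha> = - \<rho>\<^sup>-\<^sup>1 \<partial>\<^sub>i (\<rho> g\<^sup>i\<^sup>j \<alpha>\<^sub>j)\<close> on 1-forms and
  \<open>(\<delta>\<beta>)\<^sub>l = - g\<^sub>l\<^sub>k \<rho>\<^sup>-\<^sup>1 \<partial>\<^sub>i (\<rho> g\<^sup>i\<^sup>a g\<^sup>k\<^sup>b \<beta>\<^sub>a\<^sub>b)\<close> on 2-forms.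
\<close>

definition codiff1 :: "('m, 'n::finite) form2 \<Rightarrow> ('m, 'n) form1 \<Rightarrow> ('m, 'n) scalar" where
  "codiff1 g \<alpha> c x =
     - (1 / metric_density g c x) *
       (\<Sum>i\<in>UNIV. partial i (\<lambda>y. metric_density g c y *
          (\<Sum>j\<in>UNIV. metric_inverse g c y $ i $ j * \<alpha> c y (axis j 1))) x)"

definition codiff2 :: "('m, 'n::finite) form2 \<Rightarrow> ('m, 'n) form2 \<Rightarrow> ('m, 'n) form1" where
  "codiff2 g \<beta> c x v =
     - (\<Sum>l\<in>UNIV. v $ l * (\<Sum>k\<in>UNIV. metric_matrix g c x $ l $ k * (1 / metric_density g c x) *
       (\<Sum>i\<in>UNIV. partial i (\<lambda>y. metric_density g c y *
          (\<Sum>a\<in>UNIV. \<Sum>b\<in>UNIV. metric_inverse g c y $ i $ a * metric_inverse g c y $ k $ b *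
             \<beta> c y (axis a 1) (axis b 1))) x)))"

definition hodge_laplacian :: "('m, 'n::finite) form2 \<Rightarrow> ('m, 'n) form1 \<Rightarrow> ('m, 'n) form1" where
  "hodge_laplacian g \<alpha> c x v = ext_d0 (codiff1 g \<alpha>) c x v + codiff2 g (ext_d1 \<alpha>) c x v"

definition harmonic :: "('m, 'n::finite) chart set \<Rightarrow> ('m, 'n) form2 \<Rightarrow> ('m, 'n) form1 \<Rightarrow> bool" where
  "harmonic A g \<alpha> \<longleftrightarrow> one_form A \<alpha> \<and> (\<forall>c\<in>A. \<forall>x\<in>cimg c. \<forall>v. hodge_laplacian g \<alpha> c x v = 0)"


section \<open>Integration against the top power of the symplectic form\<close>

text \<open>
  The value of the \<open>n\<close>-fold wedge power \<open>B \<and> ... \<and> B\<close> of an alternating bilinear form on the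
  vectors \<open>v 0, ..., v (2 n - 1)\<close>.
\<close>

definition wedge_power :: "nat \<Rightarrow> ('a \<Rightarrow> 'a \<Rightarrow> real) \<Rightarrow> (nat \<Rightarrow> 'a) \<Rightarrow> real" where
  "wedge_power n B v =
     (\<Sum>p | p permutes {..<2 * n}. of_int (sign p) * (\<Prod>i<n. B (v (p (2 * i))) (v (p (2 * i + 1))))) / 2 ^ n"

text \<open>
  \<open>M\<close> is oriented by \<open>\<omega>\<^sup>n\<close>, so in coordinates \<open>\<omega>\<^sup>n\<close> integrates like Lebesgue measure with the
  density below. The absolute value makes it independent of the enumeration of the coordinates.
\<close>

definition liouville_density :: "('m, 'n::finite) form2 \<Rightarrow> ('m, 'n) chart \<Rightarrow> real^'n \<Rightarrow> real" where
  "liouville_density \<omega> c x =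
     (let e = (SOME e. bij_betw e {..<CARD('n)} (UNIV :: 'n set))
      in \<bar>wedge_power (CARD('n) div 2) (\<omega> c x) (\<lambda>i. axis (e i) 1)\<bar>)"

text \<open>
  The measure of \<open>\<omega>\<^sup>n\<close> is the unique Borel measure with that density in every chart (unique because
  countably many chart domains cover, existent by the change of variables formula).
\<close>

definition liouville ::
  "('m::{t2_space, second_countable_topology}, 'n::finite) chart set \<Rightarrow> ('m, 'n) form2 \<Rightarrow> 'm measure" where
  "liouville A \<omega> = (THE \<mu>. sets \<mu> = sets borel \<and>
     (\<forall>c\<in>A. \<forall>B\<in>sets borel. B \<subseteq> cdom c \<longrightarrow>
        emeasure \<mu> B =
        (\<integral>\<^sup>+ x. ennreal (liouville_density \<omega> c x) * indicator (cmap c ` B) x \<partial>lborel)))"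

definition normalize ::
  "('m::{t2_space, second_countable_topology}, 'n::finite) chart set \<Rightarrow> ('m, 'n) form2 \<Rightarrow>
     ('m \<Rightarrow> real) \<Rightarrow> 'm \<Rightarrow> real" where
  "normalize A \<omega> f p = f p - integral\<^sup>L (liouville A \<omega>) f / measure (liouville A \<omega>) UNIV"


section \<open>Paths of maps and the \<open>C\<^sup>\<infinity>\<close> topology\<close>

text \<open>Paths are functions of real time, of which only the times in \<open>{0..1}\<close> matter.\<close>

definition path_dom ::
  "(real \<Rightarrow> 'm \<Rightarrow> 'm) \<Rightarrow> ('m, 'n::finite) chart \<Rightarrow> ('m, 'n) chart \<Rightarrow> (real \<times> (real^'n)) set" where
  "path_dom \<phi> c c' = {(t, x). t \<in> {0..1} \<and> x \<in> cimg c \<and> \<phi> t (cinv c x) \<in> cdom c'}"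

definition path_rep ::
  "(real \<Rightarrow> 'm \<Rightarrow> 'm) \<Rightarrow> ('m, 'n::finite) chart \<Rightarrow> ('m, 'n) chart \<Rightarrow> real \<times> (real^'n) \<Rightarrow> real^'n" where
  "path_rep \<phi> c c' = (\<lambda>(t, x). cmap c' (\<phi> t (cinv c x)))"

definition smooth_path ::
  "('m::{t2_space, second_countable_topology}, 'n::finite) chart set \<Rightarrow> (real \<Rightarrow> 'm \<Rightarrow> 'm) \<Rightarrow> bool" where
  "smooth_path A \<phi> \<longleftrightarrow> continuous_on ({0..1} \<times> UNIV) (\<lambda>(t, p). \<phi> t p) \<and>
     (\<forall>c\<in>A. \<forall>c'\<in>A. smooth_on (path_dom \<phi> c c') (path_rep \<phi> c c'))"

text \<open>
  The \<open>C\<^sup>\<infinity>\<close> (Whitney) topology on smooth maps \<open>[0,1] \<times> M \<rightarrow> M\<close>, generated by the usual subbasic sets: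
  \<open>\<psi>\<close> maps the compact set \<open>K\<close> into the target chart and its derivatives in space and time up to
  order \<open>k\<close> are \<open>e\<close>-close on \<open>K\<close> to those of \<open>\<phi>\<close>.
\<close>

definition cinf_basic ::
  "('m::{t2_space, second_countable_topology}, 'n::finite) chart set \<Rightarrow> (real \<Rightarrow> 'm \<Rightarrow> 'm) \<Rightarrow>
     ('m, 'n) chart \<Rightarrow> ('m, 'n) chart \<Rightarrow> (real \<times> 'm) set \<Rightarrow> nat \<Rightarrow> real \<Rightarrow> (real \<Rightarrow> 'm \<Rightarrow> 'm) set" where
  "cinf_basic A \<phi> c c' K k e = {\<psi>. smooth_path A \<psi> \<and>
     (\<forall>(t, p)\<in>K. \<psi> t p \<in> cdom c' \<and>
        (\<forall>vs. set vs \<subseteq> Basis \<and> length vs \<le> k \<longrightarrow>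
           norm (nder (path_rep \<psi> c c') (path_dom \<psi> c c') vs (t, cmap c p)
               - nder (path_rep \<phi> c c') (path_dom \<phi> c c') vs (t, cmap c p)) < e))}"

definition cinf_topology ::
  "('m::{t2_space, second_countable_topology}, 'n::finite) chart set \<Rightarrow> (real \<Rightarrow> 'm \<Rightarrow> 'm) topology" where
  "cinf_topology A = topology_generated_by
     {cinf_basic A \<phi> c c' K k e | \<phi> c c' K k e.
        smooth_path A \<phi> \<and> c \<in> A \<and> c' \<in> A \<and> compact K \<and> K \<subseteq> {0..1} \<times> cdom c \<and>
        (\<forall>(t, p)\<in>K. \<phi> t p \<in> cdom c') \<and> 0 < e}"


section \<open>Symplectic isotopies and their generators\<close>

text \<open>The vector field \<open>(d\<phi>\<^sub>t/dt) \<circ> \<phi>\<^sub>t\<^sup>-\<^sup>1\<close>, with one-sided derivatives at the times 0 and 1.\<close>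

definition velocity :: "(real \<Rightarrow> 'm \<Rightarrow> 'm) \<Rightarrow> real \<Rightarrow> ('m, 'n::finite) vfield" where
  "velocity \<phi> t c x =
     vector_derivative (\<lambda>s. cmap c (\<phi> s (inv (\<phi> t) (cinv c x)))) (at t within {0..1})"

definition symplectic_isotopy ::
  "('m::{t2_space, second_countable_topology}, 'n::finite) chart set \<Rightarrow> ('m, 'n) form2 \<Rightarrow>
     (real \<Rightarrow> 'm \<Rightarrow> 'm) \<Rightarrow> bool" where
  "symplectic_isotopy A \<omega> \<phi> \<longleftrightarrow>
     smooth_path A \<phi> \<and> (\<forall>t\<in>{0..1}. diffeomorphism A (\<phi> t)) \<and> \<phi> 0 = id \<and>
     (\<forall>t\<in>{0..1}. \<forall>c\<in>A. \<forall>x\<in>cimg c. \<forall>u v.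
        ext_d1 (interior_prod (velocity \<phi> t) \<omega>) c x u v = 0)"

definition smooth_function_family ::
  "('m, 'n::finite) chart set \<Rightarrow> (real \<Rightarrow> 'm \<Rightarrow> real) \<Rightarrow> bool" where
  "smooth_function_family A U \<longleftrightarrow> (\<forall>c\<in>A. smooth_on ({0..1} \<times> cimg c) (\<lambda>(t, x). U t (cinv c x)))"

definition smooth_form_family ::
  "('m, 'n::finite) chart set \<Rightarrow> (real \<Rightarrow> ('m, 'n) form1) \<Rightarrow> bool" where
  "smooth_form_family A H \<longleftrightarrow> (\<forall>c\<in>A. \<forall>v. smooth_on ({0..1} \<times> cimg c) (\<lambda>(t, x). H t c x v))"

text \<open>\<open>generates A \<omega> g (U, H) \<phi>\<close>: \<open>\<phi>\<close> is a symplectic isotopy with generator \<open>(U, H)\<close>.\<close>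

definition generates ::
  "('m::{t2_space, second_countable_topology}, 'n::finite) chart set \<Rightarrow> ('m, 'n) form2 \<Rightarrow> ('m, 'n) form2 \<Rightarrow>
     (real \<Rightarrow> 'm \<Rightarrow> real) \<times> (real \<Rightarrow> ('m, 'n) form1) \<Rightarrow> (real \<Rightarrow> 'm \<Rightarrow> 'm) \<Rightarrow> bool" where
  "generates A \<omega> g = (\<lambda>(U, H) \<phi>.
     symplectic_isotopy A \<omega> \<phi> \<and> smooth_function_family A U \<and> smooth_form_family A H \<and>
     (\<forall>t\<in>{0..1}. harmonic A g (H t) \<and> integral\<^sup>L (liouville A \<omega>) (U t) = 0 \<and>
        (\<forall>c\<in>A. \<forall>x\<in>cimg c. \<forall>v.
           interior_prod (velocity \<phi> t) \<omega> c x v = ext_d0 (scalar_rep (U t)) c x v + H t c x v)))"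

definition zero_forms :: "real \<Rightarrow> ('m, 'n::finite) form1" where
  "zero_forms = (\<lambda>t c x v. 0)"

definition hamiltonian_loop ::
  "('m::{t2_space, second_countable_topology}, 'n::finite) chart set \<Rightarrow> ('m, 'n) form2 \<Rightarrow> ('m, 'n) form2 \<Rightarrow>
     (real \<Rightarrow> 'm \<Rightarrow> real) \<Rightarrow> (real \<Rightarrow> 'm \<Rightarrow> 'm) \<Rightarrow> bool" where
  "hamiltonian_loop A \<omega> g r \<theta> \<longleftrightarrow> generates A \<omega> g (r, zero_forms) \<theta> \<and> \<theta> 1 = id"

definition isotopy_comp :: "(real \<Rightarrow> 'm \<Rightarrow> 'm) \<Rightarrow> (real \<Rightarrow> 'm \<Rightarrow> 'm) \<Rightarrow> real \<Rightarrow> 'm \<Rightarrow> 'm" where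
  "isotopy_comp \<phi> \<psi> t = \<phi> t \<circ> \<psi> t"

definition isotopy_inv :: "(real \<Rightarrow> 'm \<Rightarrow> 'm) \<Rightarrow> real \<Rightarrow> 'm \<Rightarrow> 'm" where
  "isotopy_inv \<phi> t = inv (\<phi> t)"

definition Delta ::
  "('m, 'n::finite) chart set \<Rightarrow> (real \<Rightarrow> ('m, 'n) form1) \<Rightarrow> (real \<Rightarrow> 'm \<Rightarrow> 'm) \<Rightarrow> real \<Rightarrow> 'm \<Rightarrow> real" where
  "Delta A H \<theta> t p = integral {0..t} (\<lambda>s. pairing A (H t) (velocity \<theta> s) (\<theta> s p))"

definition Delta_normalized ::
  "('m::{t2_space, second_countable_topology}, 'n::finite) chart set \<Rightarrow> ('m, 'n) form2 \<Rightarrow>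
     (real \<Rightarrow> ('m, 'n) form1) \<Rightarrow> (real \<Rightarrow> 'm \<Rightarrow> 'm) \<Rightarrow> real \<Rightarrow> 'm \<Rightarrow> real" where
  "Delta_normalized A \<omega> H \<theta> t = normalize A \<omega> (Delta A H \<theta> t)"

text \<open>On a compact manifold the supremum and infimum of a continuous function are its max and min.\<close>

definition osc :: "('m \<Rightarrow> real) \<Rightarrow> real" where
  "osc f = (SUP p. f p) - (INF p. f p)"

definition hofer_norm :: "(real \<Rightarrow> 'm \<Rightarrow> real) \<Rightarrow> real" where
  "hofer_norm r = integral {0..1} (\<lambda>t. osc (r t))"

definition regular_isotopy :: "('m, 'n::finite) chart set \<Rightarrow> (real \<Rightarrow> 'm \<Rightarrow> 'm) \<Rightarrow> bool" where
  "regular_isotopy A \<phi> \<longleftrightarrow> (\<forall>t\<in>{0..1}. \<exists>c\<in>A. \<exists>x\<in>cimg c. velocity \<phi> t c x \<noteq> 0)"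

end

theory Submission
  imports Defs
begin

text \<open>
  Let \<open>F\<close> be a bump function supported in one chart. The flows of the Hamiltonians \<open>F\<close> and \<open>F\<^sup>2 / 2\<close> commute,
  so every closed curve \<open>(a, b)\<close> in the plane based at the origin yields a Hamiltonian loop, with generator
  \<open>r = a' * F + b' * F\<^sup>2 / 2\<close>. For the circle \<open>a + \<i> b = l (cis (2 \<pi> t) - 1) / (2 \<pi> \<i>)\<close> the speed is
  \<open>l cis (2 \<pi> t)\<close>. If \<open>r\<^sub>t\<close> differs from \<open>U\<^sub>t\<close> by a constant, then comparing differentials at two fixed points of
  the chart forces the speed at time \<open>t\<close> to be the value of a smooth curve which only depends on \<open>U\<close>; if the
  composed isotopy has zero velocity at time \<open>t\<close>, then the differential of \<open>r\<^sub>t\<close> is \<open>dU\<^sub>t + H\<^sub>t\<close> on the chart, and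
  the speed lies on a second such curve. The values of \<open>l\<close> for which one of these happens at some time form
  a smooth image of two intervals, hence a null set in the complex plane, and so arbitrarily small good \<open>l\<close>
  exist. The composed isotopy has the stated generator because a local primitive \<open>h\<close> of the harmonic part
  turns the correction term into \<open>h \<circ> \<theta> - h\<close>, where \<open>\<theta>\<close> is the loop; it has mean zero since \<open>\<theta>\<close> preserves
  volume.
\<close>

section \<open>Finite order smoothness\<close>

text \<open>Two commuting flows are used because one does not suffice: a closed curve on the line
  has a speed that vanishes somewhere, where \<open>r\<close> would vanish too, and a curve of
  forbidden speeds may fill an interval of the line while it is a null set in the plane. The partner
  \<open>F\<^sup>2 / 2\<close> has the field \<open>F * X\<close>, so its flow is that of
  \<open>F\<close> with the time rescaled by \<open>F\<close>; the differentials \<open>DF\<close>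
  and \<open>F * DF\<close> are told apart by testing on two levels of \<open>F\<close>. All flow
  times stay in \<open>[-1, 1]\<close> and all fields have Lipschitz constant 1/2, which makes the
  solution operator a contraction on the whole interval at once. The bump function is scaled by a
  constant \<open>\<kappa>\<close> for this purpose. The cut-off has radius \<open>\<rho>\<close>,
  while the chart formulas hold on a larger radius \<open>R\<close>. The open \<open>R\<close>-ball
  and the complement of the compact \<open>\<rho>\<close>-ball cover the manifold, so each global
  statement splits into a chart computation and a trivial one. Smallness in the smooth topology is
  obtained by treating \<open>l\<close> as one more variable of a jointly smooth map: all
  derivatives are then continuous at \<open>l = 0\<close>, uniformly on compact sets by the tube
  lemma.\<close>

text \<open>In contrast to \<open>smooth_on\<close>, the derivatives are not given by choice, so that the closure properties
  hold on arbitrary sets; on \<open>thick\<close> sets, where derivatives are unique, both notions agree.\<close>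

primrec Ck :: "nat \<Rightarrow> 'a::euclidean_space set \<Rightarrow> ('a \<Rightarrow> 'b::euclidean_space) \<Rightarrow> bool" where
  "Ck 0 S f = continuous_on S f"
| "Ck (Suc k) S f = (\<exists>f'. (\<forall>x\<in>S. (f has_derivative f' x) (at x within S)) \<and> (\<forall>v. Ck k S (\<lambda>x. f' x v)))"

definition Cinf :: "'a::euclidean_space set \<Rightarrow> ('a \<Rightarrow> 'b::euclidean_space) \<Rightarrow> bool" where
  "Cinf S f \<longleftrightarrow> (\<forall>k. Ck k S f)"

definition thick :: "'a::euclidean_space set \<Rightarrow> bool" where
  "thick S \<longleftrightarrow> (\<forall>x\<in>S. \<forall>i\<in>Basis. \<forall>e>0. \<exists>d. 0 < \<bar>d\<bar> \<and> \<bar>d\<bar> < e \<and> x + d *\<^sub>R i \<in> S)"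

lemma Ck_SucI:
  assumes "\<And>x. x \<in> S \<Longrightarrow> (f has_derivative f' x) (at x within S)" "\<And>v. Ck k S (\<lambda>x. f' x v)"
  shows "Ck (Suc k) S f"
  using assms by auto

lemma Ck_SucE:
  assumes "Ck (Suc k) S f"
  obtains f' where "\<And>x. x \<in> S \<Longrightarrow> (f has_derivative f' x) (at x within S)" "\<And>v. Ck k S (\<lambda>x. f' x v)"
  using assms by auto

declare Ck.simps(2)[simp del]

lemma Ck_continuous: "Ck k S f \<Longrightarrow> continuous_on S f"
  by (cases k) (auto simp: Ck.simps continuous_on_eq_continuous_within intro: has_derivative_continuous)

lemma Ck_Suc_imp: "Ck (Suc k) S f \<Longrightarrow> Ck k S f"
proof (induction k arbitrary: f)
  case 0
  then show ?case using Ck_continuous by auto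
next
  case (Suc k)
  from Suc.prems show ?case
  proof (rule Ck_SucE)
    fix f' assume "\<And>x. x \<in> S \<Longrightarrow> (f has_derivative f' x) (at x within S)" "\<And>v. Ck (Suc k) S (\<lambda>x. f' x v)"
    then show "Ck (Suc k) S f" using Suc.IH by (intro Ck_SucI) blast+
  qed
qed

lemma Ck_cong:
  assumes "Ck k S f" "\<And>x. x \<in> S \<Longrightarrow> f x = g x"
  shows "Ck k S g"
proof (cases k)
  case 0
  then show ?thesis using assms continuous_on_cong[of S S f g] by auto
next
  case (Suc m)
  show ?thesis using assms(1) unfolding Suc
  proof (rule Ck_SucE)
    fix f' assume f': "\<And>x. x \<in> S \<Longrightarrow> (f has_derivative f' x) (at x within S)" "\<And>v. Ck m S (\<lambda>x. f' x v)"
    have "(g has_derivative f' x) (at x within S)" if "x \<in> S" for x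
      using f'(1)[OF that] by (rule has_derivative_transform[rotated 2]) (use that assms(2) in auto)
    then show "Ck (Suc m) S g" using f'(2) by (rule Ck_SucI)
  qed
qed

lemma Ck_subset: "Ck k S f \<Longrightarrow> T \<subseteq> S \<Longrightarrow> Ck k T f"
proof (induction k arbitrary: f)
  case 0
  then show ?case by (auto intro: continuous_on_subset)
next
  case (Suc k)
  from Suc.prems(1) show ?case
  proof (rule Ck_SucE)
    fix f' assume f': "\<And>x. x \<in> S \<Longrightarrow> (f has_derivative f' x) (at x within S)" "\<And>v. Ck k S (\<lambda>x. f' x v)"
    show "Ck (Suc k) T f"
      using f'(1) Suc.prems(2) by (intro Ck_SucI[of _ _ f'] Suc.IH f') (auto intro: has_derivative_subset)
  qed
qed

lemma Ck_const: "Ck k S (\<lambda>x. c)"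
  by (induction k arbitrary: c) (auto intro!: Ck_SucI[of _ _ "\<lambda>_ _. 0"])

lemma Ck_linear: "bounded_linear f \<Longrightarrow> Ck k S f"
  by (cases k)
    (auto intro!: Ck_SucI[of _ _ "\<lambda>_. f"] Ck_const bounded_linear_imp_has_derivative linear_continuous_on)

lemma Ck_id: "Ck k S (\<lambda>x. x)"
  by (rule Ck_linear) simp

lemma Ck_add:
  assumes "Ck k S f" "Ck k S g"
  shows "Ck k S (\<lambda>x. f x + g x)"
  using assms
proof (induction k arbitrary: f g)
  case 0
  then show ?case by (auto intro: continuous_intros)
next
  case (Suc k)
  obtain f' where f': "\<And>x. x \<in> S \<Longrightarrow> (f has_derivative f' x) (at x within S)" "\<And>v. Ck k S (\<lambda>x. f' x v)"
    using Suc.prems(1) by (rule Ck_SucE) blast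
  obtain g' where g': "\<And>x. x \<in> S \<Longrightarrow> (g has_derivative g' x) (at x within S)" "\<And>v. Ck k S (\<lambda>x. g' x v)"
    using Suc.prems(2) by (rule Ck_SucE) blast
  show ?case
    by (rule Ck_SucI[of _ _ "\<lambda>x v. f' x v + g' x v"]) (auto intro!: has_derivative_add f' g' Suc.IH)
qed

lemma Ck_sum: "(\<And>i. i \<in> I \<Longrightarrow> Ck k S (f i)) \<Longrightarrow> Ck k S (\<lambda>x. \<Sum>i\<in>I. f i x)"
  by (induction I rule: infinite_finite_induct) (auto intro: Ck_const Ck_add)

lemma Ck_bilinear:
  assumes B: "bounded_bilinear B" and "Ck k S f" "Ck k S g"
  shows "Ck k S (\<lambda>x. B (f x) (g x))"
  using assms(2,3)
proof (induction k arbitrary: f g)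
  case 0
  then show ?case by (auto intro: bounded_bilinear.continuous_on[OF B])
next
  case (Suc k)
  note fg = Suc.prems[THEN Ck_Suc_imp]
  obtain f' where f': "\<And>x. x \<in> S \<Longrightarrow> (f has_derivative f' x) (at x within S)" "\<And>v. Ck k S (\<lambda>x. f' x v)"
    using Suc.prems(1) by (rule Ck_SucE) blast
  obtain g' where g': "\<And>x. x \<in> S \<Longrightarrow> (g has_derivative g' x) (at x within S)" "\<And>v. Ck k S (\<lambda>x. g' x v)"
    using Suc.prems(2) by (rule Ck_SucE) blast
  show ?case
    by (rule Ck_SucI[of _ _ "\<lambda>x v. B (f x) (g' x v) + B (f' x v) (g x)"])
      (auto intro!: bounded_bilinear.FDERIV[OF B] f' g' Ck_add Suc.IH fg)
qed

lemmas Ck_mult = Ck_bilinear[OF bounded_bilinear_mult]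
lemmas Ck_scaleR = Ck_bilinear[OF bounded_bilinear_scaleR]
lemmas Ck_inner = Ck_bilinear[OF bounded_bilinear_inner]

lemma Ck_bounded_linear:
  assumes L: "bounded_linear L" and "Ck k S f"
  shows "Ck k S (\<lambda>x. L (f x))"
  using assms(2)
proof (induction k arbitrary: f)
  case 0
  then show ?case by (auto intro: bounded_linear.continuous_on[OF L])
next
  case (Suc k)
  obtain f' where f': "\<And>x. x \<in> S \<Longrightarrow> (f has_derivative f' x) (at x within S)" "\<And>v. Ck k S (\<lambda>x. f' x v)"
    using Suc.prems(1) by (rule Ck_SucE) blast
  show ?case
    by (rule Ck_SucI[of _ _ "\<lambda>x v. L (f' x v)"])
      (auto intro!: bounded_linear.has_derivative[OF L] f' Suc.IH)
qed

lemma Ck_minus: "Ck k S f \<Longrightarrow> Ck k S (\<lambda>x. - f x)"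
  by (rule Ck_bounded_linear[OF bounded_linear_minus[OF bounded_linear_ident]])

lemma Ck_diff: "Ck k S f \<Longrightarrow> Ck k S g \<Longrightarrow> Ck k S (\<lambda>x. f x - g x)"
  using Ck_add[OF _ Ck_minus, of k S f g] by simp

lemma Ck_fst: "Ck k S f \<Longrightarrow> Ck k S (\<lambda>x. fst (f x))"
  by (rule Ck_bounded_linear[OF bounded_linear_fst])

lemma Ck_snd: "Ck k S f \<Longrightarrow> Ck k S (\<lambda>x. snd (f x))"
  by (rule Ck_bounded_linear[OF bounded_linear_snd])

lemma Ck_Pair:
  assumes "Ck k S f" "Ck k S g"
  shows "Ck k S (\<lambda>x. (f x, g x))"
proof -
  have 1: "bounded_linear (\<lambda>x. (x, 0 :: 'c))" and 2: "bounded_linear (\<lambda>x. (0 :: 'b, x))"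
    by (auto intro: bounded_linear_intros)
  show ?thesis
    using Ck_add[OF Ck_bounded_linear[OF 1 assms(1)] Ck_bounded_linear[OF 2 assms(2)]] by simp
qed

lemma Ck_power: "Ck k S f \<Longrightarrow> Ck k S (\<lambda>x. (f x :: real) ^ n)"
  by (induction n) (auto intro: Ck_const Ck_mult)

lemma Ck_prod: "(\<And>i. i \<in> I \<Longrightarrow> Ck k S (f i)) \<Longrightarrow> Ck k S (\<lambda>x. \<Prod>i\<in>I. (f i x :: real))"
  by (induction I rule: infinite_finite_induct) (auto intro: Ck_const Ck_mult)

lemma Ck_componentwise:
  assumes "\<And>i. i \<in> Basis \<Longrightarrow> Ck k S (\<lambda>x. f x \<bullet> i)"
  shows "Ck k S f"
proof (rule Ck_cong)
  show "Ck k S (\<lambda>x. \<Sum>i\<in>Basis. (f x \<bullet> i) *\<^sub>R i)"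
    by (intro Ck_sum Ck_scaleR assms Ck_const)
qed (simp add: euclidean_representation)

lemma has_derivative_Basis_expand:
  assumes "(g has_derivative g') F"
  shows "g' v = (\<Sum>b\<in>Basis. (v \<bullet> b) *\<^sub>R g' b)"
proof -
  interpret bounded_linear g' using assms by (rule has_derivative_bounded_linear)
  have "g' v = g' (\<Sum>b\<in>Basis. (v \<bullet> b) *\<^sub>R b)" by (simp only: euclidean_representation)
  also have "\<dots> = (\<Sum>b\<in>Basis. (v \<bullet> b) *\<^sub>R g' b)" by (simp only: sum scaleR)
  finally show ?thesis .
qed

text \<open>In the chain rule \<open>g'\<close> is evaluated in the direction \<open>f' x v\<close>,
  which varies with \<open>x\<close>, while \<open>Ck\<close> controls derivatives in fixed
  directions. Expanding that direction over the basis leaves products of functions of class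
  \<open>Ck k\<close>.\<close>

lemma Ck_compose:
  fixes f :: "'a::euclidean_space \<Rightarrow> 'b::euclidean_space" and g :: "'b \<Rightarrow> 'c::euclidean_space"
  assumes "Ck k S f" "Ck k T g" "f ` S \<subseteq> T"
  shows "Ck k S (\<lambda>x. g (f x))"
  using assms(1,2)
proof (induction k arbitrary: g)
  case 0
  then show ?case using assms(3) by (auto intro: continuous_on_compose2)
next
  case (Suc k)
  note f = Suc.prems(1)[THEN Ck_Suc_imp]
  obtain f' where f': "\<And>x. x \<in> S \<Longrightarrow> (f has_derivative f' x) (at x within S)" "\<And>v. Ck k S (\<lambda>x. f' x v)"
    using Suc.prems(1) by (rule Ck_SucE) blast
  obtain g' where g': "\<And>x. x \<in> T \<Longrightarrow> (g has_derivative g' x) (at x within T)" "\<And>v. Ck k T (\<lambda>x. g' x v)"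
    using Suc.prems(2) by (rule Ck_SucE) blast
  show ?case
  proof (rule Ck_SucI)
    fix x assume x: "x \<in> S"
    have "((\<lambda>x. g (f x)) has_derivative (\<lambda>v. g' (f x) (f' x v))) (at x within S)"
    proof (rule has_derivative_in_compose[OF f'(1)[OF x]])
      have "f x \<in> T" using x assms(3) by blast
      then show "(g has_derivative g' (f x)) (at (f x) within f ` S)"
        using has_derivative_subset[OF g'(1) assms(3)] by blast
    qed
    also have "(\<lambda>v. g' (f x) (f' x v)) = (\<lambda>v. \<Sum>b\<in>Basis. (f' x v \<bullet> b) *\<^sub>R g' (f x) b)"
    proof
      fix v show "g' (f x) (f' x v) = (\<Sum>b\<in>Basis. (f' x v \<bullet> b) *\<^sub>R g' (f x) b)"
        using x assms(3) has_derivative_Basis_expand[OF g'(1)[of "f x"]] by auto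
    qed
    finally show "((\<lambda>x. g (f x)) has_derivative (\<lambda>v. \<Sum>b\<in>Basis. (f' x v \<bullet> b) *\<^sub>R g' (f x) b)) (at x within S)" .
  next
    fix v
    have "Ck k S (\<lambda>x. g' (f x) b)" for b by (rule Suc.IH[OF f g'(2)])
    moreover have "Ck k S (\<lambda>x. f' x v \<bullet> b)" for b by (rule Ck_inner[OF f'(2) Ck_const])
    ultimately show "Ck k S (\<lambda>x. \<Sum>b\<in>Basis. (f' x v \<bullet> b) *\<^sub>R g' (f x) b)"
      by (intro Ck_sum Ck_scaleR)
  qed
qed

lemma Ck_exp: "Ck k S f \<Longrightarrow> Ck k S (\<lambda>x. exp (f x :: real))"
proof (induction k)
  case (Suc k)
  note f = Suc.prems[THEN Ck_Suc_imp]
  obtain f' where f': "\<And>x. x \<in> S \<Longrightarrow> (f has_derivative f' x) (at x within S)" "\<And>v. Ck k S (\<lambda>x. f' x v)"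
    using Suc.prems(1) by (rule Ck_SucE) blast
  show ?case
    by (rule Ck_SucI[of _ _ "\<lambda>x v. f' x v * exp (f x)"])
      (auto intro!: derivative_eq_intros f' Ck_mult Suc.IH f simp: algebra_simps)
qed (auto intro: continuous_intros)

lemma Ck_inverse:
  assumes "\<And>x. x \<in> S \<Longrightarrow> f x \<noteq> 0"
  shows "Ck k S f \<Longrightarrow> Ck k S (\<lambda>x. inverse (f x :: real))"
proof (induction k)
  case (Suc k)
  note f = Suc.prems[THEN Ck_Suc_imp]
  obtain f' where f': "\<And>x. x \<in> S \<Longrightarrow> (f has_derivative f' x) (at x within S)" "\<And>v. Ck k S (\<lambda>x. f' x v)"
    using Suc.prems(1) by (rule Ck_SucE) blast
  show ?case
    by (rule Ck_SucI[of _ _ "\<lambda>x v. - (inverse (f x) * f' x v * inverse (f x))"])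
      (auto intro!: Deriv.has_derivative_inverse f' Ck_mult Ck_minus Suc.IH f assms)
qed (auto intro!: continuous_intros assms)

lemma Ck_cis: "Ck k S f \<Longrightarrow> Ck k S (\<lambda>x. cis (f x))"
proof (induction k)
  case 0
  then show ?case by (auto simp: cis_conv_exp intro!: continuous_intros)
next
  case (Suc k)
  note f = Suc.prems[THEN Ck_Suc_imp]
  obtain f' where f': "\<And>x. x \<in> S \<Longrightarrow> (f has_derivative f' x) (at x within S)" "\<And>v. Ck k S (\<lambda>x. f' x v)"
    using Suc.prems(1) by (rule Ck_SucE) blast
  show ?case
  proof (rule Ck_SucI[of _ _ "\<lambda>x v. of_real (f' x v) * (\<i> * cis (f x))"])
    fix x assume "x \<in> S"
    then have "((\<lambda>x. \<i> * of_real (f x)) has_derivative (\<lambda>v. \<i> * of_real (f' x v))) (at x within S)"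
      by (intro bounded_linear.has_derivative[OF bounded_linear_mult_right]
          bounded_linear.has_derivative[OF bounded_linear_of_real] f')
    from has_derivative_compose[OF this DERIV_exp[unfolded has_field_derivative_def]]
    show "((\<lambda>x. cis (f x)) has_derivative (\<lambda>v. of_real (f' x v) * (\<i> * cis (f x)))) (at x within S)"
      unfolding cis_conv_exp by (simp add: algebra_simps)
  next
    fix v show "Ck k S (\<lambda>x. of_real (f' x v) * (\<i> * cis (f x)))"
      by (intro Ck_mult Ck_const Suc.IH f Ck_bounded_linear[OF bounded_linear_of_real] f')
  qed
qed

section \<open>Thick sets: unique derivatives, localisation and agreement with
  \<open>smooth_on\<close>\<close>

lemma frechet_within_unique:
  assumes "thick S" "x \<in> S" "(f has_derivative f') (at x within S)"
  shows "frechet_derivative f (at x within S) = f'"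
proof -
  have "(f has_derivative frechet_derivative f (at x within S)) (at x within S)"
    using assms(3) frechet_derivative_works differentiableI by blast
  then show ?thesis
    using assms unfolding thick_def by (intro frechet_derivative_unique_within[where x=x and S=S and f=f]) auto
qed

text \<open>The filters \<open>at x within S \<inter> T\<close> and \<open>at x within S\<close>
  coincide for open \<open>T\<close>, and derivatives within a thick set are unique. Hence the local
  derivatives all agree with \<open>frechet_derivative\<close> within \<open>S\<close> and patch
  together.\<close>

lemma Ck_local:
  assumes "thick S" "\<And>x. x \<in> S \<Longrightarrow> \<exists>T. open T \<and> x \<in> T \<and> Ck k (S \<inter> T) f"
  shows "Ck k S f"
  using assms(2)
proof (induction k arbitrary: f)
  case 0
  show ?case unfolding Ck.simps continuous_on_eq_continuous_within
  proof
    fix x assume "x \<in> S"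
    then obtain T where "open T" "x \<in> T" "continuous_on (S \<inter> T) f" using 0 by force
    then have c: "continuous (at x within S \<inter> T) f"
      using \<open>x \<in> S\<close> by (auto simp: continuous_on_eq_continuous_within)
    have e: "at x within S \<inter> T = at x within S"
      using \<open>x \<in> T\<close> \<open>open T\<close> at_within_nhd[of x T "S \<inter> T" S] by auto
    show "continuous (at x within S) f" using c unfolding e .
  qed
next
  case (Suc k)
  have *: "at x within S \<inter> T = at x within S" if "open T" "x \<in> T" for x T
    using at_within_nhd[of x T "S \<inter> T" S] that by blast
  have D: "(f has_derivative frechet_derivative f (at x within S)) (at x within S)" if "x \<in> S" for x
    using Suc.prems[OF that] * by (metis Ck_SucE IntI differentiableI frechet_derivative_works that)
  show ?case
  proof (rule Ck_SucI[OF D], assumption, rule Suc.IH)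
    fix v x assume "x \<in> S"
    then obtain T where T: "open T" "x \<in> T" "Ck (Suc k) (S \<inter> T) f" using Suc.prems by blast
    obtain f' where f': "\<And>x. x \<in> S \<inter> T \<Longrightarrow> (f has_derivative f' x) (at x within S \<inter> T)" 
        "\<And>v. Ck k (S \<inter> T) (\<lambda>x. f' x v)"
      using T(3) by (rule Ck_SucE) blast
    have "frechet_derivative f (at y within S) = f' y" if "y \<in> S \<inter> T" for y
      using f'(1)[OF that] *[of T y] T(1) that assms(1) by (intro frechet_within_unique) auto
    then have "Ck k (S \<inter> T) (\<lambda>x. frechet_derivative f (at x within S) v)"
      using f'(2)[of v] by (auto elim!: Ck_cong)
    then show "\<exists>T. open T \<and> x \<in> T \<and> Ck k (S \<inter> T) (\<lambda>x. frechet_derivative f (at x within S) v)"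
      using T by blast
  qed
qed

text \<open>\<open>nder\<close> puts the derivative taken last at the head of the list, but the
  induction over the order strips the derivative taken first, which is the last entry.\<close>

lemma nder_snoc: "nder f S (vs @ [v]) = nder (\<lambda>x. frechet_derivative f (at x within S) v) S vs"
  by (induction vs) auto

lemma smooth_on_imp_Ck: "smooth_on S f \<Longrightarrow> Ck k S f"
proof (induction k arbitrary: f)
  case 0
  then show ?case
    by (auto simp: smooth_on_def intro!: differentiable_imp_continuous_on dest!: spec[of _ "[]"])
next
  case (Suc k)
  show ?case
  proof (rule Ck_SucI)
    fix x assume "x \<in> S"
    then show "(f has_derivative frechet_derivative f (at x within S)) (at x within S)"
      using Suc.prems unfolding smooth_on_def
      by (metis differentiable_on_def frechet_derivative_works nder.simps(1))
  next
    fix v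
    show "Ck k S (\<lambda>x. frechet_derivative f (at x within S) v)"
      using Suc.prems by (intro Suc.IH) (auto simp: smooth_on_def nder_snoc[symmetric])
  qed
qed

lemma Ck_nder: "thick S \<Longrightarrow> Ck (k + length vs) S f \<Longrightarrow> Ck k S (nder f S vs)"
proof (induction vs arbitrary: k)
  case (Cons v vs)
  from Cons.prems have "Ck (Suc k) S (nder f S vs)" by (intro Cons.IH) auto
  then obtain f' where f': "\<And>x. x \<in> S \<Longrightarrow> (nder f S vs has_derivative f' x) (at x within S)" 
        "\<And>v. Ck k S (\<lambda>x. f' x v)"
    by (rule Ck_SucE) blast
  show ?case using f'(2)[of v] 
    by (rule Ck_cong) (simp add: frechet_within_unique[OF Cons.prems(1) _ f'(1)])
qed auto

lemma smooth_on_iff_Cinf: "thick S \<Longrightarrow> smooth_on S f \<longleftrightarrow> Cinf S f"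
proof
  assume "thick S" "Cinf S f"
  then have "Ck (Suc 0) S (nder f S vs)" for vs by (intro Ck_nder) (auto simp: Cinf_def)
  then show "smooth_on S f" unfolding smooth_on_def
    by (metis Ck_SucE differentiable_on_def differentiableI)
qed (auto simp: Cinf_def smooth_on_imp_Ck)

lemma thick_open: "open S \<Longrightarrow> thick S"
proof (unfold thick_def, intro ballI allI impI)
  fix x and i :: 'a and e :: real assume *: "open S" "x \<in> S" "i \<in> Basis" "0 < e"
  then obtain d where d: "d > 0" "ball x d \<subseteq> S" using open_contains_ball by blast
  show "\<exists>d. 0 < \<bar>d\<bar> \<and> \<bar>d\<bar> < e \<and> x + d *\<^sub>R i \<in> S"
    using d * by (intro exI[of _ "min d e / 2"]) (auto intro!: subsetD[OF d(2)] simp: dist_norm)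
qed

lemma thick_Int_open:
  assumes "thick S" "open T"
  shows "thick (S \<inter> T)"
proof (unfold thick_def, intro ballI allI impI)
  fix x and i :: 'a and e :: real assume *: "x \<in> S \<inter> T" "i \<in> Basis" "0 < e"
  then obtain d where d: "d > 0" "ball x d \<subseteq> T" using assms open_contains_ball by blast
  obtain c where "0 < \<bar>c\<bar> \<and> \<bar>c\<bar> < min d e \<and> x + c *\<^sub>R i \<in> S" 
    using assms(1) * d(1) unfolding thick_def by (metis IntD1 min_less_iff_conj)
  then show "\<exists>d. 0 < \<bar>d\<bar> \<and> \<bar>d\<bar> < e \<and> x + d *\<^sub>R i \<in> S \<inter> T"
    using * by (intro exI[of _ c]) (auto intro!: subsetD[OF d(2)] simp: dist_norm)
qed

lemma thick_Times:
  assumes "thick S" "thick T"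
  shows "thick (S \<times> T)"
proof (unfold thick_def, intro ballI allI impI)
  fix x and i :: "'a \<times> 'b" and e :: real assume *: "x \<in> S \<times> T" "i \<in> Basis" "0 < e"
  from *(2) consider j where "j \<in> Basis" "i = (j, 0)" | j where "j \<in> Basis" "i = (0, j)"
    by (auto simp: Basis_prod_def)
  then show "\<exists>d. 0 < \<bar>d\<bar> \<and> \<bar>d\<bar> < e \<and> x + d *\<^sub>R i \<in> S \<times> T"
    using * assms unfolding thick_def by cases (cases x; force)+
qed

lemma thick_interval: "a < b \<Longrightarrow> thick {a..b::real}"
proof (unfold thick_def, intro ballI allI impI)
  fix x i e :: real assume *: "a < b" "x \<in> {a..b}" "i \<in> Basis" "0 < e"
  show "\<exists>d. 0 < \<bar>d\<bar> \<and> \<bar>d\<bar> < e \<and> x + d *\<^sub>R i \<in> {a..b}"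
  proof (cases "x < b")
    case True
    define d where "d = min (b - x) e / 2"
    have "0 < d" "d < e" "d \<le> b - x" using True * by (auto simp: d_def min_def)
    then show ?thesis using * by (intro exI[of _ d]) auto
  next
    case False
    define d where "d = min (b - a) e / 2"
    have "0 < d" "d < e" "d \<le> b - a" using * by (auto simp: d_def min_def)
    then show ?thesis using * False by (intro exI[of _ "- d"]) auto
  qed
qed

text \<open>Freezing the first variable commutes with differentiating in the second one, because a
  direction \<open>v\<close> of the slice is the direction \<open>(0, v)\<close> of the whole
  domain. Later \<open>l\<close> is the loop parameter: the derivatives of each loop become
  restrictions of functions that are continuous in \<open>l\<close> as well.\<close>

lemma nder_slice:
  fixes R :: "'l::euclidean_space \<times> 'a::euclidean_space \<Rightarrow> 'b::euclidean_space"
  assumes "thick D" "Cinf D R" "thick {z. (l, z) \<in> D}" "(l, z) \<in> D"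
  shows "nder (\<lambda>z. R (l, z)) {z. (l, z) \<in> D} vs z = nder R D (map (Pair 0) vs) (l, z)"
  using assms(4)
proof (induction vs arbitrary: z)
  case (Cons v vs)
  let ?S = "{z. (l, z) \<in> D}" and ?n = "nder R D (map (Pair 0) vs)"
  have "Ck (Suc 0) D ?n"
    using assms(1,2) by (intro Ck_nder) (auto simp: Cinf_def)
  then obtain f' where "\<And>x. x \<in> D \<Longrightarrow> (?n has_derivative f' x) (at x within D)"
    by (rule Ck_SucE) blast
  note f' = this[OF Cons.prems]
  have 1: "frechet_derivative ?n (at (l,z) within D) = f' (l,z)"
    using assms(1) Cons.prems f' by (rule frechet_within_unique)
  have "((\<lambda>z. ?n (l, z)) has_derivative (\<lambda>v. f' (l,z) (0, v))) (at z within ?S)"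
  proof (rule has_derivative_in_compose[of "Pair l" "Pair 0"])
    show "(Pair l has_derivative Pair 0) (at z within ?S)"
      by (intro has_derivative_Pair has_derivative_const has_derivative_ident)
    show "(?n has_derivative f' (l,z)) (at (l,z) within Pair l ` ?S)"
      by (rule has_derivative_subset[OF f']) auto
  qed
  then have "(nder (\<lambda>z. R (l, z)) ?S vs has_derivative (\<lambda>v. f' (l,z) (0, v))) (at z within ?S)"
    by (rule has_derivative_transform[rotated 2]) (use Cons.prems Cons.IH in auto)
  from frechet_within_unique[OF assms(3) _ this] show ?case
    using Cons.prems 1 by simp
qed simp

lemma Cinf_local:
  assumes "thick S" "\<And>x. x \<in> S \<Longrightarrow> \<exists>T. open T \<and> x \<in> T \<and> Cinf (S \<inter> T) f"
  shows "Cinf S f"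
  using assms unfolding Cinf_def by (intro allI Ck_local) (auto simp: Cinf_def)

lemma Cinf_cong: "Cinf S f \<Longrightarrow> (\<And>x. x \<in> S \<Longrightarrow> f x = g x) \<Longrightarrow> Cinf S g"
  unfolding Cinf_def by (blast intro: Ck_cong)

lemma Cinf_continuous: "Cinf S f \<Longrightarrow> continuous_on S f"
  unfolding Cinf_def by (blast intro: Ck_continuous)

lemma Cinf_subset: "Cinf S f \<Longrightarrow> T \<subseteq> S \<Longrightarrow> Cinf T f"
  unfolding Cinf_def by (blast intro: Ck_subset)

lemma Cinf_compose:
  fixes f :: "'a::euclidean_space \<Rightarrow> 'b::euclidean_space" and g :: "'b \<Rightarrow> 'c::euclidean_space"
  shows "Cinf T g \<Longrightarrow> Cinf S f \<Longrightarrow> f ` S \<subseteq> T \<Longrightarrow> Cinf S (\<lambda>x. g (f x))"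
  unfolding Cinf_def by (blast intro: Ck_compose)

lemma Cinf_derivative:
  assumes "Cinf S f" "x \<in> S" 
  shows "(f has_derivative frechet_derivative f (at x within S)) (at x within S)"
  using assms unfolding Cinf_def by (metis Ck_SucE differentiableI frechet_derivative_works)

lemma Cinf_frechet:
  assumes "Cinf S f" "thick S"
  shows "Cinf S (\<lambda>x. frechet_derivative f (at x within S) v)"
  unfolding Cinf_def
proof
  fix k
  have "Ck k S (nder f S [v])" using assms by (intro Ck_nder) (auto simp: Cinf_def)
  then show "Ck k S (\<lambda>x. frechet_derivative f (at x within S) v)" by simp
qed

lemmas Ck_intros = Ck_const Ck_id Ck_add Ck_minus Ck_diff Ck_mult Ck_scaleR Ck_inner Ck_sum Ck_prod
  Ck_Pair Ck_fst Ck_snd Ck_power Ck_exp Ck_cis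

section \<open>Smooth dependence of solutions of differential equations on parameters\<close>

text \<open>With \<open>B = 0\<close> this is the principle that conserved quantities are constant;
  applied to a difference of solutions it drives \<open>ode_estimate\<close>.\<close>

lemma vector_derivative_bound:
  fixes f :: "real \<Rightarrow> 'a::real_normed_vector"
  assumes "\<And>x. x \<in> {a..b} \<Longrightarrow> (f has_vector_derivative f' x) (at x within {a..b})"
    and "\<And>x. x \<in> {a..b} \<Longrightarrow> norm (f' x) \<le> B" "x \<in> {a..b}" "y \<in> {a..b}"
  shows "norm (f x - f y) \<le> B * \<bar>x - y\<bar>"
proof -
  have "norm (f x - f y) \<le> B * norm (x - y)"
  proof (rule differentiable_bound[of "{a..b}" f "\<lambda>x h. h *\<^sub>R f' x"])
    fix x assume x: "x \<in> {a..b}"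
    show "(f has_derivative (\<lambda>h. h *\<^sub>R f' x)) (at x within {a..b})"
      using assms(1)[OF x] by (simp add: has_vector_derivative_def)
    show "onorm (\<lambda>h. h *\<^sub>R f' x) \<le> B"
    proof (rule onorm_le)
      fix h :: real
      show "norm (h *\<^sub>R f' x) \<le> B * norm h"
        using mult_right_mono[OF assms(2)[OF x], of "\<bar>h\<bar>"] by (simp add: mult.commute)
    qed
  qed (use assms in auto)
  then show ?thesis by simp
qed

text \<open>Let \<open>D\<close> be the maximal distance, attained at time \<open>m\<close>. The
  mean value inequality from time 0 gives \<open>D \<le> (D / 2 + e) * \<bar>m\<bar>\<close>, and
  \<open>\<bar>m\<bar> \<le> 1\<close> lets the left side absorb \<open>D / 2\<close>. This is where
  the constant 1/2 and the unit time span are spent.\<close>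

lemma ode_estimate:
  fixes y z :: "real \<Rightarrow> 'a::real_normed_vector"
  assumes ab: "-1 \<le> a" "a \<le> 0" "0 \<le> b" "b \<le> 1"
    and y: "\<And>t. t \<in> {a..b} \<Longrightarrow> (y has_vector_derivative y' t) (at t within {a..b})"
    and z: "\<And>t. t \<in> {a..b} \<Longrightarrow> (z has_vector_derivative z' t) (at t within {a..b})"
    and e: "\<And>t. t \<in> {a..b} \<Longrightarrow> norm (y' t - z' t) \<le> 1/2 * norm (y t - z t) + e"
    and 0: "y 0 = z 0" and t: "t \<in> {a..b}"
  shows "norm (y t - z t) \<le> 2 * e"
proof -
  let ?d = "\<lambda>t. y t - z t"
  have d: "(?d has_vector_derivative (y' t - z' t)) (at t within {a..b})" if "t \<in> {a..b}" for t
    by (intro has_vector_derivative_diff y z that)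
  have "continuous_on {a..b} (\<lambda>t. norm (?d t))"
    using has_vector_derivative_continuous[OF d]
    by (intro continuous_on_norm) (auto simp: continuous_on_eq_continuous_within)
  then obtain m where m: "m \<in> {a..b}" "\<And>t. t \<in> {a..b} \<Longrightarrow> norm (?d t) \<le> norm (?d m)"
    using continuous_attains_sup[of "{a..b}" "\<lambda>t. norm (?d t)"] t by auto
  let ?B = "1/2 * norm (?d m) + e"
  have "norm (y' t - z' t) \<le> ?B" if "t \<in> {a..b}" for t
    using e[OF that] m(2)[OF that] by simp
  then have "norm (?d m - ?d 0) \<le> ?B * \<bar>m - 0\<bar>"
    using ab m(1) by (intro vector_derivative_bound[OF d]) auto
  moreover have "?B \<ge> 0" using e[OF m(1)] norm_ge_zero order_trans by blast
  then have "?B * \<bar>m - 0\<bar> \<le> ?B * 1" using ab m(1) by (intro mult_left_mono) auto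
  ultimately have "norm (?d m) \<le> ?B" using 0 by simp
  then show ?thesis using m(2)[OF t] by simp
qed

text \<open>Banach's fixed point theorem for the integral operator on bounded continuous functions
  of all real times. The clamp \<open>cl\<close> makes each iterate constant outside
  \<open>[-1, 1]\<close>, hence bounded; on a time span of length one to each side of 0 the
  Lipschitz constant 1/2 of \<open>G\<close> is also a contraction constant of the operator.\<close>

lemma picard_exists:
  fixes G :: "real \<Rightarrow> 'e::euclidean_space \<Rightarrow> 'e"
  assumes cont: "continuous_on ({-1..1} \<times> UNIV) (\<lambda>(s, w). G s w)"
    and lip: "\<And>s w w'. s \<in> {-1..1} \<Longrightarrow> norm (G s w - G s w') \<le> 1/2 * norm (w - w')"
  shows "\<exists>w. w 0 = 0 \<and> (\<forall>s\<in>{-1..1}. (w has_vector_derivative G s (w s)) (at s within {-1..1}))"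
proof -
  \<comment> \<open>The integral from 0 to \<open>s\<close>, written as a difference of integrals
    from the left end so that one formula serves both signs of \<open>s\<close>.\<close>
  define J :: "(real \<Rightarrow> 'e) \<Rightarrow> real \<Rightarrow> 'e" where "J g s = integral {-1..s} g - integral {-1..0} g" for g s
  define cl :: "real \<Rightarrow> real" where "cl s = max (-1) (min 1 s)" for s
  have cl: "cl s \<in> {-1..1}" for s by (auto simp: cl_def)
  have cl_id: "cl s = s" if "s \<in> {-1..1}" for s using that by (auto simp: cl_def)
  have J: "(J g has_vector_derivative g s) (at s within {-1..1})"
    if "continuous_on {-1..1} g" "s \<in> {-1..1}" for g s
    unfolding J_def using integral_has_vector_derivative[OF that] by (simp add: has_vector_derivative_diff_const)
  have J0: "J g 0 = 0" for g by (simp add: J_def)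
  have Jbound: "norm (J g s - J h s) \<le> c" if g: "continuous_on {-1..1} g" and h: "continuous_on {-1..1} h"
    and c: "\<And>s. s \<in> {-1..1} \<Longrightarrow> norm (g s - h s) \<le> c" and s: "s \<in> {-1..1}" for g h c s
  proof -
    have "norm ((J g s - J h s) - (J g 0 - J h 0)) \<le> c * \<bar>s - 0\<bar>"
      using s by (intro vector_derivative_bound[where a = "-1" and b = 1 and f' = "\<lambda>s. g s - h s"]
          has_vector_derivative_diff J g h c) auto
    moreover have "0 \<le> c" by (rule order_trans[OF norm_ge_zero c[of 0]]) simp
    then have "c * \<bar>s - 0\<bar> \<le> c * 1" using s by (intro mult_left_mono) auto
    ultimately show ?thesis by (simp add: J0)
  qed
  define \<Gamma> where "\<Gamma> w = Bcontfun (\<lambda>s. J (\<lambda>\<sigma>. G \<sigma> (apply_bcontfun w \<sigma>)) (cl s))" for w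
  have Gw: "continuous_on {-1..1} (\<lambda>\<sigma>. G \<sigma> (w \<sigma>))" if "continuous_on {-1..1} w" for w
  proof -
    have "continuous_on {-1..1} (\<lambda>\<sigma>. (\<lambda>(s, w). G s w) (\<sigma>, w \<sigma>))"
      by (rule continuous_on_compose2[OF cont continuous_on_Pair[OF continuous_on_id that]]) auto
    then show ?thesis by simp
  qed
  have w: "continuous_on S (apply_bcontfun w)" for w :: "real \<Rightarrow>\<^sub>C 'e" and S
    by (rule continuous_on_apply_bcontfun)
  have \<Gamma>: "apply_bcontfun (\<Gamma> w) s = J (\<lambda>\<sigma>. G \<sigma> (apply_bcontfun w \<sigma>)) (cl s)" for w s
  proof -
    let ?g = "J (\<lambda>\<sigma>. G \<sigma> (apply_bcontfun w \<sigma>))"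
    have c: "continuous_on {-1..1} ?g"
      unfolding continuous_on_eq_continuous_within
    proof
      fix s :: real assume "s \<in> {-1..1}"
      from J[OF Gw[OF w] this] show "continuous (at s within {-1..1}) ?g"
        by (rule has_vector_derivative_continuous)
    qed
    have "continuous_on UNIV (\<lambda>s. ?g (cl s))"
      by (rule continuous_on_compose2[OF c]) (auto simp: cl_def intro!: continuous_intros)
    moreover have "bounded (range (\<lambda>s. ?g (cl s)))"
      by (rule bounded_subset[OF compact_imp_bounded[OF compact_continuous_image[OF c compact_Icc]]])
        (use cl in auto)
    ultimately show ?thesis
      unfolding \<Gamma>_def by (subst Bcontfun_inverse) (auto simp: bcontfun_def)
  qed
  have "dist (\<Gamma> v) (\<Gamma> w) \<le> 1/2 * dist v w" for v w
  proof (rule dist_bound)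
    fix s
    have "norm (J (\<lambda>\<sigma>. G \<sigma> (apply_bcontfun v \<sigma>)) (cl s) - J (\<lambda>\<sigma>. G \<sigma> (apply_bcontfun w \<sigma>)) (cl s))
        \<le> 1/2 * dist v w"
    proof (rule Jbound[OF Gw[OF w] Gw[OF w] _ cl])
      fix s :: real assume "s \<in> {-1..1}"
      from lip[OF this] have "norm (G s (apply_bcontfun v s) - G s (apply_bcontfun w s))
        \<le> 1/2 * dist (apply_bcontfun v s) (apply_bcontfun w s)" by (simp add: dist_norm)
      also have "\<dots> \<le> 1/2 * dist v w" using dist_bounded[of v s w] by simp
      finally show "norm (G s (apply_bcontfun v s) - G s (apply_bcontfun w s)) \<le> 1/2 * dist v w" .
    qed
    then show "dist (apply_bcontfun (\<Gamma> v) s) (apply_bcontfun (\<Gamma> w) s) \<le> 1/2 * dist v w"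
      by (simp add: \<Gamma> dist_norm)
  qed
  then obtain v where v: "\<Gamma> v = v" using banach_fix_type[of "1/2" \<Gamma>] by auto
  let ?w = "apply_bcontfun v"
  have eq: "?w s = J (\<lambda>\<sigma>. G \<sigma> (?w \<sigma>)) s" if "s \<in> {-1..1}" for s
    using \<Gamma>[of v s] v cl_id[OF that] by simp
  show ?thesis
  proof (intro exI[of _ ?w] conjI ballI)
    show "?w 0 = 0" using eq[of 0] by (simp add: J0)
    fix s :: real assume s: "s \<in> {-1..1}"
    show "(?w has_vector_derivative G s (?w s)) (at s within {-1..1})"
      by (rule has_vector_derivative_transform[OF s eq J[OF Gw[OF w] s]])
  qed
qed

lemma continuous_uniform_at:
  fixes H :: "real \<times> 'p::euclidean_space \<Rightarrow> 'b::metric_space"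
  assumes "continuous_on ({a..b} \<times> UNIV) H" "0 < e"
  obtains d where "0 < d" "\<And>s p. s \<in> {a..b} \<Longrightarrow> dist p p0 < d \<Longrightarrow> dist (H (s, p)) (H (s, p0)) < e"
proof -
  have "uniformly_continuous_on ({a..b} \<times> cball p0 1) H"
    by (intro compact_uniformly_continuous continuous_on_subset[OF assms(1)] compact_Times) auto
  then obtain d where d: "0 < d" "\<And>x y. x \<in> {a..b} \<times> cball p0 1 \<Longrightarrow> y \<in> {a..b} \<times> cball p0 1 \<Longrightarrow>
      dist x y < d \<Longrightarrow> dist (H x) (H y) < e"
    using assms(2) unfolding uniformly_continuous_on_def by (metis dist_commute)
  show thesis
  proof (rule that[of "min d 1"])
    fix s p assume "s \<in> {a..b}" "dist p p0 < min d 1"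
    then show "dist (H (s, p)) (H (s, p0)) < e"
      by (intro d(2)) (auto simp: dist_commute dist_Pair_Pair)
  qed (use d in auto)
qed

lemma has_derivative_norm_bound:
  assumes f: "(f has_derivative f') (at x)" and lip: "\<And>y. norm (f y - f x) \<le> L * norm (y - x)"
  shows "norm (f' v) \<le> L * norm v"
proof (cases "v = 0")
  case True
  then show ?thesis using linear_0[OF has_derivative_linear[OF f]] by simp
next
  case False
  have "norm (f' v) \<le> L * norm v + e * norm v" if "0 < e" for e
  proof -
    obtain d where d: "0 < d" "\<And>y. norm (y - x) < d \<Longrightarrow> norm (f y - f x - f' (y - x)) \<le> e * norm (y - x)"
      using f[unfolded has_derivative_at_alt, THEN conjunct2, rule_format, OF \<open>0 < e\<close>] by auto
    define t where "t = d / 2 / norm v"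
    have t: "0 < t" "norm (t *\<^sub>R v) < d" using False d(1) by (auto simp: t_def)
    have "norm (f' (t *\<^sub>R v)) \<le> norm (f (x + t *\<^sub>R v) - f x) + norm (f (x + t *\<^sub>R v) - f x - f' (t *\<^sub>R v))"
      using norm_triangle_ineq4[of "f (x + t *\<^sub>R v) - f x" "f (x + t *\<^sub>R v) - f x - f' (t *\<^sub>R v)"] by simp
    also have "\<dots> \<le> L * norm (t *\<^sub>R v) + e * norm (t *\<^sub>R v)"
      using lip[of "x + t *\<^sub>R v"] d(2)[of "x + t *\<^sub>R v"] t(2) by simp
    finally have "t * norm (f' v) \<le> t * (L * norm v + e * norm v)"
      using t(1) linear_scale[OF has_derivative_linear[OF f], of t v] by (simp add: algebra_simps)
    then show ?thesis using t(1) by simp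
  qed
  then have "norm (f' v) \<le> L * norm v + e" if "0 < e" for e
    using False that by (metis divide_pos_pos nonzero_eq_divide_eq norm_eq_zero zero_less_norm_iff)
  then show ?thesis by (rule field_le_epsilon)
qed

text \<open>The mean value inequality is applied to \<open>G\<close> minus its linear part at
  \<open>\<gamma> s\<close>, whose derivative is small near 0 uniformly in \<open>s\<close> because
  the curve is compact. Each basis direction contributes at most \<open>e' = e / DIM('z)\<close> to
  the operator norm.\<close>

lemma ode_uniform_expansion:
  fixes G :: "real \<times> 'z::euclidean_space \<Rightarrow> 'e::euclidean_space" and \<gamma> :: "real \<Rightarrow> 'z"
  assumes D: "\<And>s z. s \<in> {a..b} \<Longrightarrow> ((\<lambda>z. G (s, z)) has_derivative D s z) (at z)"
    and cont: "\<And>v. continuous_on ({a..b} \<times> UNIV) (\<lambda>(s, z). D s z v)"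
    and \<gamma>: "continuous_on {a..b} \<gamma>" and e: "0 < e"
  obtains d where "0 < d"
    "\<And>s \<zeta>. s \<in> {a..b} \<Longrightarrow> norm \<zeta> < d \<Longrightarrow> norm (G (s, \<gamma> s + \<zeta>) - G (s, \<gamma> s) - D s (\<gamma> s) \<zeta>) \<le> e * norm \<zeta>"
proof -
  define e' where "e' = e / real DIM('z)"
  have e': "0 < e'" using e by (simp add: e'_def)
  have "\<exists>d>0. \<forall>s \<zeta>. s \<in> {a..b} \<longrightarrow> norm \<zeta> < d \<longrightarrow> norm (D s (\<gamma> s + \<zeta>) v - D s (\<gamma> s) v) < e'" for v
  proof -
    have "continuous_on ({a..b} \<times> UNIV) (\<lambda>x. (\<lambda>(s, z). D s z v) (fst x, \<gamma> (fst x) + snd x))"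
      by (rule continuous_on_compose2[OF cont])
        (auto intro!: continuous_intros continuous_on_compose2[OF \<gamma>])
    then obtain d where "0 < d" "\<And>s p. s \<in> {a..b} \<Longrightarrow> dist p 0 < d \<Longrightarrow>
      dist (D s (\<gamma> s + p) v) (D s (\<gamma> s + 0) v) < e'"
      using continuous_uniform_at[OF _ e', of a b "\<lambda>x. (\<lambda>(s, z). D s z v) (fst x, \<gamma> (fst x) + snd x)" 0] by auto
    then show ?thesis by (auto simp: dist_norm)
  qed
  then obtain d where d: "\<And>v. 0 < d v" "\<And>v s \<zeta>. s \<in> {a..b} \<Longrightarrow> norm \<zeta> < d v \<Longrightarrow>
      norm (D s (\<gamma> s + \<zeta>) v - D s (\<gamma> s) v) < e'"
    by metis
  define \<delta> where "\<delta> = Min (d ` Basis)"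
  have \<delta>: "0 < \<delta>" "\<And>b. b \<in> Basis \<Longrightarrow> \<delta> \<le> d b" by (auto simp: \<delta>_def d(1))
  show thesis
  proof (rule that[OF \<delta>(1)])
    fix s and \<zeta> :: 'z assume s: "s \<in> {a..b}" and \<zeta>: "norm \<zeta> < \<delta>"
    let ?f = "\<lambda>\<zeta>. G (s, \<gamma> s + \<zeta>) - D s (\<gamma> s) \<zeta>" and ?f' = "\<lambda>\<zeta> v. D s (\<gamma> s + \<zeta>) v - D s (\<gamma> s) v"
    have lin: "linear (D s z)" for z using has_derivative_linear[OF D[OF s]] .
    have "norm (?f \<zeta> - ?f 0) \<le> e * norm (\<zeta> - 0)"
    proof (rule differentiable_bound[of "ball 0 \<delta>" ?f ?f'])
      fix x :: 'z assume x: "x \<in> ball 0 \<delta>"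
      have "((\<lambda>\<zeta>. G (s, \<gamma> s + \<zeta>)) has_derivative D s (\<gamma> s + x)) (at x within ball 0 \<delta>)"
        by (rule has_derivative_compose[of "\<lambda>\<zeta>. \<gamma> s + \<zeta>" "\<lambda>v. v" _ _ "\<lambda>z. G (s, z)", OF _ D[OF s]])
          (auto intro!: derivative_eq_intros)
      moreover have "(D s (\<gamma> s) has_derivative D s (\<gamma> s)) (at x within ball 0 \<delta>)"
        using lin by (intro bounded_linear_imp_has_derivative linear_linear[THEN iffD2])
      ultimately show "(?f has_derivative ?f' x) (at x within ball 0 \<delta>)"
        by (rule has_derivative_diff)
      show "onorm (?f' x) \<le> e"
      proof (rule onorm_le)
        fix v
        interpret linear "?f' x" using lin by (rule linear_compose_sub[OF lin])
        have "norm (?f' x v) = norm (\<Sum>b\<in>Basis. (v \<bullet> b) *\<^sub>R ?f' x b)"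
          by (metis (no_types, lifting) euclidean_representation sum scale sum.cong)
        also have "\<dots> \<le> (\<Sum>b\<in>(Basis::'z set). norm v * e')"
        proof (rule sum_norm_le)
          fix b :: 'z assume b: "b \<in> Basis"
          have "norm (?f' x b) \<le> e'"
            using d(2)[OF s, of x b] x \<delta>(2)[OF b] by (simp add: less_imp_le)
          then show "norm ((v \<bullet> b) *\<^sub>R ?f' x b) \<le> norm v * e'"
            using Basis_le_norm[OF b, of v] by (auto intro!: mult_mono)
        qed
        also have "\<dots> = e * norm v" by (simp add: e'_def)
        finally show "norm (?f' x v) \<le> e * norm v" .
      qed
    qed (use \<zeta> \<delta> in auto)
    then show "norm (G (s, \<gamma> s + \<zeta>) - G (s, \<gamma> s) - D s (\<gamma> s) \<zeta>) \<le> e * norm \<zeta>"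
      using linear_0[OF lin] by (simp add: algebra_simps)
  qed
qed

text \<open>The derivative of a solution with respect to the parameter solves the linearised equation, which is
  again an equation of the same kind; so smoothness of all orders follows by induction.\<close>

lemma ode_parameter_derivative:
  fixes G :: "real \<times> 'p::euclidean_space \<times> 'e::euclidean_space \<Rightarrow> 'e"
  assumes D: "\<And>x. x \<in> {-1..1} \<times> UNIV \<Longrightarrow> (G has_derivative D x) (at x within {-1..1} \<times> UNIV)"
    and contD: "\<And>v. continuous_on ({-1..1} \<times> UNIV) (\<lambda>x. D x v)"
    and lip: "\<And>s p y z. s \<in> {-1..1} \<Longrightarrow> norm (G (s, p, y) - G (s, p, z)) \<le> 1/2 * norm (y - z)"
    and w0: "\<And>p. w 0 p = 0"
    and w: "\<And>s p. s \<in> {-1..1} \<Longrightarrow> ((\<lambda>s. w s p) has_vector_derivative G (s, p, w s p)) (at s within {-1..1})"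
  obtains W where "\<And>h p. W h 0 p = 0"
    "\<And>h s p. s \<in> {-1..1} \<Longrightarrow> ((\<lambda>s. W h s p) has_vector_derivative D (s, p, w s p) (0, h, W h s p)) (at s within {-1..1})"
    "\<And>s p. s \<in> {-1..1} \<Longrightarrow> ((\<lambda>(s, p). w s p) has_derivative (\<lambda>(k, h). k *\<^sub>R G (s, p, w s p) + W h s p))
        (at (s, p) within {-1..1} \<times> UNIV)"
proof -
  let ?I = "{-1..1::real}"
  define E where "E s z v = D (s, z) (0, v)" for s z v
  have E: "((\<lambda>z. G (s, z)) has_derivative E s z) (at z)" if "s \<in> ?I" for s z
    unfolding E_def
  proof (rule has_derivative_in_compose[of "Pair s" "Pair 0" z UNIV])
    show "(Pair s has_derivative Pair 0) (at z)"
      by (intro has_derivative_Pair has_derivative_const has_derivative_ident)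
    show "(G has_derivative D (s, z)) (at (s, z) within range (Pair s))"
      by (rule has_derivative_subset[OF D]) (use that in auto)
  qed
  have contE: "continuous_on (?I \<times> UNIV) (\<lambda>(s, z). E s z v)" for v
    using contD[of "(0, v)"] by (simp add: E_def case_prod_beta)
  have linE: "linear (E s z)" if "s \<in> ?I" for s z by (rule has_derivative_linear[OF E[OF that]])
  have lipE: "norm (E s z (0, k)) \<le> 1/2 * norm k" if s: "s \<in> ?I" for s z k
  proof -
    have "((\<lambda>y. G (s, fst z, y)) has_derivative (\<lambda>k. E s z (0, k))) (at (snd z))"
      by (rule has_derivative_compose[of "Pair (fst z)" "Pair 0" "snd z" UNIV "\<lambda>z. G (s, z)"])
        (auto intro!: derivative_eq_intros E s)
    then show ?thesis by (rule has_derivative_norm_bound) (rule lip[OF s])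
  qed
  have wcont: "continuous_on ?I (\<lambda>s. w s p)" for p
    unfolding continuous_on_eq_continuous_within
    using has_vector_derivative_continuous[OF w] by blast
  have Ecomp: "continuous_on S (\<lambda>x. E (a x) (b x, c x) v)"
    if "continuous_on S a" "continuous_on S b" "continuous_on S c" "a ` S \<subseteq> ?I"
    for S :: "'s::topological_space set" and a b c v
  proof -
    have "continuous_on S (\<lambda>x. (\<lambda>(s, z). E s z v) (a x, b x, c x))"
      by (rule continuous_on_compose2[OF contE]) (use that in \<open>auto intro!: continuous_intros\<close>)
    then show ?thesis by simp
  qed
  \<comment> \<open>The variational equation for a change of the parameter in direction
    \<open>b\<close>. Its right-hand side is affine in \<open>u\<close>, and \<open>lipE\<close>
    hands the Lipschitz constant 1/2 down to it, so \<open>picard_exists\<close> applies once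
    more.\<close>
  have "\<exists>u. u 0 = 0 \<and> (\<forall>s\<in>?I. (u has_vector_derivative E s (p, w s p) (b, u s)) (at s within ?I))" for p b
  proof (rule picard_exists)
    have eq: "E s (p, w s p) (b, u) = E s (p, w s p) (b, 0) + (\<Sum>i\<in>Basis. (u \<bullet> i) *\<^sub>R E s (p, w s p) (0, i))"
      if "s \<in> ?I" for s u
    proof -
      interpret linear "E s (p, w s p)" by (rule linE[OF that])
      have "(b, u) = (b, 0) + (\<Sum>i\<in>Basis. (u \<bullet> i) *\<^sub>R (0, i))"
        by (simp add: sum_prod[symmetric] euclidean_representation prod_eq_iff fst_sum snd_sum)
      then show ?thesis by (metis (no_types, lifting) add sum scale sum.cong)
    qed
    have "continuous_on (?I \<times> UNIV) (\<lambda>x. E (fst x) (p, w (fst x) p) (b, 0) +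
        (\<Sum>i\<in>Basis. (snd x \<bullet> i) *\<^sub>R E (fst x) (p, w (fst x) p) (0, i)))"
      by (intro continuous_intros Ecomp continuous_on_compose2[OF wcont]) auto
    then show "continuous_on (?I \<times> UNIV) (\<lambda>(s, u). E s (p, w s p) (b, u))"
    proof (rule continuous_on_eq)
      fix x assume "x \<in> ?I \<times> (UNIV::'e set)"
      then show "E (fst x) (p, w (fst x) p) (b, 0) +
        (\<Sum>i\<in>Basis. (snd x \<bullet> i) *\<^sub>R E (fst x) (p, w (fst x) p) (0, i)) = (case x of (s, u) \<Rightarrow> E s (p, w s p) (b, u))"
        using eq[of "fst x" "snd x"] by (simp add: case_prod_beta mem_Times_iff)
    qed
    fix s :: real and u u' :: 'e assume s: "s \<in> ?I"
    have "E s (p, w s p) (b, u) - E s (p, w s p) (b, u') = E s (p, w s p) (0, u - u')"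
      using linear_diff[OF linE[OF s], of "(p, w s p)" "(b, u)" "(b, u')"] by simp
    then show "norm (E s (p, w s p) (b, u) - E s (p, w s p) (b, u')) \<le> 1/2 * norm (u - u')"
      using lipE[OF s] by simp
  qed
  then obtain u where u0: "\<And>p b. u p b 0 = 0" and
    u: "\<And>p b s. s \<in> ?I \<Longrightarrow> (u p b has_vector_derivative E s (p, w s p) (b, u p b s)) (at s within ?I)"
    by metis
  \<comment> \<open>Assembled from the basis directions, so that linearity in \<open>h\<close>,
    required of a derivative, holds by construction.\<close>
  define W where "W h s p = (\<Sum>b\<in>Basis. (h \<bullet> b) *\<^sub>R u p b s)" for h :: 'p and s p
  have W0: "W h 0 p = 0" for h p by (simp add: W_def u0)
  have W': "((\<lambda>s. W h s p) has_vector_derivative E s (p, w s p) (h, W h s p)) (at s within ?I)"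
    if s: "s \<in> ?I" for h s p
  proof -
    have "((\<lambda>s. W h s p) has_vector_derivative (\<Sum>b\<in>Basis. (h \<bullet> b) *\<^sub>R E s (p, w s p) (b, u p b s))) (at s within ?I)"
      unfolding W_def by (intro has_vector_derivative_sum bounded_linear.has_vector_derivative[OF bounded_linear_scaleR_right] u s)
    moreover have "(\<Sum>b\<in>Basis. (h \<bullet> b) *\<^sub>R E s (p, w s p) (b, u p b s)) = E s (p, w s p) (h, W h s p)"
    proof -
      interpret linear "E s (p, w s p)" by (rule linE[OF s])
      have "(h, W h s p) = (\<Sum>b\<in>Basis. (h \<bullet> b) *\<^sub>R (b, u p b s))"
        by (simp add: W_def euclidean_representation prod_eq_iff fst_sum snd_sum)
      then show ?thesis by (simp only: sum scale)
    qed
    ultimately show ?thesis by simp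
  qed
  have linW: "linear (\<lambda>h. W h s p)" for s p
    by (rule linearI) (simp_all add: W_def inner_add_left scaleR_add_left sum.distrib scaleR_sum_right)
  have ucont: "continuous_on ?I (u p b)" for p b
    unfolding continuous_on_eq_continuous_within
    using has_vector_derivative_continuous[OF u] by blast
  show thesis
  proof (rule that[of W, OF W0])
    fix h s p assume "s \<in> ?I"
    from W'[OF this, of h p] show "((\<lambda>s. W h s p) has_vector_derivative D (s, p, w s p) (0, h, W h s p)) (at s within ?I)"
      by (simp add: E_def)
  next
    fix s p assume s: "s \<in> ?I"
    let ?f' = "\<lambda>(k, h). k *\<^sub>R G (s, p, w s p) + W h s p"
    have lin: "bounded_linear ?f'"
      unfolding linear_linear case_prod_beta
      by (intro linear_compose_add linear_compose[OF linear_snd linW, unfolded o_def]) 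
         (auto intro!: bounded_linear.linear bounded_linear_intros)
    have "\<exists>C. \<forall>s\<in>?I. norm (u p b s) \<le> C" for b
      using compact_imp_bounded[OF compact_continuous_image[OF ucont compact_Icc]] unfolding bounded_iff by blast
    then obtain C where C: "\<And>b s. s \<in> ?I \<Longrightarrow> norm (u p b s) \<le> C b" by metis
    define K where "K = 1 + (\<Sum>b\<in>(Basis::'p set). C b)"
    have C0: "0 \<le> C b" for b by (rule order_trans[OF norm_ge_zero C[of 0 b]]) simp
    have K: "1 \<le> K" by (auto simp: K_def intro!: sum_nonneg C0)
    have WK: "norm (h, W h s p) \<le> K * norm h" if "s \<in> ?I" for h s
    proof -
      have "norm (W h s p) \<le> (\<Sum>b\<in>(Basis::'p set). norm h * C b)" unfolding W_def
      proof (rule sum_norm_le)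
        fix b :: 'p assume b: "b \<in> Basis"
        show "norm ((h \<bullet> b) *\<^sub>R u p b s) \<le> norm h * C b"
          using Basis_le_norm[OF b, of h] C[OF that, of b] C0 by (auto intro!: mult_mono)
      qed
      then have "norm h + norm (W h s p) \<le> K * norm h"
        by (simp add: K_def sum_distrib_left algebra_simps)
      then show ?thesis using norm_Pair_le order_trans by blast
    qed
    have "\<exists>d>0. \<forall>y\<in>?I \<times> UNIV. norm (y - (s, p)) < d \<longrightarrow>
       norm ((\<lambda>(s, p). w s p) y - w s p - ?f' (y - (s, p))) \<le> e * norm (y - (s, p))" if e: "0 < e" for e
    proof -
      \<comment> \<open>\<open>K\<close> bounds \<open>(h, W h s p)\<close> by
        \<open>norm h\<close>, and \<open>ode_estimate\<close> doubles the error, so this choice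
        yields \<open>2 * e1 * K = e / 4\<close>. Three errors of this size occur below.\<close>
      define e1 where "e1 = e / (8 * K)"
      have e1: "0 < e1" using e K by (simp add: e1_def)
      have pw: "continuous_on ?I (\<lambda>s. (p, w s p))" by (intro continuous_intros wcont)
      obtain d1 where d1: "0 < d1" "\<And>s \<zeta>. s \<in> ?I \<Longrightarrow> norm \<zeta> < d1 \<Longrightarrow>
          norm (G (s, (p, w s p) + \<zeta>) - G (s, (p, w s p)) - E s (p, w s p) \<zeta>) \<le> e1 * norm \<zeta>"
        using ode_uniform_expansion[OF E contE pw e1] by metis
      have 1: "norm (w \<sigma> (p + h) - w \<sigma> p - W h \<sigma> p) \<le> e / 4 * norm h"
        if h: "K * norm h < d1" and \<sigma>: "\<sigma> \<in> ?I" for h \<sigma>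
      proof -
        have "norm (w \<sigma> (p + h) - (w \<sigma> p + W h \<sigma> p)) \<le> 2 * (e1 * (K * norm h))"
        proof (rule ode_estimate[where a = "-1" and b = 1])
          fix t assume t: "t \<in> ?I"
          show "((\<lambda>s. w s (p + h)) has_vector_derivative G (t, p + h, w t (p + h))) (at t within ?I)"
            by (rule w[OF t])
          show "((\<lambda>s. w s p + W h s p) has_vector_derivative
              G (t, p, w t p) + E t (p, w t p) (h, W h t p)) (at t within ?I)"
            by (intro has_vector_derivative_add w W' t)
          have "norm (h, W h t p) < d1" using WK[OF t, of h] h by simp
          from d1(2)[OF t this] have
            "norm (G (t, p + h, w t p + W h t p) - G (t, p, w t p) - E t (p, w t p) (h, W h t p)) \<le> e1 * norm (h, W h t p)"
            by simp
          also have "\<dots> \<le> e1 * (K * norm h)" using e1 by (intro mult_left_mono WK t) simp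
          finally have
            "norm (G (t, p + h, w t p + W h t p) - G (t, p, w t p) - E t (p, w t p) (h, W h t p)) \<le> e1 * (K * norm h)" .
          then show "norm (G (t, p + h, w t (p + h)) - (G (t, p, w t p) + E t (p, w t p) (h, W h t p)))
            \<le> 1/2 * norm (w t (p + h) - (w t p + W h t p)) + e1 * (K * norm h)"
            using lip[OF t, of "p + h" "w t (p + h)" "w t p + W h t p"]
              norm_triangle_ineq[of "G (t, p + h, w t (p + h)) - G (t, p + h, w t p + W h t p)"
                "G (t, p + h, w t p + W h t p) - G (t, p, w t p) - E t (p, w t p) (h, W h t p)"]
            by (simp add: algebra_simps)
        qed (use \<sigma> w0 W0 in auto)
        also have "2 * (e1 * (K * norm h)) = e / 4 * norm h" using K by (simp add: e1_def)
        finally show ?thesis by (simp add: algebra_simps)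
      qed
      define e2 where "e2 = e / (4 * real DIM('p))"
      have e2: "0 < e2" using e by (simp add: e2_def)
      have "\<exists>d>0. \<forall>\<sigma>\<in>?I. \<bar>\<sigma> - s\<bar> < d \<longrightarrow> norm (u p b \<sigma> - u p b s) \<le> e2" for b
        using ucont[of p b] s e2 unfolding continuous_on_iff dist_norm real_norm_def by (meson less_imp_le)
      then obtain d2 where d2: "\<And>b. 0 < d2 b" 
        "\<And>b \<sigma>. \<sigma> \<in> ?I \<Longrightarrow> \<bar>\<sigma> - s\<bar> < d2 b \<Longrightarrow> norm (u p b \<sigma> - u p b s) \<le> e2" by metis
      define d2' where "d2' = Min (d2 ` (Basis :: 'p set))"
      have d2': "0 < d2'" "\<And>b. b \<in> Basis \<Longrightarrow> d2' \<le> d2 b" by (auto simp: d2'_def d2(1))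
      have 2: "norm (W h \<sigma> p - W h s p) \<le> e / 4 * norm h" if "\<sigma> \<in> ?I" "\<bar>\<sigma> - s\<bar> < d2'" for h \<sigma>
      proof -
        have "norm (W h \<sigma> p - W h s p) = norm (\<Sum>b\<in>Basis. (h \<bullet> b) *\<^sub>R (u p b \<sigma> - u p b s))"
          by (simp add: W_def sum_subtractf scaleR_diff_right)
        also have "\<dots> \<le> (\<Sum>b\<in>(Basis::'p set). norm h * e2)"
        proof (rule sum_norm_le)
          fix b :: 'p assume b: "b \<in> Basis"
          have "norm (u p b \<sigma> - u p b s) \<le> e2" using that d2'(2)[OF b] by (intro d2(2)) auto
          then show "norm ((h \<bullet> b) *\<^sub>R (u p b \<sigma> - u p b s)) \<le> norm h * e2"
            using Basis_le_norm[OF b, of h] by (auto intro!: mult_mono)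
        qed
        also have "\<dots> = e / 4 * norm h" by (simp add: e2_def)
        finally show ?thesis .
      qed
      obtain d3 where d3: "0 < d3" "\<And>\<sigma>. \<sigma> \<in> ?I \<Longrightarrow> norm (\<sigma> - s) < d3 \<Longrightarrow>
          norm (w \<sigma> p - w s p - (\<sigma> - s) *\<^sub>R G (s, p, w s p)) \<le> e / 4 * norm (\<sigma> - s)"
        using w[OF s, of p, unfolded has_vector_derivative_def has_derivative_within_alt, THEN conjunct2, rule_format, of "e / 4"] e
        by auto
      define d where "d = min (d1 / K) (min d2' d3)"
      show ?thesis
      proof (intro exI[of _ d] conjI ballI impI)
        show "0 < d" using d1 d2' d3 K by (simp add: d_def)
        fix y assume y: "y \<in> ?I \<times> (UNIV::'p set)" "norm (y - (s, p)) < d"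
        obtain \<sigma> q where yq: "y = (\<sigma>, q)" by (cases y)
        define h where "h = q - p"
        have q: "q = p + h" by (simp add: h_def)
        have \<sigma>: "\<sigma> \<in> ?I" using y yq by auto
        let ?n = "norm (y - (s, p))"
        have n1: "norm h \<le> ?n" by (simp add: yq h_def norm_snd_le)
        have n2: "norm (\<sigma> - s) \<le> ?n" using norm_fst_le[of "\<sigma> - s"] by (simp add: yq)
        have "norm h < d1 / K" using n1 y(2) by (simp add: d_def)
        then have "K * norm h < d1" using K by (simp add: field_simps)
        note b1 = 1[OF this \<sigma>]
        have b2: "norm (W h \<sigma> p - W h s p) \<le> e / 4 * norm h" using n2 y(2) by (intro 2 \<sigma>) (simp add: d_def)
        have b3: "norm (w \<sigma> p - w s p - (\<sigma> - s) *\<^sub>R G (s, p, w s p)) \<le> e / 4 * norm (\<sigma> - s)"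
          using n2 y(2) by (intro d3(2) \<sigma>) (simp add: d_def)
        \<comment> \<open>The increment is split into a change of the parameter at the new time, a
          change of time in the linear term, and a change of time at the old parameter.\<close>
        have "(\<lambda>(s, p). w s p) y - w s p - ?f' (y - (s, p)) = (w \<sigma> (p + h) - w \<sigma> p - W h \<sigma> p) + (W h \<sigma> p - W h s p) +
            (w \<sigma> p - w s p - (\<sigma> - s) *\<^sub>R G (s, p, w s p))"
          by (simp add: yq q)
        also have "norm \<dots> \<le> e / 4 * norm h + e / 4 * norm h + e / 4 * norm (\<sigma> - s)"
          by (intro norm_triangle_le add_mono b1 b2 b3)
        also have "\<dots> \<le> e / 4 * ?n + e / 4 * ?n + e / 4 * ?n"
          using e by (intro add_mono mult_left_mono n1 n2) auto
        also have "\<dots> \<le> e * ?n" using e by simp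
        finally show "norm ((\<lambda>(s, p). w s p) y - w s p - ?f' (y - (s, p))) \<le> e * ?n" .
      qed
    qed
    with lin show "((\<lambda>(s, p). w s p) has_derivative ?f') (at (s, p) within ?I \<times> UNIV)"
      unfolding has_derivative_within_alt by simp
  qed
qed

text \<open>The solution for \<open>p0\<close> nearly solves the equation for a nearby
  \<open>p\<close>: along this one compact curve the two fields differ by less than
  \<open>e / 8\<close>, and \<open>ode_estimate\<close> turns that into a distance of at most
  \<open>e / 4\<close>.\<close>

lemma ode_continuous:
  fixes G :: "real \<times> 'p::euclidean_space \<times> 'e::euclidean_space \<Rightarrow> 'e"
  assumes cont: "continuous_on ({-1..1} \<times> UNIV) G"
    and lip: "\<And>s p y z. s \<in> {-1..1} \<Longrightarrow> norm (G (s, p, y) - G (s, p, z)) \<le> 1/2 * norm (y - z)"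
    and w0: "\<And>p. w 0 p = 0"
    and w: "\<And>s p. s \<in> {-1..1} \<Longrightarrow> ((\<lambda>s. w s p) has_vector_derivative G (s, p, w s p)) (at s within {-1..1})"
  shows "continuous_on ({-1..1} \<times> UNIV) (\<lambda>(s, p). w s p)"
  unfolding continuous_on_iff
proof (intro ballI allI impI)
  let ?I = "{-1..1::real}"
  fix x and e :: real assume x: "x \<in> ?I \<times> (UNIV :: 'p set)" and e: "0 < e"
  obtain s0 p0 where sp: "x = (s0, p0)" by (cases x)
  have s0: "s0 \<in> ?I" using x sp by auto
  have wcont: "continuous_on ?I (\<lambda>s. w s p)" for p
    unfolding continuous_on_eq_continuous_within
    using has_vector_derivative_continuous[OF w] by blast
  have "continuous_on (?I \<times> UNIV) (\<lambda>x. G (fst x, snd x, w (fst x) p0))"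
    by (rule continuous_on_compose2[OF cont])
      (auto intro!: continuous_intros continuous_on_compose2[OF wcont])
  from continuous_uniform_at[OF this, of "e / 8" p0] e
  obtain d where d: "0 < d" "\<And>s p. s \<in> ?I \<Longrightarrow> dist p p0 < d \<Longrightarrow>
     dist (G (s, p, w s p0)) (G (s, p0, w s p0)) < e / 8" by auto
  obtain d' where d': "0 < d'" "\<And>s. s \<in> ?I \<Longrightarrow> dist s s0 < d' \<Longrightarrow> dist (w s p0) (w s0 p0) < e / 2"
    using wcont[of p0] s0 e unfolding continuous_on_iff by (meson half_gt_zero)
  have *: "norm (w s p - w s p0) \<le> 2 * (e / 8)" if "dist p p0 < d" "s \<in> ?I" for s p
  proof (rule ode_estimate[where a = "-1" and b = 1])
    fix t assume t: "t \<in> ?I"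
    show "((\<lambda>s. w s p) has_vector_derivative G (t, p, w t p)) (at t within ?I)"
      "((\<lambda>s. w s p0) has_vector_derivative G (t, p0, w t p0)) (at t within ?I)" by (intro w t)+
    show "norm (G (t, p, w t p) - G (t, p0, w t p0)) \<le> 1/2 * norm (w t p - w t p0) + e / 8"
      using lip[OF t, of p "w t p" "w t p0"] d(2)[OF t that(1)]
        norm_triangle_ineq[of "G (t, p, w t p) - G (t, p, w t p0)" "G (t, p, w t p0) - G (t, p0, w t p0)"]
      by (simp add: dist_norm)
  qed (use that w0 in auto)
  show "\<exists>d>0. \<forall>x'\<in>?I \<times> UNIV. dist x' x < d \<longrightarrow> dist (case x' of (s, p) \<Rightarrow> w s p) (case x of (s, p) \<Rightarrow> w s p) < e"
  proof (intro exI[of _ "min d d'"] conjI ballI impI)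
    fix x' assume x': "x' \<in> ?I \<times> (UNIV :: 'p set)" "dist x' x < min d d'"
    obtain s p where sp': "x' = (s, p)" by (cases x')
    have "dist s s0 < d'" "dist p p0 < d"
      using x'(2) dist_fst_le[of x' x] dist_snd_le[of x' x] by (auto simp: sp sp')
    then have "dist (w s p) (w s p0) < e / 2" "dist (w s p0) (w s0 p0) < e / 2"
      using *[of p s] d'(2)[of s] x'(1) e by (auto simp: sp' dist_norm)
    then show "dist (case x' of (s, p) \<Rightarrow> w s p) (case x of (s, p) \<Rightarrow> w s p) < e"
      using dist_triangle_half_r[of "w s p0" "w s p" e "w s0 p0"] by (simp add: sp sp' dist_commute)
  qed (use d d' in auto)
qed

lemma ode_Ck:
  fixes G :: "real \<times> 'p::euclidean_space \<times> 'e::euclidean_space \<Rightarrow> 'e"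
  assumes "Ck k ({-1..1} \<times> UNIV) G"
    and "\<And>s p y z. s \<in> {-1..1} \<Longrightarrow> norm (G (s, p, y) - G (s, p, z)) \<le> 1/2 * norm (y - z)"
    and "\<And>p. w 0 p = 0"
    and "\<And>s p. s \<in> {-1..1} \<Longrightarrow> ((\<lambda>s. w s p) has_vector_derivative G (s, p, w s p)) (at s within {-1..1})"
  shows "Ck k ({-1..1} \<times> UNIV) (\<lambda>(s, p). w s p)"
  using assms
proof (induction k arbitrary: G w)
  case 0
  then show ?case using ode_continuous[of G w] by auto
next
  case (Suc k)
  let ?I = "{-1..1::real}" and ?S = "{-1..1::real} \<times> (UNIV :: 'p set)"
  note lip = Suc.prems(2) and w0 = Suc.prems(3) and w = Suc.prems(4)
  obtain D where D: "\<And>x. x \<in> ?I \<times> UNIV \<Longrightarrow> (G has_derivative D x) (at x within ?I \<times> UNIV)"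
    "\<And>v. Ck k (?I \<times> UNIV) (\<lambda>x. D x v)"
    using Suc.prems(1) by (rule Ck_SucE) blast
  have contD: "continuous_on (?I \<times> UNIV) (\<lambda>x. D x v)" for v by (rule Ck_continuous[OF D(2)])
  obtain W where W0: "\<And>h p. W h 0 p = 0" and
    W: "\<And>h s p. s \<in> ?I \<Longrightarrow> ((\<lambda>s. W h s p) has_vector_derivative D (s, p, w s p) (0, h, W h s p)) (at s within ?I)" and
    W': "\<And>s p. s \<in> ?I \<Longrightarrow> ((\<lambda>(s, p). w s p) has_derivative (\<lambda>(k, h). k *\<^sub>R G (s, p, w s p) + W h s p)) (at (s, p) within ?S)"
    using ode_parameter_derivative[OF D(1) contD lip w0 w] by blast
  \<comment> \<open>The linearised equation has \<open>w\<close> in its coefficients, so its field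
    is of class \<open>Ck k\<close> only after the induction hypothesis has been applied to the
    original equation.\<close>
  have wk: "Ck k ?S (\<lambda>(s, p). w s p)"
    by (rule Suc.IH[OF Ck_Suc_imp[OF Suc.prems(1)] lip w0 w])
  have curve: "Ck k ?S (\<lambda>x. (fst x, snd x, w (fst x) (snd x)))"
    using wk by (intro Ck_Pair Ck_fst Ck_snd Ck_id) (simp add: case_prod_unfold)
  have linD: "linear (D x)" if "x \<in> ?I \<times> UNIV" for x by (rule has_derivative_linear[OF D(1)[OF that]])
  have Wk: "Ck k ?S (\<lambda>(s, p). W h s p)" for h
  proof (rule Suc.IH[where G = "\<lambda>(s, p, u). D (s, p, w s p) (0, h, u)"])
    have Dc: "Ck k (?I \<times> UNIV) (\<lambda>x. D (fst x, fst (snd x), w (fst x) (fst (snd x))) v)" for v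
    proof (rule Ck_compose[OF _ D(2)])
      have "Ck k (?I \<times> UNIV) (\<lambda>x. (\<lambda>x. (fst x, snd x, w (fst x) (snd x))) (fst x, fst (snd x)))"
        by (rule Ck_compose[OF _ curve]) (intro Ck_Pair Ck_fst Ck_snd Ck_id, auto)
      then show "Ck k (?I \<times> UNIV) (\<lambda>x. (fst x, fst (snd x), w (fst x) (fst (snd x))))" by simp
    qed auto
    show "Ck k (?I \<times> UNIV) (\<lambda>(s, p, u). D (s, p, w s p) (0, h, u))"
    proof (rule Ck_cong)
      show "Ck k (?I \<times> UNIV) (\<lambda>x. D (fst x, fst (snd x), w (fst x) (fst (snd x))) (0, h, 0) +
          (\<Sum>i\<in>Basis. (snd (snd x) \<bullet> i) *\<^sub>R D (fst x, fst (snd x), w (fst x) (fst (snd x))) (0, 0, i)))"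
        by (intro Ck_add Dc Ck_sum Ck_scaleR Ck_inner Ck_snd Ck_id Ck_const)
      fix x assume "x \<in> ?I \<times> (UNIV :: ('p \<times> 'e) set)"
      then have "(fst x, fst (snd x), w (fst x) (fst (snd x))) \<in> ?I \<times> UNIV" by auto
      from linD[OF this] interpret linear "D (fst x, fst (snd x), w (fst x) (fst (snd x)))" .
      have "(0, h, snd (snd x)) = (0, h, 0) + (\<Sum>i\<in>Basis. (snd (snd x) \<bullet> i) *\<^sub>R (0, 0, i))"
        by (simp add: euclidean_representation prod_eq_iff fst_sum snd_sum)
      then have "D (fst x, fst (snd x), w (fst x) (fst (snd x))) (0, h, snd (snd x)) =
        D (fst x, fst (snd x), w (fst x) (fst (snd x))) ((0, h, 0) + (\<Sum>i\<in>Basis. (snd (snd x) \<bullet> i) *\<^sub>R (0, 0, i)))"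
        by (rule arg_cong)
      then show "D (fst x, fst (snd x), w (fst x) (fst (snd x))) (0, h, 0) +
          (\<Sum>i\<in>Basis. (snd (snd x) \<bullet> i) *\<^sub>R D (fst x, fst (snd x), w (fst x) (fst (snd x))) (0, 0, i)) =
          (case x of (s, p, u) \<Rightarrow> D (s, p, w s p) (0, h, u))"
        by (simp only: add sum scale case_prod_beta)
    qed
    fix s :: real and p :: 'p and y z :: 'e assume s: "s \<in> ?I"
    have "((\<lambda>y. G (s, p, y)) has_derivative (\<lambda>v. D (s, p, w s p) (0, 0, v))) (at (w s p))"
    proof (rule has_derivative_in_compose[of "\<lambda>y. (s, p, y)" "\<lambda>v. (0, 0, v)" _ UNIV])
      show "((\<lambda>y. (s, p, y)) has_derivative (\<lambda>v. (0, 0, v))) (at (w s p))"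
        by (intro has_derivative_Pair has_derivative_const has_derivative_ident)
      show "(G has_derivative D (s, p, w s p)) (at (s, p, w s p) within range (\<lambda>y. (s, p, y)))"
        by (rule has_derivative_subset[OF D(1)]) (use s in auto)
    qed
    then have "norm (D (s, p, w s p) (0, 0, y - z)) \<le> 1/2 * norm (y - z)"
      by (rule has_derivative_norm_bound) (rule lip[OF s])
    moreover have "D (s, p, w s p) (0, h, y) - D (s, p, w s p) (0, h, z) = D (s, p, w s p) (0, 0, y - z)"
      using linear_diff[OF linD, of "(s, p, w s p)" "(0, h, y)" "(0, h, z)"] s by simp
    ultimately show "norm ((case (s, p, y) of (s, p, u) \<Rightarrow> D (s, p, w s p) (0, h, u)) -
        (case (s, p, z) of (s, p, u) \<Rightarrow> D (s, p, w s p) (0, h, u))) \<le> 1/2 * norm (y - z)"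
      by simp
  next
    fix s p assume "s \<in> ?I"
    from W[OF this, of h p] show "((\<lambda>s. W h s p) has_vector_derivative
        (case (s, p, W h s p) of (s, p, u) \<Rightarrow> D (s, p, w s p) (0, h, u))) (at s within ?I)"
      by simp
  qed (rule W0)
  have Gk: "Ck k ?S (\<lambda>x. G (fst x, snd x, w (fst x) (snd x)))"
    by (rule Ck_compose[OF curve Ck_Suc_imp[OF Suc.prems(1)]]) auto
  show ?case
  proof (rule Ck_SucI[where f' = "\<lambda>x v. fst v *\<^sub>R G (fst x, snd x, w (fst x) (snd x)) + W (snd v) (fst x) (snd x)"])
    fix x assume "x \<in> ?S"
    then show "((\<lambda>(s, p). w s p) has_derivative
        (\<lambda>v. fst v *\<^sub>R G (fst x, snd x, w (fst x) (snd x)) + W (snd v) (fst x) (snd x))) (at x within ?S)"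
      using W'[of "fst x" "snd x"] by (auto simp: case_prod_unfold)
  next
    fix v show "Ck k ?S (\<lambda>x. fst v *\<^sub>R G (fst x, snd x, w (fst x) (snd x)) + W (snd v) (fst x) (snd x))"
      using Wk[of "snd v"] by (intro Ck_add Ck_scaleR Ck_const Gk) (simp add: case_prod_unfold)
  qed
qed

text \<open>The initial value is turned into a parameter by writing
  \<open>\<phi> s p = p + w p s\<close>, where \<open>w\<close> starts at 0 and solves the equation
  with field \<open>X (p + w)\<close>. The space derivative \<open>J\<close> is recorded with its
  own differential equation, since the invariance of the symplectic form is proved by
  differentiating along it.\<close>

theorem smooth_flow_exists:
  fixes X :: "'e::euclidean_space \<Rightarrow> 'e"
  assumes X: "Cinf UNIV X" and lip: "\<And>y z. norm (X y - X z) \<le> 1/2 * norm (y - z)"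
  obtains \<phi> J where "\<And>p. \<phi> 0 p = p" "\<And>p h. J 0 p h = h"
    "\<And>s p. s \<in> {-1..1} \<Longrightarrow> ((\<lambda>s. \<phi> s p) has_vector_derivative X (\<phi> s p)) (at s within {-1..1})"
    "\<And>s p h. s \<in> {-1..1} \<Longrightarrow> ((\<lambda>s. J s p h) has_vector_derivative
        frechet_derivative X (at (\<phi> s p)) (J s p h)) (at s within {-1..1})"
    "\<And>s p. s \<in> {-1..1} \<Longrightarrow> ((\<lambda>(s, p). \<phi> s p) has_derivative (\<lambda>(k, h). k *\<^sub>R X (\<phi> s p) + J s p h))
        (at (s, p) within {-1..1} \<times> UNIV)"
    "Cinf ({-1..1} \<times> UNIV) (\<lambda>(s, p). \<phi> s p)"
proof -
  let ?G = "\<lambda>x::real \<times> 'e \<times> 'e. X (fst (snd x) + snd (snd x))"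
  let ?DX = "\<lambda>y. frechet_derivative X (at y)"
  let ?D = "\<lambda>x v::real \<times> 'e \<times> 'e. ?DX (fst (snd x) + snd (snd x)) (fst (snd v) + snd (snd v))"
  have G: "Ck k ({-1..1} \<times> UNIV) ?G" for k
    by (rule Ck_compose[where T = UNIV]) (use X in \<open>auto simp: Cinf_def intro!: Ck_intros\<close>)
  have DX: "(X has_derivative ?DX y) (at y)" for y using Cinf_derivative[OF X, of y] by simp
  have D: "(?G has_derivative ?D x) (at x within S)" for x S
    by (rule has_derivative_compose[where g = X and f = "\<lambda>x. fst (snd x) + snd (snd x)", OF _ DX])
      (auto intro!: derivative_eq_intros)
  have "continuous_on UNIV (\<lambda>y. ?DX y v)" for v
    using Cinf_continuous[OF Cinf_frechet[OF X thick_open[OF open_UNIV], of v]] by simp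
  then have contD: "continuous_on S (\<lambda>x. ?D x v)" for v and S :: "(real \<times> 'e \<times> 'e) set"
    by (rule continuous_on_compose2) (auto intro!: continuous_intros)
  have lipG: "norm (?G (s, p, y) - ?G (s, p, z)) \<le> 1/2 * norm (y - z)" for s p y z
    using lip[of "p + y" "p + z"] by simp
  have "\<exists>w. w 0 = 0 \<and> (\<forall>s\<in>{-1..1}. (w has_vector_derivative X (p + w s)) (at s within {-1..1}))" for p
  proof (rule picard_exists)
    have "continuous_on ({-1..1} \<times> UNIV) (\<lambda>x::real \<times> 'e. X (p + snd x))"
      by (rule continuous_on_compose2[OF Cinf_continuous[OF X]]) (auto intro!: continuous_intros)
    then show "continuous_on ({-1..1} \<times> UNIV) (\<lambda>(s::real, y). X (p + y))" by (simp add: case_prod_beta)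
    show "norm (X (p + y) - X (p + z)) \<le> 1/2 * norm (y - z)" for y z using lip[of "p + y" "p + z"] by simp
  qed
  then obtain w where w0: "\<And>p. w p 0 = 0" and
    w: "\<And>p s. s \<in> {-1..1} \<Longrightarrow> (w p has_vector_derivative X (p + w p s)) (at s within {-1..1})"
    by metis
  have w': "((\<lambda>s. w p s) has_vector_derivative ?G (s, p, w p s)) (at s within {-1..1})" if "s \<in> {-1..1}" for s p
    using w[OF that, of p] by simp
  obtain W where W0: "\<And>h p. W h 0 p = 0" and
    W: "\<And>h s p. s \<in> {-1..1} \<Longrightarrow> ((\<lambda>s. W h s p) has_vector_derivative ?D (s, p, w p s) (0, h, W h s p)) (at s within {-1..1})" and
    W': "\<And>s p. s \<in> {-1..1} \<Longrightarrow> ((\<lambda>(s, p). w p s) has_derivative (\<lambda>(k, h). k *\<^sub>R ?G (s, p, w p s) + W h s p))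
        (at (s, p) within {-1..1} \<times> UNIV)"
    using ode_parameter_derivative[where G = ?G and D = ?D and w = "\<lambda>s p. w p s", OF D contD lipG w0 w'] by blast
  have "Ck k ({-1..1} \<times> UNIV) (\<lambda>(s, p). w p s)" for k
    by (rule ode_Ck[OF G, of "\<lambda>s p. w p s"]) (use w' w0 lipG in auto)
  then have "Ck k ({-1..1} \<times> UNIV) (\<lambda>(s, p). p + w p s)" for k
    unfolding case_prod_unfold by (intro Ck_add Ck_snd Ck_id)
  then have smooth: "Cinf ({-1..1} \<times> UNIV) (\<lambda>(s, p). p + w p s)" by (auto simp: Cinf_def)
  show thesis
  proof (rule that[of "\<lambda>s p. p + w p s" "\<lambda>s p h. h + W h s p"])
    fix s p assume s: "s \<in> {-1..1::real}"
    from has_vector_derivative_add[OF has_vector_derivative_const w[OF s, of p], of p]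
    show "((\<lambda>s. p + w p s) has_vector_derivative X (p + w p s)) (at s within {-1..1})" by simp
    show "((\<lambda>s. h + W h s p) has_vector_derivative ?DX (p + w p s) (h + W h s p)) (at s within {-1..1})" for h
      using has_vector_derivative_add[OF has_vector_derivative_const W[OF s, of h p], of h] by simp
    have "((\<lambda>x. snd x + (\<lambda>(s, p). w p s) x) has_derivative (\<lambda>v. snd v + (\<lambda>(k, h). k *\<^sub>R ?G (s, p, w p s) + W h s p) v))
        (at (s, p) within {-1..1} \<times> UNIV)"
      by (intro has_derivative_add has_derivative_snd has_derivative_ident W' s)
    then show "((\<lambda>(s, p). p + w p s) has_derivative (\<lambda>(k, h). k *\<^sub>R X (p + w p s) + (h + W h s p)))
        (at (s, p) within {-1..1} \<times> UNIV)"
      by (simp add: case_prod_unfold algebra_simps)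
  qed (use smooth w0 W0 in auto)
qed

section \<open>Symmetry of second derivatives\<close>

text \<open>The mean value theorem is used twice, first in direction \<open>u\<close> on the
  difference in direction \<open>v\<close>, then in direction \<open>v\<close> on the derivative
  along \<open>u\<close>. The left side is symmetric in \<open>u\<close> and \<open>v\<close> while
  the right side is not, which is the source of symmetry.\<close>

lemma second_difference:
  fixes f :: "'a::euclidean_space \<Rightarrow> real"
  assumes S: "\<And>\<sigma> \<tau>. 0 \<le> \<sigma> \<Longrightarrow> \<sigma> \<le> s \<Longrightarrow> 0 \<le> \<tau> \<Longrightarrow> \<tau> \<le> s \<Longrightarrow> x + \<sigma> *\<^sub>R u + \<tau> *\<^sub>R v \<in> S" and s: "0 < s"
    and f: "\<And>y. y \<in> S \<Longrightarrow> (f has_derivative f' y) (at y)"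
    and fu: "\<And>y. y \<in> S \<Longrightarrow> ((\<lambda>y. f' y u) has_derivative f'' y) (at y)"
  shows "\<exists>\<sigma> \<tau>. 0 \<le> \<sigma> \<and> \<sigma> \<le> s \<and> 0 \<le> \<tau> \<and> \<tau> \<le> s \<and>
    f (x + s *\<^sub>R u + s *\<^sub>R v) - f (x + s *\<^sub>R u) - f (x + s *\<^sub>R v) + f x = s * s * f'' (x + \<sigma> *\<^sub>R u + \<tau> *\<^sub>R v) v"
proof -
  let ?h = "\<lambda>\<sigma>. f (x + \<sigma> *\<^sub>R u + s *\<^sub>R v) - f (x + \<sigma> *\<^sub>R u)"
  have "\<exists>\<sigma>\<in>{0<..<s}. ?h s - ?h 0 = (\<lambda>k. k * (f' (x + \<sigma> *\<^sub>R u + s *\<^sub>R v) u - f' (x + \<sigma> *\<^sub>R u) u)) (s - 0)"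
  proof (rule mvt_simple[OF s])
    fix \<sigma> assume \<sigma>: "0 \<le> \<sigma>" "\<sigma> \<le> s"
    have d: "((\<lambda>\<sigma>. f (x + \<sigma> *\<^sub>R u + z)) has_derivative (\<lambda>k. k * f' (x + \<sigma> *\<^sub>R u + z) u)) (at \<sigma> within {0..s})"
      if "x + \<sigma> *\<^sub>R u + z \<in> S" for z
    proof -
      have "((\<lambda>\<sigma>. f (x + \<sigma> *\<^sub>R u + z)) has_derivative (\<lambda>k. f' (x + \<sigma> *\<^sub>R u + z) (k *\<^sub>R u))) (at \<sigma> within {0..s})"
        by (rule has_derivative_compose[where g = f and f = "\<lambda>\<sigma>. x + \<sigma> *\<^sub>R u + z", OF _ f[OF that]]) (auto intro!: derivative_eq_intros)
      then show ?thesis using linear_scale[OF has_derivative_linear[OF f[OF that]]] by simp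
    qed
    have "x + \<sigma> *\<^sub>R u + s *\<^sub>R v \<in> S" "x + \<sigma> *\<^sub>R u + 0 \<in> S"
      using S[of \<sigma> s] S[of \<sigma> 0] \<sigma> s by auto
    from has_derivative_diff[OF d[OF this(1)] d[OF this(2)]]
    show "(?h has_derivative (\<lambda>k. k * (f' (x + \<sigma> *\<^sub>R u + s *\<^sub>R v) u - f' (x + \<sigma> *\<^sub>R u) u))) (at \<sigma> within {0..s})"
      by (simp add: algebra_simps)
  qed
  then obtain \<sigma> where \<sigma>: "0 < \<sigma>" "\<sigma> < s" "?h s - ?h 0 = s * (f' (x + \<sigma> *\<^sub>R u + s *\<^sub>R v) u - f' (x + \<sigma> *\<^sub>R u) u)"
    by auto
  let ?k = "\<lambda>\<tau>. f' (x + \<sigma> *\<^sub>R u + \<tau> *\<^sub>R v) u"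
  have "\<exists>\<tau>\<in>{0<..<s}. ?k s - ?k 0 = (\<lambda>k. k * f'' (x + \<sigma> *\<^sub>R u + \<tau> *\<^sub>R v) v) (s - 0)"
  proof (rule mvt_simple[OF s])
    fix \<tau> assume \<tau>: "0 \<le> \<tau>" "\<tau> \<le> s"
    have *: "x + \<sigma> *\<^sub>R u + \<tau> *\<^sub>R v \<in> S" using S[of \<sigma> \<tau>] \<sigma> \<tau> by auto
    have "(?k has_derivative (\<lambda>k. f'' (x + \<sigma> *\<^sub>R u + \<tau> *\<^sub>R v) (k *\<^sub>R v))) (at \<tau> within {0..s})"
      by (rule has_derivative_compose[where g = "\<lambda>y. f' y u" and f = "\<lambda>\<tau>. x + \<sigma> *\<^sub>R u + \<tau> *\<^sub>R v", OF _ fu[OF *]])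
        (auto intro!: derivative_eq_intros)
    then show "(?k has_derivative (\<lambda>k. k * f'' (x + \<sigma> *\<^sub>R u + \<tau> *\<^sub>R v) v)) (at \<tau> within {0..s})"
      using linear_scale[OF has_derivative_linear[OF fu[OF *]]] by simp
  qed
  then obtain \<tau> where "0 < \<tau>" "\<tau> < s" "?k s - ?k 0 = s * f'' (x + \<sigma> *\<^sub>R u + \<tau> *\<^sub>R v) v" by auto
  with \<sigma> show ?thesis by (intro exI[of _ \<sigma>] exI[of _ \<tau>]) (simp add: algebra_simps)
qed

text \<open>One and the same second difference equals \<open>s * s\<close> times either mixed
  derivative at points close to \<open>x\<close>. By continuity both are within half of the supposed
  gap of their values at \<open>x\<close>, which contradicts the gap.\<close>

lemma second_derivative_symmetric:
  fixes f :: "'a::euclidean_space \<Rightarrow> real"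
  assumes S: "open S" "x \<in> S" and f: "Cinf S f"
  shows "frechet_derivative (\<lambda>y. frechet_derivative f (at y) v) (at x) u =
    frechet_derivative (\<lambda>y. frechet_derivative f (at y) u) (at x) v"
proof (rule ccontr)
  let ?f' = "\<lambda>y v. frechet_derivative f (at y) v" and
    ?f'' = "\<lambda>u y v. frechet_derivative (\<lambda>y. frechet_derivative f (at y) u) (at y) v"
  assume "?f'' v x u \<noteq> ?f'' u x v"
  then have e: "0 < \<bar>?f'' v x u - ?f'' u x v\<bar> / 2" (is "0 < ?e") by simp
  have at: "at y within S = at y" if "y \<in> S" for y using S(1) that by (rule at_within_open[rotated])
  have f': "(f has_derivative ?f' y) (at y)" if "y \<in> S" for y
    using Cinf_derivative[OF f that] at[OF that] by simp
  have Cf': "Cinf S (\<lambda>y. ?f' y v)" for v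
    by (rule Cinf_cong[OF Cinf_frechet[OF f thick_open[OF S(1)], of v]]) (simp add: at)
  have f'': "((\<lambda>y. ?f' y v) has_derivative ?f'' v y) (at y)" if "y \<in> S" for y v
    using Cinf_derivative[OF Cf' that, of v] at[OF that] by simp
  have "Cinf S (\<lambda>y. ?f'' u y v)" for u v
    by (rule Cinf_cong[OF Cinf_frechet[OF Cf'[of u] thick_open[OF S(1)], of v]]) (simp add: at)
  note cont = Cinf_continuous[OF this]
  have near: "\<exists>d>0. \<forall>y. dist y x < d \<longrightarrow> y \<in> S \<and> \<bar>?f'' u y v - ?f'' u x v\<bar> < ?e" for u v
  proof -
    obtain d where d: "0 < d" "\<And>y. y \<in> S \<Longrightarrow> dist y x < d \<Longrightarrow> \<bar>?f'' u y v - ?f'' u x v\<bar> < ?e"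
      using cont[of u v] S(2) e unfolding continuous_on_iff dist_real_def by meson
    obtain d' where "0 < d'" "\<And>y. dist y x < d' \<Longrightarrow> y \<in> S" using S unfolding open_dist by blast
    with d show ?thesis by (intro exI[of _ "min d d'"]) auto
  qed
  obtain d1 where d1: "0 < d1" "\<And>y. dist y x < d1 \<Longrightarrow> y \<in> S \<and> \<bar>?f'' v y u - ?f'' v x u\<bar> < ?e"
    using near[of v u] by blast
  obtain d2 where d2: "0 < d2" "\<And>y. dist y x < d2 \<Longrightarrow> \<bar>?f'' u y v - ?f'' u x v\<bar> < ?e"
    using near[of u v] by blast
  \<comment> \<open>The summand 1 keeps \<open>N\<close> positive when both directions vanish. The
    step \<open>s\<close> makes \<open>s * N\<close> half of the smaller radius, so the
    parallelogram spanned by \<open>s *\<^sub>R u\<close> and \<open>s *\<^sub>R v\<close> stays in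
    both neighbourhoods.\<close>
  define N where "N = norm u + norm v + 1"
  define s where "s = min d1 d2 / (2 * N)"
  have "0 < N" "0 < min d1 d2" using d1(1) d2(1) by (simp_all add: N_def add_nonneg_pos)
  then have "0 < s" "s * N < min d1 d2" by (auto simp: s_def)
  then have s: "0 < s" "s * (norm u + norm v + 1) < min d1 d2" by (simp_all add: N_def)
  have near': "dist (x + \<sigma> *\<^sub>R u + \<tau> *\<^sub>R v) x < min d1 d2" if "0 \<le> \<sigma>" "\<sigma> \<le> s" "0 \<le> \<tau>" "\<tau> \<le> s" for \<sigma> \<tau>
  proof -
    have "dist (x + \<sigma> *\<^sub>R u + \<tau> *\<^sub>R v) x \<le> \<sigma> * norm u + \<tau> * norm v"
      using norm_triangle_ineq[of "\<sigma> *\<^sub>R u" "\<tau> *\<^sub>R v"] that by (simp add: dist_norm)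
    also have "\<dots> \<le> s * norm u + s * norm v" using that by (intro add_mono mult_right_mono) auto
    also have "\<dots> \<le> s * (norm u + norm v + 1)" using s(1) by (simp add: algebra_simps)
    finally show ?thesis using s(2) by simp
  qed
  have near'': "dist (x + \<tau> *\<^sub>R v + \<sigma> *\<^sub>R u) x < min d1 d2" if "0 \<le> \<sigma>" "\<sigma> \<le> s" "0 \<le> \<tau>" "\<tau> \<le> s" for \<sigma> \<tau>
    using near'[OF that] by (simp add: add_ac)
  obtain \<sigma> \<tau> where 1: "0 \<le> \<sigma>" "\<sigma> \<le> s" "0 \<le> \<tau>" "\<tau> \<le> s"
    "f (x + s *\<^sub>R u + s *\<^sub>R v) - f (x + s *\<^sub>R u) - f (x + s *\<^sub>R v) + f x = s * s * ?f'' u (x + \<sigma> *\<^sub>R u + \<tau> *\<^sub>R v) v"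
    using second_difference[where S = S and f = f and f' = ?f' and f'' = "?f'' u" and x = x and u = u and v = v, OF _ s(1) f' f'']
      d1(2) near' by (metis min_less_iff_conj)
  obtain \<sigma>' \<tau>' where 2: "0 \<le> \<sigma>'" "\<sigma>' \<le> s" "0 \<le> \<tau>'" "\<tau>' \<le> s"
    "f (x + s *\<^sub>R v + s *\<^sub>R u) - f (x + s *\<^sub>R v) - f (x + s *\<^sub>R u) + f x = s * s * ?f'' v (x + \<sigma>' *\<^sub>R v + \<tau>' *\<^sub>R u) u"
    using second_difference[where S = S and f = f and f' = ?f' and f'' = "?f'' v" and x = x and u = v and v = u, OF _ s(1) f' f'']
      d1(2) near'' by (metis min_less_iff_conj)
  have "f (x + s *\<^sub>R v + s *\<^sub>R u) - f (x + s *\<^sub>R v) - f (x + s *\<^sub>R u) + f x =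
    f (x + s *\<^sub>R u + s *\<^sub>R v) - f (x + s *\<^sub>R u) - f (x + s *\<^sub>R v) + f x"
    by (simp add: add_ac)
  then have "?f'' u (x + \<sigma> *\<^sub>R u + \<tau> *\<^sub>R v) v = ?f'' v (x + \<sigma>' *\<^sub>R v + \<tau>' *\<^sub>R u) u"
    using 1(5) 2(5) s(1) by simp
  moreover have "\<bar>?f'' u (x + \<sigma> *\<^sub>R u + \<tau> *\<^sub>R v) v - ?f'' u x v\<bar> < ?e"
    using near'[OF 1(1-4)] by (intro d2(2)) simp
  moreover have "\<bar>?f'' v (x + \<sigma>' *\<^sub>R v + \<tau>' *\<^sub>R u) u - ?f'' v x u\<bar> < ?e"
    using near''[OF 2(3,4,1,2)] d1(2) by simp
  ultimately show False by (simp add: field_simps abs_if split: if_splits)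
qed

section \<open>Integrals depending on a parameter\<close>

text \<open>The Leibniz rule is stated for operator valued derivatives. Continuity in every fixed
  direction suffices for that, because in finite dimension continuity into \<open>blinfun\<close>
  may be checked on basis vectors.\<close>

lemma integral_parameter_has_derivative:
  fixes f :: "'z::euclidean_space \<Rightarrow> real \<Rightarrow> 'b::euclidean_space"
  assumes d: "\<And>z \<tau>. z \<in> Z \<Longrightarrow> \<tau> \<in> {0..1} \<Longrightarrow> ((\<lambda>z. f z \<tau>) has_derivative D z \<tau>) (at z within Z)"
    and contD: "\<And>v. continuous_on (Z \<times> {0..1}) (\<lambda>x. D (fst x) (snd x) v)"
    and contf: "\<And>z. z \<in> Z \<Longrightarrow> continuous_on {0..1} (f z)"
    and Z: "convex Z" "z \<in> Z"
  shows "((\<lambda>z. integral {0..1} (f z)) has_derivative (\<lambda>v. integral {0..1} (\<lambda>\<tau>. D z \<tau> v))) (at z within Z)"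
proof -
  define B where "B z \<tau> = Blinfun (D z \<tau>)" for z \<tau>
  have B: "blinfun_apply (B z \<tau>) = D z \<tau>" if "z \<in> Z" "\<tau> \<in> {0..1}" for z \<tau>
    unfolding B_def by (rule bounded_linear_Blinfun_apply[OF has_derivative_bounded_linear[OF d[OF that]]])
  have contB: "continuous_on (Z \<times> cbox 0 1) (\<lambda>(z, \<tau>). B z \<tau>)"
  proof (rule continuous_on_blinfun_componentwise)
    fix i :: 'z
    show "continuous_on (Z \<times> cbox 0 1) (\<lambda>x. blinfun_apply (case x of (z, \<tau>) \<Rightarrow> B z \<tau>) i)"
      unfolding cbox_interval by (rule continuous_on_eq[OF contD[of i]]) (auto simp: B)
  qed
  have "((\<lambda>z. integral (cbox 0 1) (f z)) has_derivative blinfun_apply (integral (cbox 0 1) (B z))) (at z within Z)"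
  proof (rule leibniz_rule[OF _ _ contB Z(2,1)])
    fix z and \<tau> :: real assume z: "z \<in> Z" and \<tau>: "\<tau> \<in> cbox 0 1"
    then have \<tau>': "\<tau> \<in> {0..1}" by simp
    show "((\<lambda>z. f z \<tau>) has_derivative blinfun_apply (B z \<tau>)) (at z within Z)"
      unfolding B[OF z \<tau>'] by (rule d[OF z \<tau>'])
  next
    fix z assume "z \<in> Z"
    from contf[OF this] show "f z integrable_on cbox 0 1" by (simp add: integrable_continuous_interval)
  qed
  moreover have "blinfun_apply (integral {0..1} (B z)) v = integral {0..1} (\<lambda>\<tau>. D z \<tau> v)" for v
  proof -
    have "continuous_on {0..1} (\<lambda>\<tau>. (\<lambda>(z, \<tau>). B z \<tau>) (z, \<tau>))"
      by (rule continuous_on_compose2[OF contB]) (use Z in \<open>auto intro!: continuous_intros\<close>)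
    then have "B z integrable_on {0..1}" by (intro integrable_continuous_interval) simp
    then have "blinfun_apply (integral {0..1} (B z)) v = integral {0..1} (\<lambda>\<tau>. blinfun_apply (B z \<tau>) v)"
      by (rule blinfun_apply_integral)
    also have "\<dots> = integral {0..1} (\<lambda>\<tau>. D z \<tau> v)"
      using Z by (intro integral_cong) (simp add: B)
    finally show ?thesis .
  qed
  then have "blinfun_apply (integral {0..1} (B z)) = (\<lambda>v. integral {0..1} (\<lambda>\<tau>. D z \<tau> v))" by blast
  ultimately show ?thesis by simp
qed

lemma Ck_integral:
  fixes f :: "'z::euclidean_space \<times> real \<Rightarrow> 'b::euclidean_space"
  assumes "Ck k (Z \<times> {0..1}) f" "convex Z"
  shows "Ck k Z (\<lambda>z. integral {0..1} (\<lambda>\<tau>. f (z, \<tau>)))"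
  using assms(1)
proof (induction k arbitrary: f)
  case 0
  then have "continuous_on (Z \<times> cbox 0 1) (\<lambda>(z, \<tau>). f (z, \<tau>))" by simp
  from integral_continuous_on_param[OF this] show ?case by simp
next
  case (Suc k)
  obtain D where D: "\<And>x. x \<in> Z \<times> {0..1} \<Longrightarrow> (f has_derivative D x) (at x within Z \<times> {0..1})"
    "\<And>v. Ck k (Z \<times> {0..1}) (\<lambda>x. D x v)"
    using Suc.prems by (rule Ck_SucE) blast
  show ?case
  proof (rule Ck_SucI)
    fix z assume z: "z \<in> Z"
    show "((\<lambda>z. integral {0..1} (\<lambda>\<tau>. f (z, \<tau>))) has_derivative
        (\<lambda>v. integral {0..1} (\<lambda>\<tau>. D (z, \<tau>) (v, 0)))) (at z within Z)"
    proof (rule integral_parameter_has_derivative[where D = "\<lambda>z \<tau> v. D (z, \<tau>) (v, 0)", OF _ _ _ assms(2) z])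
      fix z \<tau> assume z: "z \<in> Z" "\<tau> \<in> {0..1::real}"
      show "((\<lambda>z. f (z, \<tau>)) has_derivative (\<lambda>v. D (z, \<tau>) (v, 0))) (at z within Z)"
      proof (rule has_derivative_in_compose[of "\<lambda>z. (z, \<tau>)" "\<lambda>v. (v, 0)"])
        show "((\<lambda>z. (z, \<tau>)) has_derivative (\<lambda>v. (v, 0))) (at z within Z)"
          by (intro has_derivative_Pair has_derivative_const has_derivative_ident)
        show "(f has_derivative D (z, \<tau>)) (at (z, \<tau>) within (\<lambda>z. (z, \<tau>)) ` Z)"
          by (rule has_derivative_subset[OF D(1)]) (use z in auto)
      qed
    next
      fix v show "continuous_on (Z \<times> {0..1}) (\<lambda>x. D (fst x, snd x) (v, 0))"
        using Ck_continuous[OF D(2)] by simp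
    next
      fix z assume "z \<in> Z"
      then show "continuous_on {0..1} (\<lambda>\<tau>. f (z, \<tau>))"
        by (intro continuous_on_compose2[OF Ck_continuous[OF Suc.prems]]) (auto intro!: continuous_intros)
    qed
  qed (rule Suc.IH[OF D(2)])
qed

section \<open>A smooth function with compact support\<close>

text \<open>For \<open>n = 0\<close> this is the classical smooth function \<open>exp (-1/u)\<close>
  that vanishes to infinite order at 0. The powers of \<open>1/u\<close> are included to obtain a
  family closed under differentiation, see \<open>flat_deriv\<close>.\<close>

definition flat :: "nat \<Rightarrow> real \<Rightarrow> real" where
  "flat n u = (if 0 < u then inverse u ^ n * exp (- inverse u) else 0)"

text \<open>With \<open>m = n + 2\<close>, the inequality \<open>x \<le> exp x\<close> at
  \<open>x = 1 / (u * m)\<close>, raised to the power \<open>m\<close>, bounds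
  \<open>(1/u)^m * exp (-1/u)\<close> by \<open>m^m\<close>. These are two powers of
  \<open>1/u\<close> more than in \<open>flat n\<close>, which leaves the factor
  \<open>u\<^sup>2\<close>; a quadratic bound forces the derivative at 0 to vanish.\<close>

lemma flat_bound: "\<bar>flat n u\<bar> \<le> real (n + 2) ^ (n + 2) * u\<^sup>2"
proof (cases "0 < u")
  case True
  let ?m = "real (n + 2)"
  have "0 < inverse u / ?m" using True by simp
  then have "inverse u / ?m \<le> exp (inverse u / ?m)"
    using exp_ge_add_one_self[of "inverse u / ?m"] by linarith
  then have "(inverse u / ?m) ^ (n + 2) \<le> exp (inverse u / ?m) ^ (n + 2)"
    using True by (intro power_mono) auto
  also have "\<dots> = exp (inverse u)"
    using exp_of_nat_mult[of "n + 2" "inverse u / ?m"] by simp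
  finally have "inverse u ^ (n + 2) / ?m ^ (n + 2) \<le> exp (inverse u)"
    by (simp only: power_divide)
  moreover have "0 < ?m ^ (n + 2)" by simp
  ultimately have "inverse u ^ (n + 2) \<le> exp (inverse u) * ?m ^ (n + 2)"
    by (simp only: pos_divide_le_eq)
  then have "inverse u ^ (n + 2) * exp (- inverse u) \<le> exp (inverse u) * ?m ^ (n + 2) * exp (- inverse u)"
    by (rule mult_right_mono) simp
  also have "\<dots> = ?m ^ (n + 2) * (exp (inverse u) * exp (- inverse u))" by (simp only: mult_ac)
  also have "\<dots> = ?m ^ (n + 2)" by (simp only: exp_minus_inverse mult_1_right)
  finally have "inverse u ^ (n + 2) * exp (- inverse u) \<le> ?m ^ (n + 2)" .
  then have "u\<^sup>2 * (inverse u ^ (n + 2) * exp (- inverse u)) \<le> u\<^sup>2 * ?m ^ (n + 2)"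
    by (intro mult_left_mono) auto
  moreover have "u\<^sup>2 * (inverse u ^ (n + 2) * exp (- inverse u)) = flat n u"
  proof -
    have "u\<^sup>2 * (inverse u ^ (n + 2) * exp (- inverse u)) = (u * inverse u)\<^sup>2 * (inverse u ^ n * exp (- inverse u))"
      by (simp only: power_add power_mult_distrib mult_ac)
    then show ?thesis using True by (simp add: flat_def)
  qed
  ultimately have "flat n u \<le> u\<^sup>2 * ?m ^ (n + 2)" by (simp only:)
  moreover have "\<bar>flat n u\<bar> = flat n u" using True by (simp add: flat_def)
  ultimately show ?thesis by (simp only: mult.commute)
qed (simp add: flat_def)

lemma flat_deriv: "(flat n has_real_derivative flat (n + 2) u - real n * flat (n + 1) u) (at u)"
proof (cases "u = 0")
  case True
  have "((\<lambda>h. flat n h / h) \<longlongrightarrow> 0) (at 0)"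
  proof (rule Lim_null_comparison)
    let ?C = "real (n + 2) ^ (n + 2)"
    have "\<bar>flat n h / h\<bar> \<le> ?C * \<bar>h\<bar>" if "h \<noteq> 0" for h
    proof -
      have "\<bar>flat n h / h\<bar> \<le> ?C * h\<^sup>2 / \<bar>h\<bar>"
        unfolding abs_divide using flat_bound by (rule divide_right_mono) simp
      also have "?C * h\<^sup>2 / \<bar>h\<bar> = ?C * \<bar>h\<bar>"
        using that by (simp add: power2_eq_square abs_if)
      finally show ?thesis .
    qed
    then show "\<forall>\<^sub>F h in at 0. norm (flat n h / h) \<le> ?C * \<bar>h\<bar>"
      by (auto simp: eventually_at_filter)
    show "((\<lambda>h. ?C * \<bar>h\<bar>) \<longlongrightarrow> 0) (at 0)" by (auto intro!: tendsto_eq_intros)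
  qed
  then show ?thesis using True by (simp add: has_field_derivative_iff flat_def)
next
  case False
  show ?thesis
  proof (cases "0 < u")
    case True
    have "((\<lambda>u. inverse u ^ n) has_real_derivative real n * (- (inverse u ^ Suc (Suc 0)) * inverse u ^ (n - Suc 0))) (at u)"
      using True by (intro DERIV_power DERIV_inverse) auto
    moreover have "real n * (- (inverse u ^ Suc (Suc 0)) * inverse u ^ (n - Suc 0)) = - (real n * inverse u ^ (n + 1))"
      by (cases n) auto
    ultimately have p: "((\<lambda>u. inverse u ^ n) has_real_derivative - (real n * inverse u ^ (n + 1))) (at u)"
      by (simp only:)
    have e: "((\<lambda>u. exp (- inverse u)) has_real_derivative exp (- inverse u) * (inverse u)\<^sup>2) (at u)"
      using True by (auto intro!: derivative_eq_intros simp: power2_eq_square)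
    have "((\<lambda>u. inverse u ^ n * exp (- inverse u)) has_real_derivative
       flat (n + 2) u - real n * flat (n + 1) u) (at u)"
      using DERIV_mult[OF p e] True by (simp add: flat_def power2_eq_square algebra_simps)
    then show ?thesis
      by (rule has_field_derivative_transform_within_open[where S = "{0<..}"]) (use True in \<open>auto simp: flat_def\<close>)
  next
    case F: False
    have "((\<lambda>u. 0) has_real_derivative 0) (at u)" by simp
    then have "(flat n has_real_derivative 0) (at u)"
      by (rule has_field_derivative_transform_within_open[where S = "{..<0}"]) (use F False in \<open>auto simp: flat_def\<close>)
    then show ?thesis using F by (simp add: flat_def)
  qed
qed

lemma flat_smooth: "Cinf S (flat n)"
proof -
  have "Ck k UNIV (flat n)" for k
  proof (induction k arbitrary: n)
    case 0
    show ?case using DERIV_isCont[OF flat_deriv] by (simp add: continuous_at_imp_continuous_on)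
  next
    case (Suc k)
    show ?case
    proof (rule Ck_SucI)
      show "(flat n has_derivative (\<lambda>v. (flat (n + 2) u - real n * flat (n + 1) u) * v)) (at u within UNIV)" for u
        using flat_deriv by (simp add: has_field_derivative_def)
      show "Ck k UNIV (\<lambda>u. (flat (n + 2) u - real n * flat (n + 1) u) * v)" for v
        by (intro Ck_mult Ck_diff Ck_const Suc.IH)
    qed
  qed
  then show ?thesis unfolding Cinf_def by (blast intro: Ck_subset)
qed

text \<open>The squared distance is used, rather than the distance, to keep the function smooth at
  the centre.\<close>

definition bump :: "'a::euclidean_space \<Rightarrow> real \<Rightarrow> 'a \<Rightarrow> real" where
  "bump x0 \<rho> x = flat 0 (\<rho>\<^sup>2 - (x - x0) \<bullet> (x - x0))"

lemma bump_smooth: "Cinf S (bump x0 \<rho>)"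
proof -
  have "Cinf S (\<lambda>x. \<rho>\<^sup>2 - (x - x0) \<bullet> (x - x0))"
    unfolding Cinf_def by (intro allI Ck_diff Ck_inner Ck_const Ck_id)
  from Cinf_compose[OF flat_smooth this subset_UNIV] show ?thesis by (simp add: bump_def[abs_def])
qed

lemma bump_outside: "0 < \<rho> \<Longrightarrow> x \<notin> ball x0 \<rho> \<Longrightarrow> bump x0 \<rho> x = 0"
proof -
  assume "0 < \<rho>" "x \<notin> ball x0 \<rho>"
  then have "\<rho>\<^sup>2 \<le> (norm (x - x0))\<^sup>2" by (intro power_mono) (auto simp: dist_norm norm_minus_commute)
  then show "bump x0 \<rho> x = 0" by (simp add: bump_def flat_def power2_norm_eq_inner)
qed

lemma bump_bounds: "0 \<le> bump x0 \<rho> x" "bump x0 \<rho> x \<le> 1"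
  by (auto simp: bump_def flat_def)

lemma bump_has_derivative:
  "(bump x0 \<rho> has_derivative (\<lambda>v. flat 2 (\<rho>\<^sup>2 - (x - x0) \<bullet> (x - x0)) * (- (2 * ((x - x0) \<bullet> v))))) (at x)"
proof -
  have "((\<lambda>x. \<rho>\<^sup>2 - (x - x0) \<bullet> (x - x0)) has_derivative (\<lambda>v. - (2 * ((x - x0) \<bullet> v)))) (at x)"
    by (auto intro!: derivative_eq_intros simp: inner_commute)
  from has_derivative_compose[OF this flat_deriv[of 0, unfolded has_field_derivative_def]]
  show ?thesis by (simp add: bump_def[abs_def] numeral_2_eq_2)
qed

lemma bump_derivative: "frechet_derivative (bump x0 \<rho>) (at x) v =
    flat 2 (\<rho>\<^sup>2 - (x - x0) \<bullet> (x - x0)) * (- (2 * ((x - x0) \<bullet> v)))"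
  using frechet_derivative_at[OF bump_has_derivative[of x0 \<rho> x], symmetric] by simp

lemma bump_derivative_outside: "0 < \<rho> \<Longrightarrow> x \<notin> ball x0 \<rho> \<Longrightarrow> frechet_derivative (bump x0 \<rho>) (at x) v = 0"
proof -
  assume "0 < \<rho>" "x \<notin> ball x0 \<rho>"
  then have "\<rho>\<^sup>2 \<le> (norm (x - x0))\<^sup>2" by (intro power_mono) (auto simp: dist_norm norm_minus_commute)
  then show ?thesis by (simp add: bump_derivative flat_def power2_norm_eq_inner)
qed

text \<open>Supplies the two test points of the main proof: points at different distances on one
  ray, with explicit values and nonzero radial derivatives.\<close>

lemma bump_ray:
  assumes "norm e = 1" "0 < s" "s < \<rho>"
  shows "bump x0 \<rho> (x0 + s *\<^sub>R e) = exp (- inverse (\<rho>\<^sup>2 - s\<^sup>2))"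
    and "frechet_derivative (bump x0 \<rho>) (at (x0 + s *\<^sub>R e)) e \<noteq> 0"
proof -
  have ee: "e \<bullet> e = 1" using assms(1) by (simp add: dot_square_norm)
  have sq: "s\<^sup>2 < \<rho>\<^sup>2" using assms by (intro power_strict_mono) auto
  show "bump x0 \<rho> (x0 + s *\<^sub>R e) = exp (- inverse (\<rho>\<^sup>2 - s\<^sup>2))"
    using sq by (simp add: bump_def flat_def ee power2_eq_square)
  have "frechet_derivative (bump x0 \<rho>) (at (x0 + s *\<^sub>R e)) e = - (flat 2 (\<rho>\<^sup>2 - s\<^sup>2) * (2 * s))"
    by (simp add: bump_derivative ee power2_eq_square)
  also have "\<dots> \<noteq> 0" using assms sq by (simp add: flat_def)
  finally show "frechet_derivative (bump x0 \<rho>) (at (x0 + s *\<^sub>R e)) e \<noteq> 0" .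
qed

text \<open>The derivative is bounded on the closed ball by compactness and vanishes off it, so the
  mean value inequality applies on the whole space.\<close>

lemma compact_support_lipschitz:
  fixes X :: "'a::euclidean_space \<Rightarrow> 'b::euclidean_space"
  assumes X: "Cinf UNIV X" and supp: "\<And>x. x \<notin> ball x0 \<rho> \<Longrightarrow> X x = 0"
  obtains L where "0 \<le> L" "\<And>y z. norm (X y - X z) \<le> L * norm (y - z)"
proof -
  let ?D = "\<lambda>x v. frechet_derivative X (at x) v"
  have D: "(X has_derivative ?D x) (at x)" for x using Cinf_derivative[OF X, of x] by simp
  have "continuous_on UNIV (\<lambda>x. ?D x v)" for v
    using Cinf_continuous[OF Cinf_frechet[OF X thick_open[OF open_UNIV], of v]] by simp
  then have "bounded ((\<lambda>x. ?D x v) ` cball x0 \<rho>)" for v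
    by (intro compact_imp_bounded compact_continuous_image) (auto intro: continuous_on_subset)
  then have "\<exists>C. \<forall>x\<in>cball x0 \<rho>. norm (?D x v) \<le> C" for v
    unfolding bounded_iff by blast
  then obtain C where C: "\<And>v x. x \<in> cball x0 \<rho> \<Longrightarrow> norm (?D x v) \<le> C v" by metis
  have D0: "?D x = (\<lambda>v. 0)" if "x \<notin> cball x0 \<rho>" for x
  proof -
    have "((\<lambda>x. 0) has_derivative (\<lambda>v. 0)) (at x)" by simp
    then have "(X has_derivative (\<lambda>v. 0)) (at x)"
      by (rule has_derivative_transform_within_open[where s = "- cball x0 \<rho>"])
        (use that supp in \<open>auto simp: less_imp_le\<close>)
    from frechet_derivative_at[OF this] show ?thesis by simp
  qed
  let ?L = "\<Sum>b\<in>(Basis::'a set). \<bar>C b\<bar>"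
  have "norm (X y - X z) \<le> ?L * norm (y - z)" for y z
  proof (rule differentiable_bound[of UNIV X ?D])
    fix x
    show "onorm (?D x) \<le> ?L"
    proof (rule onorm_le)
      fix v
      have "norm (?D x v) = norm (\<Sum>b\<in>Basis. (v \<bullet> b) *\<^sub>R ?D x b)"
        using has_derivative_Basis_expand[OF D[of x], of v] by simp
      also have "\<dots> \<le> (\<Sum>b\<in>(Basis::'a set). norm v * \<bar>C b\<bar>)"
      proof (rule sum_norm_le)
        fix b :: 'a assume b: "b \<in> Basis"
        have "norm (?D x b) \<le> \<bar>C b\<bar>"
          using C[of x b] D0[of x] by (cases "x \<in> cball x0 \<rho>") auto
        then show "norm ((v \<bullet> b) *\<^sub>R ?D x b) \<le> norm v * \<bar>C b\<bar>"
          using Basis_le_norm[OF b, of v] by (auto intro!: mult_mono)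
      qed
      finally show "norm (?D x v) \<le> ?L * norm v" by (simp add: sum_distrib_left mult.commute)
    qed
  qed (use D in auto)
  then show thesis by (intro that[of ?L]) (auto intro: sum_nonneg)
qed

section \<open>The top wedge power and determinants\<close>

text \<open>Conjugation by \<open>e\<close> is a sign preserving bijection between the permutations
  of \<open>S\<close> and those of \<open>T\<close>. It moves signed sums between an interval of
  numbers and an index type.\<close>

lemma sum_permutations_bij:
  assumes e: "bij_betw e S T" and fin: "finite S"
  shows "(\<Sum>q | q permutes T. of_int (sign q) * G q) =
    (\<Sum>p | p permutes S. of_int (sign p) * (G (map_permutation S e p) :: real))"
proof (rule sum.reindex_bij_witness[where i = "map_permutation S e" and j = "map_permutation T (inv_into S e)"])
  have e': "bij_betw (inv_into S e) T S" using e by (rule bij_betw_inv_into)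
  have inj: "inj_on e S" "inj_on (inv_into S e) T" using e e' by (auto simp: bij_betw_def)
  have finT: "finite T" using e fin by (simp add: bij_betw_finite)
  fix q assume "q \<in> {q. q permutes T}"
  then have q: "q permutes T" by simp
  show *: "map_permutation S e (map_permutation T (inv_into S e) q) = q"
    by (rule map_permutation_compose_inv[OF e' q]) (rule bij_betw_inv_into_right[OF e])
  show "map_permutation T (inv_into S e) q \<in> {p. p permutes S}"
    using map_permutation_permutes[OF e' q] by simp
  show "of_int (sign (map_permutation T (inv_into S e) q)) *
      G (map_permutation S e (map_permutation T (inv_into S e) q)) = of_int (sign q) * G q"
    unfolding * by (simp add: sign_map_permutation inj finT q)
next
  fix p assume "p \<in> {p. p permutes S}"
  then have p: "p permutes S" by simp
  show "map_permutation S e p \<in> {q. q permutes T}" using map_permutation_permutes[OF e p] by simp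
  show "map_permutation T (inv_into S e) (map_permutation S e p) = p"
    by (rule map_permutation_compose_inv[OF e p]) (rule bij_betw_inv_into_left[OF e])
qed

lemma prod_pairs: "(\<Prod>i<(n::nat). F (2 * i) * F (2 * i + 1)) = (\<Prod>k<2 * n. F k :: real)"
  by (induction n) (auto simp: mult_ac)

lemma wedge_power_UNIV:
  fixes e :: "nat \<Rightarrow> 'n::finite"
  assumes e: "bij_betw e {..<2 * n} UNIV"
  shows "wedge_power n B (\<lambda>i. v (e i)) =
    (\<Sum>q | q permutes (UNIV :: 'n set). of_int (sign q) * (\<Prod>i<n. B (v (q (e (2 * i)))) (v (q (e (2 * i + 1)))))) / 2 ^ n"
proof -
  have inj: "inj_on e {..<2 * n}" using e by (simp add: bij_betw_def)
  have "map_permutation {..<2 * n} e p (e k) = e (p k)" if "k < 2 * n" for p k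
    using map_permutation_apply[OF inj, of k p] that by simp
  then show ?thesis
    unfolding wedge_power_def by (subst sum_permutations_bij[OF e]) simp_all
qed

text \<open>A form of top degree is pulled back by the determinant. Expanding each
  \<open>L (axis a 1)\<close> gives a sum over all maps \<open>f\<close> of the index type; summing
  over the permutations first produces the determinant of the matrix with rows
  \<open>M $ f m\<close>. It vanishes if \<open>f\<close> is not injective, as two rows agree, and
  equals \<open>sign f * det M\<close> if \<open>f\<close> is a permutation.\<close>

lemma wedge_power_linear:
  fixes L :: "real^'n::finite \<Rightarrow> real^'n" and e :: "nat \<Rightarrow> 'n"
  assumes e: "bij_betw e {..<2 * n} UNIV" and L: "linear L" and B: "bilinear B"
  shows "wedge_power n (\<lambda>u v. B (L u) (L v)) (\<lambda>i. axis (e i) 1) =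
    det (matrix L) * wedge_power n B (\<lambda>i. axis (e i) 1)"
proof -
  define M where "M = matrix L"
  define C where "C f = (\<Prod>i<n. B (axis (f (e (2 * i))) 1) (axis (f (e (2 * i + 1))) 1))" for f :: "'n \<Rightarrow> 'n"
  have La: "L (axis a 1) = (\<Sum>j\<in>UNIV. (M $ j $ a) *\<^sub>R axis j 1)" for a
    by (simp add: M_def matrix_def vec_eq_iff axis_def if_distrib cong: if_cong)
  have factor: "B (L (axis a 1)) (L (axis b 1)) =
    (\<Sum>y\<in>UNIV. (M $ fst y $ a) * (M $ snd y $ b) * B (axis (fst y) 1) (axis (snd y) 1))" for a b
    unfolding La bilinear_sum[OF B] UNIV_Times_UNIV[symmetric]
    by (simp add: bilinear_lmul[OF B] bilinear_rmul[OF B] case_prod_unfold mult_ac)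
  have expand: "(\<Prod>i<n. B (L (axis (q (e (2 * i))) 1)) (L (axis (q (e (2 * i + 1))) 1))) =
      (\<Sum>f\<in>UNIV. (\<Prod>m\<in>UNIV. M $ f m $ q m) * C f)" for q :: "'n \<Rightarrow> 'n"
  proof -
    let ?F = "\<lambda>i y. (M $ fst y $ q (e (2 * i))) * (M $ snd y $ q (e (2 * i + 1))) * B (axis (fst y) 1) (axis (snd y) 1)"
    let ?k = "inv_into {..<2 * n} e"
    have ke: "?k (e k) = k" if "k < 2 * n" for k using bij_betw_inv_into_left[OF e] that by auto
    have ek: "e (?k m) = m" and k_less: "?k m < 2 * n" for m
      using bij_betw_inv_into_right[OF e, of m] bij_betwE[OF bij_betw_inv_into[OF e]] by auto
    have "(\<Prod>i<n. B (L (axis (q (e (2 * i))) 1)) (L (axis (q (e (2 * i + 1))) 1))) =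
      (\<Prod>i<n. \<Sum>y\<in>UNIV. ?F i y)"
      unfolding factor ..
    also have "\<dots> = (\<Sum>g\<in>PiE {..<n} (\<lambda>_. UNIV). \<Prod>i<n. ?F i (g i))"
      by (rule prod_sum_PiE) auto
    \<comment> \<open>Choosing a pair of indices for every \<open>i < n\<close> amounts to choosing
      one index for each of the \<open>2 * n\<close> positions: even positions carry first
      components, odd ones second components.\<close>
    also have "\<dots> = (\<Sum>f\<in>UNIV. (\<Prod>i<n. ?F i (f (e (2 * i)), f (e (2 * i + 1)))))"
    proof (rule sum.reindex_bij_witness[where
          i = "\<lambda>f. \<lambda>i\<in>{..<n}. (f (e (2 * i)), f (e (2 * i + 1)))" and
          j = "\<lambda>g m. if even (?k m) then fst (g (?k m div 2)) else snd (g (?k m div 2))"])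
      fix g assume g: "g \<in> PiE {..<n} (\<lambda>_. UNIV :: ('n \<times> 'n) set)"
      let ?f = "\<lambda>m. if even (?k m) then fst (g (?k m div 2)) else snd (g (?k m div 2))"
      have eq: "(?f (e (2 * i)), ?f (e (2 * i + 1))) = g i" if "i < n" for i
        using that by (simp add: ke)
      show "(\<lambda>i\<in>{..<n}. (?f (e (2 * i)), ?f (e (2 * i + 1)))) = g"
      proof
        fix i show "(\<lambda>i\<in>{..<n}. (?f (e (2 * i)), ?f (e (2 * i + 1)))) i = g i"
        proof (cases "i < n")
          case True
          then show ?thesis
            unfolding restrict_apply using eq[OF True] by (simp only: lessThan_iff if_True)
        next
          case False
          then have "g i = undefined" by (intro PiE_arb[OF g]) simp
          then show ?thesis
            unfolding restrict_apply using False by (simp only: lessThan_iff if_False)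
        qed
      qed
      show "(\<Prod>i<n. ?F i (?f (e (2 * i)), ?f (e (2 * i + 1)))) = (\<Prod>i<n. ?F i (g i))"
      proof (rule prod.cong[OF refl])
        fix i assume "i \<in> {..<n}"
        then have i: "i < n" by simp
        show "?F i (?f (e (2 * i)), ?f (e (2 * i + 1))) = ?F i (g i)"
          by (rule arg_cong[OF eq[OF i], of "?F i"])
      qed
    next
      fix f :: "'n \<Rightarrow> 'n"
      let ?g = "\<lambda>i\<in>{..<n}. (f (e (2 * i)), f (e (2 * i + 1)))"
      show "(\<lambda>m. if even (?k m) then fst (?g (?k m div 2)) else snd (?g (?k m div 2))) = f"
      proof
        fix m
        have "?k m div 2 < n" using k_less[of m] by (simp add: less_mult_imp_div_less mult.commute)
        then show "(if even (?k m) then fst (?g (?k m div 2)) else snd (?g (?k m div 2))) = f m"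
          using ek[of m] by (cases "even (?k m)") auto
      qed
    qed auto
    also have "\<dots> = (\<Sum>f\<in>UNIV. (\<Prod>m\<in>UNIV. M $ f m $ q m) * C f)"
    proof (rule sum.cong[OF refl])
      fix f :: "'n \<Rightarrow> 'n"
      have "(\<Prod>i<n. ?F i (f (e (2 * i)), f (e (2 * i + 1)))) =
        (\<Prod>i<n. (M $ f (e (2 * i)) $ q (e (2 * i))) * (M $ f (e (2 * i + 1)) $ q (e (2 * i + 1)))) * C f"
        unfolding C_def by (simp add: prod.distrib)
      also have "(\<Prod>i<n. (M $ f (e (2 * i)) $ q (e (2 * i))) * (M $ f (e (2 * i + 1)) $ q (e (2 * i + 1)))) =
        (\<Prod>k<2 * n. M $ f (e k) $ q (e k))"
        by (rule prod_pairs[of "\<lambda>k. M $ f (e k) $ q (e k)"])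
      also have "\<dots> = (\<Prod>m\<in>UNIV. M $ f m $ q m)"
        by (rule prod.reindex_bij_betw[OF e])
      finally show "(\<Prod>i<n. ?F i (f (e (2 * i)), f (e (2 * i + 1)))) = (\<Prod>m\<in>UNIV. M $ f m $ q m) * C f" .
    qed
    finally show ?thesis .
  qed
  have rows: "(\<Sum>q | q permutes UNIV. of_int (sign q) * (\<Prod>m\<in>UNIV. M $ f m $ q m)) = det (\<chi> m. M $ f m)" for f :: "'n \<Rightarrow> 'n"
    by (simp add: det_def)
  have "(\<Sum>q | q permutes (UNIV :: 'n set). of_int (sign q) *
        (\<Prod>i<n. B (L (axis (q (e (2 * i))) 1)) (L (axis (q (e (2 * i + 1))) 1)))) =
      (\<Sum>q | q permutes (UNIV :: 'n set). \<Sum>f\<in>UNIV. of_int (sign q) * (\<Prod>m\<in>UNIV. M $ f m $ q m) * C f)"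
    unfolding expand by (simp add: sum_distrib_left mult.assoc)
  also have "\<dots> = (\<Sum>f\<in>UNIV. det (\<chi> m. M $ f m) * C f)"
    by (subst sum.swap) (simp add: rows[symmetric] sum_distrib_right)
  also have "\<dots> = (\<Sum>f | f permutes UNIV. of_int (sign f) * det M * C f)"
  proof (rule sum.mono_neutral_cong_right)
    show "\<forall>f\<in>UNIV - {f. f permutes UNIV}. det (\<chi> m. M $ f m) * C f = 0"
    proof
      fix f :: "'n \<Rightarrow> 'n" assume f: "f \<in> UNIV - {f. f permutes UNIV}"
      have "\<not> inj f"
      proof
        assume "inj f"
        then have "bij f" using finite_UNIV_inj_surj[of f] by (simp add: bij_def)
        then have "f permutes UNIV" by (intro bij_imp_permutes) auto
        then show False using f by simp
      qed
      then obtain a b where "a \<noteq> b" "f a = f b" by (auto simp: inj_def)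
      then have "det (\<chi> m. M $ f m) = 0"
        by (intro det_identical_rows[of a b]) (auto simp: row_def)
      then show "det (\<chi> m. M $ f m) * C f = 0" by simp
    qed
    fix f :: "'n \<Rightarrow> 'n" assume "f \<in> {f. f permutes UNIV}"
    then show "det (\<chi> m. M $ f m) * C f = of_int (sign f) * det M * C f"
      by (simp add: det_permute_rows)
  qed auto
  also have "\<dots> = det M * (\<Sum>f | f permutes UNIV. of_int (sign f) * C f)"
    by (simp add: sum_distrib_left mult_ac)
  finally show ?thesis
    unfolding wedge_power_UNIV[OF e, where v = "\<lambda>m. axis m 1"] by (simp add: M_def C_def)
qed

section \<open>Change of variables in arbitrary finite dimension\<close>

text \<open>The change of variables theorem of the library needs a well-ordered index type; every finite index
  type has a well-ordered copy.\<close>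

typedef 'n idx = "UNIV :: 'n set" by simp

instance idx :: (finite) finite
proof
  have "(UNIV :: 'a idx set) = range Abs_idx"
    using Rep_idx_inverse by (metis surj_def)
  moreover have "finite (range (Abs_idx :: 'a \<Rightarrow> _))" by simp
  ultimately show "finite (UNIV :: 'a idx set)" by (simp only:)
qed

definition idx_rank :: "'n::finite \<Rightarrow> nat" where
  "idx_rank = (SOME f. inj f)"

lemma inj_idx_rank: "inj (idx_rank :: 'n::finite \<Rightarrow> nat)"
  unfolding idx_rank_def using finite_imp_inj_to_nat_seg[of "UNIV :: 'n set"]
  by (metis finite someI_ex)

instantiation idx :: (finite) wellorder
begin

definition less_eq_idx :: "'a idx \<Rightarrow> 'a idx \<Rightarrow> bool" where
  "less_eq_idx x y \<longleftrightarrow> idx_rank (Rep_idx x) \<le> idx_rank (Rep_idx y)"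

definition less_idx :: "'a idx \<Rightarrow> 'a idx \<Rightarrow> bool" where
  "less_idx x y \<longleftrightarrow> idx_rank (Rep_idx x) < idx_rank (Rep_idx y)"

instance
proof
  fix x y :: "'a idx"
  assume "x \<le> y" "y \<le> x"
  then have "idx_rank (Rep_idx x) = idx_rank (Rep_idx y)" by (simp add: less_eq_idx_def)
  then show "x = y" using inj_idx_rank by (metis Rep_idx_inject injD)
next
  fix P :: "'a idx \<Rightarrow> bool" and x :: "'a idx"
  assume *: "\<And>x. (\<And>y. y < x \<Longrightarrow> P y) \<Longrightarrow> P x"
  show "P x"
  proof (induction "idx_rank (Rep_idx x)" arbitrary: x rule: less_induct)
    case less
    show ?case by (rule *, rule less) (simp add: less_idx_def)
  qed
qed (auto simp: less_eq_idx_def less_idx_def)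

end

definition to_idx :: "real^'n::finite \<Rightarrow> real^('n idx)" where
  "to_idx x = (\<chi> i. x $ Rep_idx i)"

definition of_idx :: "real^('n::finite idx) \<Rightarrow> real^'n" where
  "of_idx x = (\<chi> i. x $ Abs_idx i)"

lemma of_to_idx [simp]: "of_idx (to_idx x) = x" "to_idx (of_idx y) = y"
  by (simp_all add: of_idx_def to_idx_def vec_eq_iff Abs_idx_inverse Rep_idx_inverse)

lemma bij_Rep_idx: "bij (Rep_idx :: 'n idx \<Rightarrow> 'n)"
  by (rule bij_betw_byWitness[where f' = Abs_idx]) (auto simp: Rep_idx_inverse Abs_idx_inverse)

lemma linear_idx: "bounded_linear (to_idx :: real^'n::finite \<Rightarrow> _)" "bounded_linear (of_idx :: _ \<Rightarrow> real^'n::finite)"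
  unfolding linear_linear by (auto intro!: linearI simp: to_idx_def of_idx_def vec_eq_iff)

lemma measurable_idx [measurable]:
  "to_idx \<in> borel_measurable borel" "of_idx \<in> borel_measurable borel"
  by (auto intro!: borel_measurable_continuous_onI linear_continuous_on linear_idx)

lemma lborel_of_idx: "(lborel :: (real^'n::finite) measure) = distr lborel borel of_idx"
proof (rule lborel_eqI)
  fix l u :: "real^'n" assume le: "\<And>b. b \<in> Basis \<Longrightarrow> l \<bullet> b \<le> u \<bullet> b"
  have le': "l $ i \<le> u $ i" for i using le[of "axis i 1"] by (simp add: inner_axis axis_in_Basis_iff)
  have vim: "of_idx -` box l u = box (to_idx l) (to_idx u)"
  proof -
    have "(\<forall>i. l $ i < x $ Abs_idx i \<and> x $ Abs_idx i < u $ i) \<longleftrightarrow>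
      (\<forall>j. l $ Rep_idx j < x $ j \<and> x $ j < u $ Rep_idx j)" for x :: "real^('n idx)"
      by (metis Abs_idx_inverse Rep_idx_inverse UNIV_I)
    then show ?thesis by (auto simp: mem_box_cart of_idx_def to_idx_def)
  qed
  have prods: "(\<Prod>b\<in>Basis. (y - x) \<bullet> b) = (\<Prod>i\<in>UNIV. y $ i - x $ i)" for x y :: "real^'k::finite"
  proof -
    have "bij_betw (\<lambda>i::'k. axis i (1::real)) UNIV Basis"
      by (auto simp: bij_betw_def inj_on_def axis_eq_axis Basis_vec_def)
    from prod.reindex_bij_betw[OF this, of "\<lambda>b. (y - x) \<bullet> b", symmetric] show ?thesis
      by (simp add: inner_axis)
  qed
  have "emeasure (distr lborel borel of_idx) (box l u) = emeasure lborel (box (to_idx l) (to_idx u))"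
    by (simp add: emeasure_distr vim)
  also have "\<dots> = ennreal (\<Prod>i\<in>UNIV. to_idx u $ i - to_idx l $ i)"
    unfolding prods[symmetric]
    by (rule emeasure_lborel_box) (auto simp: to_idx_def le' Basis_vec_def inner_axis)
  also have "(\<Prod>i\<in>UNIV. to_idx u $ i - to_idx l $ i) = (\<Prod>i\<in>UNIV. u $ i - l $ i)"
    using prod.reindex_bij_betw[OF bij_Rep_idx, of "\<lambda>i. u $ i - l $ i"] by (simp add: to_idx_def)
  finally show "emeasure (distr lborel borel of_idx) (box l u) = (\<Prod>b\<in>Basis. (u - l) \<bullet> b)"
    by (simp add: prods)
qed simp

lemma det_reindex:
  fixes M :: "real^'n^('n::finite)"
  shows "det (\<chi> i j. M $ Rep_idx i $ Rep_idx j) = det M"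
proof -
  have e: "bij_betw (Rep_idx :: 'n idx \<Rightarrow> 'n) UNIV UNIV" using bij_Rep_idx by simp
  have inj: "inj (Rep_idx :: 'n idx \<Rightarrow> 'n)" using e by (simp add: bij_betw_def)
  have "det M = (\<Sum>p | p permutes (UNIV :: 'n idx set). of_int (sign p) *
      (\<Prod>i\<in>UNIV. M $ i $ map_permutation UNIV Rep_idx p i))"
    unfolding det_def by (rule sum_permutations_bij[OF e]) simp
  also have "\<dots> = (\<Sum>p | p permutes (UNIV :: 'n idx set). of_int (sign p) *
      (\<Prod>i\<in>UNIV. M $ Rep_idx i $ Rep_idx (p i)))"
    by (subst prod.reindex_bij_betw[OF e, symmetric]) (simp add: map_permutation_apply[OF inj])
  finally show ?thesis by (simp add: det_def)
qed

lemma has_integral_iff_nn_integral: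
  fixes g :: "'a::euclidean_space \<Rightarrow> real"
  assumes nonneg: "\<And>x. x \<in> S \<Longrightarrow> 0 \<le> g x" and meas: "(\<lambda>x. g x * indicator S x) \<in> borel_measurable borel"
  shows "(g has_integral r) S \<longleftrightarrow> (\<integral>\<^sup>+x. ennreal (g x) * indicator S x \<partial>lborel) = ennreal r \<and> 0 \<le> r"
proof
  assume g: "(g has_integral r) S"
  show "(\<integral>\<^sup>+x. ennreal (g x) * indicator S x \<partial>lborel) = ennreal r \<and> 0 \<le> r"
    using nn_integral_has_integral_lebesgue'[OF nonneg g] has_integral_nonneg[OF g nonneg] by auto
next
  assume r: "(\<integral>\<^sup>+x. ennreal (g x) * indicator S x \<partial>lborel) = ennreal r \<and> 0 \<le> r"
  have "(\<integral>\<^sup>+x. ennreal (g x * indicator S x) \<partial>lborel) = ennreal r"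
    unfolding conjunct1[OF r, symmetric] by (intro nn_integral_cong) (auto simp: indicator_def)
  then have "((\<lambda>x. g x * indicator S x) has_integral r) UNIV"
    using r nonneg by (intro nn_integral_has_integral meas) (auto simp: indicator_def)
  moreover have "(\<lambda>x. g x * indicator S x) = (\<lambda>x. if x \<in> S then g x else 0)" by (auto simp: indicator_def)
  ultimately show "(g has_integral r) S" by (simp add: has_integral_restrict_UNIV)
qed

text \<open>The hypothesis matches the finite values on both sides. If one side is infinite, the
  other cannot be finite, so infinite values match as well.\<close>

lemma nn_integral_eq_if_same_integral:
  fixes f :: "'a::euclidean_space \<Rightarrow> real" and g :: "'b::euclidean_space \<Rightarrow> real"
  assumes "\<And>x. x \<in> S \<Longrightarrow> 0 \<le> g x" "(\<lambda>x. g x * indicator S x) \<in> borel_measurable borel"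
    and "\<And>x. x \<in> T \<Longrightarrow> 0 \<le> f x" "(\<lambda>x. f x * indicator T x) \<in> borel_measurable borel"
    and "\<And>r. (g has_integral r) S \<longleftrightarrow> (f has_integral r) T"
  shows "(\<integral>\<^sup>+x. ennreal (g x) * indicator S x \<partial>lborel) = (\<integral>\<^sup>+x. ennreal (f x) * indicator T x \<partial>lborel)"
proof -
  let ?g = "\<integral>\<^sup>+x. ennreal (g x) * indicator S x \<partial>lborel" and ?f = "\<integral>\<^sup>+x. ennreal (f x) * indicator T x \<partial>lborel"
  have "?g = ennreal r \<and> 0 \<le> r \<longleftrightarrow> ?f = ennreal r \<and> 0 \<le> r" for r
    using assms(5)[of r] has_integral_iff_nn_integral[OF assms(1,2), of r]
      has_integral_iff_nn_integral[OF assms(3,4), of r] by simp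
  then have *: "?g = ennreal r \<Longrightarrow> 0 \<le> r \<Longrightarrow> ?f = ennreal r" "?f = ennreal r \<Longrightarrow> 0 \<le> r \<Longrightarrow> ?g = ennreal r" for r
    by blast+
  show ?thesis
  proof (cases "?g" rule: ennreal_cases)
    case (real r)
    then show ?thesis using *(1) by simp
  next
    case top
    then show ?thesis using *(2) by (cases "?f" rule: ennreal_cases) auto
  qed
qed

lemma change_of_variables_wellorder:
  fixes h :: "real^'n::{finite,wellorder} \<Rightarrow> real^'n::_" and f :: "real^'n::_ \<Rightarrow> real"
  assumes S: "S \<in> sets borel"
    and der: "\<And>x. x \<in> S \<Longrightarrow> (h has_derivative h' x) (at x within S)" and inj: "inj_on h S"
    and nonneg: "\<And>x. x \<in> S \<Longrightarrow> 0 \<le> f (h x)"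
    and mf: "(\<lambda>y. f y * indicator (h ` S) y) \<in> borel_measurable borel"
    and mg: "(\<lambda>x. \<bar>det (matrix (h' x))\<bar> * f (h x) * indicator S x) \<in> borel_measurable borel"
  shows "(\<integral>\<^sup>+x. ennreal (\<bar>det (matrix (h' x))\<bar> * f (h x)) * indicator S x \<partial>lborel) =
    (\<integral>\<^sup>+y. ennreal (f y) * indicator (h ` S) y \<partial>lborel)"
proof (rule nn_integral_eq_if_same_integral)
  let ?g = "\<lambda>x. \<bar>det (matrix (h' x))\<bar> * f (h x)"
  have "S \<in> sets lebesgue" using S by simp
  \<comment> \<open>The theorem concerns vector valued integrands, so the function is wrapped into
    \<open>real^1\<close>. Letting \<open>r\<close> vary captures integrability and the value of the
    integral together.\<close>
  note * = has_absolute_integral_change_of_variables[OF this der inj, of "\<lambda>y. vec (f y) :: real^1" "vec r" for r]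
  have eq: "?g absolutely_integrable_on S \<and> integral S ?g = r \<longleftrightarrow>
      f absolutely_integrable_on (h ` S) \<and> integral (h ` S) f = r" for r
    using *[of r] by (simp add: absolutely_integrable_on_1_iff integral_on_1_eq o_def vec_eq_iff)
  have "(u has_integral r) V \<longleftrightarrow> u absolutely_integrable_on V \<and> integral V u = r"
    if "\<And>x. x \<in> V \<Longrightarrow> 0 \<le> u x" for u :: "real^'n::_ \<Rightarrow> real" and V r
    using nonnegative_absolutely_integrable_1[of u V] that
    by (auto simp: has_integral_iff absolutely_integrable_on_def)
  note nn = this
  have "(?g has_integral r) S \<longleftrightarrow> ?g absolutely_integrable_on S \<and> integral S ?g = r"
    "(f has_integral r) (h ` S) \<longleftrightarrow> f absolutely_integrable_on (h ` S) \<and> integral (h ` S) f = r" for r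
    using nonneg by (intro nn; auto)+
  then show "(?g has_integral r) S \<longleftrightarrow> (f has_integral r) (h ` S)" for r
    using eq[of r] by (simp only:)
qed (use assms in auto)

lemma nn_integral_change_of_variables:
  fixes h :: "real^'n::finite \<Rightarrow> real^'n" and f :: "real^'n \<Rightarrow> real"
  assumes S: "S \<in> sets borel"
    and der: "\<And>x. x \<in> S \<Longrightarrow> (h has_derivative h' x) (at x within S)" and inj: "inj_on h S"
    and nonneg: "\<And>x. x \<in> S \<Longrightarrow> 0 \<le> f (h x)"
    and mf: "(\<lambda>y. f y * indicator (h ` S) y) \<in> borel_measurable borel"
    and mg: "(\<lambda>x. \<bar>det (matrix (h' x))\<bar> * f (h x) * indicator S x) \<in> borel_measurable borel"
  shows "(\<integral>\<^sup>+x. ennreal (\<bar>det (matrix (h' x))\<bar> * f (h x)) * indicator S x \<partial>lborel) =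
    (\<integral>\<^sup>+y. ennreal (f y) * indicator (h ` S) y \<partial>lborel)"
proof -
  let ?h = "\<lambda>x. to_idx (h (of_idx x))" and ?h' = "\<lambda>x v. to_idx (h' (of_idx x) (of_idx v))"
    and ?f = "\<lambda>y. f (of_idx y)" and ?S = "of_idx -` S"
  let ?g = "\<lambda>x. \<bar>det (matrix (h' x))\<bar> * f (h x)"
  have det: "det (matrix (?h' x)) = det (matrix (h' (of_idx x)))" for x
  proof -
    have ax: "of_idx (axis j 1) = axis (Rep_idx j) (1::real)" for j :: "'n idx"
      by (auto simp: of_idx_def axis_def vec_eq_iff Abs_idx_inverse Rep_idx_inverse)
    have "matrix (?h' x) = (\<chi> i j. matrix (h' (of_idx x)) $ Rep_idx i $ Rep_idx j)"
      unfolding matrix_def ax by (simp add: to_idx_def vec_eq_iff)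
    then show ?thesis by (simp add: det_reindex)
  qed
  have lift: "(\<integral>\<^sup>+x. ennreal (u x) * indicator V x \<partial>lborel) = (\<integral>\<^sup>+x. ennreal (u (of_idx x)) * indicator (of_idx -` V) x \<partial>lborel)"
    if "(\<lambda>x. u x * indicator V x) \<in> borel_measurable borel" for u :: "real^'n \<Rightarrow> real" and V
  proof -
    have *: "ennreal (u x) * indicator V x = ennreal (u x * indicator V x)" for x
      by (simp add: indicator_def)
    have "(\<integral>\<^sup>+x. ennreal (u x) * indicator V x \<partial>lborel) = (\<integral>\<^sup>+x. ennreal (u x * indicator V x) \<partial>distr lborel borel of_idx)"
      by (simp add: * lborel_of_idx[symmetric])
    also have "\<dots> = (\<integral>\<^sup>+x. ennreal (u (of_idx x) * indicator V (of_idx x)) \<partial>lborel)"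
      using that by (subst nn_integral_distr) auto
    also have "\<dots> = (\<integral>\<^sup>+x. ennreal (u (of_idx x)) * indicator (of_idx -` V) x \<partial>lborel)"
      by (intro nn_integral_cong) (simp add: indicator_def)
    finally show ?thesis .
  qed
  have img: "?h ` ?S = of_idx -` (h ` S)"
  proof (intro set_eqI iffI)
    fix y assume "y \<in> of_idx -` (h ` S)"
    then obtain x where x: "x \<in> S" "of_idx y = h x" by auto
    then have "y = ?h (to_idx x)" by (metis of_to_idx)
    then show "y \<in> ?h ` ?S" using x(1) by (intro image_eqI[of _ _ "to_idx x"]) auto
  qed auto
  have pull: "(\<lambda>x. u (of_idx x) * indicator (of_idx -` V) x) \<in> borel_measurable borel"
    if "(\<lambda>x. u x * indicator V x) \<in> borel_measurable borel" for u :: "real^'n \<Rightarrow> real" and V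
    using measurable_compose[OF measurable_idx(2) that] by (simp add: indicator_def)
  have "(\<integral>\<^sup>+x. ennreal (\<bar>det (matrix (?h' x))\<bar> * ?f (?h x)) * indicator ?S x \<partial>lborel) =
    (\<integral>\<^sup>+y. ennreal (?f y) * indicator (?h ` ?S) y \<partial>lborel)"
  proof (rule change_of_variables_wellorder)
    show "?S \<in> sets borel" using measurable_sets[OF measurable_idx(2) S] by simp
    show "inj_on ?h ?S" using inj by (auto simp: inj_on_def) (metis of_to_idx)
    show "(?h has_derivative ?h' x) (at x within ?S)" if "x \<in> ?S" for x
    proof (rule bounded_linear.has_derivative[OF linear_idx(1)])
      show "((\<lambda>x. h (of_idx x)) has_derivative (\<lambda>v. h' (of_idx x) (of_idx v))) (at x within ?S)"
        by (rule has_derivative_in_compose[OF bounded_linear_imp_has_derivative[OF linear_idx(2)]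
              has_derivative_subset[OF der]]) (use that in auto)
    qed
    show "0 \<le> ?f (?h x)" if "x \<in> ?S" for x using that nonneg by simp
    show "(\<lambda>y. ?f y * indicator (?h ` ?S) y) \<in> borel_measurable borel" unfolding img by (rule pull[OF mf])
    show "(\<lambda>x. \<bar>det (matrix (?h' x))\<bar> * ?f (?h x) * indicator ?S x) \<in> borel_measurable borel"
      using pull[OF mg] by (simp add: det)
  qed
  then show ?thesis
    unfolding lift[OF mf] lift[OF mg] img by (simp add: det)
qed

section \<open>Charts and the Liouville measure\<close>

lemma smooth_on_imp_Cinf: "smooth_on S f \<Longrightarrow> Cinf S f"
  by (auto simp: Cinf_def smooth_on_imp_Ck)

lemma Cinf_imp_smooth_on: "thick S \<Longrightarrow> Cinf S f \<Longrightarrow> smooth_on S f"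
  by (simp add: smooth_on_iff_Cinf)

locale symplectic_manifold =
  fixes A :: "('m::{t2_space, second_countable_topology}, 'n::finite) chart set"
    and \<omega> :: "('m, 'n) form2" and n :: nat
  assumes card: "CARD('n) = 2 * n" and csm: "closed_symplectic_manifold A \<omega>"
begin

lemma atlas: "smooth_atlas A" and compact_UNIV: "compact (UNIV :: 'm set)" and symp: "symplectic_form A \<omega>"
  using csm by (auto simp: closed_symplectic_manifold_def closed_manifold_def)

lemma omega_field: "bilinear_field A \<omega>"
  using symp by (simp add: symplectic_form_def)

lemma chart_at: "\<exists>c\<in>A. p \<in> cdom c"
  using atlas unfolding smooth_atlas_def by (metis UNIV_I UN_iff)

lemma chart_homeo: "c \<in> A \<Longrightarrow> homeomorphism (cdom c) (cimg c) (cmap c) (cinv c)"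
  using atlas unfolding smooth_atlas_def by blast

lemma open_cdom: "c \<in> A \<Longrightarrow> open (cdom c)" and open_cimg: "c \<in> A \<Longrightarrow> open (cimg c)"
  using atlas unfolding smooth_atlas_def by blast+

lemma cinv_cmap: "c \<in> A \<Longrightarrow> p \<in> cdom c \<Longrightarrow> cinv c (cmap c p) = p"
  using chart_homeo homeomorphism_apply1 by blast

lemma cmap_cinv: "c \<in> A \<Longrightarrow> x \<in> cimg c \<Longrightarrow> cmap c (cinv c x) = x"
  using chart_homeo homeomorphism_apply2 by blast

lemma cinv_cdom: "c \<in> A \<Longrightarrow> x \<in> cimg c \<Longrightarrow> cinv c x \<in> cdom c"
  using chart_homeo homeomorphism_image2 by blast

lemma cmap_cimg: "p \<in> cdom c \<Longrightarrow> cmap c p \<in> cimg c"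
  by (simp add: cimg_def)

lemma cmap_cont: "c \<in> A \<Longrightarrow> continuous_on (cdom c) (cmap c)"
  and cinv_cont: "c \<in> A \<Longrightarrow> continuous_on (cimg c) (cinv c)"
  using chart_homeo homeomorphism_cont1 homeomorphism_cont2 by blast+

lemma cmap_image:
  assumes "c \<in> A" "B \<subseteq> cdom c"
  shows "cmap c ` B = {x \<in> cimg c. cinv c x \<in> B}"
proof (intro set_eqI iffI)
  fix x assume "x \<in> cmap c ` B"
  then show "x \<in> {x \<in> cimg c. cinv c x \<in> B}" using assms by (auto simp: cinv_cmap cmap_cimg)
next
  fix x assume "x \<in> {x \<in> cimg c. cinv c x \<in> B}"
  then show "x \<in> cmap c ` B" using assms(1) cmap_cinv by (intro image_eqI[of _ _ "cinv c x"]) auto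
qed

lemma open_cmap_image: "c \<in> A \<Longrightarrow> open B \<Longrightarrow> B \<subseteq> cdom c \<Longrightarrow> open (cmap c ` B)"
  using continuous_on_open_vimage[OF open_cimg, of c "cinv c"] cinv_cont
  by (simp add: cmap_image Collect_conj_eq vimage_def Int_commute)

lemma open_cinv_image: "c \<in> A \<Longrightarrow> open V \<Longrightarrow> V \<subseteq> cimg c \<Longrightarrow> open (cinv c ` V)"
proof -
  assume c: "c \<in> A" and V: "open V" "V \<subseteq> cimg c"
  have "cinv c ` V = cmap c -` V \<inter> cdom c"
    using c V(2) by (auto simp: cinv_cdom cmap_cinv subset_iff) (metis cinv_cmap image_eqI)
  then show ?thesis
    using continuous_on_open_vimage[OF open_cdom[OF c], of "cmap c"] cmap_cont[OF c] V(1) by simp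
qed

lemma transition_smooth:
  assumes "c \<in> A" "c' \<in> A"
  shows "open (cmap c ` (cdom c \<inter> cdom c'))" "Cinf (cmap c ` (cdom c \<inter> cdom c')) (\<lambda>x. cmap c' (cinv c x))"
proof -
  show "open (cmap c ` (cdom c \<inter> cdom c'))"
    using assms by (intro open_cmap_image) (auto simp: open_cdom)
  have "smooth_on (cmap c ` (cdom c \<inter> cdom c')) (cmap c' \<circ> cinv c)"
    using atlas assms unfolding smooth_atlas_def by blast
  then show "Cinf (cmap c ` (cdom c \<inter> cdom c')) (\<lambda>x. cmap c' (cinv c x))"
    by (auto dest: smooth_on_imp_Cinf simp: o_def)
qed

lemma transition_has_derivative:
  assumes "c \<in> A" "c' \<in> A" "p \<in> cdom c" "p \<in> cdom c'"
  shows "((\<lambda>x. cmap c' (cinv c x)) has_derivative transition_deriv c c' p) (at (cmap c p))"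
proof -
  let ?S = "cmap c ` (cdom c \<inter> cdom c')"
  have x: "cmap c p \<in> ?S" using assms by auto
  have "((\<lambda>x. cmap c' (cinv c x)) has_derivative
      frechet_derivative (\<lambda>x. cmap c' (cinv c x)) (at (cmap c p) within ?S)) (at (cmap c p) within ?S)"
    using transition_smooth(2)[OF assms(1,2)] x by (rule Cinf_derivative)
  then show ?thesis
    unfolding at_within_open[OF x transition_smooth(1)[OF assms(1,2)]] transition_deriv_def o_def .
qed

section \<open>The symplectic form and its volume density in charts\<close>

lemma omega_bilinear: "c \<in> A \<Longrightarrow> x \<in> cimg c \<Longrightarrow> bilinear (\<omega> c x)"
  and omega_smooth: "c \<in> A \<Longrightarrow> Cinf (cimg c) (\<lambda>x. \<omega> c x u v)"
  and omega_transform: "c \<in> A \<Longrightarrow> c' \<in> A \<Longrightarrow> p \<in> cdom c \<Longrightarrow> p \<in> cdom c' \<Longrightarrow>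
    \<omega> c (cmap c p) u v = \<omega> c' (cmap c' p) (transition_deriv c c' p u) (transition_deriv c c' p v)"
  using omega_field unfolding bilinear_field_def by (blast intro: smooth_on_imp_Cinf)+

text \<open>The same choice term as inside \<open>liouville_density\<close>, so that the density
  unfolds to a wedge power on this enumeration.\<close>

definition enum :: "nat \<Rightarrow> 'n" where
  "enum = (SOME e. bij_betw e {..<CARD('n)} (UNIV :: 'n set))"

lemma enum_bij: "bij_betw enum {..<2 * n} UNIV"
proof -
  have "\<exists>e. bij_betw e {..<CARD('n)} (UNIV :: 'n set)"
    using ex_bij_betw_nat_finite[of "UNIV :: 'n set"] by (simp add: atLeast0LessThan)
  from someI_ex[OF this] show ?thesis by (simp add: enum_def card)
qed

abbreviation dens :: "('m, 'n) chart \<Rightarrow> real^'n \<Rightarrow> real" where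
  "dens \<equiv> liouville_density \<omega>"

lemma dens_eq: "dens c x = \<bar>wedge_power n (\<omega> c x) (\<lambda>i. axis (enum i) 1)\<bar>"
  by (simp add: liouville_density_def Let_def enum_def card)

lemma dens_transform:
  assumes "linear L" "bilinear (\<omega> c' y)" "\<And>u v. \<omega> c x u v = \<omega> c' y (L u) (L v)"
  shows "dens c x = \<bar>det (matrix L)\<bar> * dens c' y"
proof -
  have "\<omega> c x = (\<lambda>u v. \<omega> c' y (L u) (L v))" using assms(3) by blast
  then show ?thesis
    by (simp add: dens_eq wedge_power_linear[OF enum_bij assms(1,2)] abs_mult)
qed

lemma dens_nonneg: "0 \<le> dens c x"
  by (simp add: dens_eq)

lemma dens_continuous: "c \<in> A \<Longrightarrow> continuous_on (cimg c) (dens c)"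
  unfolding dens_eq[abs_def] wedge_power_def
  by (intro continuous_intros Cinf_continuous[OF omega_smooth]) auto

definition mass :: "('m, 'n) chart \<Rightarrow> 'm set \<Rightarrow> ennreal" where
  "mass c B = (\<integral>\<^sup>+ x. ennreal (dens c x) * indicator (cmap c ` B) x \<partial>lborel)"

text \<open>The constant value off the chart image makes the inverse chart a Borel map on the whole
  coordinate space, so that measures can be pushed forward along it.\<close>

definition chart_inv :: "('m, 'n) chart \<Rightarrow> real^'n \<Rightarrow> 'm" where
  "chart_inv c x = (if x \<in> cimg c then cinv c x else undefined)"

lemma chart_inv_measurable: "c \<in> A \<Longrightarrow> chart_inv c \<in> borel_measurable borel"
  unfolding chart_inv_def[abs_def]
  by (intro borel_measurable_continuous_on_if) (auto simp: open_cimg cinv_cont borel_open)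

lemma cmap_image_borel:
  assumes "c \<in> A" "B \<in> sets borel" "B \<subseteq> cdom c"
  shows "cmap c ` B \<in> sets borel"
proof -
  have "cmap c ` B = chart_inv c -` B \<inter> cimg c"
    using assms by (auto simp: cmap_image chart_inv_def)
  moreover have "chart_inv c -` B \<in> sets borel"
    using measurable_sets[OF chart_inv_measurable[OF assms(1)] assms(2)] by simp
  ultimately show ?thesis using assms(1) open_cimg borel_open by auto
qed

lemma dens_measurable:
  assumes "c \<in> A" "B \<in> sets borel" "B \<subseteq> cdom c"
  shows "(\<lambda>x. dens c x * indicator (cmap c ` B) x) \<in> borel_measurable borel"
proof -
  have "(\<lambda>x. indicator (cimg c) x *\<^sub>R dens c x) \<in> borel_measurable borel"
    using assms(1) by (intro borel_measurable_continuous_on_indicator dens_continuous borel_open open_cimg)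
  moreover have "(indicator (cmap c ` B) :: _ \<Rightarrow> real) \<in> borel_measurable borel"
    using cmap_image_borel[OF assms] by simp
  ultimately have "(\<lambda>x. indicator (cimg c) x *\<^sub>R dens c x * indicator (cmap c ` B) x) \<in> borel_measurable borel"
    by (rule borel_measurable_times)
  moreover have "(\<lambda>x. indicator (cimg c) x *\<^sub>R dens c x * indicator (cmap c ` B) x) =
      (\<lambda>x. dens c x * indicator (cmap c ` B) x)"
    using assms(3) by (intro ext) (auto simp: indicator_def cimg_def)
  ultimately show ?thesis by (simp only:)
qed

text \<open>A map with derivative \<open>h'\<close> that carries one coordinate form to the other
  multiplies the density by exactly its Jacobian determinant, which the change of variables cancels.
  It serves twice: for chart transitions, where it makes the measure well defined, and for the
  Hamiltonian maps, where it gives volume preservation.\<close>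

lemma mass_image:
  assumes c: "c \<in> A" "c' \<in> A" and B: "B \<in> sets borel" "B \<subseteq> cdom c" "B' \<in> sets borel" "B' \<subseteq> cdom c'"
    and der: "\<And>x. x \<in> cmap c ` B \<Longrightarrow> (h has_derivative h' x) (at x within cmap c ` B)"
    and inj: "inj_on h (cmap c ` B)" and img: "h ` cmap c ` B = cmap c' ` B'"
    and pres: "\<And>x u v. x \<in> cmap c ` B \<Longrightarrow> \<omega> c x u v = \<omega> c' (h x) (h' x u) (h' x v)"
  shows "mass c B = mass c' B'"
proof -
  let ?S = "cmap c ` B"
  have d: "dens c x = \<bar>det (matrix (h' x))\<bar> * dens c' (h x)" if x: "x \<in> ?S" for x
  proof (rule dens_transform[OF has_derivative_linear[OF der[OF x]]])
    have "h x \<in> cimg c'" using img x B(4) by (auto simp: cimg_def)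
    then show "bilinear (\<omega> c' (h x))" using c by (intro omega_bilinear)
  qed (rule pres[OF x])
  have "(\<integral>\<^sup>+x. ennreal (\<bar>det (matrix (h' x))\<bar> * dens c' (h x)) * indicator ?S x \<partial>lborel) =
    (\<integral>\<^sup>+y. ennreal (dens c' y) * indicator (h ` ?S) y \<partial>lborel)"
  proof (rule nn_integral_change_of_variables[OF cmap_image_borel[OF c(1) B(1,2)] der inj])
    show "(\<lambda>y. dens c' y * indicator (h ` ?S) y) \<in> borel_measurable borel"
      unfolding img by (rule dens_measurable[OF c(2) B(3,4)])
    have "(\<lambda>x. \<bar>det (matrix (h' x))\<bar> * dens c' (h x) * indicator ?S x) = (\<lambda>x. dens c x * indicator ?S x)"
      by (auto simp: d indicator_def)
    then show "(\<lambda>x. \<bar>det (matrix (h' x))\<bar> * dens c' (h x) * indicator ?S x) \<in> borel_measurable borel"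
      using dens_measurable[OF c(1) B(1,2)] by simp
  qed (use dens_nonneg in auto)
  moreover have "(\<integral>\<^sup>+x. ennreal (\<bar>det (matrix (h' x))\<bar> * dens c' (h x)) * indicator ?S x \<partial>lborel) = mass c B"
    unfolding mass_def by (intro nn_integral_cong) (auto simp: d indicator_def)
  ultimately show ?thesis by (simp add: mass_def img)
qed

lemma mass_transition:
  assumes c: "c \<in> A" "c' \<in> A" and B: "B \<in> sets borel" "B \<subseteq> cdom c" "B \<subseteq> cdom c'"
  shows "mass c B = mass c' B"
proof (rule mass_image[OF c B(1,2) B(1,3), where h = "\<lambda>x. cmap c' (cinv c x)" and
      h' = "\<lambda>x. transition_deriv c c' (cinv c x)"])
  have *: "cinv c x \<in> B" "x = cmap c (cinv c x)" if "x \<in> cmap c ` B" for x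
    using that B c by (auto simp: cinv_cmap)
  show "((\<lambda>x. cmap c' (cinv c x)) has_derivative transition_deriv c c' (cinv c x)) (at x within cmap c ` B)"
    if "x \<in> cmap c ` B" for x
    using transition_has_derivative[OF c, of "cinv c x"] *[OF that] B by (auto intro: has_derivative_at_withinI)
  show "inj_on (\<lambda>x. cmap c' (cinv c x)) (cmap c ` B)"
    by (rule inj_onI) (metis * cinv_cmap B(3) c(2) subsetD)
  show "(\<lambda>x. cmap c' (cinv c x)) ` cmap c ` B = cmap c' ` B"
    unfolding image_image using B c by (intro image_cong) (auto simp: cinv_cmap)
  show "\<omega> c x u v = \<omega> c' (cmap c' (cinv c x)) (transition_deriv c c' (cinv c x) u) (transition_deriv c c' (cinv c x) v)"
    if "x \<in> cmap c ` B" for x u v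
    using omega_transform[OF c, of "cinv c x" u v] *[OF that] B by auto
qed

text \<open>The indicator removes all mass off the chart image; the points there are sent to the
  default value of \<open>chart_inv\<close> and must not charge it.\<close>

definition chart_measure :: "('m, 'n) chart \<Rightarrow> 'm measure" where
  "chart_measure c = distr (density lborel (\<lambda>x. ennreal (dens c x) * indicator (cimg c) x)) borel (chart_inv c)"

lemma emeasure_chart_measure:
  assumes c: "c \<in> A" and B: "B \<in> sets borel" "B \<subseteq> cdom c"
  shows "emeasure (chart_measure c) B = mass c B"
proof -
  have m: "(\<lambda>x. ennreal (dens c x) * indicator (cimg c) x) \<in> borel_measurable lborel"
  proof -
    have "cmap c ` cdom c = cimg c" by (simp add: cimg_def)
    moreover have "ennreal (dens c x) * indicator (cimg c) x = ennreal (dens c x * indicator (cimg c) x)" for x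
      by (simp add: indicator_def)
    ultimately show ?thesis
      using dens_measurable[OF c borel_open[OF open_cdom[OF c]] order_refl] by simp
  qed
  have v: "chart_inv c -` B \<in> sets borel"
    using measurable_sets[OF chart_inv_measurable[OF c] B(1)] by simp
  have "emeasure (chart_measure c) B =
      (\<integral>\<^sup>+x. ennreal (dens c x) * indicator (cimg c) x * indicator (chart_inv c -` B) x \<partial>lborel)"
    using chart_inv_measurable[OF c] B(1) v m by (simp add: chart_measure_def emeasure_distr emeasure_density)
  also have "\<dots> = mass c B"
    unfolding mass_def cmap_image[OF c B(2)]
    by (intro nn_integral_cong) (auto simp: indicator_def chart_inv_def)
  finally show ?thesis .
qed

lemma sets_chart_measure [simp]: "sets (chart_measure c) = sets borel"
  by (simp add: chart_measure_def)

section \<open>Existence, uniqueness and finiteness of the Liouville measure\<close>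

definition is_liouville :: "'m measure \<Rightarrow> bool" where
  "is_liouville \<mu> \<longleftrightarrow> sets \<mu> = sets borel \<and> (\<forall>c\<in>A. \<forall>B\<in>sets borel. B \<subseteq> cdom c \<longrightarrow> emeasure \<mu> B = mass c B)"

text \<open>Compactness selects finitely many charts, and making their domains disjoint one after
  the other gives a Borel partition. On each piece the measure of a set is prescribed by a single
  chart.\<close>

lemma liouville_cover:
  "\<exists>(k::nat) C D. (\<forall>i<k. C i \<in> A \<and> D i \<subseteq> cdom (C i)) \<and> (\<forall>i. D i \<in> sets borel) \<and>
    disjoint_family D \<and> (\<Union>i<k. D i) = UNIV"
proof -
  have "UNIV \<subseteq> (\<Union>c\<in>A. cdom c)" using chart_at by blast
  from compactE_image[OF compact_UNIV open_cdom this]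
  obtain F where F: "F \<subseteq> A" "finite F" "UNIV \<subseteq> (\<Union>c\<in>F. cdom c)" by blast
  from finite_imp_nat_seg_image_inj_on[OF F(2)]
  obtain k and C :: "nat \<Rightarrow> ('m, 'n) chart" where "F = C ` {i. i < k}" by blast
  then have C: "\<And>i. i < k \<Longrightarrow> C i \<in> A" "(\<Union>i<k. cdom (C i)) = UNIV"
    using F(1,3) by (auto simp: lessThan_def)
  define E where "E i = (if i < k then cdom (C i) else {})" for i
  have "(\<Union>i. disjointed E i) = UNIV"
    using C(2) by (auto simp: UN_disjointed_eq E_def)
  moreover have "disjointed E i = {}" if "\<not> i < k" for i
    using disjointed_subset[of E i] that by (auto simp: E_def)
  ultimately have "(\<Union>i<k. disjointed E i) = UNIV" by blast
  moreover have "E i \<in> sets borel" for i using C(1) open_cdom by (auto simp: E_def)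
  then have "range E \<subseteq> sets borel" by auto
  then have "range (disjointed E) \<subseteq> sets borel" by (rule sets.range_disjointed_sets)
  moreover have "disjointed E i \<subseteq> cdom (C i)" if "i < k" for i
    using disjointed_subset[of E i] that by (simp add: E_def)
  ultimately show ?thesis
    using C(1) disjoint_family_disjointed[of E]
    by (intro exI[of _ k] exI[of _ C] exI[of _ "disjointed E"]) auto
qed

lemma is_liouville_unique: "is_liouville \<mu> \<Longrightarrow> is_liouville \<nu> \<Longrightarrow> \<mu> = \<nu>"
proof (rule measure_eqI)
  assume l: "is_liouville \<mu>" "is_liouville \<nu>"
  then show "sets \<mu> = sets \<nu>" by (simp add: is_liouville_def)
  fix B assume "B \<in> sets \<mu>"
  then have B: "B \<in> sets borel" using l by (simp add: is_liouville_def)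
  obtain k :: nat and C D where "(\<forall>i<k. C i \<in> A \<and> D i \<subseteq> cdom (C i)) \<and> (\<forall>i. D i \<in> sets borel) \<and>
    disjoint_family D \<and> (\<Union>i<k. D i) = UNIV"
    using liouville_cover by blast
  then have C: "\<And>i. i < k \<Longrightarrow> C i \<in> A" "\<And>i. i < k \<Longrightarrow> D i \<subseteq> cdom (C i)"
    "\<And>i. D i \<in> sets borel" "disjoint_family D" "(\<Union>i<k. D i) = UNIV"
    by simp_all
  have "emeasure \<kappa> B = (\<Sum>i<k. mass (C i) (B \<inter> D i))" if \<kappa>: "is_liouville \<kappa>" for \<kappa>
  proof -
    have "B = (\<Union>i<k. B \<inter> D i)" using C(5) by auto
    moreover have "(\<Sum>i<k. emeasure \<kappa> (B \<inter> D i)) = emeasure \<kappa> (\<Union>i<k. B \<inter> D i)"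
      using B C(3,4) \<kappa> by (intro sum_emeasure) (auto simp: is_liouville_def disjoint_family_on_def)
    moreover have "emeasure \<kappa> (B \<inter> D i) = mass (C i) (B \<inter> D i)" if "i < k" for i
    proof -
      have "B \<inter> D i \<in> sets borel" "B \<inter> D i \<subseteq> cdom (C i)" using B C(3) C(2)[OF that] by auto
      then show ?thesis using \<kappa> C(1)[OF that] unfolding is_liouville_def by blast
    qed
    ultimately show ?thesis by simp
  qed
  then show "emeasure \<mu> B = emeasure \<nu> B" using l by simp
qed

text \<open>The chart measures are added up over the partition. That the result is right on sets
  inside any other chart domain is \<open>mass_transition\<close>, applied to each piece.\<close>

lemma is_liouville_exists: "\<exists>\<mu>. is_liouville \<mu>"
proof -
  obtain k :: nat and C D where "(\<forall>i<k. C i \<in> A \<and> D i \<subseteq> cdom (C i)) \<and> (\<forall>i. D i \<in> sets borel) \<and>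
    disjoint_family D \<and> (\<Union>i<k. D i) = UNIV"
    using liouville_cover by blast
  then have C: "\<And>i. i < k \<Longrightarrow> C i \<in> A" "\<And>i. i < k \<Longrightarrow> D i \<subseteq> cdom (C i)"
    "\<And>i. D i \<in> sets borel" "disjoint_family D" "(\<Union>i<k. D i) = UNIV"
    by simp_all
  define m where "m B = (\<Sum>i<k. emeasure (chart_measure (C i)) (B \<inter> D i))" for B
  define \<mu> where "\<mu> = measure_of UNIV (sets borel) m"
  have sets: "sets \<mu> = sets borel"
    unfolding \<mu>_def by (simp add: sets.sigma_sets_eq[of borel, simplified space_borel])
  have em: "emeasure \<mu> B = m B" if B: "B \<in> sets borel" for B
  proof (rule emeasure_measure_of[OF \<mu>_def])
    show "positive (sets \<mu>) m" by (simp add: positive_def m_def)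
    show "countably_additive (sets \<mu>) m"
    proof (rule countably_additiveI)
      fix F :: "nat \<Rightarrow> 'm set" assume F: "range F \<subseteq> sets \<mu>" "disjoint_family F"
      have "(\<Sum>j. m (F j)) = (\<Sum>i<k. \<Sum>j. emeasure (chart_measure (C i)) (F j \<inter> D i))"
        unfolding m_def by (rule suminf_sum) simp
      also have "\<dots> = (\<Sum>i<k. emeasure (chart_measure (C i)) (\<Union>j. F j \<inter> D i))"
      proof (rule sum.cong[OF refl])
        fix i
        have "range (\<lambda>j. F j \<inter> D i) \<subseteq> sets borel" using F(1) C(3) by (auto simp: sets)
        then show "(\<Sum>j. emeasure (chart_measure (C i)) (F j \<inter> D i)) = emeasure (chart_measure (C i)) (\<Union>j. F j \<inter> D i)"
          using F(2) by (intro suminf_emeasure) (auto simp: disjoint_family_on_def)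
      qed
      also have "\<dots> = m (\<Union>j. F j)" by (simp add: m_def)
      finally show "(\<Sum>j. m (F j)) = m (\<Union>j. F j)" .
    qed
    show "B \<in> sets \<mu>" using B by (simp add: sets)
  qed auto
  have "emeasure \<mu> B = mass c B" if c: "c \<in> A" and B: "B \<in> sets borel" "B \<subseteq> cdom c" for c B
  proof -
    have "m B = (\<Sum>i<k. emeasure (chart_measure c) (B \<inter> D i))"
      unfolding m_def
    proof (rule sum.cong[OF refl])
      fix i assume "i \<in> {..<k}"
      then have i: "i < k" by simp
      have BD: "B \<inter> D i \<in> sets borel" "B \<inter> D i \<subseteq> cdom (C i)" "B \<inter> D i \<subseteq> cdom c"
        using B C(3) C(2)[OF i] by auto
      show "emeasure (chart_measure (C i)) (B \<inter> D i) = emeasure (chart_measure c) (B \<inter> D i)"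
        unfolding emeasure_chart_measure[OF C(1)[OF i] BD(1,2)] emeasure_chart_measure[OF c BD(1,3)]
        by (rule mass_transition[OF C(1)[OF i] c BD])
    qed
    also have "disjoint_family_on (\<lambda>i. B \<inter> D i) {..<k}"
      using C(4) unfolding disjoint_family_on_def by blast
    then have "(\<Sum>i<k. emeasure (chart_measure c) (B \<inter> D i)) = emeasure (chart_measure c) (\<Union>i<k. B \<inter> D i)"
      using B C(3) by (intro sum_emeasure) auto
    also have "(\<Union>i<k. B \<inter> D i) = B" using C(5) by auto
    finally show ?thesis using em[OF B(1)] emeasure_chart_measure[OF c B] by simp
  qed
  then have "is_liouville \<mu>" by (simp add: is_liouville_def sets)
  then show ?thesis by blast
qed

abbreviation vol :: "'m measure" where "vol \<equiv> liouville A \<omega>"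

lemma is_liouville_vol: "is_liouville vol"
proof -
  have "is_liouville (THE \<mu>. is_liouville \<mu>)"
    using is_liouville_exists is_liouville_unique by (metis theI)
  then show ?thesis by (simp add: liouville_def is_liouville_def[abs_def] mass_def)
qed

lemma sets_vol [simp]: "sets vol = sets borel"
  using is_liouville_vol by (simp add: is_liouville_def)

lemma space_vol [simp]: "space vol = UNIV"
  using sets_eq_imp_space_eq[OF sets_vol] by simp

lemma emeasure_vol: "c \<in> A \<Longrightarrow> B \<in> sets borel \<Longrightarrow> B \<subseteq> cdom c \<Longrightarrow> emeasure vol B = mass c B"
  using is_liouville_vol by (simp add: is_liouville_def)

text \<open>The density is bounded on a closed coordinate ball around each point, so every point has
  an open neighbourhood of finite volume; compactness does the rest.\<close>

lemma finite_vol: "finite_measure vol"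
proof
  have "\<exists>V. open V \<and> p \<in> V \<and> emeasure vol V < \<infinity>" for p
  proof -
    obtain c where c: "c \<in> A" "p \<in> cdom c" using chart_at by blast
    obtain r where r: "0 < r" "cball (cmap c p) r \<subseteq> cimg c"
      using open_contains_cball open_cimg[OF c(1)] cmap_cimg[OF c(2)] by blast
    let ?B = "ball (cmap c p) r"
    have sub: "?B \<subseteq> cimg c" using r(2) ball_subset_cball by blast
    let ?V = "cinv c ` ?B"
    have V: "open ?V" using open_cinv_image[OF c(1) _ sub] by simp
    have "?V \<subseteq> cdom c" using sub cinv_cdom[OF c(1)] by auto
    have img: "cmap c ` ?V = ?B"
      unfolding image_image using sub cmap_cinv[OF c(1)] by force
    have "bounded (dens c ` cball (cmap c p) r)"
      by (intro compact_imp_bounded compact_continuous_image continuous_on_subset[OF dens_continuous[OF c(1)] r(2)] compact_cball)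
    then obtain K where "\<forall>y\<in>dens c ` cball (cmap c p) r. norm y \<le> K" unfolding bounded_iff by blast
    then have K: "\<And>x. x \<in> cball (cmap c p) r \<Longrightarrow> \<bar>dens c x\<bar> \<le> K" by auto
    have "emeasure vol ?V = mass c ?V" using c V \<open>?V \<subseteq> cdom c\<close> by (intro emeasure_vol) auto
    also have "\<dots> \<le> (\<integral>\<^sup>+ x. ennreal K * indicator ?B x \<partial>lborel)"
      unfolding mass_def img
    proof (rule nn_integral_mono)
      fix x show "ennreal (dens c x) * indicator ?B x \<le> ennreal K * indicator ?B x"
        using K[of x] by (auto simp: indicator_def intro!: ennreal_leI)
    qed
    also have "\<dots> = ennreal K * emeasure lborel ?B" by (simp add: nn_integral_cmult_indicator)
    also have "\<dots> < \<infinity>" using emeasure_lborel_ball_finite[of "cmap c p" r] by (simp add: ennreal_mult_less_top)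
    finally show ?thesis using V c r by (intro exI[of _ ?V]) (auto intro!: image_eqI[of _ _ "cmap c p"] simp: cinv_cmap)
  qed
  then obtain V where V: "\<And>p. open (V p)" "\<And>p. p \<in> V p" "\<And>p. emeasure vol (V p) < \<infinity>" by metis
  obtain F where F: "finite F" "UNIV \<subseteq> (\<Union>p\<in>F. V p)"
    using compactE_image[OF compact_UNIV, of UNIV V] V by (metis UNIV_I UN_I subsetI)
  have "emeasure vol (space vol) \<le> emeasure vol (\<Union>p\<in>F. V p)" using F(2) V(1) by (intro emeasure_mono) (auto intro!: borel_open open_UN)
  also have "\<dots> \<le> (\<Sum>p\<in>F. emeasure vol (V p))" using F(1) V(1) by (intro emeasure_subadditive_finite) auto
  also have "\<dots> < \<infinity>" using F(1) V(3) by (simp add: ennreal_sum_less_top less_top)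
  finally show "emeasure vol (space vol) \<noteq> \<infinity>" by simp
qed

lemma integrable_continuous: "continuous_on UNIV f \<Longrightarrow> integrable vol (f :: 'm \<Rightarrow> real)"
proof -
  assume f: "continuous_on UNIV f"
  interpret finite_measure vol by (rule finite_vol)
  have "bounded (range f)" using compact_imp_bounded[OF compact_continuous_image[OF f compact_UNIV]] .
  then obtain K where "\<And>p. norm (f p) \<le> K" unfolding bounded_iff by auto
  moreover have "f \<in> borel_measurable vol"
    using borel_measurable_continuous_onI[OF f] by (simp add: measurable_def)
  ultimately show ?thesis by (intro integrable_const_bound[of _ K]) auto
qed

end

section \<open>Hamiltonian flows in a chart\<close>

lemma Ck_vec: "(\<And>i. Ck k S (\<lambda>x. f x $ i)) \<Longrightarrow> Ck k S (f :: _ \<Rightarrow> real^'n::finite)"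
  by (rule Ck_componentwise) (auto simp: Basis_vec_def inner_axis)

lemma Ck_det: "(\<And>i j. Ck k S (\<lambda>x. M x $ i $ j)) \<Longrightarrow> Ck k S (\<lambda>x. det (M x :: real^'n^('n::finite)))"
  unfolding det_def by (intro Ck_sum Ck_mult Ck_const Ck_prod)

lemma linear_expand:
  fixes L :: "real^'n::finite \<Rightarrow> real"
  assumes "linear L" shows "L v = (\<Sum>i\<in>UNIV. v $ i * L (axis i 1))"
proof -
  have "L v = L (\<Sum>i\<in>UNIV. v $ i *\<^sub>R axis i 1)"
    using basis_expansion[of v] by (simp only: scalar_mult_eq_scaleR)
  also have "\<dots> = (\<Sum>i\<in>UNIV. v $ i * L (axis i 1))"
    by (simp only: linear_sum[OF assms] linear_scale[OF assms] real_scaleR_def)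
  finally show ?thesis .
qed

lemma bilinear_expand:
  fixes B :: "real^'n::finite \<Rightarrow> real^'n \<Rightarrow> real"
  assumes "bilinear B"
  shows "B u v = (\<Sum>i\<in>UNIV. \<Sum>j\<in>UNIV. u $ i * v $ j * B (axis i 1) (axis j 1))"
proof -
  have l: "linear (\<lambda>u. B u v)" "\<And>u. linear (B u)" for v
    using assms by (auto simp: bilinear_def)
  show ?thesis
    by (subst linear_expand[OF l(1)], subst linear_expand[OF l(2)]) (simp add: sum_distrib_left mult.assoc)
qed

context symplectic_manifold begin

definition domega :: "('m, 'n) chart \<Rightarrow> real^'n \<Rightarrow> real^'n \<Rightarrow> real^'n \<Rightarrow> real^'n \<Rightarrow> real" where
  "domega c x w u v = frechet_derivative (\<lambda>x. \<omega> c x u v) (at x) w"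

lemma omega_has_derivative:
  "c \<in> A \<Longrightarrow> x \<in> cimg c \<Longrightarrow> ((\<lambda>x. \<omega> c x u v) has_derivative (\<lambda>w. domega c x w u v)) (at x)"
  unfolding domega_def using Cinf_derivative[OF omega_smooth[of c u v], of x] at_within_open[OF _ open_cimg, of x c] by simp

lemma omega_expand: "c \<in> A \<Longrightarrow> x \<in> cimg c \<Longrightarrow>
    \<omega> c x u v = (\<Sum>i\<in>UNIV. \<Sum>j\<in>UNIV. u $ i * v $ j * \<omega> c x (axis i 1) (axis j 1))"
  by (rule bilinear_expand[OF omega_bilinear])

lemma domega_expand:
  assumes "c \<in> A" "x \<in> cimg c"
  shows "domega c x w u v = (\<Sum>i\<in>UNIV. \<Sum>j\<in>UNIV. u $ i * v $ j * domega c x w (axis i 1) (axis j 1))"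
proof -
  have "((\<lambda>x. \<Sum>i\<in>UNIV. \<Sum>j\<in>UNIV. u $ i * v $ j * \<omega> c x (axis i 1) (axis j 1)) has_derivative
      (\<lambda>w. \<Sum>i\<in>UNIV. \<Sum>j\<in>UNIV. u $ i * v $ j * domega c x w (axis i 1) (axis j 1))) (at x)"
    by (intro has_derivative_sum has_derivative_mult_right omega_has_derivative assms)
  then have "((\<lambda>x. \<omega> c x u v) has_derivative
      (\<lambda>w. \<Sum>i\<in>UNIV. \<Sum>j\<in>UNIV. u $ i * v $ j * domega c x w (axis i 1) (axis j 1))) (at x)"
    by (rule has_derivative_transform_within_open[OF _ open_cimg[OF assms(1)] assms(2)])
      (rule omega_expand[symmetric, OF assms(1)])
  from has_derivative_unique[OF omega_has_derivative[OF assms] this] show ?thesis by meson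
qed

lemma omega_alternating: "c \<in> A \<Longrightarrow> x \<in> cimg c \<Longrightarrow> \<omega> c x v v = 0"
  and omega_nondegenerate: "c \<in> A \<Longrightarrow> x \<in> cimg c \<Longrightarrow> (\<And>v. \<omega> c x u v = 0) \<Longrightarrow> u = 0"
  using symp unfolding symplectic_form_def by blast+

lemma omega_closed: "c \<in> A \<Longrightarrow> x \<in> cimg c \<Longrightarrow>
    domega c x u v w - domega c x v u w + domega c x w u v = 0"
  using symp unfolding symplectic_form_def ext_d2_def domega_def by blast

lemma omega_antisym: "c \<in> A \<Longrightarrow> x \<in> cimg c \<Longrightarrow> \<omega> c x u v = - \<omega> c x v u"
proof -
  assume c: "c \<in> A" "x \<in> cimg c"
  have "\<omega> c x (u + v) (u + v) = \<omega> c x u u + \<omega> c x u v + (\<omega> c x v u + \<omega> c x v v)"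
    by (simp add: bilinear_ladd[OF omega_bilinear[OF c]] bilinear_radd[OF omega_bilinear[OF c]])
  then show ?thesis by (simp add: omega_alternating[OF c])
qed

lemma omega_linear: "c \<in> A \<Longrightarrow> x \<in> cimg c \<Longrightarrow> linear (\<omega> c x u)"
  "c \<in> A \<Longrightarrow> x \<in> cimg c \<Longrightarrow> linear (\<lambda>u. \<omega> c x u v)"
  using omega_bilinear by (auto simp: bilinear_def)

text \<open>Base point and both arguments move at once. The form is differentiable in the base point
  for fixed arguments, so the product rule is carried out on its coordinate expansion and
  reassembled.\<close>

lemma omega_curve:
  assumes c: "c \<in> A" and s: "s \<in> T" and yc: "\<And>\<sigma>. \<sigma> \<in> T \<Longrightarrow> y \<sigma> \<in> cimg c"
    and y: "(y has_vector_derivative y') (at s within T)"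
    and a: "(a has_vector_derivative a') (at s within T)" and b: "(b has_vector_derivative b') (at s within T)"
  shows "((\<lambda>s. \<omega> c (y s) (a s) (b s)) has_vector_derivative
    (domega c (y s) y' (a s) (b s) + \<omega> c (y s) a' (b s) + \<omega> c (y s) (a s) b')) (at s within T)"
proof -
  note ys = yc[OF s]
  let ?O = "\<lambda>i j x. \<omega> c x (axis i 1) (axis j 1)" and ?D = "\<lambda>i j. domega c (y s) y' (axis i 1) (axis j 1)"
  have O: "((\<lambda>\<sigma>. ?O i j (y \<sigma>)) has_real_derivative ?D i j) (at s within T)" for i j
    using vector_derivative_diff_chain_within[OF y has_derivative_at_withinI[OF omega_has_derivative[OF c ys]]]
    by (simp add: o_def has_real_derivative_iff_has_vector_derivative)
  have comp: "((\<lambda>s. f s $ i) has_real_derivative f' $ i) (at s within T)"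
    if "(f has_vector_derivative f') (at s within T)" for f f' and i :: 'n
    using bounded_linear.has_vector_derivative[OF bounded_linear_vec_nth that, of i]
    by (simp add: has_real_derivative_iff_has_vector_derivative)
  let ?t = "\<lambda>i j. (a' $ i * b s $ j + b' $ j * a s $ i) * ?O i j (y s) + ?D i j * (a s $ i * b s $ j)"
  have "((\<lambda>\<sigma>. a \<sigma> $ i * b \<sigma> $ j * ?O i j (y \<sigma>)) has_real_derivative ?t i j) (at s within T)" for i j
    by (intro DERIV_mult comp a b O)
  then have "((\<lambda>\<sigma>. \<Sum>i\<in>UNIV. \<Sum>j\<in>UNIV. a \<sigma> $ i * b \<sigma> $ j * ?O i j (y \<sigma>)) has_real_derivative
      (\<Sum>i\<in>UNIV. \<Sum>j\<in>UNIV. ?t i j)) (at s within T)"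
    by (intro DERIV_sum)
  moreover have "(\<Sum>i\<in>UNIV. \<Sum>j\<in>UNIV. ?t i j) =
      domega c (y s) y' (a s) (b s) + \<omega> c (y s) a' (b s) + \<omega> c (y s) (a s) b'"
    unfolding domega_expand[OF c ys, of y' "a s" "b s"] omega_expand[OF c ys, of a' "b s"] omega_expand[OF c ys, of "a s" b']
      sum.distrib[symmetric]
    by (intro sum.cong refl) (simp add: algebra_simps)
  ultimately have "((\<lambda>\<sigma>. \<Sum>i\<in>UNIV. \<Sum>j\<in>UNIV. a \<sigma> $ i * b \<sigma> $ j * ?O i j (y \<sigma>)) has_vector_derivative
      (domega c (y s) y' (a s) (b s) + \<omega> c (y s) a' (b s) + \<omega> c (y s) (a s) b')) (at s within T)"
    by (simp only: has_real_derivative_iff_has_vector_derivative)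
  then show ?thesis
    by (rule has_vector_derivative_transform[OF s, rotated]) (rule omega_expand[OF c yc])
qed

text \<open>Nondegeneracy makes \<open>\<omega> (Y, .) = d bump\<close> uniquely solvable at every
  point of the chart, and Cramer's rule exhibits the solution as a smooth function of the point.
  Field and Hamiltonian are then scaled together to reach Lipschitz constant 1/2.\<close>

lemma hamiltonian_field:
  assumes c: "c \<in> A" and rR: "0 < \<rho>" "\<rho> < R" and ballR: "ball x0 R \<subseteq> cimg c"
  shows "\<exists>\<kappa> X. 0 < \<kappa> \<and> \<kappa> \<le> 1 \<and> Cinf UNIV X \<and> (\<forall>y z. norm (X y - X z) \<le> 1/2 * norm (y - z)) \<and>
    (\<forall>x. x \<notin> ball x0 \<rho> \<longrightarrow> X x = 0) \<and>
    (\<forall>x\<in>ball x0 R. \<forall>v. \<omega> c x (X x) v = \<kappa> * frechet_derivative (bump x0 \<rho>) (at x) v)"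
proof -
  \<comment> \<open>The indices are transposed so that entry \<open>i\<close> of
    \<open>Om x *v u\<close> is \<open>\<omega> c x u (axis i 1)\<close>, with the unknown field in
    the first slot.\<close>
  define Om where "Om x = (\<chi> i j. \<omega> c x (axis j 1) (axis i 1))" for x
  define b where "b x = (\<chi> i. frechet_derivative (bump x0 \<rho>) (at x) (axis i (1::real)))" for x
  define Y where "Y x = (if x \<in> ball x0 R then
    (\<chi> k. det (\<chi> i j. if j = k then b x $ i else Om x $ i $ j) / det (Om x)) else 0)" for x
  have Om: "(Om x *v u) $ i = \<omega> c x u (axis i 1)" if "x \<in> cimg c" for x u i
    using linear_expand[OF omega_linear(2)[OF c that, of "axis i 1"], of u]
    by (simp add: Om_def matrix_vector_mult_def mult.commute)
  have detOm: "det (Om x) \<noteq> 0" if x: "x \<in> cimg c" for x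
  proof -
    have "u = 0" if u: "Om x *v u = 0" for u
    proof (rule omega_nondegenerate[OF c x])
      fix v
      have "\<omega> c x u (axis i 1) = 0" for i using Om[OF x, of u i] u by simp
      then show "\<omega> c x u v = 0" using linear_expand[OF omega_linear(1)[OF c x, of u], of v] by simp
    qed
    then have "invertible (Om x)" unfolding invertible_left_inverse matrix_left_invertible_ker by blast
    then show ?thesis by (simp add: invertible_det_nz)
  qed
  have Y: "Om x *v Y x = b x" if "x \<in> ball x0 R" for x
    using cramer[OF detOm, of x "Y x" "b x"] that ballR by (auto simp: Y_def)
  have DB: "linear (frechet_derivative (bump x0 \<rho>) (at x))" for x
    using bump_has_derivative linear_frechet_derivative differentiableI by blast
  have YB: "\<omega> c x (Y x) v = frechet_derivative (bump x0 \<rho>) (at x) v" if x: "x \<in> ball x0 R" for x v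
  proof -
    have x': "x \<in> cimg c" using x ballR by auto
    have "\<omega> c x (Y x) (axis i 1) = frechet_derivative (bump x0 \<rho>) (at x) (axis i 1)" for i
      using Om[OF x', of "Y x" i] Y[OF x] by (simp add: b_def)
    then show ?thesis
      using linear_expand[OF omega_linear(1)[OF c x', of "Y x"], of v] linear_expand[OF DB, of x v] by simp
  qed
  have Y0: "Y x = 0" if "x \<notin> ball x0 \<rho>" for x
  proof (cases "x \<in> ball x0 R")
    case True
    have "b x = 0" using bump_derivative_outside[OF rR(1) that] by (simp add: b_def vec_eq_iff)
    then have "\<omega> c x (Y x) v = 0" for v using YB[OF True, of v] bump_derivative_outside[OF rR(1) that] by simp
    then show ?thesis using omega_nondegenerate[OF c, of x "Y x"] True ballR by auto
  qed (auto simp: Y_def)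
  have "Ck k (ball x0 R) Y" for k
  proof (rule Ck_cong)
    have O: "Ck k (ball x0 R) (\<lambda>x. Om x $ i $ j)" for i j
      using Ck_subset[OF _ ballR, of k "\<lambda>x. \<omega> c x (axis j 1) (axis i 1)"] omega_smooth[OF c, of "axis j 1" "axis i 1"] unfolding Cinf_def by (simp add: Om_def)
    have bk: "Ck k (ball x0 R) (\<lambda>x. b x $ i)" for i
      using Cinf_frechet[OF bump_smooth thick_open[OF open_UNIV], of x0 \<rho> "axis i 1"]
      unfolding Cinf_def by (auto simp: b_def intro: Ck_subset)
    show "Ck k (ball x0 R) (\<lambda>x. \<chi> k. det (\<chi> i j. if j = k then b x $ i else Om x $ i $ j) * inverse (det (Om x)))"
    proof (rule Ck_vec)
      fix l
      have "Ck k (ball x0 R) (\<lambda>x. if j = l then b x $ i else Om x $ i $ j)" for i j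
        using O bk by (cases "j = l") auto
      then have "Ck k (ball x0 R) (\<lambda>x. det (\<chi> i j. if j = l then b x $ i else Om x $ i $ j) * inverse (det (Om x)))"
        using detOm ballR by (intro Ck_mult Ck_inverse Ck_det) (auto intro: O)
      then show "Ck k (ball x0 R) (\<lambda>x. (\<chi> k. det (\<chi> i j. if j = k then b x $ i else Om x $ i $ j) * inverse (det (Om x))) $ l)"
        by simp
    qed
  qed (simp add: Y_def divide_inverse)
  then have Y_ball: "Cinf (ball x0 R) Y" by (simp add: Cinf_def)
  have Y_out: "Cinf (- cball x0 \<rho>) Y"
    by (rule Cinf_cong[of _ "\<lambda>x. 0"]) (use Y0 in \<open>auto simp: Cinf_def Ck_const less_imp_le\<close>)
  \<comment> \<open>The \<open>R\<close>-ball and the complement of the closed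
    \<open>\<rho>\<close>-ball are open and cover the space; on the second set \<open>Y\<close> is
    zero.\<close>
  have Y_smooth: "Cinf UNIV Y"
  proof (rule Cinf_local)
    fix x
    show "\<exists>T. open T \<and> x \<in> T \<and> Cinf (UNIV \<inter> T) Y"
    proof (cases "x \<in> ball x0 R")
      case True
      then show ?thesis using Y_ball by (intro exI[of _ "ball x0 R"]) auto
    next
      case False
      then show ?thesis using Y_out rR by (intro exI[of _ "- cball x0 \<rho>"]) auto
    qed
  qed (rule thick_open[OF open_UNIV])
  obtain L where L: "0 \<le> L" "\<And>y z. norm (Y y - Y z) \<le> L * norm (y - z)"
    using compact_support_lipschitz[OF Y_smooth Y0] by blast
  \<comment> \<open>The summand 2 keeps the constant defined for \<open>L = 0\<close> and makes it
    at most 1; the latter will bound the scaled bump function by 1.\<close>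
  define \<kappa> where "\<kappa> = 1 / (2 * L + 2)"
  have \<kappa>: "0 < \<kappa>" "\<kappa> \<le> 1" "\<kappa> * L \<le> 1/2" using L(1) by (auto simp: \<kappa>_def field_simps)
  show ?thesis
  proof (intro exI[of _ \<kappa>] exI[of _ "\<lambda>x. \<kappa> *\<^sub>R Y x"] conjI allI impI ballI)
    show "Cinf UNIV (\<lambda>x. \<kappa> *\<^sub>R Y x)" using Y_smooth by (auto simp: Cinf_def intro: Ck_scaleR Ck_const)
    fix y z
    have "norm (\<kappa> *\<^sub>R Y y - \<kappa> *\<^sub>R Y z) = \<kappa> * norm (Y y - Y z)"
      using \<kappa>(1) by (simp add: scaleR_diff_right[symmetric])
    also have "\<dots> \<le> \<kappa> * (L * norm (y - z))" using \<kappa>(1) by (intro mult_left_mono L) auto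
    also have "\<dots> \<le> 1/2 * norm (y - z)"
      using mult_right_mono[OF \<kappa>(3), of "norm (y - z)"] by (simp add: mult.assoc)
    finally show "norm (\<kappa> *\<^sub>R Y y - \<kappa> *\<^sub>R Y z) \<le> 1/2 * norm (y - z)" .
  next
    fix x v assume x: "x \<in> ball x0 R"
    then have "x \<in> cimg c" using ballR by auto
    then show "\<omega> c x (\<kappa> *\<^sub>R Y x) v = \<kappa> * frechet_derivative (bump x0 \<rho>) (at x) v"
      using YB[OF x] by (simp add: bilinear_lmul[OF omega_bilinear[OF c]])
  qed (use \<kappa> Y0 in auto)
qed

end

text \<open>\<open>X\<close> is the Hamiltonian field of \<open>F\<close> and vanishes off the
  \<open>\<rho>\<close>-ball, while the symplectic identities are available on the larger
  \<open>R\<close>-ball. The bounds \<open>0 \<le> F x \<le> 1\<close> keep the time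
  \<open>a + b * F x\<close> in \<open>[-1, 1]\<close> as long as
  \<open>\<bar>a\<bar> + \<bar>b\<bar> \<le> 1\<close>.\<close>

locale hamiltonian_flow = symplectic_manifold A \<omega> n
  for A :: "('m::{t2_space, second_countable_topology}, 'n::finite) chart set" and \<omega> n +
  fixes c0 :: "('m, 'n) chart" and x0 :: "real^'n" and \<rho> R :: real
    and F :: "real^'n \<Rightarrow> real" and X :: "real^'n \<Rightarrow> real^'n" and \<phi> :: "real \<Rightarrow> real^'n \<Rightarrow> real^'n" and J
  assumes c0: "c0 \<in> A" and rR: "0 < \<rho>" "\<rho> < R" and ballR: "ball x0 R \<subseteq> cimg c0"
    and F_smooth: "Cinf UNIV F" and F_bounds: "\<And>x. 0 \<le> F x" "\<And>x. F x \<le> 1"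
    and F_out: "\<And>x. x \<notin> ball x0 \<rho> \<Longrightarrow> F x = 0"
    and X_smooth: "Cinf UNIV X" and X_lip: "\<And>y z. norm (X y - X z) \<le> 1/2 * norm (y - z)"
    and X_out: "\<And>x. x \<notin> ball x0 \<rho> \<Longrightarrow> X x = 0"
    and X_F: "\<And>x v. x \<in> ball x0 R \<Longrightarrow> \<omega> c0 x (X x) v = frechet_derivative F (at x) v"
    and flow_0: "\<And>p. \<phi> 0 p = p" and J_0: "\<And>p h. J 0 p h = h"
    and flow': "\<And>s p. s \<in> {-1..1} \<Longrightarrow> ((\<lambda>s. \<phi> s p) has_vector_derivative X (\<phi> s p)) (at s within {-1..1})"
    and J': "\<And>s p h. s \<in> {-1..1} \<Longrightarrow> ((\<lambda>s. J s p h) has_vector_derivative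
        frechet_derivative X (at (\<phi> s p)) (J s p h)) (at s within {-1..1})"
    and flow_deriv: "\<And>s p. s \<in> {-1..1} \<Longrightarrow> ((\<lambda>(s, p). \<phi> s p) has_derivative (\<lambda>(k, h). k *\<^sub>R X (\<phi> s p) + J s p h))
        (at (s, p) within {-1..1} \<times> UNIV)"
    and flow_smooth: "Cinf ({-1..1} \<times> UNIV) (\<lambda>(s, p). \<phi> s p)"
begin

abbreviation DF :: "real^'n \<Rightarrow> real^'n \<Rightarrow> real" where "DF x \<equiv> frechet_derivative F (at x)"

lemma F_deriv: "(F has_derivative DF x) (at x)"
  using Cinf_derivative[OF F_smooth, of x] by simp

lemma X_deriv: "(X has_derivative frechet_derivative X (at x)) (at x)"
  using Cinf_derivative[OF X_smooth, of x] by simp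

lemma ballR_cimg: "x \<in> ball x0 R \<Longrightarrow> x \<in> cimg c0"
  using ballR by blast

lemma ball_rR: "x \<in> ball x0 \<rho> \<Longrightarrow> x \<in> ball x0 R"
  using rR by simp

text \<open>\<open>ode_estimate\<close> with error \<open>e = 0\<close>. The sign
  \<open>\<epsilon>\<close> admits the time reversed equation, which \<open>flow_inverse\<close>
  needs.\<close>

lemma flow_unique:
  assumes "-1 \<le> a" "a \<le> 0" "0 \<le> b" "b \<le> 1" "\<bar>\<epsilon>\<bar> = 1"
    and y: "\<And>t. t \<in> {a..b} \<Longrightarrow> (y has_vector_derivative \<epsilon> *\<^sub>R X (y t)) (at t within {a..b})"
    and z: "\<And>t. t \<in> {a..b} \<Longrightarrow> (z has_vector_derivative \<epsilon> *\<^sub>R X (z t)) (at t within {a..b})"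
    and "y 0 = z 0" "t \<in> {a..b}"
  shows "y t = z t"
proof -
  have "norm (y t - z t) \<le> 2 * 0"
  proof (rule ode_estimate[OF assms(1-4) y z])
    fix t
    show "norm (\<epsilon> *\<^sub>R X (y t) - \<epsilon> *\<^sub>R X (z t)) \<le> 1/2 * norm (y t - z t) + 0"
      using X_lip[of "y t" "z t"] assms(5) by (simp add: scaleR_diff_right[symmetric])
  qed (use assms in auto)
  then show ?thesis by simp
qed

lemma flow_outside: "x \<notin> ball x0 \<rho> \<Longrightarrow> s \<in> {-1..1} \<Longrightarrow> \<phi> s x = x"
  by (rule flow_unique[where a = "-1" and b = 1 and \<epsilon> = 1]) (use flow' flow_0 X_out in auto)

text \<open>As functions of \<open>\<tau>\<close>, both \<open>\<phi> (s - \<tau>) x\<close> and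
  \<open>\<phi> (- \<tau>) (\<phi> s x)\<close> solve the reversed equation and start at
  \<open>\<phi> s x\<close>. They agree at \<open>\<tau> = s\<close>, where the first is
  \<open>x\<close>.\<close>

lemma flow_inverse:
  assumes s: "s \<in> {-1..1}"
  shows "\<phi> (- s) (\<phi> s x) = x"
proof -
  let ?I = "{min 0 s..max 0 s}"
  have "\<phi> (s - s) x = \<phi> (- s) (\<phi> s x)"
  proof (rule flow_unique[where a = "min 0 s" and b = "max 0 s" and \<epsilon> = "-1" and t = s
        and y = "\<lambda>\<tau>. \<phi> (s - \<tau>) x" and z = "\<lambda>\<tau>. \<phi> (- \<tau>) (\<phi> s x)"])
    fix t assume t: "t \<in> ?I"
    have d: "((\<lambda>\<tau>. \<phi> (u \<tau>) p) has_vector_derivative (-1) *\<^sub>R X (\<phi> (u t) p)) (at t within ?I)"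
      if "(u has_vector_derivative -1) (at t within ?I)" "u ` ?I \<subseteq> {-1..1}" for u p
    proof -
      have ut: "u t \<in> {-1..1}" using that(2) t by blast
      have "((\<lambda>s. \<phi> s p) has_vector_derivative X (\<phi> (u t) p)) (at (u t) within u ` ?I)"
        by (rule has_vector_derivative_within_subset[OF flow'[OF ut] that(2)])
      from vector_diff_chain_within[OF that(1) this] show ?thesis by (simp add: o_def)
    qed
    show "((\<lambda>\<tau>. \<phi> (s - \<tau>) x) has_vector_derivative (-1) *\<^sub>R X (\<phi> (s - t) x)) (at t within ?I)"
      by (rule d) (use s in \<open>auto intro!: derivative_eq_intros\<close>)
    show "((\<lambda>\<tau>. \<phi> (- \<tau>) (\<phi> s x)) has_vector_derivative (-1) *\<^sub>R X (\<phi> (- t) (\<phi> s x))) (at t within ?I)"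
      by (rule d) (use s in \<open>auto intro!: derivative_eq_intros\<close>)
  qed (use s flow_0 in auto)
  then show ?thesis by (simp add: flow_0)
qed

lemma flow_ball: "s \<in> {-1..1} \<Longrightarrow> \<phi> s x \<in> ball x0 \<rho> \<longleftrightarrow> x \<in> ball x0 \<rho>"
proof (rule ccontr)
  assume s: "s \<in> {-1..1}" and *: "(\<phi> s x \<in> ball x0 \<rho>) \<noteq> (x \<in> ball x0 \<rho>)"
  have "- s \<in> {-1..1}" using s by auto
  then show False
    using * flow_outside[OF _ s, of x] flow_outside[of "\<phi> s x" "- s"] flow_inverse[OF s, of x] by auto
qed

lemma flow_ballR: "s \<in> {-1..1} \<Longrightarrow> \<phi> s x \<in> ball x0 R \<longleftrightarrow> x \<in> ball x0 R"
  using flow_ball[of s x] flow_outside[of x s] ball_rR by (cases "x \<in> ball x0 \<rho>") auto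

section \<open>Invariance of the Hamiltonian and of the symplectic form under the flow\<close>

lemma DF_X: "DF x (X x) = 0"
proof (cases "x \<in> ball x0 \<rho>")
  case True
  then show ?thesis using X_F[of x "X x"] omega_alternating[OF c0 ballR_cimg] ball_rR by auto
next
  case False
  then show ?thesis using X_out linear_0[OF has_derivative_linear[OF F_deriv]] by simp
qed

lemma F_flow:
  assumes "s \<in> {-1..1}" shows "F (\<phi> s x) = F x"
proof -
  have "norm (F (\<phi> s x) - F (\<phi> 0 x)) \<le> 0 * \<bar>s - 0\<bar>"
  proof (rule vector_derivative_bound[where a = "-1" and b = 1 and f' = "\<lambda>s. DF (\<phi> s x) (X (\<phi> s x))"])
    fix t :: real assume "t \<in> {-1..1}"
    from vector_derivative_diff_chain_within[OF flow'[OF this] has_derivative_at_withinI[OF F_deriv]]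
    show "((\<lambda>s. F (\<phi> s x)) has_vector_derivative DF (\<phi> t x) (X (\<phi> t x))) (at t within {-1..1})"
      by (simp add: o_def)
  qed (use assms DF_X in auto)
  then show ?thesis by (simp add: flow_0)
qed

text \<open>The identity \<open>\<omega> (X, v) = DF v\<close> is differentiated along the line
  through \<open>x\<close> in direction \<open>w\<close>. This expresses the derivative of
  \<open>X\<close> through second derivatives of \<open>F\<close>.\<close>

lemma X_F_derivative:
  assumes x: "x \<in> ball x0 R"
  shows "domega c0 x w (X x) v + \<omega> c0 x (frechet_derivative X (at x) w) v =
    frechet_derivative (\<lambda>y. DF y v) (at x) w"
proof -
  let ?y = "\<lambda>t. x + t *\<^sub>R w"
  let ?T = "?y -` ball x0 R"
  have T: "open ?T" "0 \<in> ?T" using x by (auto intro!: open_vimage continuous_intros)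
  have y: "(?y has_vector_derivative w) (at 0 within ?T)"
    by (auto intro!: derivative_eq_intros)
  have Xy: "((\<lambda>t. X (?y t)) has_vector_derivative frechet_derivative X (at (?y 0)) w) (at 0 within ?T)"
    using vector_derivative_diff_chain_within[OF y has_derivative_at_withinI[OF X_deriv]] by (simp add: o_def)
  have 1: "((\<lambda>t. \<omega> c0 (?y t) (X (?y t)) v) has_vector_derivative
      domega c0 (?y 0) w (X (?y 0)) v + \<omega> c0 (?y 0) (frechet_derivative X (at (?y 0)) w) v + \<omega> c0 (?y 0) (X (?y 0)) 0) (at 0 within ?T)"
    by (rule omega_curve[OF c0 T(2) _ y Xy has_vector_derivative_const]) (use ballR_cimg in auto)
  have D: "((\<lambda>y. DF y v) has_derivative frechet_derivative (\<lambda>y. DF y v) (at x)) (at x)"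
    using Cinf_derivative[OF Cinf_frechet[OF F_smooth thick_open[OF open_UNIV], of v], of x] by simp
  have "((\<lambda>t. DF (?y t) v) has_vector_derivative frechet_derivative (\<lambda>y. DF y v) (at x) w) (at 0 within ?T)"
    using vector_derivative_diff_chain_within[OF y has_derivative_at_withinI[where x = "?y 0"]] D by (simp add: o_def)
  then have 2: "((\<lambda>t. \<omega> c0 (?y t) (X (?y t)) v) has_vector_derivative frechet_derivative (\<lambda>y. DF y v) (at x) w) (at 0 within ?T)"
    by (rule has_vector_derivative_transform[OF T(2), rotated]) (use X_F in auto)
  have e: "at 0 within ?T = at 0" by (rule at_within_open[OF T(2,1)])
  from vector_derivative_unique_at[OF 1[unfolded e] 2[unfolded e]]
  have "domega c0 x w (X x) v + \<omega> c0 x (frechet_derivative X (at x) w) v + \<omega> c0 x (X x) 0 =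
    frechet_derivative (\<lambda>y. DF y v) (at x) w"
    by simp
  then show ?thesis using linear_0[OF omega_linear(1)[OF c0 ballR_cimg[OF x]]] by simp
qed

text \<open>The coordinate version of the Cartan formula, by which the Lie derivative of the form
  along \<open>X\<close> is \<open>d (dF) = 0\<close>. In the time derivative the second derivatives
  of \<open>F\<close> cancel by symmetry, and the three remaining derivatives of the form add up to
  zero by closedness.\<close>

lemma flow_symplectic:
  assumes s: "s \<in> {-1..1}" and x: "x \<in> ball x0 R"
  shows "\<omega> c0 (\<phi> s x) (J s x u) (J s x v) = \<omega> c0 x u v"
proof -
  let ?D = "\<lambda>x. frechet_derivative X (at x)"
  let ?f' = "\<lambda>s. domega c0 (\<phi> s x) (X (\<phi> s x)) (J s x u) (J s x v) +
    \<omega> c0 (\<phi> s x) (?D (\<phi> s x) (J s x u)) (J s x v) + \<omega> c0 (\<phi> s x) (J s x u) (?D (\<phi> s x) (J s x v))"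
  have "norm (\<omega> c0 (\<phi> s x) (J s x u) (J s x v) - \<omega> c0 (\<phi> 0 x) (J 0 x u) (J 0 x v)) \<le> 0 * \<bar>s - 0\<bar>"
  proof (rule vector_derivative_bound[where a = "-1" and b = 1 and f' = ?f'])
    fix t :: real assume t: "t \<in> {-1..1}"
    have y: "\<phi> t x \<in> ball x0 R" using flow_ballR[OF t] x by simp
    show "((\<lambda>s. \<omega> c0 (\<phi> s x) (J s x u) (J s x v)) has_vector_derivative ?f' t) (at t within {-1..1})"
      by (rule omega_curve[OF c0 t _ flow'[OF t] J'[OF t] J'[OF t]]) (use flow_ballR x ballR_cimg in auto)
    let ?y = "\<phi> t x" and ?a = "J t x u" and ?b = "J t x v"
    have "\<omega> c0 ?y ?a (?D ?y ?b) = - \<omega> c0 ?y (?D ?y ?b) ?a"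
      by (rule omega_antisym[OF c0 ballR_cimg[OF y]])
    moreover have "frechet_derivative (\<lambda>y. DF y ?b) (at ?y) ?a = frechet_derivative (\<lambda>y. DF y ?a) (at ?y) ?b"
      by (rule second_derivative_symmetric[OF open_UNIV _ F_smooth]) simp
    ultimately have "?f' t = 0"
      using X_F_derivative[OF y, of ?a ?b] X_F_derivative[OF y, of ?b ?a]
        omega_closed[OF c0 ballR_cimg[OF y], of "X ?y" ?a ?b] by simp
    then show "norm (?f' t) \<le> 0" by simp
  qed (use s in auto)
  then show ?thesis by (simp add: flow_0 J_0)
qed

text \<open>Since \<open>F\<close> is constant along its flow, this is the composition of the time \<open>a\<close> flow of \<open>F\<close> with the
  time \<open>b\<close> flow of \<open>F\<^sup>2 / 2\<close>; the two flows commute.\<close>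

definition Th :: "real \<Rightarrow> real \<Rightarrow> real^'n \<Rightarrow> real^'n" where
  "Th a b x = \<phi> (a + b * F x) x"

text \<open>The space derivative of \<open>Th a b\<close>: the first summand comes from the
  dependence of the flow time \<open>a + b * F x\<close> on the point, the second from the flow at
  that fixed time.\<close>

definition JTh :: "real \<Rightarrow> real \<Rightarrow> real^'n \<Rightarrow> real^'n \<Rightarrow> real^'n" where
  "JTh a b x v = (b * DF x v) *\<^sub>R X (Th a b x) + J (a + b * F x) x v"

section \<open>The two-parameter family \<open>Th\<close>\<close>

lemma small_time: "\<bar>a\<bar> + \<bar>b\<bar> \<le> 1 \<Longrightarrow> a + b * F x \<in> {-1..1}"
proof -
  assume "\<bar>a\<bar> + \<bar>b\<bar> \<le> 1"
  moreover have "\<bar>b * F x\<bar> \<le> \<bar>b\<bar>"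
    using F_bounds[of x] by (simp add: abs_mult mult_left_le)
  ultimately show ?thesis by auto
qed

lemma Th_0 [simp]: "Th 0 0 x = x"
  by (simp add: Th_def flow_0)

lemma Th_outside: "x \<notin> ball x0 \<rho> \<Longrightarrow> \<bar>a\<bar> + \<bar>b\<bar> \<le> 1 \<Longrightarrow> Th a b x = x"
  unfolding Th_def by (intro flow_outside small_time)

lemma Th_ballR: "\<bar>a\<bar> + \<bar>b\<bar> \<le> 1 \<Longrightarrow> Th a b x \<in> ball x0 R \<longleftrightarrow> x \<in> ball x0 R"
  unfolding Th_def by (intro flow_ballR small_time)

lemma F_Th: "\<bar>a\<bar> + \<bar>b\<bar> \<le> 1 \<Longrightarrow> F (Th a b x) = F x"
  unfolding Th_def by (intro F_flow small_time)

text \<open>\<open>F\<close> has the same value at a point and at its image, so the way back uses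
  exactly the opposite flow time.\<close>

lemma Th_inverse: "\<bar>a\<bar> + \<bar>b\<bar> \<le> 1 \<Longrightarrow> Th (- a) (- b) (Th a b x) = x"
proof -
  assume ab: "\<bar>a\<bar> + \<bar>b\<bar> \<le> 1"
  have "Th (- a) (- b) (Th a b x) = \<phi> (- (a + b * F x)) (\<phi> (a + b * F x) x)"
    unfolding Th_def[of "- a"] F_Th[OF ab] by (simp add: Th_def)
  then show ?thesis using flow_inverse[OF small_time[OF ab]] by simp
qed

lemma Th_smooth:
  assumes "Cinf P a" "Cinf P b" "Cinf P z" "\<And>q. q \<in> P \<Longrightarrow> \<bar>a q\<bar> + \<bar>b q\<bar> \<le> 1"
  shows "Cinf P (\<lambda>q. Th (a q) (b q) (z q))"
proof -
  have Fz: "Cinf P (\<lambda>q. F (z q))" by (rule Cinf_compose[OF F_smooth assms(3)]) simp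
  have "Cinf P (\<lambda>q. (a q + b q * F (z q), z q))"
    using assms(1-3) Fz unfolding Cinf_def by (intro allI Ck_Pair Ck_add Ck_mult) auto
  from Cinf_compose[OF flow_smooth this] show ?thesis
    using small_time[OF assms(4)] by (simp add: Th_def image_subset_iff)
qed

text \<open>The parameters and the point move simultaneously. A constant \<open>z\<close> gives the
  velocity of the loop, a moving \<open>z\<close> that of the inverse loop composed with the given
  isotopy.\<close>

lemma Th_curve:
  assumes "t \<in> T" "\<And>s. s \<in> T \<Longrightarrow> \<bar>a s\<bar> + \<bar>b s\<bar> \<le> 1"
    and a: "(a has_real_derivative a') (at t within T)" and b: "(b has_real_derivative b') (at t within T)"
    and z: "(z has_vector_derivative z') (at t within T)"
  shows "((\<lambda>s. Th (a s) (b s) (z s)) has_vector_derivative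
    (a' + b' * F (z t)) *\<^sub>R X (Th (a t) (b t) (z t)) + JTh (a t) (b t) (z t) z') (at t within T)"
proof -
  have "((\<lambda>s. F (z s)) has_real_derivative DF (z t) z') (at t within T)"
    using vector_derivative_diff_chain_within[OF z has_derivative_at_withinI[OF F_deriv]]
    by (simp add: o_def has_real_derivative_iff_has_vector_derivative)
  then have "((\<lambda>s. a s + b s * F (z s)) has_real_derivative a' + (b' * F (z t) + DF (z t) z' * b t)) (at t within T)"
    by (intro DERIV_add DERIV_mult a b)
  then have "((\<lambda>s. (a s + b s * F (z s), z s)) has_vector_derivative (a' + (b' * F (z t) + DF (z t) z' * b t), z')) (at t within T)"
    using z by (intro has_vector_derivative_Pair) (simp_all add: has_real_derivative_iff_has_vector_derivative)
  moreover have "(\<lambda>s. (a s + b s * F (z s), z s)) ` T \<subseteq> {-1..1} \<times> UNIV"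
    using small_time assms(2) by auto
  from has_derivative_subset[OF flow_deriv[OF small_time[OF assms(2)[OF assms(1)]], of "z t" "z t"] this]
  have "((\<lambda>(s, p). \<phi> s p) has_derivative (\<lambda>(k, h). k *\<^sub>R X (Th (a t) (b t) (z t)) + J (a t + b t * F (z t)) (z t) h))
    (at (a t + b t * F (z t), z t) within (\<lambda>s. (a s + b s * F (z s), z s)) ` T)"
    by (simp add: Th_def)
  ultimately have "((\<lambda>(s, p). \<phi> s p) \<circ> (\<lambda>s. (a s + b s * F (z s), z s)) has_vector_derivative
     (\<lambda>(k, h). k *\<^sub>R X (Th (a t) (b t) (z t)) + J (a t + b t * F (z t)) (z t) h) (a' + (b' * F (z t) + DF (z t) z' * b t), z')) (at t within T)"
    by (rule vector_derivative_diff_chain_within)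
  then have "((\<lambda>s. Th (a s) (b s) (z s)) has_vector_derivative
     (a' + (b' * F (z t) + DF (z t) z' * b t)) *\<^sub>R X (Th (a t) (b t) (z t)) + J (a t + b t * F (z t)) (z t) z') (at t within T)"
    by (simp add: o_def Th_def)
  then show ?thesis by (simp add: JTh_def algebra_simps scaleR_add_left)
qed

lemma Th_has_derivative:
  assumes "\<bar>a\<bar> + \<bar>b\<bar> \<le> 1"
  shows "(Th a b has_derivative JTh a b x) (at x)"
proof -
  have "((\<lambda>x. a + b * F x) has_derivative (\<lambda>v. b * DF x v)) (at x)"
    by (auto intro!: derivative_eq_intros F_deriv)
  then have 1: "((\<lambda>x. (a + b * F x, x)) has_derivative (\<lambda>v. (b * DF x v, v))) (at x)"
    by (intro has_derivative_Pair has_derivative_ident)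
  have 2: "((\<lambda>(s, p). \<phi> s p) has_derivative (\<lambda>(k, h). k *\<^sub>R X (\<phi> (a + b * F x) x) + J (a + b * F x) x h))
    (at (a + b * F x, x) within range (\<lambda>x. (a + b * F x, x)))"
    by (rule has_derivative_subset[OF flow_deriv[OF small_time[OF assms]]]) (use small_time[OF assms] in auto)
  from has_derivative_in_compose[OF 1 2] show ?thesis by (simp add: Th_def[abs_def] JTh_def[abs_def])
qed

lemma JTh_inverse:
  assumes "\<bar>a\<bar> + \<bar>b\<bar> \<le> 1"
  shows "JTh (- a) (- b) (Th a b x) (JTh a b x v) = v"
proof -
  have "((\<lambda>x. Th (- a) (- b) (Th a b x)) has_derivative (\<lambda>v. JTh (- a) (- b) (Th a b x) (JTh a b x v))) (at x)"
    using assms by (intro has_derivative_compose[OF Th_has_derivative Th_has_derivative]) auto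
  then have "((\<lambda>x. x) has_derivative (\<lambda>v. JTh (- a) (- b) (Th a b x) (JTh a b x v))) (at x)"
    by (simp add: Th_inverse[OF assms])
  from has_derivative_unique[OF this has_derivative_ident] show ?thesis by meson
qed

lemma DF_J:
  assumes "s \<in> {-1..1}" shows "DF (\<phi> s x) (J s x v) = DF x v"
proof -
  have "((\<lambda>x. (s, x)) has_derivative (\<lambda>v. (0, v))) (at x)"
    by (intro has_derivative_Pair has_derivative_const has_derivative_ident)
  moreover have "((\<lambda>(s, p). \<phi> s p) has_derivative (\<lambda>(k, h). k *\<^sub>R X (\<phi> s x) + J s x h)) (at (s, x) within range (Pair s))"
    by (rule has_derivative_subset[OF flow_deriv[OF assms]]) (use assms in auto)
  ultimately have "(\<phi> s has_derivative J s x) (at x)"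
    using has_derivative_in_compose[of "Pair s"] by fastforce
  from has_derivative_compose[OF this F_deriv] have "(F has_derivative (\<lambda>v. DF (\<phi> s x) (J s x v))) (at x)"
    by (simp add: F_flow[OF assms])
  from has_derivative_unique[OF this F_deriv] show ?thesis by (rule fun_cong)
qed

text \<open>The variable flow time adds a multiple \<open>b * DF v\<close> of \<open>X\<close> to
  the derivative of the flow. Its contributions from the two slots are
  \<open>b * DF u * DF v\<close> with opposite signs, so only the invariance at fixed time
  remains.\<close>

lemma Th_symplectic:
  assumes ab: "\<bar>a\<bar> + \<bar>b\<bar> \<le> 1" and x: "x \<in> ball x0 R"
  shows "\<omega> c0 (Th a b x) (JTh a b x u) (JTh a b x v) = \<omega> c0 x u v"
proof -
  let ?s = "a + b * F x"
  note s = small_time[OF ab, of x]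
  let ?y = "Th a b x"
  have y: "?y = \<phi> ?s x" by (simp add: Th_def)
  have yR: "?y \<in> ball x0 R" using Th_ballR[OF ab] x by simp
  note B = omega_bilinear[OF c0 ballR_cimg[OF yR]]
  have "\<omega> c0 ?y (J ?s x u) (X ?y) = - DF x u" "\<omega> c0 ?y (X ?y) (J ?s x v) = DF x v"
    using omega_antisym[OF c0 ballR_cimg[OF yR], of "J ?s x u" "X ?y"] X_F[OF yR] DF_J[OF s] by (simp_all add: y)
  moreover have "\<omega> c0 ?y (J ?s x u) (J ?s x v) = \<omega> c0 x u v"
    unfolding y by (rule flow_symplectic[OF s x])
  moreover have "\<omega> c0 ?y (X ?y) (X ?y) = 0" by (rule omega_alternating[OF c0 ballR_cimg[OF yR]])
  ultimately show ?thesis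
    by (simp add: JTh_def bilinear_ladd[OF B] bilinear_radd[OF B] bilinear_lmul[OF B] bilinear_rmul[OF B])
qed

end

section \<open>Smooth maps and paths on the manifold\<close>

lemma relative_open_preimage:
  assumes "continuous_on P \<psi>" "open V"
  obtains T where "open T" "{q \<in> P. \<psi> q \<in> V} = P \<inter> T"
proof -
  obtain T where "open T" "T \<inter> P = \<psi> -` V \<inter> P"
    using assms unfolding continuous_on_open_invariant by blast
  then show thesis by (intro that[of T]) auto
qed

lemma thick_preimage: "thick P \<Longrightarrow> continuous_on P \<psi> \<Longrightarrow> open V \<Longrightarrow> thick {q \<in> P. \<psi> q \<in> V}"
proof -
  assume P: "thick P" and *: "continuous_on P \<psi>" "open V"
  obtain T where T: "open T" "{q \<in> P. \<psi> q \<in> V} = P \<inter> T" using relative_open_preimage[OF *] by blast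
  show ?thesis unfolding T(2) by (rule thick_Int_open[OF P T(1)])
qed

lemma Cinf_Pair: "Cinf S f \<Longrightarrow> Cinf S g \<Longrightarrow> Cinf S (\<lambda>x. (f x, g x))"
  by (simp add: Cinf_def Ck_Pair)

lemma Cinf_fst: "Cinf S fst" and Cinf_snd: "Cinf S snd"
  by (auto simp: Cinf_def Ck_linear bounded_linear_fst bounded_linear_snd)

lemma Cinf_const: "Cinf S (\<lambda>_. k)"
  by (simp add: Cinf_def Ck_const)

lemma Cinf_ident: "Cinf S (\<lambda>x. x)"
  by (simp add: Cinf_def Ck_id)

lemma thick_unit_interval: "thick {0..1::real}"
  by (rule thick_interval) simp

lemma continuous_on_local:
  fixes f :: "'a::t2_space \<Rightarrow> 'b::topological_space"
  assumes "\<And>x. x \<in> S \<Longrightarrow> \<exists>T. open T \<and> x \<in> T \<and> continuous_on (S \<inter> T) f"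
  shows "continuous_on S f"
  unfolding continuous_on_eq_continuous_within
proof
  fix x assume x: "x \<in> S"
  then obtain T where T: "open T" "x \<in> T" "continuous_on (S \<inter> T) f" using assms by blast
  have c: "continuous (at x within S \<inter> T) f" using T x by (auto simp: continuous_on_eq_continuous_within)
  have "at x within S \<inter> T = at x within S" using T at_within_nhd[of x T "S \<inter> T" S] by auto
  with c show "continuous (at x within S) f" by (simp only:)
qed

context symplectic_manifold begin

text \<open>\<open>P\<close> may have any dimension: time alone, time and coordinates, or these
  together with the loop parameter. All smoothness statements about manifold valued maps are routed
  through this notion.\<close>

definition msmooth :: "'q::euclidean_space set \<Rightarrow> ('q \<Rightarrow> 'm) \<Rightarrow> bool" where
  "msmooth P \<psi> \<longleftrightarrow> continuous_on P \<psi> \<and> (\<forall>c\<in>A. Cinf {q \<in> P. \<psi> q \<in> cdom c} (\<lambda>q. cmap c (\<psi> q)))"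

lemma msmooth_continuous: "msmooth P \<psi> \<Longrightarrow> continuous_on P \<psi>"
  by (simp add: msmooth_def)

lemma msmooth_Cinf: "msmooth P \<psi> \<Longrightarrow> c \<in> A \<Longrightarrow> Cinf {q \<in> P. \<psi> q \<in> cdom c} (\<lambda>q. cmap c (\<psi> q))"
  by (simp add: msmooth_def)

lemma msmoothD:
  assumes "msmooth P \<psi>" "q \<in> P" "\<psi> q \<in> V" "open V" "V \<subseteq> cdom c" "c \<in> A"
  obtains T where "open T" "q \<in> T" "\<And>q'. q' \<in> P \<inter> T \<Longrightarrow> \<psi> q' \<in> V" "Cinf (P \<inter> T) (\<lambda>q. cmap c (\<psi> q))"
proof -
  obtain T where T: "open T" "{q \<in> P. \<psi> q \<in> V} = P \<inter> T"
    using relative_open_preimage[OF msmooth_continuous[OF assms(1)] assms(4)] by blast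
  have "Cinf (P \<inter> T) (\<lambda>q. cmap c (\<psi> q))"
    by (rule Cinf_subset[OF msmooth_Cinf[OF assms(1,6)]]) (use T assms(5) in auto)
  then show thesis using T assms(2,3) by (intro that[of T]) auto
qed

text \<open>One suitable chart near each parameter suffices, since any other chart differs from it
  by a smooth transition map. The target chart may be chosen by cases, inside or outside the support
  of the Hamiltonian.\<close>

lemma msmoothI:
  assumes P: "thick P"
    and loc: "\<And>q. q \<in> P \<Longrightarrow> \<exists>T c. open T \<and> q \<in> T \<and> c \<in> A \<and> (\<forall>q'\<in>P \<inter> T. \<psi> q' \<in> cdom c) \<and>
      Cinf (P \<inter> T) (\<lambda>q. cmap c (\<psi> q))"
  shows "msmooth P \<psi>"
  unfolding msmooth_def
proof (intro conjI ballI)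
  show cont: "continuous_on P \<psi>"
  proof (rule continuous_on_local)
    fix q assume "q \<in> P"
    then obtain T c where T: "open T" "q \<in> T" "c \<in> A" "\<forall>q'\<in>P \<inter> T. \<psi> q' \<in> cdom c"
      "Cinf (P \<inter> T) (\<lambda>q. cmap c (\<psi> q))" using loc by blast
    have "continuous_on (P \<inter> T) (\<lambda>q. cinv c (cmap c (\<psi> q)))"
      using T(4) by (intro continuous_on_compose2[OF cinv_cont[OF T(3)] Cinf_continuous[OF T(5)]]) (auto simp: cmap_cimg)
    then have "continuous_on (P \<inter> T) \<psi>"
      by (rule continuous_on_eq) (use T(3,4) cinv_cmap in auto)
    then show "\<exists>T. open T \<and> q \<in> T \<and> continuous_on (P \<inter> T) \<psi>" using T by blast
  qed
  fix c' assume c': "c' \<in> A"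
  show "Cinf {q \<in> P. \<psi> q \<in> cdom c'} (\<lambda>q. cmap c' (\<psi> q))"
  proof (rule Cinf_local[OF thick_preimage[OF P cont open_cdom[OF c']]])
    fix q assume q: "q \<in> {q \<in> P. \<psi> q \<in> cdom c'}"
    then obtain T c where T: "open T" "q \<in> T" "c \<in> A" "\<forall>q'\<in>P \<inter> T. \<psi> q' \<in> cdom c"
      "Cinf (P \<inter> T) (\<lambda>q. cmap c (\<psi> q))" using loc by blast
    let ?S = "{q \<in> P. \<psi> q \<in> cdom c'} \<inter> T"
    have "Cinf ?S (\<lambda>q. cmap c' (cinv c (cmap c (\<psi> q))))"
      by (rule Cinf_compose[OF transition_smooth(2)[OF T(3) c'] Cinf_subset[OF T(5)]]) (use T(4) in auto)
    then have "Cinf ?S (\<lambda>q. cmap c' (\<psi> q))"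
      by (rule Cinf_cong) (use T(3,4) cinv_cmap in auto)
    then show "\<exists>T. open T \<and> q \<in> T \<and> Cinf ({q \<in> P. \<psi> q \<in> cdom c'} \<inter> T) (\<lambda>q. cmap c' (\<psi> q))"
      using T by blast
  qed
qed

lemma msmooth_chart:
  assumes "thick P" "c \<in> A" "Cinf P z" "\<And>q. q \<in> P \<Longrightarrow> z q \<in> cimg c"
  shows "msmooth P (\<lambda>q. cinv c (z q))"
proof (rule msmoothI[OF assms(1)])
  fix q assume "q \<in> P"
  have "Cinf P (\<lambda>q. cmap c (cinv c (z q)))"
    by (rule Cinf_cong[OF assms(3)]) (use assms cmap_cinv in auto)
  then show "\<exists>T c'. open T \<and> q \<in> T \<and> c' \<in> A \<and> (\<forall>q'\<in>P \<inter> T. cinv c (z q') \<in> cdom c') \<and>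
      Cinf (P \<inter> T) (\<lambda>q. cmap c' (cinv c (z q)))"
    using assms cinv_cdom by (intro exI[of _ UNIV] exI[of _ c]) auto
qed

lemma msmooth_const: "thick P \<Longrightarrow> msmooth P (\<lambda>_. p)"
proof -
  assume P: "thick P"
  obtain c where c: "c \<in> A" "p \<in> cdom c" using chart_at by blast
  have "msmooth P (\<lambda>_. cinv c (cmap c p))"
    by (rule msmooth_chart[OF P c(1)]) (auto simp: cmap_cimg c Cinf_def Ck_const)
  then show ?thesis by (simp add: cinv_cmap c)
qed

lemma thick_cylinder: "c \<in> A \<Longrightarrow> thick ({0..1::real} \<times> cimg c)"
  by (intro thick_Times thick_interval thick_open open_cimg) auto

text \<open>The bridge to the definition of paths. Preimages of chart domains in a slab are thick,
  so there \<open>Cinf\<close> yields the derivatives required by \<open>smooth_on\<close>.\<close>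

lemma smooth_path_iff:
  "smooth_path A f \<longleftrightarrow> (\<forall>c\<in>A. msmooth ({0..1} \<times> cimg c) (\<lambda>q. f (fst q) (cinv c (snd q))))"
proof -
  have dom: "path_dom f c c' = {q \<in> {0..1} \<times> cimg c. f (fst q) (cinv c (snd q)) \<in> cdom c'}" for c c'
    by (auto simp: path_dom_def)
  have rep: "path_rep f c c' = (\<lambda>q. cmap c' (f (fst q) (cinv c (snd q))))" for c c'
    by (auto simp: path_rep_def)
  show ?thesis
  proof
    assume f: "smooth_path A f"
    show "\<forall>c\<in>A. msmooth ({0..1} \<times> cimg c) (\<lambda>q. f (fst q) (cinv c (snd q)))"
    proof
      fix c assume c: "c \<in> A"
      have "continuous_on ({0..1} \<times> cimg c) (\<lambda>q. (\<lambda>(t, p). f t p) (fst q, cinv c (snd q)))"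
        using f unfolding smooth_path_def
        by (elim conjE continuous_on_compose2)
          (auto intro!: continuous_intros continuous_on_compose2[OF cinv_cont[OF c]])
      then show "msmooth ({0..1} \<times> cimg c) (\<lambda>q. f (fst q) (cinv c (snd q)))"
        using f c unfolding smooth_path_def msmooth_def dom rep by (auto intro: smooth_on_imp_Cinf)
    qed
  next
    assume f: "\<forall>c\<in>A. msmooth ({0..1} \<times> cimg c) (\<lambda>q. f (fst q) (cinv c (snd q)))"
    show "smooth_path A f" unfolding smooth_path_def
    proof (intro conjI ballI)
      show "continuous_on ({0..1} \<times> UNIV) (\<lambda>(t, p). f t p)"
      proof (rule continuous_on_local)
        fix x :: "real \<times> 'm" assume "x \<in> {0..1} \<times> UNIV"
        obtain c where c: "c \<in> A" "snd x \<in> cdom c" using chart_at by blast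
        have "continuous_on ({0..1} \<times> cdom c) (\<lambda>x. f (fst (fst x, cmap c (snd x))) (cinv c (snd (fst x, cmap c (snd x)))))"
          by (rule continuous_on_compose2[OF msmooth_continuous[OF f[rule_format, OF c(1)]]])
            (auto intro!: continuous_intros continuous_on_compose2[OF cmap_cont[OF c(1)]] simp: cmap_cimg)
        then have "continuous_on ({0..1} \<times> cdom c) (\<lambda>(t, p). f t p)"
          by (rule continuous_on_eq) (auto simp: cinv_cmap c(1))
        moreover have "({0..1} \<times> UNIV) \<inter> (UNIV \<times> cdom c) = {0..1::real} \<times> cdom c" by auto
        ultimately show "\<exists>T. open T \<and> x \<in> T \<and> continuous_on (({0..1} \<times> UNIV) \<inter> T) (\<lambda>(t, p). f t p)"
          using c open_cdom[OF c(1)]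
          by (intro exI[of _ "UNIV \<times> cdom c"]) (auto simp: mem_Times_iff open_Times)
      qed
      fix c c' assume c: "c \<in> A" and c': "c' \<in> A"
      then show "smooth_on (path_dom f c c') (path_rep f c c')"
        unfolding dom rep using f
        by (intro Cinf_imp_smooth_on thick_preimage msmooth_Cinf msmooth_continuous thick_cylinder open_cdom) auto
    qed
  qed
qed

lemma msmooth_path:
  assumes P: "thick P" and f: "smooth_path A f" and \<psi>: "msmooth P \<psi>" and \<tau>: "Cinf P \<tau>" "\<tau> ` P \<subseteq> {0..1}"
  shows "msmooth P (\<lambda>q. f (\<tau> q) (\<psi> q))"
proof (rule msmoothI[OF P])
  have "continuous_on P (\<lambda>q. (\<lambda>(t, p). f t p) (\<tau> q, \<psi> q))"
    using f unfolding smooth_path_def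
    by (elim conjE continuous_on_compose2)
      (use \<tau> in \<open>auto intro!: continuous_on_Pair Cinf_continuous[OF \<tau>(1)] msmooth_continuous[OF \<psi>]\<close>)
  then have cont: "continuous_on P (\<lambda>q. f (\<tau> q) (\<psi> q))" by simp
  fix q assume q: "q \<in> P"
  obtain c where c: "c \<in> A" "\<psi> q \<in> cdom c" using chart_at by blast
  obtain c' where c': "c' \<in> A" "f (\<tau> q) (\<psi> q) \<in> cdom c'" using chart_at by blast
  obtain T1 where T1: "open T1" "q \<in> T1" "\<And>q'. q' \<in> P \<inter> T1 \<Longrightarrow> \<psi> q' \<in> cdom c" "Cinf (P \<inter> T1) (\<lambda>q. cmap c (\<psi> q))"
    using msmoothD[OF \<psi> q c(2) open_cdom[OF c(1)] order_refl c(1)] by blast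
  obtain T2 where T2: "open T2" "{q \<in> P. f (\<tau> q) (\<psi> q) \<in> cdom c'} = P \<inter> T2"
    using relative_open_preimage[OF cont open_cdom[OF c'(1)]] by blast
  let ?S = "P \<inter> (T1 \<inter> T2)"
  have "msmooth ({0..1} \<times> cimg c) (\<lambda>q. f (fst q) (cinv c (snd q)))"
    using f c(1) by (simp add: smooth_path_iff)
  from msmooth_Cinf[OF this c'(1)]
  have "Cinf ?S (\<lambda>q. cmap c' (f (fst (\<tau> q, cmap c (\<psi> q))) (cinv c (snd (\<tau> q, cmap c (\<psi> q))))))"
  proof (rule Cinf_compose)
    show "Cinf ?S (\<lambda>q. (\<tau> q, cmap c (\<psi> q)))"
      by (intro Cinf_Pair Cinf_subset[OF \<tau>(1)] Cinf_subset[OF T1(4)]) auto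
    show "(\<lambda>q. (\<tau> q, cmap c (\<psi> q))) ` ?S \<subseteq>
      {q \<in> {0..1} \<times> cimg c. f (fst q) (cinv c (snd q)) \<in> cdom c'}"
      using \<tau>(2) T1(3) T2(2) by (auto simp: cmap_cimg cinv_cmap c(1))
  qed
  then have "Cinf ?S (\<lambda>q. cmap c' (f (\<tau> q) (\<psi> q)))"
    by (rule Cinf_cong) (use T1(3) in \<open>auto simp: cinv_cmap c(1)\<close>)
  then show "\<exists>T c. open T \<and> q \<in> T \<and> c \<in> A \<and> (\<forall>q'\<in>P \<inter> T. f (\<tau> q') (\<psi> q') \<in> cdom c) \<and>
      Cinf (P \<inter> T) (\<lambda>q. cmap c (f (\<tau> q) (\<psi> q)))"
    using T1(1,2) T2 q c' by (intro exI[of _ "T1 \<inter> T2"] exI[of _ c']) auto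
qed

lemma Cinf_family:
  assumes P: "thick P" and U: "smooth_function_family A U" and \<psi>: "msmooth P \<psi>" and \<tau>: "Cinf P \<tau>" "\<tau> ` P \<subseteq> {0..1}"
  shows "Cinf P (\<lambda>q. U (\<tau> q) (\<psi> q))"
proof (rule Cinf_local[OF P])
  fix q assume q: "q \<in> P"
  obtain c where c: "c \<in> A" "\<psi> q \<in> cdom c" using chart_at by blast
  obtain T where T: "open T" "q \<in> T" "\<And>q'. q' \<in> P \<inter> T \<Longrightarrow> \<psi> q' \<in> cdom c" "Cinf (P \<inter> T) (\<lambda>q. cmap c (\<psi> q))"
    using msmoothD[OF \<psi> q c(2) open_cdom[OF c(1)] order_refl c(1)] by blast
  have "smooth_on ({0..1} \<times> cimg c) (\<lambda>(t, x). U t (cinv c x))"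
    using U c(1) by (simp add: smooth_function_family_def)
  from smooth_on_imp_Cinf[OF this]
  have "Cinf (P \<inter> T) (\<lambda>q. (\<lambda>(t, x). U t (cinv c x)) (\<tau> q, cmap c (\<psi> q)))"
  proof (rule Cinf_compose)
    show "Cinf (P \<inter> T) (\<lambda>q. (\<tau> q, cmap c (\<psi> q)))"
      by (intro Cinf_Pair Cinf_subset[OF \<tau>(1)] T(4)) auto
    show "(\<lambda>q. (\<tau> q, cmap c (\<psi> q))) ` (P \<inter> T) \<subseteq> {0..1} \<times> cimg c"
      using \<tau>(2) T(3) by (auto simp: cmap_cimg)
  qed
  then have "Cinf (P \<inter> T) (\<lambda>q. U (\<tau> q) (\<psi> q))"
    by (rule Cinf_cong) (use T(3) in \<open>auto simp: cinv_cmap c(1)\<close>)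
  then show "\<exists>T. open T \<and> q \<in> T \<and> Cinf (P \<inter> T) (\<lambda>q. U (\<tau> q) (\<psi> q))" using T by blast
qed

lemma msmooth_cylinder: "c \<in> A \<Longrightarrow> msmooth ({0..1::real} \<times> cimg c) (\<lambda>q. cinv c (snd q))"
  by (intro msmooth_chart thick_cylinder Cinf_snd) auto

lemma smooth_function_family_iff:
  "smooth_function_family A U \<longleftrightarrow> (\<forall>c\<in>A. Cinf ({0..1} \<times> cimg c) (\<lambda>q. U (fst q) (cinv c (snd q))))"
  unfolding smooth_function_family_def by (auto simp: smooth_on_iff_Cinf thick_cylinder case_prod_unfold)

lemma smooth_path_compose:
  assumes "smooth_path A f" "smooth_path A g"
  shows "smooth_path A (\<lambda>t p. f t (g t p))"
  unfolding smooth_path_iff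
proof
  fix c assume c: "c \<in> A"
  have "msmooth ({0..1} \<times> cimg c) (\<lambda>q. g (fst q) (cinv c (snd q)))"
    using assms(2) c by (simp add: smooth_path_iff)
  then show "msmooth ({0..1} \<times> cimg c) (\<lambda>q. f (fst q) (g (fst q) (cinv c (snd q))))"
    by (rule msmooth_path[OF thick_cylinder[OF c] assms(1)]) (auto simp: Cinf_fst)
qed

lemma smooth_map_at_time:
  assumes f: "smooth_path A f" and t: "t \<in> {0..1}"
  shows "smooth_map A (f t)"
  unfolding smooth_map_def
proof (intro conjI ballI)
  have "continuous_on UNIV (\<lambda>p. (\<lambda>(t, p). f t p) (t, p))"
    using f unfolding smooth_path_def
    by (elim conjE continuous_on_compose2) (use t in \<open>auto intro!: continuous_intros\<close>)
  then show cont: "continuous_on UNIV (f t)" by simp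
  fix c c' assume c: "c \<in> A" and c': "c' \<in> A"
  let ?S = "{x \<in> cimg c. f t (cinv c x) \<in> cdom c'}"
  have "msmooth ({0..1} \<times> cimg c) (\<lambda>q. f (fst q) (cinv c (snd q)))"
    using f c by (simp add: smooth_path_iff)
  from msmooth_Cinf[OF this c']
  have "Cinf ?S (\<lambda>x. cmap c' (f (fst (t, x)) (cinv c (snd (t, x)))))"
    by (rule Cinf_compose) (use t in \<open>auto simp: Cinf_def intro!: Ck_Pair Ck_const Ck_id\<close>)
  moreover have "continuous_on (cimg c) (\<lambda>x. f t (cinv c x))"
    by (rule continuous_on_compose2[OF cont cinv_cont[OF c]]) auto
  then have "thick ?S" by (intro thick_preimage thick_open open_cimg open_cdom c c')
  ultimately show "smooth_on ?S (\<lambda>x. cmap c' (f t (cinv c x)))" by (simp add: Cinf_imp_smooth_on)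
qed

text \<open>Regarding a map as a constant path lets the composition of maps be read off from the
  composition of paths.\<close>

lemma smooth_path_constant:
  assumes f: "smooth_map A f" shows "smooth_path A (\<lambda>t. f)"
  unfolding smooth_path_def
proof (intro conjI ballI)
  have cont: "continuous_on UNIV f" using f by (simp add: smooth_map_def)
  have "continuous_on ({0..1} \<times> UNIV) (\<lambda>x::real \<times> 'm. f (snd x))"
    by (rule continuous_on_compose2[OF cont]) (auto intro!: continuous_intros)
  then show "continuous_on ({0..1} \<times> UNIV) (\<lambda>(t::real, p). f p)" by (simp add: case_prod_unfold)
  fix c c' assume c: "c \<in> A" and c': "c' \<in> A"
  have dom: "path_dom (\<lambda>t. f) c c' = {q \<in> {0..1} \<times> cimg c. f (cinv c (snd q)) \<in> cdom c'}"
    by (auto simp: path_dom_def)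
  have "Cinf {x \<in> cimg c. f (cinv c x) \<in> cdom c'} (\<lambda>x. cmap c' (f (cinv c x)))"
    using f c c' unfolding smooth_map_def by (blast intro: smooth_on_imp_Cinf)
  then have "Cinf (path_dom (\<lambda>t. f) c c') (\<lambda>q. cmap c' (f (cinv c (snd q))))"
    by (rule Cinf_compose[OF _ Cinf_snd]) (auto simp: dom)
  moreover have "continuous_on ({0..1::real} \<times> cimg c) (\<lambda>q. f (cinv c (snd q)))"
    by (rule continuous_on_compose2[OF cont continuous_on_compose2[OF cinv_cont[OF c]]]) (auto intro!: continuous_intros)
  then have "thick (path_dom (\<lambda>t. f) c c')" unfolding dom
    by (intro thick_preimage thick_cylinder open_cdom c c')
  ultimately show "smooth_on (path_dom (\<lambda>t. f) c c') (path_rep (\<lambda>t. f) c c')"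
    by (simp add: path_rep_def case_prod_unfold Cinf_imp_smooth_on)
qed

lemma smooth_map_compose: "smooth_map A f \<Longrightarrow> smooth_map A g \<Longrightarrow> smooth_map A (\<lambda>p. f (g p))"
  using smooth_map_at_time[OF smooth_path_compose[OF smooth_path_constant smooth_path_constant], of f g 0] by simp

subsection \<open>Velocities\<close>

text \<open>The velocity at \<open>x\<close> is that of the trajectory passing through
  \<open>x\<close> at time \<open>t\<close>. Its starting point \<open>q\<close> is what stays
  fixed, and injectivity identifies it with the preimage in the definition.\<close>

lemma velocity_eqI:
  assumes "((\<lambda>s. cmap c (f s q)) has_vector_derivative w) (at t within {0..1})"
    and "t \<in> {0..1}" "inj (f t)" "f t q = cinv c x"
  shows "velocity f t c x = w"
proof -
  have "inv (f t) (cinv c x) = q" using assms(3,4) by (metis inv_f_f)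
  then show ?thesis
    unfolding velocity_def using vector_derivative_within_cbox[of 0 1 t "\<lambda>s. cmap c (f s q)" w] assms(1,2) by simp
qed

lemma path_curve:
  assumes f: "smooth_path A f" and t: "t \<in> {0..1}" and c: "c \<in> A" and V: "open V" "f t q \<in> V"
  obtains d where "0 < d" "\<And>s. s \<in> {0..1} \<Longrightarrow> dist s t < d \<Longrightarrow> f s q \<in> V"
proof -
  have "msmooth {0..1} (\<lambda>s. f s q)"
    by (rule msmooth_path[OF thick_unit_interval f msmooth_const[OF thick_unit_interval] Cinf_ident]) auto
  from relative_open_preimage[OF msmooth_continuous[OF this] V(1)]
  obtain T where T: "open T" "{s \<in> {0..1}. f s q \<in> V} = {0..1} \<inter> T" by blast
  then have "t \<in> T" using t V(2) by auto
  then obtain d where "0 < d" "ball t d \<subseteq> T" using T(1) open_contains_ball by blast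
  then show thesis using T(2) by (intro that[of d]) (auto simp: dist_commute subset_iff)
qed

lemma velocity_has_derivative:
  assumes f: "smooth_path A f" and t: "t \<in> {0..1}" and c: "c \<in> A" and inj: "inj (f t)" and q: "f t q \<in> cdom c"
  shows "((\<lambda>s. cmap c (f s q)) has_vector_derivative velocity f t c (cmap c (f t q))) (at t within {0..1})"
proof -
  have "msmooth {0..1} (\<lambda>s. f s q)"
    by (rule msmooth_path[OF thick_unit_interval f msmooth_const[OF thick_unit_interval] Cinf_ident]) auto
  from relative_open_preimage[OF msmooth_continuous[OF this] open_cdom[OF c]]
  obtain T where T': "open T" "{s \<in> {0..1}. f s q \<in> cdom c} = {0..1} \<inter> T" by blast
  have T: "open T" "t \<in> T" "Cinf ({0..1} \<inter> T) (\<lambda>s. cmap c (f s q))"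
    using T' t q msmooth_Cinf[OF \<open>msmooth {0..1} (\<lambda>s. f s q)\<close> c] by auto
  have e: "at t within {0..1} \<inter> T = at t within {0..1}" using T at_within_nhd[of t T "{0..1} \<inter> T" "{0..1}"] by auto
  have "t \<in> {0..1} \<inter> T" using t T(2) by simp
  from differentiableI[OF Cinf_derivative[OF T(3) this]]
  have "(\<lambda>s. cmap c (f s q)) differentiable (at t within {0..1})" unfolding e .
  then have *: "((\<lambda>s. cmap c (f s q)) has_vector_derivative vector_derivative (\<lambda>s. cmap c (f s q)) (at t within {0..1})) (at t within {0..1})"
    by (simp add: vector_derivative_works)
  moreover have "velocity f t c (cmap c (f t q)) = vector_derivative (\<lambda>s. cmap c (f s q)) (at t within {0..1})"
    by (rule velocity_eqI[where f = f and q = q, OF * t inj]) (simp add: cinv_cmap c q)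
  ultimately show ?thesis by simp
qed

lemma curve_transition:
  assumes f: "smooth_path A f" and t: "t \<in> {0..1}" and c: "c \<in> A" "c' \<in> A" and q: "f t q \<in> cdom c" "f t q \<in> cdom c'"
    and w: "((\<lambda>s. cmap c (f s q)) has_vector_derivative w) (at t within {0..1})"
  shows "((\<lambda>s. cmap c' (f s q)) has_vector_derivative transition_deriv c c' (f t q) w) (at t within {0..1})"
proof -
  from vector_derivative_diff_chain_within[OF w has_derivative_at_withinI[OF transition_has_derivative[OF c q]]]
  have d: "((\<lambda>s. cmap c' (cinv c (cmap c (f s q)))) has_vector_derivative transition_deriv c c' (f t q) w) (at t within {0..1})"
    by (simp add: o_def)
  obtain d where d': "0 < d" "\<And>s. s \<in> {0..1} \<Longrightarrow> dist s t < d \<Longrightarrow> f s q \<in> cdom c"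
    using path_curve[OF f t c(1) open_cdom[OF c(1)] q(1)] by blast
  show ?thesis
    by (rule has_vector_derivative_transform_within[OF d d'(1) t]) (simp add: cinv_cmap[OF c(1) d'(2)])
qed

lemma velocity_transition:
  assumes f: "smooth_path A f" and t: "t \<in> {0..1}" and c: "c \<in> A" "c' \<in> A" and bij: "bij (f t)" and p: "p \<in> cdom c" "p \<in> cdom c'"
  shows "velocity f t c' (cmap c' p) = transition_deriv c c' p (velocity f t c (cmap c p))"
proof -
  obtain q where q: "f t q = p" using bij by (metis bij_pointE)
  have inj: "inj (f t)" using bij by (simp add: bij_def)
  have "((\<lambda>s. cmap c (f s q)) has_vector_derivative velocity f t c (cmap c p)) (at t within {0..1})"
    using velocity_has_derivative[OF f t c(1) inj, of q] p q by simp
  from curve_transition[OF f t c _ _ this] p q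
  have "((\<lambda>s. cmap c' (f s q)) has_vector_derivative transition_deriv c c' p (velocity f t c (cmap c p))) (at t within {0..1})"
    by simp
  then show ?thesis by (rule velocity_eqI[where f = f and q = q, OF _ t inj]) (simp add: q cinv_cmap c p)
qed

lemma transition_deriv_inverse:
  assumes c: "c \<in> A" "c' \<in> A" and p: "p \<in> cdom c" "p \<in> cdom c'"
  shows "transition_deriv c c' p (transition_deriv c' c p v) = v"
proof -
  have "((\<lambda>x. cmap c' (cinv c (cmap c (cinv c' x)))) has_derivative
      (\<lambda>v. transition_deriv c c' p (transition_deriv c' c p v))) (at (cmap c' p))"
    by (rule has_derivative_compose[OF transition_has_derivative[OF c(2,1) p(2,1)]])
      (simp add: cinv_cmap c p transition_has_derivative)
  then have "((\<lambda>x. x) has_derivative (\<lambda>v. transition_deriv c c' p (transition_deriv c' c p v))) (at (cmap c' p))"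
  proof (rule has_derivative_transform_within_open)
    show "open (cmap c' ` (cdom c' \<inter> cdom c))" by (rule transition_smooth(1)[OF c(2,1)])
    show "cmap c' p \<in> cmap c' ` (cdom c' \<inter> cdom c)" using p by auto
    fix x assume "x \<in> cmap c' ` (cdom c' \<inter> cdom c)"
    then show "cmap c' (cinv c (cmap c (cinv c' x))) = x" using c by (auto simp: cinv_cmap)
  qed
  from has_derivative_unique[OF this has_derivative_ident] show ?thesis by meson
qed

section \<open>Differentials and the generator equation under a change of charts\<close>

definition smooth_fun :: "('m \<Rightarrow> real) \<Rightarrow> bool" where
  "smooth_fun f \<longleftrightarrow> (\<forall>c\<in>A. Cinf (cimg c) (\<lambda>x. f (cinv c x)))"

lemma family_smooth_fun:
  assumes "smooth_function_family A U" "t \<in> {0..1}"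
  shows "smooth_fun (U t)"
  unfolding smooth_fun_def
proof
  fix c assume c: "c \<in> A"
  have "Cinf ({0..1} \<times> cimg c) (\<lambda>q. U (fst q) (cinv c (snd q)))"
    using assms(1) c by (simp add: smooth_function_family_iff)
  then have "Cinf (cimg c) (\<lambda>x. U (fst (t, x)) (cinv c (snd (t, x))))"
    by (rule Cinf_compose) (use assms(2) in \<open>auto simp: Cinf_def intro!: Ck_Pair Ck_const Ck_id\<close>)
  then show "Cinf (cimg c) (\<lambda>x. U t (cinv c x))" by simp
qed

lemma smooth_fun_derivative:
  assumes "smooth_fun f" "c \<in> A" "x \<in> cimg c"
  shows "((\<lambda>x. f (cinv c x)) has_derivative ext_d0 (scalar_rep f) c x) (at x)"
proof -
  have "Cinf (cimg c) (\<lambda>x. f (cinv c x))" using assms by (simp add: smooth_fun_def)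
  from Cinf_derivative[OF this assms(3)] show ?thesis
    using at_within_open[OF assms(3) open_cimg[OF assms(2)]] by (simp add: ext_d0_def[abs_def] scalar_rep_def[abs_def])
qed

lemma smooth_fun_continuous:
  assumes "smooth_fun f" shows "continuous_on UNIV f"
proof (rule continuous_on_local)
  fix p :: 'm
  obtain c where c: "c \<in> A" "p \<in> cdom c" using chart_at by blast
  have "continuous_on (cdom c) (\<lambda>p. f (cinv c (cmap c p)))"
    by (rule continuous_on_compose2[OF Cinf_continuous cmap_cont[OF c(1)]])
      (use assms c in \<open>auto simp: smooth_fun_def cmap_cimg\<close>)
  then have "continuous_on (cdom c) f" by (rule continuous_on_eq) (simp add: cinv_cmap c)
  then show "\<exists>T. open T \<and> p \<in> T \<and> continuous_on (UNIV \<inter> T) f"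
    using c open_cdom[OF c(1)] by (intro exI[of _ "cdom c"]) auto
qed

lemma ext_d0_transition:
  assumes f: "smooth_fun f" and c: "c \<in> A" "c' \<in> A" and p: "p \<in> cdom c" "p \<in> cdom c'"
  shows "ext_d0 (scalar_rep f) c (cmap c p) v = ext_d0 (scalar_rep f) c' (cmap c' p) (transition_deriv c c' p v)"
proof -
  have "((\<lambda>x. f (cinv c' (cmap c' (cinv c x)))) has_derivative
      (\<lambda>v. ext_d0 (scalar_rep f) c' (cmap c' p) (transition_deriv c c' p v))) (at (cmap c p))"
    by (rule has_derivative_compose[OF transition_has_derivative[OF c p]])
      (simp add: cinv_cmap c p smooth_fun_derivative[OF f c(2)] cmap_cimg)
  then have "((\<lambda>x. f (cinv c x)) has_derivative
      (\<lambda>v. ext_d0 (scalar_rep f) c' (cmap c' p) (transition_deriv c c' p v))) (at (cmap c p))"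
  proof (rule has_derivative_transform_within_open)
    show "open (cmap c ` (cdom c \<inter> cdom c'))" by (rule transition_smooth(1)[OF c])
    show "cmap c p \<in> cmap c ` (cdom c \<inter> cdom c')" using p by auto
    fix x assume "x \<in> cmap c ` (cdom c \<inter> cdom c')"
    then show "f (cinv c' (cmap c' (cinv c x))) = f (cinv c x)" using c by (auto simp: cinv_cmap)
  qed
  from has_derivative_unique[OF smooth_fun_derivative[OF f c(1) cmap_cimg[OF p(1)]] this] show ?thesis by meson
qed

text \<open>All terms of the generator equation are tensorial, so it may be verified in one
  convenient chart. For points in the support this is always the chart that carries the bump
  function.\<close>

lemma generator_equation_transition:
  assumes f: "smooth_path A f" and t: "t \<in> {0..1}" and c: "c \<in> A" "c' \<in> A" and bij: "bij (f t)" and p: "p \<in> cdom c" "p \<in> cdom c'"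
    and U: "smooth_fun U" and H: "one_form A H"
    and eq: "\<And>v. interior_prod (velocity f t) \<omega> c (cmap c p) v = ext_d0 (scalar_rep U) c (cmap c p) v + H c (cmap c p) v"
  shows "interior_prod (velocity f t) \<omega> c' (cmap c' p) v = ext_d0 (scalar_rep U) c' (cmap c' p) v + H c' (cmap c' p) v"
proof -
  let ?L = "transition_deriv c c' p"
  define u where "u = transition_deriv c' c p v"
  have v: "v = ?L u" by (simp add: u_def transition_deriv_inverse[OF c p])
  have Ht: "H c (cmap c p) u = H c' (cmap c' p) (?L u)"
    using H c p unfolding one_form_def by blast
  have "interior_prod (velocity f t) \<omega> c' (cmap c' p) v = \<omega> c' (cmap c' p) (?L (velocity f t c (cmap c p))) (?L u)"
    by (simp add: interior_prod_def v velocity_transition[OF f t c bij p])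
  also have "\<dots> = interior_prod (velocity f t) \<omega> c (cmap c p) u"
    by (simp add: interior_prod_def omega_transform[OF c p, of "velocity f t c (cmap c p)" u])
  also have "\<dots> = ext_d0 (scalar_rep U) c' (cmap c' p) v + H c' (cmap c' p) v"
    unfolding eq ext_d0_transition[OF U c p] Ht v ..
  finally show ?thesis .
qed

text \<open>\<open>d (dU) = 0\<close> by symmetry of second derivatives. This is used in both
  directions: to see that the harmonic part of the given isotopy is closed, and to see that the new
  isotopies are symplectic.\<close>

lemma ext_d1_exact_plus:
  assumes U: "smooth_fun U" and H: "one_form A H" and c: "c \<in> A" and x: "x \<in> cimg c"
    and eq: "\<And>x v. x \<in> cimg c \<Longrightarrow> \<alpha> c x v = ext_d0 (scalar_rep U) c x v + H c x v"
  shows "ext_d1 \<alpha> c x u v = ext_d1 H c x u v"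
proof -
  let ?f = "\<lambda>x. U (cinv c x)"
  have f: "Cinf (cimg c) ?f" using U c by (simp add: smooth_fun_def)
  note at = at_within_open[OF _ open_cimg[OF c]]
  have d: "Cinf (cimg c) (\<lambda>x. ext_d0 (scalar_rep U) c x v)" for v
    by (rule Cinf_cong[OF Cinf_frechet[OF f thick_open[OF open_cimg[OF c]], of v]])
      (simp add: at ext_d0_def scalar_rep_def[abs_def])
  have h: "Cinf (cimg c) (\<lambda>x. H c x v)" for v
    using H c unfolding one_form_def by (blast intro: smooth_on_imp_Cinf)
  have *: "frechet_derivative (\<lambda>y. \<alpha> c y v) (at x) =
      (\<lambda>u. frechet_derivative (\<lambda>x. ext_d0 (scalar_rep U) c x v) (at x) u + frechet_derivative (\<lambda>x. H c x v) (at x) u)" for v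
  proof -
    have "((\<lambda>x. ext_d0 (scalar_rep U) c x v + H c x v) has_derivative
      (\<lambda>u. frechet_derivative (\<lambda>x. ext_d0 (scalar_rep U) c x v) (at x) u + frechet_derivative (\<lambda>x. H c x v) (at x) u)) (at x)"
      using Cinf_derivative[OF d x, of v] Cinf_derivative[OF h x, of v] by (intro has_derivative_add) (simp_all add: at x)
    then have "((\<lambda>x. \<alpha> c x v) has_derivative
      (\<lambda>u. frechet_derivative (\<lambda>x. ext_d0 (scalar_rep U) c x v) (at x) u + frechet_derivative (\<lambda>x. H c x v) (at x) u)) (at x)"
      by (rule has_derivative_transform_within_open[OF _ open_cimg[OF c] x]) (simp add: eq)
    from frechet_derivative_at[OF this, symmetric] show ?thesis .
  qed
  have "frechet_derivative (\<lambda>x. ext_d0 (scalar_rep U) c x v) (at x) u = frechet_derivative (\<lambda>x. ext_d0 (scalar_rep U) c x u) (at x) v"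
    using second_derivative_symmetric[OF open_cimg[OF c] x f, of v u] by (simp add: ext_d0_def scalar_rep_def[abs_def])
  then show ?thesis by (simp add: ext_d1_def *)
qed

end

section \<open>Hamiltonian paths supported in a chart\<close>

context symplectic_manifold begin

lemma integral_minus_mean:
  assumes "integrable vol f"
  shows "integral\<^sup>L vol (\<lambda>p. f p - integral\<^sup>L vol f / measure vol UNIV) = 0"
proof -
  interpret finite_measure vol by (rule finite_vol)
  have "integral\<^sup>L vol (\<lambda>p. f p - integral\<^sup>L vol f / measure vol UNIV) =
      integral\<^sup>L vol f - measure vol UNIV * (integral\<^sup>L vol f / measure vol UNIV)"
    using assms by simp
  \<comment> \<open>If the total volume is zero, the quotient is zero by convention, so the integral
    of \<open>f\<close> itself has to vanish.\<close>
  moreover have "integral\<^sup>L vol f = 0" if "measure vol UNIV = 0"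
  proof -
    have "emeasure vol UNIV = 0" using that by (simp add: emeasure_eq_measure)
    then have "AE p in vol. f p = 0" by (intro AE_I[of _ _ UNIV]) auto
    then show ?thesis by (rule integral_eq_zero_AE)
  qed
  ultimately show ?thesis by (cases "measure vol UNIV = 0") auto
qed

lemma zero_form: "one_form A (zero_forms t)"
  unfolding one_form_def zero_forms_def
  by (auto intro!: linearI Cinf_imp_smooth_on thick_open open_cimg Cinf_const)

lemma zero_harmonic: "harmonic A g (zero_forms t)"
proof -
  have "codiff1 g (zero_forms t :: ('m, 'n) form1) = (\<lambda>c x. 0)"
    by (auto simp: codiff1_def zero_forms_def fun_eq_iff)
  moreover have "ext_d1 (zero_forms t :: ('m, 'n) form1) = (\<lambda>c x u v. 0)"
    by (auto simp: ext_d1_def zero_forms_def fun_eq_iff)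
  ultimately show ?thesis
    by (simp add: harmonic_def zero_form hodge_laplacian_def ext_d0_def codiff2_def)
qed

end

section \<open>Extension of the local maps by the identity\<close>

context hamiltonian_flow begin

text \<open>Chart formulas are valid on the open set \<open>Bq\<close>, and everything is trivial
  off the compact set \<open>Kq\<close> defined next. As \<open>Kq\<close> lies in
  \<open>Bq\<close>, the open sets \<open>Bq\<close> and \<open>- Kq\<close> cover the
  manifold.\<close>

definition Bq :: "'m set" where "Bq = cinv c0 ` ball x0 R"

definition Kq :: "'m set" where "Kq = cinv c0 ` cball x0 \<rho>"

lemma cball_ball: "cball x0 \<rho> \<subseteq> ball x0 R"
  using rR by auto

lemma Bq_iff: "p \<in> Bq \<longleftrightarrow> p \<in> cdom c0 \<and> cmap c0 p \<in> ball x0 R"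
proof
  assume "p \<in> Bq"
  then obtain x where x: "x \<in> ball x0 R" "p = cinv c0 x" by (auto simp: Bq_def)
  have "x \<in> cimg c0" using x(1) by (rule ballR_cimg)
  then show "p \<in> cdom c0 \<and> cmap c0 p \<in> ball x0 R"
    using x cinv_cdom[OF c0] cmap_cinv[OF c0] by simp
next
  assume "p \<in> cdom c0 \<and> cmap c0 p \<in> ball x0 R"
  then show "p \<in> Bq" unfolding Bq_def using cinv_cmap[OF c0, of p] by (intro image_eqI[of _ _ "cmap c0 p"]) auto
qed

lemma Kq_Bq: "Kq \<subseteq> Bq"
  unfolding Kq_def Bq_def using cball_ball by blast

lemma Kq_cmap: "p \<in> Bq \<Longrightarrow> p \<notin> Kq \<Longrightarrow> cmap c0 p \<notin> ball x0 \<rho>"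
proof
  assume p: "p \<in> Bq" "p \<notin> Kq" and "cmap c0 p \<in> ball x0 \<rho>"
  then have "cmap c0 p \<in> cball x0 \<rho>" by auto
  then have "cinv c0 (cmap c0 p) \<in> Kq" unfolding Kq_def by (rule imageI)
  then show False using p cinv_cmap[OF c0] by (simp add: Bq_iff)
qed

lemma Bq_cdom: "Bq \<subseteq> cdom c0"
  by (auto simp: Bq_iff)

lemma cinv_Bq: "x \<in> ball x0 R \<Longrightarrow> cinv c0 x \<in> Bq"
  by (simp add: Bq_def)

lemma cmap_cinv_ball: "x \<in> ball x0 R \<Longrightarrow> cmap c0 (cinv c0 x) = x"
  using cmap_cinv[OF c0 ballR_cimg] .

lemma open_Bq: "open Bq"
  unfolding Bq_def by (rule open_cinv_image[OF c0]) (auto intro: ballR_cimg)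

lemma open_Kq: "open (- Kq)"
proof -
  have "continuous_on (cball x0 \<rho>) (cinv c0)"
    by (rule continuous_on_subset[OF cinv_cont[OF c0]]) (use cball_ball ballR in blast)
  then have "compact Kq" unfolding Kq_def by (intro compact_continuous_image compact_cball)
  then show ?thesis by (intro open_Compl compact_imp_closed)
qed

definition Tm :: "real \<Rightarrow> real \<Rightarrow> 'm \<Rightarrow> 'm" where
  "Tm a b p = (if p \<in> Bq then cinv c0 (Th a b (cmap c0 p)) else p)"

lemma Tm_Bq:
  assumes "\<bar>a\<bar> + \<bar>b\<bar> \<le> 1" "p \<in> Bq"
  shows "Tm a b p \<in> Bq" "cmap c0 (Tm a b p) = Th a b (cmap c0 p)"
proof -
  have "Th a b (cmap c0 p) \<in> ball x0 R" using assms Th_ballR[of a b] by (simp add: Bq_iff)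
  then show "Tm a b p \<in> Bq" "cmap c0 (Tm a b p) = Th a b (cmap c0 p)"
    using assms(2) by (simp_all add: Tm_def cinv_Bq cmap_cinv_ball)
qed

lemma Tm_outside: "\<bar>a\<bar> + \<bar>b\<bar> \<le> 1 \<Longrightarrow> p \<notin> Kq \<Longrightarrow> Tm a b p = p"
  using Th_outside[OF Kq_cmap] cinv_cmap[OF c0] by (auto simp: Tm_def Bq_iff)

lemma Tm_inverse:
  assumes "\<bar>a\<bar> + \<bar>b\<bar> \<le> 1" shows "Tm (- a) (- b) (Tm a b p) = p"
proof (cases "p \<in> Bq")
  case True
  have "Tm (- a) (- b) (Tm a b p) = cinv c0 (Th (- a) (- b) (Th a b (cmap c0 p)))"
    using Tm_Bq[OF assms True] by (simp add: Tm_def[of "- a"])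
  then show ?thesis using Th_inverse[OF assms] cinv_cmap[OF c0, of p] True by (simp add: Bq_iff)
next
  case False
  then show ?thesis by (simp add: Tm_def)
qed

lemma Tm_Kq: "\<bar>a\<bar> + \<bar>b\<bar> \<le> 1 \<Longrightarrow> Tm a b p \<in> Kq \<longleftrightarrow> p \<in> Kq"
proof -
  assume ab: "\<bar>a\<bar> + \<bar>b\<bar> \<le> 1"
  have "Tm (- a) (- b) q = q" if "q \<notin> Kq" for q using Tm_outside[of "- a" "- b" q] ab that by simp
  then show ?thesis using Tm_outside[OF ab, of p] Tm_inverse[OF ab, of p] by metis
qed

lemma Tm_0 [simp]: "Tm 0 0 p = p"
  using cinv_cmap[OF c0, of p] by (simp add: Tm_def Bq_iff)

lemma bij_Tm:
  assumes "\<bar>a\<bar> + \<bar>b\<bar> \<le> 1" shows "bij (Tm a b)" "inv (Tm a b) = Tm (- a) (- b)"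
proof -
  have 1: "Tm (- a) (- b) (Tm a b p) = p" "Tm a b (Tm (- a) (- b) p) = p" for p
    using Tm_inverse[OF assms] Tm_inverse[of "- a" "- b"] assms by auto
  show "bij (Tm a b)"
    by (rule bij_betw_byWitness[where f' = "Tm (- a) (- b)"]) (auto simp: 1)
  show "inv (Tm a b) = Tm (- a) (- b)"
    by (rule inv_unique_comp) (auto simp: fun_eq_iff 1)
qed

lemma msmooth_Tm:
  assumes P: "thick P" and \<psi>: "msmooth P \<psi>" and ab: "Cinf P a" "Cinf P b" "\<And>q. q \<in> P \<Longrightarrow> \<bar>a q\<bar> + \<bar>b q\<bar> \<le> 1"
  shows "msmooth P (\<lambda>q. Tm (a q) (b q) (\<psi> q))"
proof (rule msmoothI[OF P])
  fix q assume q: "q \<in> P"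
  show "\<exists>T c. open T \<and> q \<in> T \<and> c \<in> A \<and> (\<forall>q'\<in>P \<inter> T. Tm (a q') (b q') (\<psi> q') \<in> cdom c) \<and>
      Cinf (P \<inter> T) (\<lambda>q. cmap c (Tm (a q) (b q) (\<psi> q)))"
  proof (cases "\<psi> q \<in> Bq")
    case True
    obtain T where T: "open T" "q \<in> T" "\<And>q'. q' \<in> P \<inter> T \<Longrightarrow> \<psi> q' \<in> Bq" "Cinf (P \<inter> T) (\<lambda>q. cmap c0 (\<psi> q))"
      using msmoothD[OF \<psi> q True open_Bq Bq_cdom c0] by blast
    have "Cinf (P \<inter> T) (\<lambda>q. Th (a q) (b q) (cmap c0 (\<psi> q)))"
      by (intro Th_smooth Cinf_subset[OF ab(1)] Cinf_subset[OF ab(2)] T(4)) (use ab(3) in auto)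
    then have "Cinf (P \<inter> T) (\<lambda>q. cmap c0 (Tm (a q) (b q) (\<psi> q)))"
      by (rule Cinf_cong) (use Tm_Bq(2) ab(3) T(3) in auto)
    moreover have "\<forall>q'\<in>P \<inter> T. Tm (a q') (b q') (\<psi> q') \<in> cdom c0"
      using Tm_Bq(1) ab(3) T(3) Bq_cdom by blast
    ultimately show ?thesis using T(1,2) c0 by blast
  next
    case False
    then have out: "\<psi> q \<notin> Kq" using Kq_Bq by blast
    obtain c where c: "c \<in> A" "\<psi> q \<in> cdom c" using chart_at by blast
    obtain T where T: "open T" "q \<in> T" "\<And>q'. q' \<in> P \<inter> T \<Longrightarrow> \<psi> q' \<in> cdom c \<inter> - Kq" "Cinf (P \<inter> T) (\<lambda>q. cmap c (\<psi> q))"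
      using msmoothD[OF \<psi> q, of "cdom c \<inter> - Kq" c] c out open_cdom[OF c(1)] open_Kq by blast
    have eq: "Tm (a q') (b q') (\<psi> q') = \<psi> q'" if "q' \<in> P \<inter> T" for q'
      using T(3)[OF that] ab(3)[of q'] that by (intro Tm_outside) auto
    have "Cinf (P \<inter> T) (\<lambda>q. cmap c (Tm (a q) (b q) (\<psi> q)))"
      by (rule Cinf_cong[OF T(4)]) (simp add: eq)
    then show ?thesis using T c eq by (intro exI[of _ T] exI[of _ c]) auto
  qed
qed

lemma smooth_path_Tm:
  assumes "Cinf {0..1} a" "Cinf {0..1} b" "\<And>t. t \<in> {0..1} \<Longrightarrow> \<bar>a t\<bar> + \<bar>b t\<bar> \<le> 1"
  shows "smooth_path A (\<lambda>t. Tm (a t) (b t))"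
  unfolding smooth_path_iff
proof
  fix c assume c: "c \<in> A"
  show "msmooth ({0..1} \<times> cimg c) (\<lambda>q. Tm (a (fst q)) (b (fst q)) (cinv c (snd q)))"
    by (rule msmooth_Tm[OF thick_cylinder[OF c] msmooth_cylinder[OF c]
          Cinf_compose[OF assms(1) Cinf_fst] Cinf_compose[OF assms(2) Cinf_fst]]) (use assms(3) in auto)
qed

lemma smooth_map_Tm: "\<bar>a\<bar> + \<bar>b\<bar> \<le> 1 \<Longrightarrow> smooth_map A (Tm a b)"
  using smooth_map_at_time[OF smooth_path_Tm[OF Cinf_const Cinf_const], of a b 0] by simp

lemma diffeomorphism_Tm: "\<bar>a\<bar> + \<bar>b\<bar> \<le> 1 \<Longrightarrow> diffeomorphism A (Tm a b)"
  using bij_Tm smooth_map_Tm smooth_map_Tm[of "- a" "- b"] by (simp add: diffeomorphism_def)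

section \<open>Volume preservation\<close>

lemma Tm_measurable: "\<bar>a\<bar> + \<bar>b\<bar> \<le> 1 \<Longrightarrow> Tm a b \<in> borel_measurable borel"
  using smooth_map_Tm by (auto simp: smooth_map_def intro: borel_measurable_continuous_onI)

text \<open>\<open>Tm a b\<close> maps \<open>Bq\<close> onto itself and fixes the other points. On
  \<open>Bq\<close> the chart computation \<open>mass_image\<close> applies with
  \<open>h = Th a b\<close>; the part of \<open>B\<close> off \<open>Bq\<close> is its own
  preimage.\<close>

lemma emeasure_Tm_vimage:
  assumes ab: "\<bar>a\<bar> + \<bar>b\<bar> \<le> 1" and B: "B \<in> sets borel"
  shows "emeasure vol (Tm a b -` B) = emeasure vol B"
proof -
  let ?f = "Tm a b"
  have Bq_borel: "Bq \<in> sets borel" using open_Bq by simp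
  have inBq: "?f p \<in> Bq \<longleftrightarrow> p \<in> Bq" for p using Tm_Bq(1)[OF ab, of p] by (auto simp: Tm_def)
  let ?B1 = "?f -` (B \<inter> Bq)"
  have B1: "?B1 \<in> sets borel" "?B1 \<subseteq> Bq" "B \<inter> Bq \<in> sets borel" "B - Bq \<in> sets borel"
    using measurable_sets[OF Tm_measurable[OF ab], of "B \<inter> Bq"] B Bq_borel inBq by auto
  have small': "\<bar>- a\<bar> + \<bar>- b\<bar> \<le> 1" using ab by simp
  have x_ball: "x \<in> ball x0 R" if "x \<in> cmap c0 ` ?B1" for x
    using that B1(2) by (auto simp: Bq_iff)
  have "mass c0 ?B1 = mass c0 (B \<inter> Bq)"
  proof (rule mass_image[OF c0 c0, where h = "Th a b" and h' = "JTh a b"])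
    show "(Th a b has_derivative JTh a b x) (at x within cmap c0 ` ?B1)" for x
      by (rule has_derivative_at_withinI[OF Th_has_derivative[OF ab]])
    show "inj_on (Th a b) (cmap c0 ` ?B1)"
      by (rule inj_onI) (metis Th_inverse[OF ab])
    show "Th a b ` cmap c0 ` ?B1 = cmap c0 ` (B \<inter> Bq)"
    proof -
      have "Th a b ` cmap c0 ` ?B1 = cmap c0 ` ?f ` ?B1"
        unfolding image_image using Tm_Bq(2)[OF ab] B1(2) by (intro image_cong) auto
      also have "?f ` ?B1 = B \<inter> Bq" by (rule surj_image_vimage_eq[OF bij_is_surj[OF bij_Tm(1)[OF ab]]])
      finally show ?thesis .
    qed
    show "\<omega> c0 x u v = \<omega> c0 (Th a b x) (JTh a b x u) (JTh a b x v)" if "x \<in> cmap c0 ` ?B1" for x u v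
      using Th_symplectic[OF ab x_ball[OF that]] by simp
  qed (use B1 Bq_cdom in auto)
  moreover have "emeasure vol ?B1 = mass c0 ?B1" "emeasure vol (B \<inter> Bq) = mass c0 (B \<inter> Bq)"
    using B1 Bq_cdom by (auto intro!: emeasure_vol[OF c0])
  ultimately have eq: "emeasure vol ?B1 = emeasure vol (B \<inter> Bq)" by simp
  have "?f -` B = ?B1 \<union> (B - Bq)"
  proof (intro set_eqI)
    fix p
    have "?f p = p" if "p \<notin> Bq" using that by (simp add: Tm_def)
    then show "p \<in> ?f -` B \<longleftrightarrow> p \<in> ?B1 \<union> (B - Bq)" using inBq[of p] by (cases "p \<in> Bq") simp_all
  qed
  then have "emeasure vol (?f -` B) = emeasure vol (?B1 \<union> (B - Bq))" by (simp only:)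
  also have "\<dots> = emeasure vol ?B1 + emeasure vol (B - Bq)"
    using B1 by (intro plus_emeasure[symmetric]) auto
  also have "\<dots> = emeasure vol (B \<inter> Bq) + emeasure vol (B - Bq)" by (simp only: eq)
  also have "\<dots> = emeasure vol ((B \<inter> Bq) \<union> (B - Bq))"
    using B1 by (intro plus_emeasure) auto
  also have "(B \<inter> Bq) \<union> (B - Bq) = B" by auto
  finally show ?thesis .
qed

lemma integral_Tm:
  assumes ab: "\<bar>a\<bar> + \<bar>b\<bar> \<le> 1" and f: "(f :: 'm \<Rightarrow> real) \<in> borel_measurable borel"
  shows "integral\<^sup>L vol (\<lambda>p. f (Tm a b p)) = integral\<^sup>L vol f"
proof -
  have m: "Tm a b \<in> vol \<rightarrow>\<^sub>M borel" using Tm_measurable[OF ab] by (simp add: measurable_def)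
  have "distr vol borel (Tm a b) = vol"
    by (rule measure_eqI) (use emeasure_Tm_vimage[OF ab] m in \<open>auto simp: emeasure_distr\<close>)
  then have "integral\<^sup>L vol f = integral\<^sup>L (distr vol borel (Tm a b)) f" by simp
  also have "\<dots> = integral\<^sup>L vol (\<lambda>p. f (Tm a b p))"
    by (rule integral_distr[OF m f])
  finally show ?thesis by simp
qed

text \<open>Near each parameter the point \<open>\<psi> q\<close> either stays in \<open>Bq\<close>
  or stays off \<open>Kq\<close>, so smoothness is decided by a chart computation or by a trivial
  formula.\<close>

lemma Cinf_glue:
  assumes P: "thick P" and \<psi>: "msmooth P \<psi>"
    and inside: "\<And>T. open T \<Longrightarrow> (\<And>q. q \<in> P \<inter> T \<Longrightarrow> \<psi> q \<in> Bq) \<Longrightarrow> Cinf (P \<inter> T) W"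
    and outside: "\<And>T. open T \<Longrightarrow> (\<And>q. q \<in> P \<inter> T \<Longrightarrow> \<psi> q \<notin> Kq) \<Longrightarrow> Cinf (P \<inter> T) W"
  shows "Cinf P W"
proof (rule Cinf_local[OF P])
  fix q assume q: "q \<in> P"
  note cont = msmooth_continuous[OF \<psi>]
  show "\<exists>T. open T \<and> q \<in> T \<and> Cinf (P \<inter> T) W"
  proof (cases "\<psi> q \<in> Bq")
    case True
    obtain T where T: "open T" "{q \<in> P. \<psi> q \<in> Bq} = P \<inter> T" using relative_open_preimage[OF cont open_Bq] by blast
    then have "q \<in> T" "\<And>q. q \<in> P \<inter> T \<Longrightarrow> \<psi> q \<in> Bq" using q True by auto
    then show ?thesis using inside[OF T(1)] T(1) by blast
  next
    case False
    obtain T where T: "open T" "{q \<in> P. \<psi> q \<in> - Kq} = P \<inter> T" using relative_open_preimage[OF cont open_Kq] by blast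
    then have "q \<in> T" "\<And>q. q \<in> P \<inter> T \<Longrightarrow> \<psi> q \<notin> Kq" using q False Kq_Bq by auto
    then show ?thesis using outside[OF T(1)] T(1) by blast
  qed
qed

section \<open>The normalised Hamiltonian functions\<close>

definition Fm :: "'m \<Rightarrow> real" where
  "Fm p = (if p \<in> Bq then F (cmap c0 p) else 0)"

lemma Fm_out: "p \<notin> Kq \<Longrightarrow> Fm p = 0"
  using F_out[OF Kq_cmap] by (auto simp: Fm_def)

lemma Fm_bounds: "0 \<le> Fm p" "Fm p \<le> 1"
  using F_bounds by (auto simp: Fm_def)

lemma Fm_Tm: "\<bar>a\<bar> + \<bar>b\<bar> \<le> 1 \<Longrightarrow> Fm (Tm a b p) = Fm p"
  using Tm_Bq[of a b p] F_Th[of a b "cmap c0 p"] by (auto simp: Fm_def) (simp_all add: Tm_def)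

lemma Cinf_Fm:
  assumes "thick P" "msmooth P \<psi>" shows "Cinf P (\<lambda>q. Fm (\<psi> q))"
proof (rule Cinf_glue[OF assms])
  fix T assume T: "open T" "\<And>q. q \<in> P \<inter> T \<Longrightarrow> \<psi> q \<in> Bq"
  have "Cinf (P \<inter> T) (\<lambda>q. cmap c0 (\<psi> q))"
    by (rule Cinf_subset[OF msmooth_Cinf[OF assms(2) c0]]) (use T(2) Bq_cdom in auto)
  then have "Cinf (P \<inter> T) (\<lambda>q. F (cmap c0 (\<psi> q)))" by (rule Cinf_compose[OF F_smooth]) auto
  then show "Cinf (P \<inter> T) (\<lambda>q. Fm (\<psi> q))" by (rule Cinf_cong) (use T(2) in \<open>auto simp: Fm_def\<close>)
next
  fix T assume "open T" "\<And>q. q \<in> P \<inter> T \<Longrightarrow> \<psi> q \<notin> Kq"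
  then show "Cinf (P \<inter> T) (\<lambda>q. Fm (\<psi> q))" using Fm_out by (intro Cinf_cong[OF Cinf_const[of _ 0]]) auto
qed

lemma Fm_continuous: "continuous_on UNIV Fm"
proof (rule smooth_fun_continuous)
  show "smooth_fun Fm" unfolding smooth_fun_def
    by (intro ballI Cinf_Fm thick_open open_cimg msmooth_chart Cinf_ident) auto
qed

text \<open>The Hamiltonian that drives the family \<open>Th\<close> at speed
  \<open>(\<alpha>, \<beta>)\<close>. Subtracting the means gives the normalisation required of
  generators and does not affect the differential.\<close>

definition ham :: "real \<Rightarrow> real \<Rightarrow> 'm \<Rightarrow> real" where
  "ham \<alpha> \<beta> p = \<alpha> * (Fm p - integral\<^sup>L vol Fm / measure vol UNIV) +
    \<beta> * ((Fm p)\<^sup>2 / 2 - integral\<^sup>L vol (\<lambda>p. (Fm p)\<^sup>2 / 2) / measure vol UNIV)"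

lemma ham_Tm: "\<bar>a\<bar> + \<bar>b\<bar> \<le> 1 \<Longrightarrow> ham \<alpha> \<beta> (Tm a b p) = ham \<alpha> \<beta> p"
  by (simp add: ham_def Fm_Tm)

lemma Cinf_ham:
  assumes "thick P" "msmooth P \<psi>" "Cinf P \<alpha>" "Cinf P \<beta>"
  shows "Cinf P (\<lambda>q. ham (\<alpha> q) (\<beta> q) (\<psi> q))"
proof -
  have "Ck k P (\<lambda>q. \<alpha> q * (Fm (\<psi> q) - integral\<^sup>L vol Fm / measure vol UNIV) +
    \<beta> q * (Fm (\<psi> q) ^ 2 * (1/2) - integral\<^sup>L vol (\<lambda>p. (Fm p)\<^sup>2 / 2) / measure vol UNIV))" for k
    using Cinf_Fm[OF assms(1,2)] assms(3,4) unfolding Cinf_def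
    by (intro Ck_add Ck_mult Ck_diff Ck_power Ck_const) auto
  then show ?thesis by (simp add: Cinf_def ham_def)
qed

lemma integral_ham: "integral\<^sup>L vol (ham \<alpha> \<beta>) = 0"
proof -
  interpret finite_measure vol by (rule finite_vol)
  have i: "integrable vol Fm" "integrable vol (\<lambda>p. (Fm p)\<^sup>2 / 2)"
    by (intro integrable_continuous continuous_intros Fm_continuous; simp)+
  have "integral\<^sup>L vol (ham \<alpha> \<beta>) =
      \<alpha> * integral\<^sup>L vol (\<lambda>p. Fm p - integral\<^sup>L vol Fm / measure vol UNIV) +
      \<beta> * integral\<^sup>L vol (\<lambda>p. (Fm p)\<^sup>2 / 2 - integral\<^sup>L vol (\<lambda>p. (Fm p)\<^sup>2 / 2) / measure vol UNIV)"
    unfolding ham_def[abs_def] using i by (subst Bochner_Integration.integral_add) auto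
  then show ?thesis by (simp only: integral_minus_mean[OF i(1)] integral_minus_mean[OF i(2)])
qed

lemma ext_d0_ham:
  assumes "x \<in> ball x0 R"
  shows "ext_d0 (scalar_rep (ham \<alpha> \<beta>)) c0 x v = (\<alpha> + \<beta> * F x) * DF x v"
proof -
  let ?m1 = "integral\<^sup>L vol Fm / measure vol UNIV" and ?m2 = "integral\<^sup>L vol (\<lambda>p. (Fm p)\<^sup>2 / 2) / measure vol UNIV"
  have "((\<lambda>x. \<alpha> * (F x - ?m1) + \<beta> * ((F x)\<^sup>2 / 2 - ?m2)) has_derivative (\<lambda>v. (\<alpha> + \<beta> * F x) * DF x v)) (at x)"
    by (auto intro!: derivative_eq_intros F_deriv simp: power2_eq_square algebra_simps)
  then have "((\<lambda>x. ham \<alpha> \<beta> (cinv c0 x)) has_derivative (\<lambda>v. (\<alpha> + \<beta> * F x) * DF x v)) (at x)"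
    by (rule has_derivative_transform_within_open[OF _ open_ball assms])
      (simp add: ham_def Fm_def cinv_Bq cmap_cinv_ball)
  from frechet_derivative_at[OF this, symmetric] show ?thesis
    by (simp add: ext_d0_def scalar_rep_def[abs_def])
qed

lemma ext_d0_outside:
  assumes c: "c \<in> A" "p \<in> cdom c" "p \<notin> Kq" and f: "\<And>q. q \<notin> Kq \<Longrightarrow> f q = k"
  shows "ext_d0 (scalar_rep f) c (cmap c p) v = 0"
proof -
  let ?S = "cmap c ` (cdom c \<inter> - Kq)"
  have S: "open ?S" "cmap c p \<in> ?S"
    using c by (auto intro!: open_cmap_image open_Int open_cdom open_Kq)
  have "((\<lambda>x. k) has_derivative (\<lambda>v. 0)) (at (cmap c p))" by simp
  then have "((\<lambda>x. f (cinv c x)) has_derivative (\<lambda>v. 0)) (at (cmap c p))"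
    by (rule has_derivative_transform_within_open[OF _ S]) (use c(1) f in \<open>auto simp: cinv_cmap\<close>)
  from frechet_derivative_at[OF this, symmetric] show ?thesis
    by (simp add: ext_d0_def scalar_rep_def[abs_def])
qed

lemma ham_out: "p \<notin> Kq \<Longrightarrow> ham \<alpha> \<beta> p = - \<alpha> * (integral\<^sup>L vol Fm / measure vol UNIV) -
    \<beta> * (integral\<^sup>L vol (\<lambda>p. (Fm p)\<^sup>2 / 2) / measure vol UNIV)"
  by (simp add: ham_def Fm_out)

lemma JTh_0: "\<bar>a\<bar> + \<bar>b\<bar> \<le> 1 \<Longrightarrow> JTh a b x 0 = 0"
  by (rule linear_0[OF has_derivative_linear[OF Th_has_derivative]])

end

locale hamiltonian_path = hamiltonian_flow A \<omega> n c0 x0 \<rho> R F X \<phi> J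
  for A :: "('m::{t2_space, second_countable_topology}, 'n::finite) chart set" and \<omega> n c0 x0 \<rho> R F X \<phi> J +
  fixes a b a' b' :: "real \<Rightarrow> real"
  assumes ab_smooth: "Cinf {0..1} a" "Cinf {0..1} b" "Cinf {0..1} a'" "Cinf {0..1} b'"
    and small: "\<And>t. t \<in> {0..1} \<Longrightarrow> \<bar>a t\<bar> + \<bar>b t\<bar> \<le> 1"
    and ab_deriv: "\<And>t. t \<in> {0..1} \<Longrightarrow> (a has_real_derivative a' t) (at t within {0..1})"
      "\<And>t. t \<in> {0..1} \<Longrightarrow> (b has_real_derivative b' t) (at t within {0..1})"
    and ab_0: "a 0 = 0" "b 0 = 0"
begin

definition theta :: "real \<Rightarrow> 'm \<Rightarrow> 'm" where "theta t = Tm (a t) (b t)"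

definition r :: "real \<Rightarrow> 'm \<Rightarrow> real" where "r t = ham (a' t) (b' t)"

lemma small': "t \<in> {0..1} \<Longrightarrow> \<bar>- a t\<bar> + \<bar>- b t\<bar> \<le> 1"
  using small by simp

lemma smooth_path_theta: "smooth_path A theta"
  unfolding theta_def[abs_def] by (rule smooth_path_Tm[OF ab_smooth(1,2) small])

lemma theta_0: "theta 0 = id"
  by (auto simp: theta_def ab_0)

lemma bij_theta: "t \<in> {0..1} \<Longrightarrow> bij (theta t)"
  and inv_theta: "t \<in> {0..1} \<Longrightarrow> inv (theta t) = Tm (- a t) (- b t)"
  by (auto simp: theta_def bij_Tm small)

lemma family_r: "smooth_function_family A r"
  unfolding smooth_function_family_iff r_def
  by (intro ballI Cinf_ham thick_cylinder msmooth_cylinder Cinf_compose[OF ab_smooth(3) Cinf_fst] Cinf_compose[OF ab_smooth(4) Cinf_fst])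
    auto

text \<open>The trajectory through \<open>x\<close> has speed factor \<open>a' t + b' t * F\<close>
  evaluated at its starting point; \<open>F\<close> is constant along it, so the factor may be taken
  at \<open>x\<close>.\<close>

lemma velocity_theta_inside:
  assumes t: "t \<in> {0..1}" and x: "x \<in> ball x0 R"
  shows "velocity theta t c0 x = (a' t + b' t * F x) *\<^sub>R X x"
proof (rule velocity_eqI[where f = theta and q = "cinv c0 (Th (- a t) (- b t) x)", OF _ t])
  let ?z = "Th (- a t) (- b t) x"
  have z: "?z \<in> ball x0 R" using Th_ballR[OF small'[OF t]] x by simp
  have Thz: "Th (a t) (b t) ?z = x" using Th_inverse[OF small'[OF t], of x] by simp
  have "((\<lambda>s. Th (a s) (b s) ?z) has_vector_derivative
      (a' t + b' t * F ?z) *\<^sub>R X (Th (a t) (b t) ?z) + JTh (a t) (b t) ?z 0) (at t within {0..1})"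
    by (rule Th_curve[OF t small ab_deriv(1)[OF t] ab_deriv(2)[OF t] has_vector_derivative_const])
  then have *: "((\<lambda>s. Th (a s) (b s) ?z) has_vector_derivative (a' t + b' t * F x) *\<^sub>R X x) (at t within {0..1})"
    by (simp add: Thz F_Th[OF small'[OF t]] JTh_0[OF small[OF t]])
  have eq: "theta s (cinv c0 ?z) = cinv c0 (Th (a s) (b s) ?z)" "Th (a s) (b s) ?z \<in> ball x0 R" if "s \<in> {0..1}" for s
    using Th_ballR[OF small[OF that], of ?z] z by (auto simp: theta_def Tm_def cinv_Bq cmap_cinv_ball)
  show "((\<lambda>s. cmap c0 (theta s (cinv c0 ?z))) has_vector_derivative (a' t + b' t * F x) *\<^sub>R X x) (at t within {0..1})"
    by (rule has_vector_derivative_transform[OF t _ *]) (simp only: eq(1) cmap_cinv_ball[OF eq(2)])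
  show "theta t (cinv c0 ?z) = cinv c0 x" by (simp add: eq[OF t] Thz)
qed (use bij_theta[OF t] bij_is_inj in auto)

lemma velocity_theta_outside:
  assumes t: "t \<in> {0..1}" and c: "c \<in> A" "p \<in> cdom c" and p: "p \<notin> Kq"
  shows "velocity theta t c (cmap c p) = 0"
proof (rule velocity_eqI[where f = theta and q = p, OF _ t])
  have eq: "theta s p = p" if "s \<in> {0..1}" for s using Tm_outside[OF small[OF that] p] by (simp add: theta_def)
  show "((\<lambda>s. cmap c (theta s p)) has_vector_derivative 0) (at t within {0..1})"
    by (rule has_vector_derivative_transform[OF t _ has_vector_derivative_const[of "cmap c p"]]) (simp add: eq)
  show "theta t p = cinv c (cmap c p)" using eq[OF t] cinv_cmap[OF c] by simp
qed (use bij_theta[OF t] bij_is_inj in auto)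

lemma theta_equation:
  assumes t: "t \<in> {0..1}" and c: "c \<in> A" and x: "x \<in> cimg c"
  shows "interior_prod (velocity theta t) \<omega> c x v = ext_d0 (scalar_rep (r t)) c x v + zero_forms t c x v"
proof -
  define p where "p = cinv c x"
  have p: "p \<in> cdom c" "x = cmap c p" using c x cinv_cdom cmap_cinv by (auto simp: p_def)
  show ?thesis
  proof (cases "p \<in> Bq")
    case True
    then have p0: "p \<in> cdom c0" "cmap c0 p \<in> ball x0 R" by (auto simp: Bq_iff)
    show ?thesis unfolding p(2)
    proof (rule generator_equation_transition[OF smooth_path_theta t c0 c bij_theta[OF t] p0(1) p(1) family_smooth_fun[OF family_r t] zero_form])
      fix v
      show "interior_prod (velocity theta t) \<omega> c0 (cmap c0 p) v =
        ext_d0 (scalar_rep (r t)) c0 (cmap c0 p) v + zero_forms t c0 (cmap c0 p) v"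
        using velocity_theta_inside[OF t p0(2)] X_F[OF p0(2)] ext_d0_ham[OF p0(2)]
          bilinear_lmul[OF omega_bilinear[OF c0 ballR_cimg[OF p0(2)]]]
        by (simp add: interior_prod_def r_def zero_forms_def)
    qed
  next
    case False
    then have out: "p \<notin> Kq" using Kq_Bq by blast
    have "interior_prod (velocity theta t) \<omega> c x v = 0"
      unfolding interior_prod_def p(2) velocity_theta_outside[OF t c p(1) out]
      by (rule bilinear_lzero[OF omega_bilinear[OF c cmap_cimg[OF p(1)]]])
    moreover have "ext_d0 (scalar_rep (r t)) c x v = 0"
      unfolding p(2) r_def by (rule ext_d0_outside[OF c p(1) out ham_out])
    ultimately show ?thesis by (simp add: zero_forms_def)
  qed
qed

lemma theta_generates: "generates A \<omega> g (r, zero_forms) theta"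
proof -
  have "ext_d1 (interior_prod (velocity theta t) \<omega>) c x u v = 0" if t: "t \<in> {0..1}" and c: "c \<in> A" "x \<in> cimg c" for t c x u v
  proof -
    have "ext_d1 (interior_prod (velocity theta t) \<omega>) c x u v = ext_d1 (zero_forms t) c x u v"
      by (rule ext_d1_exact_plus[where \<alpha> = "interior_prod (velocity theta t) \<omega>", OF family_smooth_fun[OF family_r t] zero_form c theta_equation[OF t c(1)]])
    then show ?thesis by (simp add: ext_d1_def zero_forms_def)
  qed
  then have "symplectic_isotopy A \<omega> theta"
    using smooth_path_theta theta_0 diffeomorphism_Tm small by (auto simp: symplectic_isotopy_def theta_def)
  moreover have "smooth_form_family A (zero_forms :: real \<Rightarrow> ('m, 'n) form1)"
    unfolding smooth_form_family_def zero_forms_def case_prod_unfold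
    by (intro ballI allI Cinf_imp_smooth_on thick_cylinder Cinf_const)
  ultimately show ?thesis
    using family_r theta_equation zero_harmonic integral_ham by (simp add: generates_def r_def)
qed

end

section \<open>The generator of the composed isotopy\<close>

lemma Ck_nth: "Ck k S f \<Longrightarrow> Ck k S (\<lambda>x. f x $ i)"
  by (rule Ck_bounded_linear[OF bounded_linear_vec_nth])

context symplectic_manifold begin

lemma msmooth_cong:
  assumes "msmooth P \<psi>" "\<And>q. q \<in> P \<Longrightarrow> \<psi> q = \<psi>' q" shows "msmooth P \<psi>'"
  unfolding msmooth_def
proof (intro conjI ballI)
  show "continuous_on P \<psi>'" by (rule continuous_on_eq[OF msmooth_continuous[OF assms(1)] assms(2)])
  fix c assume c: "c \<in> A"
  have "{q \<in> P. \<psi>' q \<in> cdom c} = {q \<in> P. \<psi> q \<in> cdom c}" using assms(2) by auto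
  then show "Cinf {q \<in> P. \<psi>' q \<in> cdom c} (\<lambda>q. cmap c (\<psi>' q))"
    using Cinf_cong[OF msmooth_Cinf[OF assms(1) c]] assms(2) by simp
qed

lemma smooth_path_cong:
  assumes "smooth_path A f" "\<And>t p. t \<in> {0..1} \<Longrightarrow> f t p = h t p" shows "smooth_path A h"
  unfolding smooth_path_iff
proof
  fix c assume "c \<in> A"
  then have "msmooth ({0..1} \<times> cimg c) (\<lambda>q. f (fst q) (cinv c (snd q)))"
    using assms(1) by (simp add: smooth_path_iff)
  then show "msmooth ({0..1} \<times> cimg c) (\<lambda>q. h (fst q) (cinv c (snd q)))"
    by (rule msmooth_cong) (use assms(2) in auto)
qed

end

section \<open>Primitives of closed forms on the coordinate ball\<close>

context hamiltonian_flow begin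

lemma ball_segment: "x \<in> ball x0 R \<Longrightarrow> \<tau> \<in> {0..1} \<Longrightarrow> x0 + \<tau> *\<^sub>R (x - x0) \<in> ball x0 R"
proof -
  assume x: "x \<in> ball x0 R" and \<tau>: "\<tau> \<in> {0..1}"
  have "\<tau> * norm (x - x0) \<le> 1 * norm (x - x0)" using \<tau> by (intro mult_right_mono) auto
  then show ?thesis using x \<tau> by (auto simp: dist_norm norm_minus_commute)
qed

text \<open>The radial primitive of the Poincare lemma, integrating along the segment from the
  centre of the ball.\<close>

definition primitive :: "('m, 'n) form1 \<Rightarrow> real^'n \<Rightarrow> real" where
  "primitive \<alpha> x = integral {0..1} (\<lambda>\<tau>. \<alpha> c0 (x0 + \<tau> *\<^sub>R (x - x0)) (x - x0))"

text \<open>By closedness the derivative of the component \<open>E v\<close> along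
  \<open>x - x0\<close> may replace the derivative of the component along \<open>x - x0\<close> in
  direction \<open>v\<close>. The differentiated integrand thus becomes the
  \<open>\<tau>\<close>-derivative of \<open>\<tau> * E v (x0 + \<tau> *\<^sub>R (x - x0))\<close>,
  and its integral is the value at \<open>x\<close>.\<close>

lemma primitive_has_derivative:
  assumes \<alpha>: "one_form A \<alpha>" and closed: "\<And>x u v. x \<in> cimg c0 \<Longrightarrow> ext_d1 \<alpha> c0 x u v = 0" and x: "x \<in> ball x0 R"
  shows "(primitive \<alpha> has_derivative \<alpha> c0 x) (at x)"
proof -
  let ?B = "ball x0 R" and ?y = "\<lambda>x \<tau>. x0 + \<tau> *\<^sub>R (x - x0)"
  define E where "E v y = \<alpha> c0 y v" for v y
  define DE where "DE v y = frechet_derivative (E v) (at y)" for v y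
  have lin: "linear (\<alpha> c0 y)" if "y \<in> cimg c0" for y using \<alpha> c0 that by (simp add: one_form_def)
  have E_smooth: "Cinf (cimg c0) (E v)" for v
    unfolding E_def using \<alpha> c0 unfolding one_form_def by (blast intro: smooth_on_imp_Cinf)
  note at = at_within_open[OF _ open_cimg[OF c0]]
  have E': "(E v has_derivative DE v y) (at y)" if "y \<in> cimg c0" for v y
    using Cinf_derivative[OF E_smooth that, of v] at[OF that] by (simp add: DE_def)
  have DE_cont: "continuous_on (cimg c0) (\<lambda>y. DE v y w)" for v w
    by (rule continuous_on_eq[OF Cinf_continuous[OF Cinf_frechet[OF E_smooth[of v] thick_open[OF open_cimg[OF c0]], of w]]])
      (simp add: at DE_def)
  have E_expand: "E v y = (\<Sum>i\<in>UNIV. v $ i * E (axis i 1) y)" if "y \<in> cimg c0" for v y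
    unfolding E_def by (rule linear_expand[OF lin[OF that]])
  have DE_expand: "DE v y w = (\<Sum>i\<in>UNIV. v $ i * DE (axis i 1) y w)" if y: "y \<in> cimg c0" for v y w
  proof -
    have "((\<lambda>y. \<Sum>i\<in>UNIV. v $ i * E (axis i 1) y) has_derivative (\<lambda>w. \<Sum>i\<in>UNIV. v $ i * DE (axis i 1) y w)) (at y)"
      by (intro has_derivative_sum has_derivative_mult_right E' y)
    then have "(E v has_derivative (\<lambda>w. \<Sum>i\<in>UNIV. v $ i * DE (axis i 1) y w)) (at y)"
      by (rule has_derivative_transform_within_open[OF _ open_cimg[OF c0] y]) (rule E_expand[symmetric])
    from has_derivative_unique[OF E'[OF y] this] show ?thesis by meson
  qed
  have DE_sym: "DE v y u = DE u y v" if "y \<in> cimg c0" for u v y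
    using closed[OF that, of u v] by (simp add: ext_d1_def DE_def E_def[abs_def])
  have pt: "?y x \<tau> \<in> cimg c0" if "x \<in> ?B" "\<tau> \<in> {0..1}" for x \<tau>
    using ball_segment[OF that] by (rule ballR_cimg)
  define f where "f x \<tau> = (\<Sum>i\<in>UNIV. (x - x0) $ i * E (axis i 1) (?y x \<tau>))" for x \<tau>
  define D where "D x \<tau> v = (\<Sum>i\<in>UNIV. (x - x0) $ i * (\<tau> * DE (axis i 1) (?y x \<tau>) v) + v $ i * E (axis i 1) (?y x \<tau>))" for x \<tau> v
  have f_eq: "\<alpha> c0 (?y x \<tau>) (x - x0) = f x \<tau>" if "x \<in> ?B" "\<tau> \<in> {0..1}" for x \<tau>
    using E_expand[OF pt[OF that], of "x - x0"] by (simp add: f_def E_def)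
  have yc: "continuous_on (?B \<times> {0..1}) (\<lambda>z. ?y (fst z) (snd z))" by (intro continuous_intros)
  have img: "(\<lambda>z. ?y (fst z) (snd z)) ` (?B \<times> {0..1}) \<subseteq> cimg c0" using pt by auto
  have Ec: "continuous_on (?B \<times> {0..1}) (\<lambda>z. E v (?y (fst z) (snd z)))" for v
    by (rule continuous_on_compose2[OF Cinf_continuous[OF E_smooth] yc img])
  have DEc: "continuous_on (?B \<times> {0..1}) (\<lambda>z. DE v (?y (fst z) (snd z)) w)" for v w
    by (rule continuous_on_compose2[OF DE_cont yc img])
  have "((\<lambda>x. integral {0..1} (f x)) has_derivative (\<lambda>v. integral {0..1} (\<lambda>\<tau>. D x \<tau> v))) (at x within ?B)"
  proof (rule integral_parameter_has_derivative[OF _ _ _ convex_ball x])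
    fix z \<tau> assume z: "z \<in> ?B" "\<tau> \<in> {0..1::real}"
    have y': "((\<lambda>x. ?y x \<tau>) has_derivative (\<lambda>v. \<tau> *\<^sub>R v)) (at z within ?B)"
      by (auto intro!: derivative_eq_intros)
    have "((\<lambda>x. E (axis i 1) (?y x \<tau>)) has_derivative (\<lambda>v. \<tau> * DE (axis i 1) (?y z \<tau>) v)) (at z within ?B)" for i
      using has_derivative_compose[OF y' E'[OF pt[OF z]], of "axis i 1"]
        linear_scale[OF has_derivative_linear[OF E'[OF pt[OF z]]], of "axis i 1" \<tau>] by simp
    moreover have "((\<lambda>x. (x - x0) $ i) has_derivative (\<lambda>v. v $ i)) (at z within ?B)" for i
      by (rule bounded_linear.has_derivative[OF bounded_linear_vec_nth]) (auto intro!: derivative_eq_intros)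
    ultimately show "((\<lambda>x. f x \<tau>) has_derivative D z \<tau>) (at z within ?B)"
      unfolding f_def D_def[abs_def] by (intro has_derivative_sum has_derivative_mult)
  next
    fix v show "continuous_on (?B \<times> {0..1}) (\<lambda>z. D (fst z) (snd z) v)"
      unfolding D_def by (intro continuous_on_sum continuous_on_add continuous_on_mult Ec DEc continuous_intros)
  next
    fix z assume z: "z \<in> ?B"
    have "continuous_on {0..1} (\<lambda>\<tau>. E (axis i 1) (?y z \<tau>))" for i
      by (rule continuous_on_compose2[OF Cinf_continuous[OF E_smooth]]) (use pt z in \<open>auto intro!: continuous_intros\<close>)
    then show "continuous_on {0..1} (f z)" unfolding f_def[abs_def] by (intro continuous_intros)
  qed
  moreover have "integral {0..1} (\<lambda>\<tau>. D x \<tau> v) = \<alpha> c0 x v" for v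
  proof -
    have "((\<lambda>\<tau>. D x \<tau> v) has_integral 1 * E v (?y x 1) - 0 * E v (?y x 0)) {0..1}"
    proof (rule fundamental_theorem_of_calculus)
      fix \<tau> :: real assume \<tau>: "\<tau> \<in> {0..1}"
      note y = pt[OF x \<tau>]
      have "((\<lambda>\<tau>. ?y x \<tau>) has_vector_derivative (x - x0)) (at \<tau> within {0..1})"
        by (auto intro!: derivative_eq_intros)
      from vector_derivative_diff_chain_within[OF this has_derivative_at_withinI[OF E'[OF y, of v]]]
      have "((\<lambda>\<tau>. E v (?y x \<tau>)) has_real_derivative DE v (?y x \<tau>) (x - x0)) (at \<tau> within {0..1})"
        by (simp add: o_def has_real_derivative_iff_has_vector_derivative)
      from DERIV_mult[OF DERIV_ident this]
      have "((\<lambda>\<tau>. \<tau> * E v (?y x \<tau>)) has_vector_derivative 1 * E v (?y x \<tau>) + DE v (?y x \<tau>) (x - x0) * \<tau>) (at \<tau> within {0..1})"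
        by (simp add: has_real_derivative_iff_has_vector_derivative)
      moreover have "D x \<tau> v = 1 * E v (?y x \<tau>) + DE v (?y x \<tau>) (x - x0) * \<tau>"
        unfolding D_def DE_sym[OF y, of v "x - x0"] DE_expand[OF y, of "x - x0" v] E_expand[OF y, of v]
        by (simp add: sum.distrib sum_distrib_left sum_distrib_right mult_ac)
      ultimately show "((\<lambda>\<tau>. \<tau> * E v (?y x \<tau>)) has_vector_derivative D x \<tau> v) (at \<tau> within {0..1})" by simp
    qed simp
    then show ?thesis by (simp add: integral_unique E_def)
  qed
  then have "(\<lambda>v. integral {0..1} (\<lambda>\<tau>. D x \<tau> v)) = \<alpha> c0 x" by blast
  ultimately have "((\<lambda>x. integral {0..1} (f x)) has_derivative \<alpha> c0 x) (at x)"
    using at_within_open[OF x open_ball] by simp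
  then show ?thesis
  proof (rule has_derivative_transform_within_open[OF _ open_ball x])
    fix x assume "x \<in> ?B"
    then show "integral {0..1} (f x) = primitive \<alpha> x"
      unfolding primitive_def using f_eq by (intro integral_cong) simp
  qed
qed

lemma primitive_smooth:
  assumes H: "smooth_form_family A H" "\<And>t. t \<in> {0..1} \<Longrightarrow> one_form A (H t)"
  shows "Cinf ({0..1} \<times> ball x0 R) (\<lambda>z. primitive (H (fst z)) (snd z))"
  unfolding Cinf_def
proof
  fix k
  let ?Z = "{0..1::real} \<times> ball x0 R" and ?y = "\<lambda>z \<tau>. x0 + \<tau> *\<^sub>R (snd z - x0)"
  let ?f = "\<lambda>q. \<Sum>i\<in>UNIV. (snd (fst q) - x0) $ i * H (fst (fst q)) c0 (?y (fst q) (snd q)) (axis i 1)"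
  have Hk: "Ck k ({0..1} \<times> cimg c0) (\<lambda>z. H (fst z) c0 (snd z) v)" for v
    using H(1) c0 unfolding smooth_form_family_def case_prod_unfold by (blast intro: smooth_on_imp_Ck)
  have "Ck k (?Z \<times> {0..1}) ?f"
  proof (intro Ck_sum Ck_mult Ck_nth Ck_diff Ck_snd Ck_fst Ck_id Ck_const)
    fix i
    have "Ck k (?Z \<times> {0..1}) (\<lambda>q. H (fst (fst (fst q), ?y (fst q) (snd q))) c0 (snd (fst (fst q), ?y (fst q) (snd q))) (axis i 1))"
    proof (rule Ck_compose[OF _ Hk])
      show "Ck k (?Z \<times> {0..1}) (\<lambda>q. (fst (fst q), ?y (fst q) (snd q)))"
        by (intro Ck_Pair Ck_add Ck_scaleR Ck_diff Ck_snd Ck_fst Ck_id Ck_const)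
      show "(\<lambda>q. (fst (fst q), ?y (fst q) (snd q))) ` (?Z \<times> {0..1}) \<subseteq> {0..1} \<times> cimg c0"
        using ball_segment ballR_cimg by fastforce
    qed
    then show "Ck k (?Z \<times> {0..1}) (\<lambda>q. H (fst (fst q)) c0 (?y (fst q) (snd q)) (axis i 1))" by simp
  qed
  from Ck_integral[OF this]
  have "Ck k ?Z (\<lambda>z. integral {0..1} (\<lambda>\<tau>. ?f (z, \<tau>)))" by (auto intro: convex_Times)
  then show "Ck k ?Z (\<lambda>z. primitive (H (fst z)) (snd z))"
  proof (rule Ck_cong)
    fix z assume z: "z \<in> ?Z"
    then have t: "fst z \<in> {0..1}" and x: "snd z \<in> ball x0 R" by auto
    show "integral {0..1} (\<lambda>\<tau>. ?f (z, \<tau>)) = primitive (H (fst z)) (snd z)"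
      unfolding primitive_def
    proof (rule integral_cong)
      fix \<tau> :: real assume "\<tau> \<in> {0..1}"
      from ballR_cimg[OF ball_segment[OF x this]]
      have "linear (H (fst z) c0 (?y z \<tau>))" using H(2)[OF t] c0 by (simp add: one_form_def)
      from linear_expand[OF this, of "snd z - x0"]
      show "?f (z, \<tau>) = H (fst z) c0 (?y z \<tau>) (snd z - x0)" by simp
    qed
  qed
qed

end

locale composed_isotopy = hamiltonian_path A \<omega> n c0 x0 \<rho> R F X \<phi> J a b a' b'
  for A :: "('m::{t2_space, second_countable_topology}, 'n::finite) chart set" and \<omega> n c0 x0 \<rho> R F X \<phi> J a b a' b' +
  fixes g :: "('m, 'n) form2" and U :: "real \<Rightarrow> 'm \<Rightarrow> real" and H :: "real \<Rightarrow> ('m, 'n) form1" and \<Phi> :: "real \<Rightarrow> 'm \<Rightarrow> 'm"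
  assumes gen: "generates A \<omega> g (U, H) \<Phi>"
begin

lemma Phi_path: "smooth_path A \<Phi>" and Phi_diffeo: "t \<in> {0..1} \<Longrightarrow> diffeomorphism A (\<Phi> t)" and Phi_0: "\<Phi> 0 = id"
  and Phi_closed: "t \<in> {0..1} \<Longrightarrow> c \<in> A \<Longrightarrow> x \<in> cimg c \<Longrightarrow> ext_d1 (interior_prod (velocity \<Phi> t) \<omega>) c x u v = 0"
  and U_family: "smooth_function_family A U" and H_family: "smooth_form_family A H"
  and H_harmonic: "t \<in> {0..1} \<Longrightarrow> harmonic A g (H t)" and U_mean: "t \<in> {0..1} \<Longrightarrow> integral\<^sup>L vol (U t) = 0"
  and Phi_equation: "t \<in> {0..1} \<Longrightarrow> c \<in> A \<Longrightarrow> x \<in> cimg c \<Longrightarrow>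
    interior_prod (velocity \<Phi> t) \<omega> c x v = ext_d0 (scalar_rep (U t)) c x v + H t c x v"
  using gen by (simp_all add: generates_def symplectic_isotopy_def)

lemma H_form: "t \<in> {0..1} \<Longrightarrow> one_form A (H t)"
  using H_harmonic by (simp add: harmonic_def)

text \<open>Read off from the isotopy: the contraction of its velocity with the symplectic form is
  closed, and it differs from \<open>H t\<close> by the exact form \<open>dU\<close>.\<close>

lemma H_closed: "t \<in> {0..1} \<Longrightarrow> c \<in> A \<Longrightarrow> x \<in> cimg c \<Longrightarrow> ext_d1 (H t) c x u v = 0"
  using ext_d1_exact_plus[where \<alpha> = "interior_prod (velocity \<Phi> t) \<omega>", OF family_smooth_fun[OF U_family] H_form _ _ Phi_equation]
    Phi_closed by simp

lemma bij_Phi: "t \<in> {0..1} \<Longrightarrow> bij (\<Phi> t)"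
  using Phi_diffeo by (simp add: diffeomorphism_def)

lemma H_linear: "t \<in> {0..1} \<Longrightarrow> c \<in> A \<Longrightarrow> x \<in> cimg c \<Longrightarrow> linear (H t c x)"
  using H_form by (simp add: one_form_def)

abbreviation h :: "real \<Rightarrow> real^'n \<Rightarrow> real" where "h t \<equiv> primitive (H t)"

lemma h_deriv: "t \<in> {0..1} \<Longrightarrow> x \<in> ball x0 R \<Longrightarrow> (h t has_derivative H t c0 x) (at x)"
  by (rule primitive_has_derivative[OF H_form H_closed[OF _ c0]])

lemma h_smooth: "Cinf ({0..1} \<times> ball x0 R) (\<lambda>z. h (fst z) (snd z))"
  by (rule primitive_smooth[OF H_family H_form])

lemma some_chart: "some_chart A p \<in> A" "p \<in> cdom (some_chart A p)"
proof -
  have "some_chart A p \<in> A \<and> p \<in> cdom (some_chart A p)"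
    unfolding some_chart_def by (rule someI_ex) (use chart_at in blast)
  then show "some_chart A p \<in> A" "p \<in> cdom (some_chart A p)" by auto
qed

section \<open>The correction term in the generator of the composition\<close>

lemma pairing_chart:
  assumes t: "t \<in> {0..1}" and s: "s \<in> {0..1}" and c: "c \<in> A" "p \<in> cdom c"
  shows "pairing A (H t) (velocity theta s) p = H t c (cmap c p) (velocity theta s c (cmap c p))"
proof -
  let ?c = "some_chart A p"
  have "H t c (cmap c p) (velocity theta s c (cmap c p)) =
      H t ?c (cmap ?c p) (transition_deriv c ?c p (velocity theta s c (cmap c p)))"
    using H_form[OF t] c some_chart[of p] unfolding one_form_def by blast
  also have "transition_deriv c ?c p (velocity theta s c (cmap c p)) = velocity theta s ?c (cmap ?c p)"
    by (rule velocity_transition[OF smooth_path_theta s c(1) some_chart(1) bij_theta[OF s] c(2) some_chart(2), symmetric])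
  finally show ?thesis by (simp add: pairing_def Let_def)
qed

lemma Delta_outside:
  assumes t: "t \<in> {0..1}" and p: "p \<notin> Kq" shows "Delta A H theta t p = 0"
proof -
  have "pairing A (H t) (velocity theta s) (theta s p) = 0" if "s \<in> {0..t}" for s
  proof -
    have s: "s \<in> {0..1}" using that t by auto
    obtain c where c: "c \<in> A" "p \<in> cdom c" using chart_at by blast
    have "theta s p = p" using Tm_outside[OF small[OF s] p] by (simp add: theta_def)
    then show ?thesis
      using pairing_chart[OF t s c] velocity_theta_outside[OF s c p] linear_0[OF H_linear[OF t c(1) cmap_cimg[OF c(2)]]] by simp
  qed
  then have "integral {0..t} (\<lambda>s. pairing A (H t) (velocity theta s) (theta s p)) = integral {0..t} (\<lambda>s. 0)"
    by (intro integral_cong) simp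
  then show ?thesis by (simp add: Delta_def)
qed

text \<open>The form is taken at the final time \<open>t\<close> throughout while only the loop
  moves with \<open>s\<close>. For this frozen form the integrand is the \<open>s\<close>-derivative
  of \<open>h t\<close> along the trajectory of \<open>p\<close>.\<close>

lemma Delta_inside:
  assumes t: "t \<in> {0..1}" and p: "p \<in> Bq"
  shows "Delta A H theta t p = h t (Th (a t) (b t) (cmap c0 p)) - h t (cmap c0 p)"
proof -
  let ?x = "cmap c0 p"
  have x: "?x \<in> ball x0 R" using p by (simp add: Bq_iff)
  let ?v = "\<lambda>s. H t c0 (Th (a s) (b s) ?x) ((a' s + b' s * F ?x) *\<^sub>R X (Th (a s) (b s) ?x))"
  have "(?v has_integral h t (Th (a t) (b t) ?x) - h t (Th (a 0) (b 0) ?x)) {0..t}"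
  proof (rule fundamental_theorem_of_calculus)
    fix s assume s: "s \<in> {0..t}"
    then have s1: "s \<in> {0..1}" using t by auto
    have sub: "{0..t} \<subseteq> {0..1}" using t by auto
    have "((\<lambda>s. Th (a s) (b s) ?x) has_vector_derivative
      (a' s + b' s * F ?x) *\<^sub>R X (Th (a s) (b s) ?x) + JTh (a s) (b s) ?x 0) (at s within {0..t})"
      by (rule Th_curve[OF s small DERIV_subset[OF ab_deriv(1)[OF s1] sub] DERIV_subset[OF ab_deriv(2)[OF s1] sub]
            has_vector_derivative_const]) (use sub in auto)
    then have c: "((\<lambda>s. Th (a s) (b s) ?x) has_vector_derivative
      (a' s + b' s * F ?x) *\<^sub>R X (Th (a s) (b s) ?x)) (at s within {0..t})"
      by (simp add: JTh_0[OF small[OF s1]])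
    have "Th (a s) (b s) ?x \<in> ball x0 R" using Th_ballR[OF small[OF s1]] x by simp
    from vector_derivative_diff_chain_within[OF c has_derivative_at_withinI[OF h_deriv[OF t this]]]
    show "((\<lambda>s. h t (Th (a s) (b s) ?x)) has_vector_derivative ?v s) (at s within {0..t})"
      by (simp add: o_def)
  qed (use t in auto)
  then have "integral {0..t} ?v = h t (Th (a t) (b t) ?x) - h t ?x"
    by (simp add: integral_unique ab_0)
  moreover have "integral {0..t} (\<lambda>s. pairing A (H t) (velocity theta s) (theta s p)) = integral {0..t} ?v"
  proof (rule integral_cong)
    fix s assume "s \<in> {0..t}"
    then have s: "s \<in> {0..1}" using t by auto
    have q: "theta s p \<in> Bq" "cmap c0 (theta s p) = Th (a s) (b s) ?x"
      using Tm_Bq[OF small[OF s] p] by (simp_all add: theta_def)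
    have y: "Th (a s) (b s) ?x \<in> ball x0 R" using Th_ballR[OF small[OF s]] x by simp
    show "pairing A (H t) (velocity theta s) (theta s p) = ?v s"
      using pairing_chart[OF t s c0, of "theta s p"] q(1) Bq_cdom velocity_theta_inside[OF s y]
      by (auto simp: q(2) F_Th[OF small[OF s]])
  qed
  ultimately show ?thesis by (simp add: Delta_def)
qed

text \<open>\<open>Delta\<close> is the difference of the primitive and its pullback by the volume preserving map \<open>theta\<close>, so it
  has mean zero without normalization.\<close>

lemma Delta_mean:
  assumes t: "t \<in> {0..1}" shows "integral\<^sup>L vol (Delta A H theta t) = 0"
proof -
  interpret finite_measure vol by (rule finite_vol)
  \<comment> \<open>The primitive has a meaning on the ball only. Cutting it off at
    \<open>Kq\<close> gives a bounded measurable function on the whole manifold; since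
    \<open>theta\<close> maps \<open>Kq\<close> onto itself and \<open>Delta\<close> vanishes off
    \<open>Kq\<close>, the difference of \<open>k\<close> at the image and at the point is exactly
    \<open>Delta\<close>.\<close>
  define k where "k p = (if p \<in> Kq then h t (cmap c0 p) else 0)" for p
  have hc: "continuous_on Kq (\<lambda>p. h t (cmap c0 p))"
  proof (rule continuous_on_compose2[of "ball x0 R" "h t"])
    show "continuous_on (ball x0 R) (h t)"
      using h_deriv[OF t] by (meson continuous_at_imp_continuous_on has_derivative_continuous)
    show "continuous_on Kq (cmap c0)"
      by (rule continuous_on_subset[OF cmap_cont[OF c0]]) (use Kq_Bq Bq_cdom in blast)
  qed (use Kq_Bq in \<open>auto simp: Bq_iff\<close>)
  have K: "Kq \<in> sets borel" "closed Kq" using open_Kq by (simp_all add: closed_def borel_closed)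
  have km: "k \<in> borel_measurable borel"
    unfolding k_def[abs_def] by (intro borel_measurable_continuous_on_if K hc continuous_on_const)
  have "compact Kq" using K(2) compact_UNIV compact_Int_closed[of UNIV Kq] by simp
  then have "bounded ((\<lambda>p. h t (cmap c0 p)) ` Kq)" by (intro compact_imp_bounded compact_continuous_image hc)
  then obtain C where "\<And>p. p \<in> Kq \<Longrightarrow> norm (h t (cmap c0 p)) \<le> C" unfolding bounded_iff by auto
  then have "norm (k p) \<le> \<bar>C\<bar>" for p by (force simp: k_def)
  then have ki: "integrable vol k" using km by (intro integrable_const_bound[of _ "\<bar>C\<bar>"]) (auto simp: measurable_def)
  have kTi: "integrable vol (\<lambda>p. k (Tm (a t) (b t) p))"
    using measurable_compose[OF Tm_measurable[OF small[OF t]] km] \<open>\<And>p. norm (k p) \<le> \<bar>C\<bar>\<close>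
    by (intro integrable_const_bound[of _ "\<bar>C\<bar>"]) (auto simp: measurable_def)
  have "Delta A H theta t p = k (Tm (a t) (b t) p) - k p" for p
  proof (cases "p \<in> Kq")
    case True
    then have "p \<in> Bq" using Kq_Bq by blast
    then show ?thesis using True Tm_Kq[OF small[OF t], of p] Delta_inside[OF t, of p] Tm_Bq(2)[OF small[OF t], of p]
      by (simp add: k_def)
  next
    case False
    then show ?thesis using Tm_Kq[OF small[OF t], of p] Delta_outside[OF t] by (simp add: k_def)
  qed
  then have "Delta A H theta t = (\<lambda>p. k (Tm (a t) (b t) p) - k p)" by blast
  then have "integral\<^sup>L vol (Delta A H theta t) = integral\<^sup>L vol (\<lambda>p. k (Tm (a t) (b t) p)) - integral\<^sup>L vol k"
    using ki kTi by (simp add: Bochner_Integration.integral_diff)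
  then show ?thesis using integral_Tm[OF small[OF t] km] by simp
qed

lemma Delta_normalized: "t \<in> {0..1} \<Longrightarrow> Delta_normalized A \<omega> H theta t = Delta A H theta t"
  by (simp add: Delta_normalized_def normalize_def[abs_def] Delta_mean)

definition V :: "real \<Rightarrow> 'm \<Rightarrow> real" where
  "V t p = - r t (theta t p) + U t (theta t p) + Delta_normalized A \<omega> H theta t p"

text \<open>The generator of the loop is a function of \<open>Fm\<close> at each time, and
  \<open>theta\<close> preserves \<open>Fm\<close>, so composing it with \<open>theta\<close>
  changes nothing.\<close>

lemma V_eq: "t \<in> {0..1} \<Longrightarrow> V t p = - r t p + U t (theta t p) + Delta A H theta t p"
  by (simp add: V_def Delta_normalized r_def theta_def ham_Tm small)

lemma Delta_family: "smooth_function_family A (Delta A H theta)"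
  unfolding smooth_function_family_iff
proof
  fix c assume c: "c \<in> A"
  let ?P = "{0..1::real} \<times> cimg c"
  show "Cinf ?P (\<lambda>q. Delta A H theta (fst q) (cinv c (snd q)))"
  proof (rule Cinf_glue[OF thick_cylinder[OF c] msmooth_cylinder[OF c]])
    fix T assume T: "open T" "\<And>q. q \<in> ?P \<inter> T \<Longrightarrow> cinv c (snd q) \<in> Bq"
    let ?x = "\<lambda>q. cmap c0 (cinv c (snd q))"
    have x: "Cinf (?P \<inter> T) ?x"
      by (rule Cinf_subset[OF msmooth_Cinf[OF msmooth_cylinder[OF c] c0]]) (use T(2) Bq_cdom in auto)
    have xb: "?x q \<in> ball x0 R" if "q \<in> ?P \<inter> T" for q using T(2)[OF that] by (simp add: Bq_iff)
    have hz: "Cinf (?P \<inter> T) (\<lambda>q. h (fst q) (z q))" if z: "Cinf (?P \<inter> T) z" "\<And>q. q \<in> ?P \<inter> T \<Longrightarrow> z q \<in> ball x0 R" for z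
    proof -
      have "Cinf (?P \<inter> T) (\<lambda>q. h (fst (fst q, z q)) (snd (fst q, z q)))"
        by (rule Cinf_compose[OF h_smooth Cinf_Pair[OF Cinf_fst z(1)]]) (use z(2) in auto)
      then show ?thesis by simp
    qed
    have Thx: "Cinf (?P \<inter> T) (\<lambda>q. Th (a (fst q)) (b (fst q)) (?x q))"
      by (intro Th_smooth x Cinf_compose[OF ab_smooth(1) Cinf_fst] Cinf_compose[OF ab_smooth(2) Cinf_fst])
        (use small in auto)
    have "Cinf (?P \<inter> T) (\<lambda>q. h (fst q) (Th (a (fst q)) (b (fst q)) (?x q)))"
      by (rule hz[OF Thx]) (use Th_ballR small xb in auto)
    moreover have "Cinf (?P \<inter> T) (\<lambda>q. h (fst q) (?x q))" by (rule hz[OF x xb])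
    ultimately have "Cinf (?P \<inter> T) (\<lambda>q. h (fst q) (Th (a (fst q)) (b (fst q)) (?x q)) - h (fst q) (?x q))"
      by (simp add: Cinf_def Ck_diff)
    then show "Cinf (?P \<inter> T) (\<lambda>q. Delta A H theta (fst q) (cinv c (snd q)))"
      by (rule Cinf_cong) (use Delta_inside T(2) in auto)
  next
    fix T assume "open T" "\<And>q. q \<in> ?P \<inter> T \<Longrightarrow> cinv c (snd q) \<notin> Kq"
    then show "Cinf (?P \<inter> T) (\<lambda>q. Delta A H theta (fst q) (cinv c (snd q)))"
      by (intro Cinf_cong[OF Cinf_const[of _ 0]]) (use Delta_outside in auto)
  qed
qed

lemma U_theta_family: "smooth_function_family A (\<lambda>t p. U t (theta t p))"
  unfolding smooth_function_family_iff
proof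
  fix c assume c: "c \<in> A"
  have "msmooth ({0..1} \<times> cimg c) (\<lambda>q. theta (fst q) (cinv c (snd q)))"
    using smooth_path_theta c by (simp add: smooth_path_iff)
  then show "Cinf ({0..1} \<times> cimg c) (\<lambda>q. U (fst q) (theta (fst q) (cinv c (snd q))))"
    by (rule Cinf_family[OF thick_cylinder[OF c] U_family _ Cinf_fst]) auto
qed

lemma V_family: "smooth_function_family A V"
  unfolding smooth_function_family_iff
proof
  fix c assume c: "c \<in> A"
  have "Cinf ({0..1} \<times> cimg c) (\<lambda>q. - r (fst q) (cinv c (snd q)) + U (fst q) (theta (fst q) (cinv c (snd q))) +
      Delta A H theta (fst q) (cinv c (snd q)))"
    using family_r U_theta_family Delta_family c
    unfolding smooth_function_family_iff Cinf_def by (intro allI Ck_add Ck_minus) auto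
  then show "Cinf ({0..1} \<times> cimg c) (\<lambda>q. V (fst q) (cinv c (snd q)))"
    by (rule Cinf_cong) (auto simp: V_eq)
qed

lemma V_mean: "t \<in> {0..1} \<Longrightarrow> integral\<^sup>L vol (V t) = 0"
proof -
  assume t: "t \<in> {0..1}"
  have i: "integrable vol (r t)" "integrable vol (\<lambda>p. U t (theta t p))" "integrable vol (Delta A H theta t)"
    using family_smooth_fun[OF _ t] family_r U_theta_family Delta_family
    by (intro integrable_continuous smooth_fun_continuous; blast)+
  have "U t \<in> borel_measurable borel"
    by (intro borel_measurable_continuous_onI smooth_fun_continuous family_smooth_fun[OF U_family t])
  then have "integral\<^sup>L vol (\<lambda>p. U t (theta t p)) = 0"
    using integral_Tm[OF small[OF t]] U_mean[OF t] by (simp add: theta_def)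
  moreover have "integral\<^sup>L vol (r t) = 0" by (simp add: r_def integral_ham)
  ultimately show ?thesis
    using i Delta_mean[OF t] by (simp add: V_eq[OF t, abs_def])
qed

text \<open>The last bracket is the differential of the primitive at the image point minus that at
  \<open>x\<close>. Adding \<open>H t\<close> at \<open>x\<close> therefore turns it into the
  pullback of \<open>H t\<close>, which is the form that the composed isotopy must produce.\<close>

lemma ext_d0_V_inside:
  assumes t: "t \<in> {0..1}" and x: "x \<in> ball x0 R"
  shows "ext_d0 (scalar_rep (V t)) c0 x v = - ((a' t + b' t * F x) * DF x v) +
    ext_d0 (scalar_rep (U t)) c0 (Th (a t) (b t) x) (JTh (a t) (b t) x v) +
    (H t c0 (Th (a t) (b t) x) (JTh (a t) (b t) x v) - H t c0 x v)"
proof -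
  let ?T = "Th (a t) (b t)" and ?J = "JTh (a t) (b t) x"
  have y: "?T x \<in> ball x0 R" using Th_ballR[OF small[OF t]] x by simp
  have T': "(?T has_derivative ?J) (at x)" by (rule Th_has_derivative[OF small[OF t]])
  have "((\<lambda>x. r t (cinv c0 x)) has_derivative (\<lambda>v. (a' t + b' t * F x) * DF x v)) (at x)"
  proof -
    have "ext_d0 (scalar_rep (r t)) c0 x = (\<lambda>v. (a' t + b' t * F x) * DF x v)"
      unfolding r_def by (rule ext) (rule ext_d0_ham[OF x])
    then show ?thesis
      using smooth_fun_derivative[OF family_smooth_fun[OF family_r t] c0 ballR_cimg[OF x]] by (simp only:)
  qed
  moreover have "((\<lambda>x. U t (cinv c0 (?T x))) has_derivative (\<lambda>v. ext_d0 (scalar_rep (U t)) c0 (?T x) (?J v))) (at x)"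
    by (rule has_derivative_compose[OF T' smooth_fun_derivative[OF family_smooth_fun[OF U_family t] c0 ballR_cimg[OF y]]])
  moreover have "((\<lambda>x. h t (?T x) - h t x) has_derivative (\<lambda>v. H t c0 (?T x) (?J v) - H t c0 x v)) (at x)"
    by (intro has_derivative_diff has_derivative_compose[OF T' h_deriv[OF t y]] h_deriv t x)
  ultimately have "((\<lambda>x. - r t (cinv c0 x) + U t (cinv c0 (?T x)) + (h t (?T x) - h t x)) has_derivative
      (\<lambda>v. - ((a' t + b' t * F x) * DF x v) + ext_d0 (scalar_rep (U t)) c0 (?T x) (?J v) +
        (H t c0 (?T x) (?J v) - H t c0 x v))) (at x)"
    by (intro has_derivative_add has_derivative_minus)
  then have "((\<lambda>x. V t (cinv c0 x)) has_derivative
      (\<lambda>v. - ((a' t + b' t * F x) * DF x v) + ext_d0 (scalar_rep (U t)) c0 (?T x) (?J v) +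
        (H t c0 (?T x) (?J v) - H t c0 x v))) (at x)"
  proof (rule has_derivative_transform_within_open[OF _ open_ball x])
    fix x assume x: "x \<in> ball x0 R"
    have "theta t (cinv c0 x) = cinv c0 (?T x)" using x by (simp add: theta_def Tm_def cinv_Bq cmap_cinv_ball)
    then show "- r t (cinv c0 x) + U t (cinv c0 (?T x)) + (h t (?T x) - h t x) = V t (cinv c0 x)"
      using Delta_inside[OF t cinv_Bq[OF x]] x by (simp add: V_eq[OF t] cmap_cinv_ball)
  qed
  from frechet_derivative_at[OF this, symmetric] show ?thesis
    by (simp add: ext_d0_def scalar_rep_def[abs_def])
qed

lemma ext_d0_V_outside:
  assumes t: "t \<in> {0..1}" and c: "c \<in> A" "p \<in> cdom c" and p: "p \<notin> Kq"
  shows "ext_d0 (scalar_rep (V t)) c (cmap c p) v = ext_d0 (scalar_rep (U t)) c (cmap c p) v"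
proof -
  let ?S = "cmap c ` (cdom c \<inter> - Kq)"
  have S: "open ?S" "cmap c p \<in> ?S"
    using c p by (auto intro!: open_cmap_image open_Int open_cdom open_Kq)
  obtain k where k: "\<And>q. q \<notin> Kq \<Longrightarrow> r t q = k" using ham_out by (auto simp: r_def)
  have "((\<lambda>x. - k + U t (cinv c x)) has_derivative (\<lambda>v. 0 + ext_d0 (scalar_rep (U t)) c (cmap c p) v)) (at (cmap c p))"
    by (intro has_derivative_add has_derivative_const smooth_fun_derivative[OF family_smooth_fun[OF U_family t] c(1) cmap_cimg[OF c(2)]])
  then have "((\<lambda>x. V t (cinv c x)) has_derivative (\<lambda>v. 0 + ext_d0 (scalar_rep (U t)) c (cmap c p) v)) (at (cmap c p))"
  proof (rule has_derivative_transform_within_open[OF _ S])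
    fix x assume "x \<in> ?S"
    then have q: "cinv c x \<notin> Kq" using c(1) by (auto simp: cinv_cmap)
    then have "theta t (cinv c x) = cinv c x" using Tm_outside[OF small[OF t]] by (simp add: theta_def)
    then show "- k + U t (cinv c x) = V t (cinv c x)" using k[OF q] Delta_outside[OF t q] by (simp add: V_eq[OF t])
  qed
  from frechet_derivative_at[OF this, symmetric] show ?thesis
    by (simp add: ext_d0_def scalar_rep_def[abs_def])
qed

section \<open>The inverse loop composed with the given isotopy\<close>

abbreviation Psi :: "real \<Rightarrow> 'm \<Rightarrow> 'm" where "Psi \<equiv> isotopy_comp (isotopy_inv theta) \<Phi>"

lemma Psi_eq: "t \<in> {0..1} \<Longrightarrow> Psi t p = Tm (- a t) (- b t) (\<Phi> t p)"
  by (simp add: isotopy_comp_def isotopy_inv_def inv_theta)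

lemma Psi_path: "smooth_path A Psi"
proof (rule smooth_path_cong)
  have "Cinf {0..1} (\<lambda>t. - a t)" "Cinf {0..1} (\<lambda>t. - b t)"
    using ab_smooth(1,2) by (simp_all add: Cinf_def Ck_minus)
  then show "smooth_path A (\<lambda>t p. Tm (- a t) (- b t) (\<Phi> t p))"
    by (intro smooth_path_compose[OF smooth_path_Tm Phi_path] small')
qed (simp add: Psi_eq)

lemma Psi_diffeo: "t \<in> {0..1} \<Longrightarrow> diffeomorphism A (Psi t)"
proof -
  assume t: "t \<in> {0..1}"
  have Psi: "Psi t = Tm (- a t) (- b t) \<circ> \<Phi> t" by (auto simp: Psi_eq[OF t])
  have bij: "bij (Tm (- a t) (- b t))" "inv (Tm (- a t) (- b t)) = Tm (a t) (b t)"
    using bij_Tm[OF small'[OF t]] by simp_all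
  have "inv (Psi t) = inv (\<Phi> t) \<circ> Tm (a t) (b t)"
    unfolding Psi using o_inv_distrib[OF bij(1) bij_Phi[OF t]] bij(2) by simp
  then have "smooth_map A (inv (Psi t))"
    using smooth_map_compose[of "inv (\<Phi> t)" "Tm (a t) (b t)"] Phi_diffeo[OF t] smooth_map_Tm[OF small[OF t]]
    by (simp add: diffeomorphism_def o_def)
  moreover have "bij (Psi t)" unfolding Psi by (rule bij_comp[OF bij_Phi[OF t] bij(1)])
  ultimately show ?thesis
    using smooth_map_at_time[OF Psi_path t] by (simp add: diffeomorphism_def)
qed

text \<open>The point \<open>p\<close> is reached from \<open>q\<close>, and
  \<open>\<Phi> t q = theta t p\<close>. Invariance of the form under \<open>Th\<close> moves the
  part of the velocity that comes from \<open>\<Phi>\<close> to this image point, where the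
  generator equation of \<open>\<Phi>\<close> is available; the motion of the inverse loop
  contributes the differential of \<open>- r\<close>. Off the support both isotopies have the same
  velocity.\<close>

lemma Psi_equation:
  assumes t: "t \<in> {0..1}" and c: "c \<in> A" and x: "x \<in> cimg c"
  shows "interior_prod (velocity Psi t) \<omega> c x v = ext_d0 (scalar_rep (V t)) c x v + H t c x v"
proof -
  define p where "p = cinv c x"
  have p: "p \<in> cdom c" "x = cmap c p" using c x cinv_cdom cmap_cinv by (auto simp: p_def)
  have bijP: "bij (Psi t)" using Psi_diffeo[OF t] by (simp add: diffeomorphism_def)
  then have injP: "inj (Psi t)" by (simp add: bij_def)
  have injPhi: "inj (\<Phi> t)" using bij_Phi[OF t] by (simp add: bij_def)
  obtain q where q: "Psi t q = p" using bijP by (metis bij_pointE)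
  have y: "\<Phi> t q = theta t p"
    using q bij_Tm[OF small[OF t]] Tm_inverse[OF small'[OF t], of "\<Phi> t q"] by (simp add: Psi_eq[OF t] theta_def)
  show ?thesis
  proof (cases "p \<in> Bq")
    case True
    then have p0: "p \<in> cdom c0" "cmap c0 p \<in> ball x0 R" by (auto simp: Bq_iff)
    let ?x = "cmap c0 p" and ?T = "Th (a t) (b t)" and ?Ti = "Th (- a t) (- b t)"
    have yB: "\<Phi> t q \<in> Bq" "cmap c0 (\<Phi> t q) = ?T ?x"
      unfolding y using Tm_Bq[OF small[OF t] True] by (simp_all add: theta_def)
    have z: "?T ?x \<in> ball x0 R" using Th_ballR[OF small[OF t]] p0 by simp
    let ?w = "velocity \<Phi> t c0 (?T ?x)"
    have zc: "((\<lambda>s. cmap c0 (\<Phi> s q)) has_vector_derivative ?w) (at t within {0..1})"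
      using velocity_has_derivative[OF Phi_path t c0 injPhi, of q] yB Bq_cdom by auto
    have ma: "((\<lambda>s. - a s) has_real_derivative - a' t) (at t within {0..1})"
      "((\<lambda>s. - b s) has_real_derivative - b' t) (at t within {0..1})"
      using ab_deriv[OF t] by (auto intro!: derivative_eq_intros)
    have TiT: "?Ti (?T ?x) = ?x" by (rule Th_inverse[OF small[OF t]])
    \<comment> \<open>The first summand is the motion of the inverse loop at the fixed point
      \<open>\<Phi> t q\<close>, the second the velocity of \<open>\<Phi>\<close> transported by its
      derivative.\<close>
    let ?W = "(- a' t + - b' t * F ?x) *\<^sub>R X ?x + JTh (- a t) (- b t) (?T ?x) ?w"
    have curve: "((\<lambda>s. Th (- a s) (- b s) (cmap c0 (\<Phi> s q))) has_vector_derivative ?W) (at t within {0..1})"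
      using Th_curve[OF t small' ma zc] by (simp add: yB(2) TiT F_Th[OF small[OF t]])
    obtain d where d: "0 < d" "\<And>s. s \<in> {0..1} \<Longrightarrow> dist s t < d \<Longrightarrow> \<Phi> s q \<in> Bq"
      using path_curve[OF Phi_path t c0 open_Bq yB(1)] by blast
    have "((\<lambda>s. cmap c0 (Psi s q)) has_vector_derivative ?W) (at t within {0..1})"
    proof (rule has_vector_derivative_transform_within[OF curve d(1) t])
      fix s assume s: "s \<in> {0..1}" "dist s t < d"
      show "Th (- a s) (- b s) (cmap c0 (\<Phi> s q)) = cmap c0 (Psi s q)"
        using Tm_Bq(2)[OF small'[OF s(1)] d(2)[OF s]] by (simp add: Psi_eq[OF s(1)])
    qed
    then have vel: "velocity Psi t c0 ?x = ?W"
      by (rule velocity_eqI[where f = Psi and q = q, OF _ t injP]) (simp add: q cinv_cmap c0 p0)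
    show ?thesis unfolding p(2)
    proof (rule generator_equation_transition[OF Psi_path t c0 c bijP p0(1) p(1) family_smooth_fun[OF V_family t] H_form[OF t]])
      fix v
      let ?u = "JTh (a t) (b t) ?x v"
      note B = omega_bilinear[OF c0 ballR_cimg[OF p0(2)]]
      have "interior_prod (velocity Psi t) \<omega> c0 ?x v =
          (- a' t + - b' t * F ?x) * \<omega> c0 ?x (X ?x) v + \<omega> c0 ?x (JTh (- a t) (- b t) (?T ?x) ?w) v"
        by (simp add: interior_prod_def vel bilinear_ladd[OF B] bilinear_lmul[OF B])
      also have "\<omega> c0 ?x (X ?x) v = DF ?x v" by (rule X_F[OF p0(2)])
      also have "\<omega> c0 ?x (JTh (- a t) (- b t) (?T ?x) ?w) v = \<omega> c0 (?T ?x) ?w ?u"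
        using Th_symplectic[OF small'[OF t] z, of ?w ?u] by (simp add: TiT JTh_inverse[OF small[OF t]])
      also have "\<dots> = ext_d0 (scalar_rep (U t)) c0 (?T ?x) ?u + H t c0 (?T ?x) ?u"
        using Phi_equation[OF t c0 ballR_cimg[OF z], of ?u] by (simp add: interior_prod_def)
      finally show "interior_prod (velocity Psi t) \<omega> c0 ?x v = ext_d0 (scalar_rep (V t)) c0 ?x v + H t c0 ?x v"
        by (simp add: ext_d0_V_inside[OF t p0(2)] algebra_simps)
    qed
  next
    case False
    then have out: "p \<notin> Kq" using Kq_Bq by blast
    have y': "\<Phi> t q = p" unfolding y using Tm_outside[OF small[OF t] out] by (simp add: theta_def)
    have zc: "((\<lambda>s. cmap c (\<Phi> s q)) has_vector_derivative velocity \<Phi> t c x) (at t within {0..1})"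
      using velocity_has_derivative[OF Phi_path t c injPhi, of q] p by (simp add: y')
    obtain d where d: "0 < d" "\<And>s. s \<in> {0..1} \<Longrightarrow> dist s t < d \<Longrightarrow> \<Phi> s q \<in> - Kq"
      using path_curve[OF Phi_path t c open_Kq, of q] out y' by auto
    have "((\<lambda>s. cmap c (Psi s q)) has_vector_derivative velocity \<Phi> t c x) (at t within {0..1})"
    proof (rule has_vector_derivative_transform_within[OF zc d(1) t])
      fix s assume s: "s \<in> {0..1}" "dist s t < d"
      then show "cmap c (\<Phi> s q) = cmap c (Psi s q)"
        using Tm_outside[OF small'[OF s(1)], of "\<Phi> s q"] d(2)[OF s] by (simp add: Psi_eq[OF s(1)])
    qed
    then have "velocity Psi t c x = velocity \<Phi> t c x"
      by (rule velocity_eqI[where f = Psi and q = q, OF _ t injP]) (simp add: q p_def)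
    then show ?thesis
      using Phi_equation[OF t c x, of v] ext_d0_V_outside[OF t c p(1) out, of v] by (simp add: interior_prod_def p(2))
  qed
qed

lemma Psi_generates: "generates A \<omega> g (V, H) Psi"
proof -
  have "ext_d1 (interior_prod (velocity Psi t) \<omega>) c x u v = 0" if t: "t \<in> {0..1}" and c: "c \<in> A" "x \<in> cimg c" for t c x u v
    using ext_d1_exact_plus[where \<alpha> = "interior_prod (velocity Psi t) \<omega>",
        OF family_smooth_fun[OF V_family t] H_form[OF t] c Psi_equation[OF t c(1)]] H_closed[OF t c] by simp
  moreover have "Psi 0 = id"
    by (simp add: isotopy_comp_def isotopy_inv_def theta_0 Phi_0)
  ultimately have "symplectic_isotopy A \<omega> Psi"
    using Psi_path Psi_diffeo by (simp add: symplectic_isotopy_def)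
  then show ?thesis
    using V_family H_family H_harmonic V_mean Psi_equation by (simp add: generates_def)
qed

end

section \<open>Small loops\<close>

lemma osc_le:
  assumes "\<And>p q. f p - f q \<le> C" shows "osc f \<le> C"
proof -
  have "f p - C \<le> (INF q. f q)" for p
    using assms[of p] by (intro cINF_greatest) (auto simp: algebra_simps)
  then have "f p \<le> (INF q. f q) + C" for p by (simp add: algebra_simps)
  then have "(SUP p. f p) \<le> (INF q. f q) + C" by (intro cSUP_least) auto
  then show ?thesis by (simp add: osc_def)
qed

lemma osc_zero_imp_constant:
  assumes "bounded (range f)" "osc f = 0" shows "f p = f q"
proof -
  have b: "bdd_above (range f)" "bdd_below (range f)"
    using assms(1) by (auto simp: bounded_imp_bdd_above bounded_imp_bdd_below)
  have "f p \<le> (SUP p. f p)" "(INF p. f p) \<le> f p" for p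
    using cSUP_upper[OF UNIV_I b(1)] cINF_lower[OF b(2) UNIV_I] by auto
  from this[of p] this[of q] show ?thesis using assms(2) by (simp add: osc_def)
qed

lemma Cinf_imp_differentiable_on: "Cinf S f \<Longrightarrow> f differentiable_on S"
  unfolding differentiable_on_def using Cinf_derivative differentiableI by blast

text \<open>The antiderivative of the speed \<open>l * cis (2 * pi * t)\<close> that vanishes at
  time 0. It is linear in \<open>l\<close>, so all loops form one smooth family around the constant
  loop \<open>l = 0\<close>.\<close>

definition loop :: "complex \<Rightarrow> real \<Rightarrow> complex" where
  "loop l t = l * (cis (2 * pi * t) - 1) * inverse (2 * pi * \<i>)"

lemma loop_0: "loop l 0 = 0" and loop_1: "loop l 1 = 0" and loop_zero: "loop 0 t = 0"
  by (simp_all add: loop_def cis.ctr complex_eq_iff)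

lemma loop_smooth: "Cinf S l \<Longrightarrow> Cinf S t \<Longrightarrow> Cinf S (\<lambda>x. loop (l x) (t x))"
  unfolding Cinf_def loop_def by (intro allI Ck_mult Ck_diff Ck_cis Ck_const) auto

lemma loop_speed_smooth: "Cinf S l \<Longrightarrow> Cinf S t \<Longrightarrow> Cinf S (\<lambda>x. l x * cis (2 * pi * t x))"
  unfolding Cinf_def by (intro allI Ck_mult Ck_cis Ck_const) auto

lemma Cinf_Re: "Cinf S f \<Longrightarrow> Cinf S (\<lambda>x. Re (f x))" and Cinf_Im: "Cinf S f \<Longrightarrow> Cinf S (\<lambda>x. Im (f x))"
  unfolding Cinf_def by (auto intro: Ck_bounded_linear[OF bounded_linear_Re] Ck_bounded_linear[OF bounded_linear_Im])

lemma loop_derivative: "(loop l has_vector_derivative l * cis (2 * pi * t)) (at t within S)"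
proof -
  have "((\<lambda>t. cis (2 * pi * t)) has_vector_derivative (2 * pi) *\<^sub>R (\<i> * cis (2 * pi * t))) (at t within S)"
    unfolding has_vector_derivative_def by (auto intro!: derivative_eq_intros)
  then have "((\<lambda>t. (l * inverse (2 * pi * \<i>)) * (cis (2 * pi * t) - 1)) has_vector_derivative
      (l * inverse (2 * pi * \<i>)) * ((2 * pi) *\<^sub>R (\<i> * cis (2 * pi * t)))) (at t within S)"
    by (intro has_vector_derivative_mult_right) (simp add: has_vector_derivative_diff_const)
  moreover have "(l * inverse (2 * pi * \<i>)) * ((2 * pi) *\<^sub>R (\<i> * cis (2 * pi * t))) = l * cis (2 * pi * t)"
    by (simp add: scaleR_conv_of_real field_simps)
  ultimately show ?thesis by (simp add: loop_def[abs_def] mult_ac)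
qed

lemma loop_components:
  "((\<lambda>t. Re (loop l t)) has_real_derivative Re (l * cis (2 * pi * t))) (at t within S)"
  "((\<lambda>t. Im (loop l t)) has_real_derivative Im (l * cis (2 * pi * t))) (at t within S)"
  using bounded_linear.has_vector_derivative[OF bounded_linear_Re loop_derivative]
    bounded_linear.has_vector_derivative[OF bounded_linear_Im loop_derivative]
  by (auto simp: has_real_derivative_iff_has_vector_derivative)

text \<open>A chord of the unit circle has length at most 2, and
  \<open>2 / (2 * pi) \<le> 1/2\<close>; each coordinate is bounded by the modulus. Thus the curve
  stays in the region where \<open>Th\<close> has its good properties.\<close>

lemma loop_small:
  assumes "norm l \<le> 1" shows "\<bar>Re (loop l t)\<bar> + \<bar>Im (loop l t)\<bar> \<le> 1"
proof -
  have "norm (cis (2 * pi * t) - 1) \<le> 2"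
    using norm_triangle_ineq4[of "cis (2 * pi * t)" 1] by simp
  then have "norm (loop l t) \<le> 1 * 2 * inverse (2 * pi)"
    unfolding loop_def norm_mult using assms by (intro mult_mono) (auto simp: norm_inverse norm_mult)
  also have "\<dots> \<le> 1/2" using pi_gt3 by (simp add: field_simps)
  finally show ?thesis using abs_Re_le_cmod[of "loop l t"] abs_Im_le_cmod[of "loop l t"] by linarith
qed

lemma avoid_curves:
  assumes "Cinf {0..1} m1" "Cinf {0..1} m2" "0 < d"
  shows "\<exists>l::complex. norm l < d \<and> (\<forall>t\<in>{0..1}. l * cis (2 * pi * t) \<noteq> m1 t \<and> l * cis (2 * pi * t) \<noteq> m2 t)"
proof -
  \<comment> \<open>The speed is rotated back: if it hits \<open>m t\<close> at time
    \<open>t\<close>, then \<open>l\<close> itself lies on this curve. Being the image of an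
    interval in the plane, the curve is negligible.\<close>
  let ?\<gamma> = "\<lambda>m t. m t * cis (2 * pi * (- t))"
  have neg: "negligible (?\<gamma> m ` {0..1})" if m: "Cinf {0..1} m" for m
  proof (rule negligible_differentiable_image_lowdim)
    have "Cinf {0..1} (\<lambda>t. - t :: real)" by (simp add: Cinf_def Ck_minus Ck_id)
    then show "?\<gamma> m differentiable_on {0..1}"
      by (intro Cinf_imp_differentiable_on loop_speed_smooth m)
  qed simp
  have "\<not> negligible (ball (0::complex) d)" using assms(3) by (intro open_not_negligible) auto
  then have "\<not> ball 0 d \<subseteq> ?\<gamma> m1 ` {0..1} \<union> ?\<gamma> m2 ` {0..1}"
    using negligible_subset negligible_Un neg assms by metis
  then obtain l where l: "l \<in> ball 0 d" "l \<notin> ?\<gamma> m1 ` {0..1}" "l \<notin> ?\<gamma> m2 ` {0..1}" by blast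
  have "l = ?\<gamma> m t" if "l * cis (2 * pi * t) = m t" for m t
    by (simp add: that[symmetric] mult.assoc cis_mult)
  then have "\<forall>t\<in>{0..1}. l * cis (2 * pi * t) \<noteq> m1 t \<and> l * cis (2 * pi * t) \<noteq> m2 t" using l(2,3) by blast
  moreover have "norm l < d" using l(1) by simp
  ultimately show ?thesis by blast
qed

section \<open>Convergence in the smooth topology\<close>

context hamiltonian_flow begin

definition loop_path :: "complex \<Rightarrow> real \<Rightarrow> 'm \<Rightarrow> 'm" where
  "loop_path l t = Tm (Re (loop l t)) (Im (loop l t))"

lemma loop_hamiltonian_path:
  assumes "norm l \<le> 1"
  shows "hamiltonian_path A \<omega> n c0 x0 \<rho> R F X \<phi> J (\<lambda>t. Re (loop l t)) (\<lambda>t. Im (loop l t))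
    (\<lambda>t. Re (l * cis (2 * pi * t))) (\<lambda>t. Im (l * cis (2 * pi * t)))"
proof unfold_locales
  show "Re (loop l 0) = 0" "Im (loop l 0) = 0" by (simp_all add: loop_0)
qed (intro Cinf_Re Cinf_Im loop_smooth loop_speed_smooth Cinf_const Cinf_ident loop_small[OF assms] loop_components)+

lemma loop_path_0: "loop_path 0 = (\<lambda>t. id)"
  by (auto simp: loop_path_def loop_zero fun_eq_iff)

lemma smooth_path_loop_path: "norm l \<le> 1 \<Longrightarrow> smooth_path A (loop_path l)"
  unfolding loop_path_def[abs_def] by (intro smooth_path_Tm Cinf_Re Cinf_Im loop_smooth Cinf_const Cinf_ident loop_small)

text \<open>The parameter \<open>l\<close> is made an honest variable. Convergence of the loops to
  the identity with all derivatives then becomes continuity of the derivatives of a single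
  map.\<close>

lemma loop_path_joint:
  assumes c: "c \<in> A"
  shows "msmooth (ball 0 1 \<times> {0..1} \<times> cimg c) (\<lambda>q. loop_path (fst q) (fst (snd q)) (cinv c (snd (snd q))))"
    and "thick (ball (0::complex) 1 \<times> {0..1::real} \<times> cimg c)"
proof -
  show thick: "thick (ball (0::complex) 1 \<times> {0..1::real} \<times> cimg c)"
    by (intro thick_Times thick_open thick_cylinder[OF c]) simp
  have s: "Cinf S (\<lambda>q. fst q)" "Cinf S (\<lambda>q. fst (snd q))" "Cinf S (\<lambda>q. snd (snd q))"
    for S :: "(complex \<times> real \<times> (real^'n)) set"
    by (auto simp: Cinf_def intro!: Ck_fst Ck_snd Ck_id)
  show "msmooth (ball 0 1 \<times> {0..1} \<times> cimg c) (\<lambda>q. loop_path (fst q) (fst (snd q)) (cinv c (snd (snd q))))"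
    unfolding loop_path_def
    by (intro msmooth_Tm thick msmooth_chart c s Cinf_Re Cinf_Im loop_smooth loop_small) auto
qed

lemma path_dom_eq: "path_dom f c c' = {q \<in> {0..1} \<times> cimg c. f (fst q) (cinv c (snd q)) \<in> cdom c'}"
  and path_rep_eq: "path_rep f c c' = (\<lambda>q. cmap c' (f (fst q) (cinv c (snd q))))"
  by (auto simp: path_dom_def path_rep_def)

text \<open>The pairs \<open>(l, z)\<close> for which the loop lands in the target chart and its
  derivative is close to that of \<open>f\<close> form a relatively open set containing
  \<open>{0} \<times> K\<close>. Compactness of \<open>K\<close> gives one neighbourhood of
  \<open>l = 0\<close> that works for all \<open>z\<close>. The centre \<open>f\<close> of the basic
  set is arbitrary; only its closeness to the identity path is used.\<close>

lemma loop_path_derivatives_close: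
  assumes f: "smooth_path A f" and c: "c \<in> A" "c' \<in> A" and K: "compact K" "K \<subseteq> {0..1} \<times> cimg c"
    and fK: "K \<subseteq> path_dom f c c'" and idK: "K \<subseteq> path_dom (\<lambda>t. id) c c'" and e: "0 < e"
    and close: "\<And>z. z \<in> K \<Longrightarrow> norm (nder (path_rep (\<lambda>t. id) c c') (path_dom (\<lambda>t. id) c c') vs z -
      nder (path_rep f c c') (path_dom f c c') vs z) < e"
  shows "\<forall>\<^sub>F l in nhds 0. \<forall>z\<in>K. z \<in> path_dom (loop_path l) c c' \<and>
    norm (nder (path_rep (loop_path l) c c') (path_dom (loop_path l) c c') vs z - nder (path_rep f c c') (path_dom f c c') vs z) < e"
proof -
  let ?P = "ball (0::complex) 1 \<times> {0..1::real} \<times> cimg c"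
  let ?\<psi> = "\<lambda>q. loop_path (fst q) (fst (snd q)) (cinv c (snd (snd q)))"
  define D where "D = {q \<in> ?P. ?\<psi> q \<in> cdom c'}"
  define Rr where "Rr = (\<lambda>q. cmap c' (?\<psi> q))"
  note ps = loop_path_joint[OF c(1)]
  have D_thick: "thick D" unfolding D_def
    by (rule thick_preimage[OF ps(2) msmooth_continuous[OF ps(1)] open_cdom[OF c(2)]])
  have D_smooth: "Cinf D Rr" unfolding D_def Rr_def by (rule msmooth_Cinf[OF ps(1) c(2)])
  have slice: "nder (path_rep (loop_path l) c c') (path_dom (loop_path l) c c') vs z = nder Rr D (map (Pair 0) vs) (l, z)"
    if "norm l < 1" "z \<in> path_dom (loop_path l) c c'" for l z
  proof -
    have dom: "path_dom (loop_path l) c c' = {z. (l, z) \<in> D}" using that(1) by (auto simp: path_dom_eq D_def)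
    have rep: "path_rep (loop_path l) c c' = (\<lambda>z. Rr (l, z))" by (simp add: path_rep_eq Rr_def)
    have "msmooth ({0..1} \<times> cimg c) (\<lambda>q. loop_path l (fst q) (cinv c (snd q)))"
      using smooth_path_loop_path[of l] that(1) c(1) by (simp add: smooth_path_iff)
    from thick_preimage[OF thick_cylinder[OF c(1)] msmooth_continuous[OF this] open_cdom[OF c(2)]]
    have "thick {z. (l, z) \<in> D}" unfolding dom[symmetric] path_dom_eq .
    from nder_slice[OF D_thick D_smooth this] show ?thesis
      unfolding dom rep using that(2) dom by auto
  qed
  let ?G = "\<lambda>q. nder Rr D (map (Pair 0) vs) q - nder (path_rep f c c') (path_dom f c c') vs (snd q)"
  let ?P' = "ball (0::complex) 1 \<times> K" and ?D' = "{q \<in> ball (0::complex) 1 \<times> K. ?\<psi> q \<in> cdom c'}"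
  have sub: "?P' \<subseteq> ?P" using K(2) by auto
  have cont: "continuous_on ?P' ?\<psi>" by (rule continuous_on_subset[OF msmooth_continuous[OF ps(1)] sub])
  have "continuous_on ?D' (nder Rr D (map (Pair 0) vs))"
  proof (rule continuous_on_subset[OF Ck_continuous])
    show "Ck 0 D (nder Rr D (map (Pair 0) vs))"
      using D_smooth unfolding Cinf_def by (intro Ck_nder D_thick) blast
  qed (use sub in \<open>auto simp: D_def\<close>)
  moreover have "continuous_on ?D' (\<lambda>q. nder (path_rep f c c') (path_dom f c c') vs (snd q))"
  proof (rule continuous_on_compose2[where t = "path_dom f c c'"])
    have "smooth_on (path_dom f c c') (path_rep f c c')" using f c by (simp add: smooth_path_def)
    then show "continuous_on (path_dom f c c') (nder (path_rep f c c') (path_dom f c c') vs)"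
      unfolding smooth_on_def by (intro differentiable_imp_continuous_on) blast
  qed (use fK in \<open>auto intro!: continuous_intros\<close>)
  ultimately have Gc: "continuous_on ?D' ?G" by (rule continuous_on_diff)
  obtain T1 where T1: "open T1" "?D' = ?P' \<inter> T1" using relative_open_preimage[OF cont open_cdom[OF c(2)]] by blast
  obtain T2 where T2: "open T2" "{q \<in> ?D'. ?G q \<in> ball 0 e} = ?D' \<inter> T2"
    using relative_open_preimage[OF Gc open_ball] by blast
  \<comment> \<open>At \<open>l = 0\<close> the loop is the identity path, for which both conditions
    hold by assumption.\<close>
  have "{0} \<times> K \<subseteq> T1 \<inter> T2"
  proof
    fix q :: "complex \<times> real \<times> (real^'n)" assume "q \<in> {0} \<times> K"
    then obtain z where q: "q = (0, z)" and z: "z \<in> K" by auto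
    have zd: "z \<in> path_dom (loop_path 0) c c'" using idK z by (auto simp: loop_path_0)
    then have "(0, z) \<in> ?D'" using z by (auto simp: path_dom_eq)
    moreover have "?G (0, z) \<in> ball 0 e"
      using close[OF z] slice[of 0 z] zd by (simp add: loop_path_0 dist_norm norm_minus_commute)
    ultimately show "q \<in> T1 \<inter> T2" using T1(2) T2(2) q by blast
  qed
  from Elementary_Topology.tube_lemma[OF K(1) open_Int[OF T1(1) T2(1)] this]
  obtain X0 where X0: "0 \<in> X0" "open X0" "X0 \<times> K \<subseteq> T1 \<inter> T2" by blast
  show ?thesis unfolding eventually_nhds
  proof (intro exI[of _ "X0 \<inter> ball 0 1"] conjI ballI)
    fix l z assume l: "l \<in> X0 \<inter> ball 0 1" and z: "z \<in> K"
    then have "(l, z) \<in> ?P' \<inter> T1" "(l, z) \<in> T2" using X0(3) by auto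
    then have d: "(l, z) \<in> ?D'" and g: "?G (l, z) \<in> ball 0 e" using T1(2) T2(2) by blast+
    have zd: "z \<in> path_dom (loop_path l) c c'" using d K(2) by (auto simp: path_dom_eq)
    then show "z \<in> path_dom (loop_path l) c c'" .
    show "norm (nder (path_rep (loop_path l) c c') (path_dom (loop_path l) c c') vs z - nder (path_rep f c c') (path_dom f c c') vs z) < e"
      using g slice[OF _ zd] l by (simp add: dist_norm norm_minus_commute)
  qed (use X0 in auto)
qed

lemma norm_le_1_eventually: "\<forall>\<^sub>F l in nhds (0::complex). norm l \<le> 1"
  unfolding eventually_nhds by (intro exI[of _ "ball 0 1"]) auto

text \<open>Membership asks for strict inequalities on a compact set and for finitely many lists of
  basis directions of bounded length. Each list is settled by
  \<open>loop_path_derivatives_close\<close>, and finitely many eventual statements hold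
  simultaneously.\<close>

lemma loop_path_in_cinf_basic:
  assumes f: "smooth_path A f" and c: "c \<in> A" "c' \<in> A" and K: "compact K" "K \<subseteq> {0..1} \<times> cdom c"
    and fK: "\<forall>(t, p)\<in>K. f t p \<in> cdom c'" and e: "0 < e" and id: "(\<lambda>t. id) \<in> cinf_basic A f c c' K k e"
  shows "\<forall>\<^sub>F l in nhds 0. loop_path l \<in> cinf_basic A f c c' K k e"
proof -
  let ?K = "(\<lambda>q. (fst q, cmap c (snd q))) ` K"
  have Kc: "compact ?K"
  proof (intro compact_continuous_image K continuous_on_Pair)
    show "continuous_on K (\<lambda>q. fst q)" by (intro continuous_intros)
    show "continuous_on K (\<lambda>q. cmap c (snd q))"
      by (rule continuous_on_compose2[OF cmap_cont[OF c(1)] continuous_on_snd[OF continuous_on_id]]) (use K in auto)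
  qed
  have Ksub: "?K \<subseteq> {0..1} \<times> cimg c" using K(2) by (auto simp: cmap_cimg)
  have inv: "cinv c (cmap c p) = p" if "(t, p) \<in> K" for t p by (rule cinv_cmap[OF c(1)]) (use subsetD[OF K(2) that] in simp)
  have dom: "(t, cmap c p) \<in> path_dom h c c' \<longleftrightarrow> h t p \<in> cdom c'" if "(t, p) \<in> K" for h t p
  proof -
    have "(t, cmap c p) \<in> {0..1} \<times> cimg c" using that Ksub by force
    then show ?thesis using inv[OF that] by (simp add: path_dom_eq)
  qed
  have fK': "?K \<subseteq> path_dom f c c'" using fK by (auto simp: dom)
  have id1: "\<And>t p. (t, p) \<in> K \<Longrightarrow> p \<in> cdom c'"
    and id2: "\<And>t p vs. (t, p) \<in> K \<Longrightarrow> set vs \<subseteq> Basis \<Longrightarrow> length vs \<le> k \<Longrightarrow>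
      norm (nder (path_rep (\<lambda>t. id) c c') (path_dom (\<lambda>t. id) c c') vs (t, cmap c p) -
        nder (path_rep f c c') (path_dom f c c') vs (t, cmap c p)) < e"
    using id by (auto simp: cinf_basic_def)
  have idK: "?K \<subseteq> path_dom (\<lambda>t. id) c c'" using id1 by (auto simp: dom)
  let ?L = "{vs :: (real \<times> (real^'n)) list. set vs \<subseteq> Basis \<and> length vs \<le> k}"
  have "finite ?L" by (rule finite_lists_length_le) simp
  then have "\<forall>\<^sub>F l in nhds 0. \<forall>vs\<in>?L. \<forall>z\<in>?K. z \<in> path_dom (loop_path l) c c' \<and>
    norm (nder (path_rep (loop_path l) c c') (path_dom (loop_path l) c c') vs z - nder (path_rep f c c') (path_dom f c c') vs z) < e"
    by (intro eventually_ball_finite ballI loop_path_derivatives_close[OF f c Kc Ksub fK' idK e]) (use id2 in auto)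
  with norm_le_1_eventually show ?thesis
  proof eventually_elim
    case (elim l)
    have "loop_path l t p \<in> cdom c'" if "(t, p) \<in> K" for t p
    proof -
      have "(t, cmap c p) \<in> ?K" using that by force
      \<comment> \<open>The empty list has admissible length for every \<open>k\<close>, so it
        always provides the condition that the loop stays in the target chart.\<close>
      moreover have "[] \<in> ?L" by simp
      ultimately have "(t, cmap c p) \<in> path_dom (loop_path l) c c'" using elim(2) by blast
      then show ?thesis using dom[OF that] by simp
    qed
    moreover have "norm (nder (path_rep (loop_path l) c c') (path_dom (loop_path l) c c') vs (t, cmap c p) -
        nder (path_rep f c c') (path_dom f c c') vs (t, cmap c p)) < e"
      if "(t, p) \<in> K" "set vs \<subseteq> Basis" "length vs \<le> k" for t p vs
    proof -
      have "(t, cmap c p) \<in> ?K" using that(1) by force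
      moreover have "vs \<in> ?L" using that by simp
      ultimately show ?thesis using elim(2) by blast
    qed
    ultimately show ?case using smooth_path_loop_path[OF elim(1)] by (auto simp: cinf_basic_def)
  qed
qed

text \<open>Induction over the generation of open sets: the subbasic case is
  \<open>loop_path_in_cinf_basic\<close>, and an eventual statement survives binary intersections
  and arbitrary unions.\<close>

lemma loop_path_eventually_in:
  assumes "openin (cinf_topology A) N" "(\<lambda>t. id) \<in> N"
  shows "\<forall>\<^sub>F l in nhds 0. loop_path l \<in> N"
proof -
  let ?B = "{cinf_basic A f c c' K k e | f c c' K k e.
        smooth_path A f \<and> c \<in> A \<and> c' \<in> A \<and> compact K \<and> K \<subseteq> {0..1} \<times> cdom c \<and>
        (\<forall>(t, p)\<in>K. f t p \<in> cdom c') \<and> 0 < e}"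
  have "generate_topology_on ?B N"
    using assms(1) unfolding cinf_topology_def openin_topology_generated_by_iff .
  then show ?thesis using assms(2)
  proof (induction rule: generate_topology_on.induct)
    case (Int S T)
    then show ?case by (auto intro: eventually_conj)
  next
    case (UN C)
    from UN.prems obtain S where S: "S \<in> C" "(\<lambda>t. id) \<in> S" by (rule UnionE)
    show ?case by (rule eventually_mono[OF UN.IH[OF S]]) (use S(1) in blast)
  next
    case (Basis S)
    then show ?case using loop_path_in_cinf_basic by blast
  qed simp
qed

lemma DF_Th: "\<bar>a\<bar> + \<bar>b\<bar> \<le> 1 \<Longrightarrow> DF (Th a b x) (JTh a b x v) = DF x v"
proof -
  assume ab: "\<bar>a\<bar> + \<bar>b\<bar> \<le> 1"
  from has_derivative_compose[OF Th_has_derivative[OF ab] F_deriv]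
  have "(F has_derivative (\<lambda>v. DF (Th a b x) (JTh a b x v))) (at x)" by (simp add: F_Th[OF ab])
  from has_derivative_unique[OF this F_deriv] show ?thesis by (rule fun_cong)
qed

text \<open>The normalising constants cancel in differences of values, and both \<open>Fm\<close>
  and its square range in the unit interval.\<close>

lemma ham_osc: "osc (ham \<alpha> \<beta>) \<le> \<bar>\<alpha>\<bar> + \<bar>\<beta>\<bar>"
proof (rule osc_le)
  fix p q
  have sq: "0 \<le> (Fm p)\<^sup>2" "(Fm p)\<^sup>2 \<le> 1" for p using Fm_bounds[of p] by (auto simp: power_le_one)
  have "ham \<alpha> \<beta> p - ham \<alpha> \<beta> q = \<alpha> * (Fm p - Fm q) + \<beta> * (((Fm p)\<^sup>2 - (Fm q)\<^sup>2) / 2)"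
    by (simp add: ham_def algebra_simps diff_divide_distrib)
  also have "\<dots> \<le> \<bar>\<alpha> * (Fm p - Fm q)\<bar> + \<bar>\<beta> * (((Fm p)\<^sup>2 - (Fm q)\<^sup>2) / 2)\<bar>"
    by linarith
  also have "\<dots> \<le> \<bar>\<alpha>\<bar> * 1 + \<bar>\<beta>\<bar> * 1"
  proof -
    have "\<bar>Fm p - Fm q\<bar> \<le> 1" "\<bar>(Fm p)\<^sup>2 - (Fm q)\<^sup>2\<bar> \<le> 1"
      using Fm_bounds[of p] Fm_bounds[of q] sq[of p] sq[of q] by linarith+
    then have "\<bar>Fm p - Fm q\<bar> \<le> 1" "\<bar>((Fm p)\<^sup>2 - (Fm q)\<^sup>2) / 2\<bar> \<le> 1" by (simp_all add: abs_divide)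
    then show ?thesis unfolding abs_mult by (intro add_mono mult_left_mono) auto
  qed
  finally show "ham \<alpha> \<beta> p - ham \<alpha> \<beta> q \<le> \<bar>\<alpha>\<bar> + \<bar>\<beta>\<bar>" by simp
qed

end

section \<open>Tests for nonzero oscillation and nonzero velocity\<close>

context composed_isotopy begin

text \<open>Zero oscillation would make \<open>U t\<close> and \<open>r t\<close> differ by a
  constant and hence have equal differentials; a single point and direction where the differentials
  differ rules this out.\<close>

lemma osc_nonzero:
  assumes t: "t \<in> {0..1}" and y: "y \<in> ball x0 R"
    and ne: "ext_d0 (scalar_rep (U t)) c0 y v \<noteq> (a' t + b' t * F y) * DF y v"
  shows "osc (\<lambda>p. - r t p + U t p) \<noteq> 0"
proof
  let ?f = "\<lambda>p. - r t p + U t p"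
  assume 0: "osc ?f = 0"
  note Us = family_smooth_fun[OF U_family t] and rs = family_smooth_fun[OF family_r t]
  have "continuous_on UNIV ?f"
    by (intro continuous_intros smooth_fun_continuous[OF Us] smooth_fun_continuous[OF rs])
  then have "bounded (range ?f)" by (intro compact_imp_bounded compact_continuous_image compact_UNIV)
  from osc_zero_imp_constant[OF this 0] have const: "?f p = ?f q" for p q .
  obtain k where k: "\<And>p. U t p = r t p + k"
  proof
    fix p show "U t p = r t p + ?f undefined" using const[of p undefined] by simp
  qed
  note yc = ballR_cimg[OF y]
  have "((\<lambda>x. r t (cinv c0 x) + k) has_derivative (\<lambda>v. ext_d0 (scalar_rep (r t)) c0 y v + 0)) (at y)"
    by (intro has_derivative_add has_derivative_const smooth_fun_derivative[OF rs c0 yc])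
  then have "((\<lambda>x. U t (cinv c0 x)) has_derivative (\<lambda>v. ext_d0 (scalar_rep (r t)) c0 y v)) (at y)"
    by (simp add: k)
  from has_derivative_unique[OF smooth_fun_derivative[OF Us c0 yc] this]
  have "ext_d0 (scalar_rep (U t)) c0 y v = ext_d0 (scalar_rep (r t)) c0 y v" by (rule fun_cong)
  then show False using ne ext_d0_ham[OF y] by (simp add: r_def)
qed

text \<open>The velocity is tested at the preimage of \<open>y\<close> under the loop, with the
  preimage of the direction \<open>v\<close>. There the pullbacks in the differential of
  \<open>V\<close> undo themselves, the correction term cancels the bare \<open>H t\<close>, and the
  value is \<open>dU + H - dr\<close> at \<open>y\<close>, evaluated on \<open>v\<close>.\<close>

lemma regular:
  assumes ne: "\<And>t. t \<in> {0..1} \<Longrightarrow> \<exists>y v. y \<in> ball x0 R \<and>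
      ext_d0 (scalar_rep (U t)) c0 y v + H t c0 y v \<noteq> (a' t + b' t * F y) * DF y v"
    and \<Psi>: "generates A \<omega> g (V, H) \<Psi>"
  shows "regular_isotopy A \<Psi>"
  unfolding regular_isotopy_def
proof
  fix t :: real assume t: "t \<in> {0..1}"
  obtain y v where y: "y \<in> ball x0 R"
    and nv: "ext_d0 (scalar_rep (U t)) c0 y v + H t c0 y v \<noteq> (a' t + b' t * F y) * DF y v"
    using ne[OF t] by blast
  let ?x = "Th (- a t) (- b t) y" and ?u = "JTh (- a t) (- b t) y v"
  have x: "?x \<in> ball x0 R" using Th_ballR[OF small'[OF t]] y by simp
  have y': "Th (a t) (b t) ?x = y" using Th_inverse[OF small'[OF t], of y] by simp
  have v: "JTh (a t) (b t) ?x ?u = v" using JTh_inverse[OF small'[OF t], of y v] by simp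
  have "interior_prod (velocity \<Psi> t) \<omega> c0 ?x ?u = ext_d0 (scalar_rep (V t)) c0 ?x ?u + H t c0 ?x ?u"
    using \<Psi> t c0 ballR_cimg[OF x] by (simp add: generates_def)
  also have "\<dots> = ext_d0 (scalar_rep (U t)) c0 y v + H t c0 y v - (a' t + b' t * F y) * DF y v"
    using DF_Th[OF small'[OF t], of y v] by (simp add: ext_d0_V_inside[OF t x] y' v F_Th[OF small'[OF t]])
  also have "\<dots> \<noteq> 0" using nv by simp
  finally have "velocity \<Psi> t c0 ?x \<noteq> 0"
    using bilinear_lzero[OF omega_bilinear[OF c0 ballR_cimg[OF x]]] by (auto simp: interior_prod_def)
  then show "\<exists>c\<in>A. \<exists>x\<in>cimg c. velocity \<Psi> t c x \<noteq> 0" using c0 ballR_cimg[OF x] by blast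
qed

end

context symplectic_manifold begin

text \<open>The space derivative at a fixed point is the joint derivative in direction
  \<open>(0, v)\<close>, hence smooth in time up to the end points. This makes the forbidden speeds
  a smooth curve.\<close>

lemma ext_d0_time_smooth:
  assumes U: "smooth_function_family A U" and c: "c \<in> A" "y \<in> cimg c"
  shows "Cinf {0..1} (\<lambda>t. ext_d0 (scalar_rep (U t)) c y v)"
proof -
  let ?S = "{0..1::real} \<times> cimg c" and ?U = "\<lambda>q. U (fst q) (cinv c (snd q))"
  have Us: "Cinf ?S ?U" using U c(1) by (simp add: smooth_function_family_iff)
  have "Cinf {0..1} (\<lambda>t. frechet_derivative ?U (at (t, y) within ?S) (0, v))"
    by (rule Cinf_compose[OF Cinf_frechet[OF Us thick_cylinder[OF c(1)], of "(0, v)"] Cinf_Pair[OF Cinf_ident Cinf_const]])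
      (use c in auto)
  then show ?thesis
  proof (rule Cinf_cong)
    fix t :: real assume t: "t \<in> {0..1}"
    have "((\<lambda>x. ?U (t, x)) has_derivative (\<lambda>v. frechet_derivative ?U (at (t, y) within ?S) (0, v))) (at y within cimg c)"
    proof (rule has_derivative_in_compose[of "Pair t" "Pair 0"])
      show "(Pair t has_derivative Pair 0) (at y within cimg c)"
        by (intro has_derivative_Pair has_derivative_const has_derivative_ident)
      show "(?U has_derivative frechet_derivative ?U (at (t, y) within ?S)) (at (t, y) within Pair t ` cimg c)"
        by (rule has_derivative_subset[OF Cinf_derivative[OF Us]]) (use t c in auto)
    qed
    then have d: "((\<lambda>x. U t (cinv c x)) has_derivative (\<lambda>v. frechet_derivative ?U (at (t, y) within ?S) (0, v))) (at y)"
      using at_within_open[OF c(2) open_cimg[OF c(1)]] by simp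
    from has_derivative_unique[OF d smooth_fun_derivative[OF family_smooth_fun[OF U t] c]]
    show "frechet_derivative ?U (at (t, y) within ?S) (0, v) = ext_d0 (scalar_rep (U t)) c y v" by (rule fun_cong)
  qed
qed

lemma form_time_smooth:
  assumes H: "smooth_form_family A H" and c: "c \<in> A" "y \<in> cimg c"
  shows "Cinf {0..1} (\<lambda>t. H t c y v)"
proof -
  have "Cinf ({0..1} \<times> cimg c) (\<lambda>q. H (fst q) c (snd q) v)"
    using H c(1) unfolding smooth_form_family_def case_prod_unfold by (blast intro: smooth_on_imp_Cinf)
  from Cinf_compose[OF this Cinf_Pair[OF Cinf_ident Cinf_const]] show ?thesis using c by auto
qed

text \<open>The unique speed \<open>(\<alpha>, \<beta>)\<close> for which \<open>\<alpha> + \<beta> * F1\<close> and \<open>\<alpha> + \<beta> * F2\<close> have prescribed values.\<close>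

definition bad_speed :: "real \<Rightarrow> real \<Rightarrow> real \<Rightarrow> real \<Rightarrow> complex" where
  "bad_speed F1 F2 u1 u2 =
    of_real (u1 - F1 * ((u1 - u2) * inverse (F1 - F2))) + \<i> * of_real ((u1 - u2) * inverse (F1 - F2))"

lemma bad_speed_eq:
  assumes "F1 \<noteq> F2" "Re z + Im z * F1 = u1" "Re z + Im z * F2 = u2"
  shows "z = bad_speed F1 F2 u1 u2"
proof -
  have "u1 - u2 = Im z * (F1 - F2)" using assms(2,3) by (simp add: algebra_simps)
  then have "(u1 - u2) * inverse (F1 - F2) = Im z" using assms(1) by simp
  then show ?thesis using assms(2) by (simp add: bad_speed_def complex_eq_iff algebra_simps)
qed

lemma bad_speed_smooth:
  assumes "Cinf S u1" "Cinf S u2" shows "Cinf S (\<lambda>t. bad_speed F1 F2 (u1 t * k1) (u2 t * k2))"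
  using assms unfolding Cinf_def bad_speed_def
  by (intro allI Ck_add Ck_mult Ck_diff Ck_const Ck_bounded_linear[OF bounded_linear_of_real]) auto

end

theorem mainTheorem4:
  fixes A :: "('m::{t2_space, second_countable_topology}, 'n::finite) chart set"
    and \<omega> g :: "('m, 'n) form2"
    and \<Phi> :: "real \<Rightarrow> 'm \<Rightarrow> 'm"
    and U :: "real \<Rightarrow> 'm \<Rightarrow> real"
    and H :: "real \<Rightarrow> ('m, 'n) form1"
    and n :: nat
  assumes "CARD('n) = 2 * n"
    and "closed_symplectic_manifold A \<omega>"
    and "riemannian_metric A g"
    and "generates A \<omega> g (U, H) \<Phi>"
  shows "\<forall>N \<epsilon>. openin (cinf_topology A) N \<and> (\<lambda>t. id) \<in> N \<and> \<epsilon> > 0 \<longrightarrow>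
    (\<exists>r \<theta>. hamiltonian_loop A \<omega> g r \<theta> \<and> \<theta> \<in> N \<and> hofer_norm r < \<epsilon> \<and>
      (\<forall>t\<in>{0..1}. osc (\<lambda>p. - r t p + U t p) \<noteq> 0) \<and>
      (let V = (\<lambda>t p. - r t (\<theta> t p) + U t (\<theta> t p) + Delta_normalized A \<omega> H \<theta> t p) in
        generates A \<omega> g (V, H) (isotopy_comp (isotopy_inv \<theta>) \<Phi>) \<and>
        (\<forall>\<Psi>. generates A \<omega> g (V, H) \<Psi> \<longrightarrow> regular_isotopy A \<Psi>)))"
proof (intro allI impI, elim conjE)
  fix N and \<epsilon> :: real assume N: "openin (cinf_topology A) N" "(\<lambda>t. id) \<in> N" and \<epsilon>: "0 < \<epsilon>"
  interpret symplectic_manifold A \<omega> n by unfold_locales (fact assms(1,2))+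
  obtain c0 where c0: "c0 \<in> A" "undefined \<in> cdom c0" using chart_at by blast
  define x0 where "x0 = cmap c0 undefined"
  obtain R where R: "0 < R" "ball x0 R \<subseteq> cimg c0"
    using open_contains_ball open_cimg[OF c0(1)] cmap_cimg[OF c0(2)] unfolding x0_def by blast
  define \<rho> where "\<rho> = R / 2"
  have \<rho>: "0 < \<rho>" "\<rho> < R" using R(1) by (auto simp: \<rho>_def)
  obtain \<kappa> X where \<kappa>: "0 < \<kappa>" "\<kappa> \<le> 1" and X: "Cinf UNIV X" "\<And>y z. norm (X y - X z) \<le> 1/2 * norm (y - z)"
    "\<And>x. x \<notin> ball x0 \<rho> \<Longrightarrow> X x = 0"
    "\<And>x v. x \<in> ball x0 R \<Longrightarrow> \<omega> c0 x (X x) v = \<kappa> * frechet_derivative (bump x0 \<rho>) (at x) v"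
    using hamiltonian_field[OF c0(1) \<rho> R(2)] by blast
  \<comment> \<open>The factor \<open>\<kappa>\<close> is part of the Hamiltonian, so that
    \<open>X\<close> is its field exactly.\<close>
  define F where "F x = \<kappa> * bump x0 \<rho> x" for x
  have DF: "frechet_derivative F (at x) v = \<kappa> * frechet_derivative (bump x0 \<rho>) (at x) v" for x v
  proof -
    have "(bump x0 \<rho> has_derivative frechet_derivative (bump x0 \<rho>) (at x)) (at x)"
      using bump_has_derivative differentiableI frechet_derivative_works by blast
    from frechet_derivative_at[OF has_derivative_mult_right[OF this, of \<kappa>], symmetric] show ?thesis
      by (simp add: F_def[abs_def])
  qed
  obtain \<phi> J where flow: "\<And>p. \<phi> 0 p = p" "\<And>p h. J 0 p h = h"
    "\<And>s p. s \<in> {-1..1} \<Longrightarrow> ((\<lambda>s. \<phi> s p) has_vector_derivative X (\<phi> s p)) (at s within {-1..1})"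
    "\<And>s p h. s \<in> {-1..1} \<Longrightarrow> ((\<lambda>s. J s p h) has_vector_derivative
        frechet_derivative X (at (\<phi> s p)) (J s p h)) (at s within {-1..1})"
    "\<And>s p. s \<in> {-1..1} \<Longrightarrow> ((\<lambda>(s, p). \<phi> s p) has_derivative (\<lambda>(k, h). k *\<^sub>R X (\<phi> s p) + J s p h))
        (at (s, p) within {-1..1} \<times> UNIV)"
    "Cinf ({-1..1} \<times> UNIV) (\<lambda>(s, p). \<phi> s p)"
    using smooth_flow_exists[OF X(1,2)] by blast
  interpret hamiltonian_flow A \<omega> n c0 x0 \<rho> R F X \<phi> J
  proof
    show "Cinf UNIV F" using bump_smooth[of UNIV x0 \<rho>] by (simp add: F_def[abs_def] Cinf_def Ck_mult Ck_const)
    show "0 \<le> F x" "F x \<le> 1" for x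
      using \<kappa> bump_bounds[of x0 \<rho> x] by (auto simp: F_def intro: mult_le_one)
    show "F x = 0" if "x \<notin> ball x0 \<rho>" for x using bump_outside[OF \<rho>(1) that] by (simp add: F_def)
    show "\<omega> c0 x (X x) v = frechet_derivative F (at x) v" if "x \<in> ball x0 R" for x v
      using X(4)[OF that] by (simp add: DF)
  qed (fact c0(1) \<rho> R(2) X(1-3) flow)+

  text \<open>The differential of \<open>\<alpha> * F + \<beta> * F\<^sup>2 / 2\<close> is \<open>(\<alpha> + \<beta> * F) * DF\<close>, so its values at two points
    on different levels of \<open>F\<close> with \<open>DF \<noteq> 0\<close> determine \<open>(\<alpha>, \<beta>)\<close>.\<close>
  define e :: "real^'n" where "e = axis undefined 1"
  have e: "norm e = 1" by (simp add: e_def)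
  \<comment> \<open>Two distinct radii strictly between 0 and \<open>\<rho>\<close>, where the bump
    function takes different values and its radial derivative does not vanish.\<close>
  define y1 y2 where "y1 = x0 + (\<rho> / 3) *\<^sub>R e" and "y2 = x0 + (\<rho> / 2) *\<^sub>R e"
  have y: "y1 \<in> ball x0 R" "y2 \<in> ball x0 R"
    using e \<rho> by (auto simp: y1_def y2_def dist_norm)
  have b1: "bump x0 \<rho> y1 = exp (- inverse (\<rho>\<^sup>2 - (\<rho> / 3)\<^sup>2))" "frechet_derivative (bump x0 \<rho>) (at y1) e \<noteq> 0"
    using bump_ray[OF e, of "\<rho> / 3" \<rho> x0] \<rho> by (auto simp: y1_def)
  have b2: "bump x0 \<rho> y2 = exp (- inverse (\<rho>\<^sup>2 - (\<rho> / 2)\<^sup>2))" "frechet_derivative (bump x0 \<rho>) (at y2) e \<noteq> 0"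
    using bump_ray[OF e, of "\<rho> / 2" \<rho> x0] \<rho> by (auto simp: y2_def)
  have DFy: "DF y1 e \<noteq> 0" "DF y2 e \<noteq> 0" using b1(2) b2(2) \<kappa> by (auto simp: DF)
  have Fy: "F y1 \<noteq> F y2"
  proof
    assume "F y1 = F y2"
    then have "\<rho>\<^sup>2 - (\<rho> / 3)\<^sup>2 = \<rho>\<^sup>2 - (\<rho> / 2)\<^sup>2" using \<kappa> b1(1) b2(1) by (simp add: F_def)
    then show False using \<rho>(1) by (simp add: power_divide)
  qed

  have gen': "smooth_function_family A U" "smooth_form_family A H" using assms(4) by (auto simp: generates_def)
  \<comment> \<open>\<open>?u\<close> gives the speeds at which the oscillation could vanish,
    \<open>?w\<close> those at which the composed isotopy could stand still. Both are values at the
    two test points in the radial direction.\<close>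
  let ?u = "\<lambda>y t. ext_d0 (scalar_rep (U t)) c0 y e" and ?w = "\<lambda>y t. ext_d0 (scalar_rep (U t)) c0 y e + H t c0 y e"
  have u_smooth: "Cinf {0..1} (?u y)" if "y \<in> ball x0 R" for y
    by (rule ext_d0_time_smooth[OF gen'(1) c0(1) ballR_cimg[OF that]])
  have w_smooth: "Cinf {0..1} (?w y)" if "y \<in> ball x0 R" for y
    using u_smooth[OF that] form_time_smooth[OF gen'(2) c0(1) ballR_cimg[OF that], of e]
    by (simp add: Cinf_def Ck_add)
  let ?m = "\<lambda>u t. bad_speed (F y1) (F y2) (u y1 t * inverse (DF y1 e)) (u y2 t * inverse (DF y2 e))"
  have m_smooth: "Cinf {0..1} (?m ?u)" "Cinf {0..1} (?m ?w)"
    by (rule bad_speed_smooth; rule u_smooth w_smooth; rule y)+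

  obtain d where d: "0 < d" "\<And>l. norm l < d \<Longrightarrow> loop_path l \<in> N"
    using loop_path_eventually_in[OF N] by (auto simp: eventually_nhds_metric dist_norm)
  \<comment> \<open>The bound \<open>d\<close> puts the loop into \<open>N\<close>, the bound 1
    keeps its flow times admissible, and \<open>\<epsilon> / 4\<close> is enough because the
    oscillation of \<open>r\<close> is at most \<open>2 * norm l\<close> at every time.\<close>
  obtain l where l: "norm l < min d (min 1 (\<epsilon> / 4))"
    and avoid: "\<And>t. t \<in> {0..1} \<Longrightarrow> l * cis (2 * pi * t) \<noteq> ?m ?u t \<and> l * cis (2 * pi * t) \<noteq> ?m ?w t"
    using avoid_curves[OF m_smooth, of "min d (min 1 (\<epsilon> / 4))"] d(1) \<epsilon> by auto
  let ?z = "\<lambda>t. l * cis (2 * pi * t)"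
  interpret P: hamiltonian_path A \<omega> n c0 x0 \<rho> R F X \<phi> J "\<lambda>t. Re (loop l t)" "\<lambda>t. Im (loop l t)" "\<lambda>t. Re (?z t)" "\<lambda>t. Im (?z t)"
    using l by (intro loop_hamiltonian_path) simp
  interpret P: composed_isotopy A \<omega> n c0 x0 \<rho> R F X \<phi> J "\<lambda>t. Re (loop l t)" "\<lambda>t. Im (loop l t)" "\<lambda>t. Re (?z t)" "\<lambda>t. Im (?z t)" g U H \<Phi>
    by unfold_locales (fact assms(4))
  have theta: "P.theta = loop_path l" by (auto simp: P.theta_def loop_path_def fun_eq_iff)
  have differ: "\<exists>y. y \<in> ball x0 R \<and> u y t \<noteq> (Re (?z t) + Im (?z t) * F y) * DF y e"
    if "?z t \<noteq> ?m u t" for u :: "real^'n \<Rightarrow> real \<Rightarrow> real" and t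
  proof (rule ccontr)
    assume "\<not> ?thesis"
    then have "u y1 t = (Re (?z t) + Im (?z t) * F y1) * DF y1 e" "u y2 t = (Re (?z t) + Im (?z t) * F y2) * DF y2 e"
      using y by auto
    then have "Re (?z t) + Im (?z t) * F y1 = u y1 t * inverse (DF y1 e)"
      "Re (?z t) + Im (?z t) * F y2 = u y2 t * inverse (DF y2 e)"
      using DFy by simp_all
    from bad_speed_eq[OF Fy this] that show False by simp
  qed
  have loop: "hamiltonian_loop A \<omega> g P.r P.theta"
    using P.theta_generates by (simp add: hamiltonian_loop_def P.theta_def loop_1 fun_eq_iff)
  have inN: "P.theta \<in> N" using d(2) l by (simp add: theta)
  have hofer: "hofer_norm P.r < \<epsilon>"
  \<comment> \<open>A function that is not integrable has integral 0 by convention, so the bound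
    holds in either case.\<close>
  proof (cases "(\<lambda>t. osc (P.r t)) integrable_on {0..1}")
    case True
    have "osc (P.r t) \<le> 2 * norm l" for t
    proof -
      have "norm (?z t) = norm l" by (simp add: norm_mult)
      moreover have "osc (P.r t) \<le> \<bar>Re (?z t)\<bar> + \<bar>Im (?z t)\<bar>" unfolding P.r_def by (rule ham_osc)
      ultimately show ?thesis using abs_Re_le_cmod[of "?z t"] abs_Im_le_cmod[of "?z t"] by linarith
    qed
    then have "integral {0..1} (\<lambda>t. osc (P.r t)) \<le> integral {0..1::real} (\<lambda>t. 2 * norm l)"
      by (intro integral_le True) auto
    then show ?thesis using l \<epsilon> by (simp add: hofer_norm_def)
  next
    case False
    then show ?thesis using \<epsilon> by (simp add: hofer_norm_def not_integrable_integral)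
  qed
  have osc: "osc (\<lambda>p. - P.r t p + U t p) \<noteq> 0" if t: "t \<in> {0..1}" for t
    using differ[of t ?u] avoid[OF t] P.osc_nonzero[OF t] by blast
  have reg: "regular_isotopy A \<Psi>" if "generates A \<omega> g (P.V, H) \<Psi>" for \<Psi>
  proof (rule P.regular[OF _ that])
    fix t :: real assume "t \<in> {0..1}"
    then show "\<exists>y v. y \<in> ball x0 R \<and> ext_d0 (scalar_rep (U t)) c0 y v + H t c0 y v \<noteq> (Re (?z t) + Im (?z t) * F y) * DF y v"
      using differ[of t ?w] avoid by blast
  qed
  have V: "(\<lambda>t p. - P.r t (P.theta t p) + U t (P.theta t p) + Delta_normalized A \<omega> H P.theta t p) = P.V"
    by (intro ext) (rule P.V_def[symmetric])
  show "\<exists>r \<theta>. hamiltonian_loop A \<omega> g r \<theta> \<and> \<theta> \<in> N \<and> hofer_norm r < \<epsilon> \<and>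
      (\<forall>t\<in>{0..1}. osc (\<lambda>p. - r t p + U t p) \<noteq> 0) \<and>
      (let V = (\<lambda>t p. - r t (\<theta> t p) + U t (\<theta> t p) + Delta_normalized A \<omega> H \<theta> t p) in
        generates A \<omega> g (V, H) (isotopy_comp (isotopy_inv \<theta>) \<Phi>) \<and>
        (\<forall>\<Psi>. generates A \<omega> g (V, H) \<Psi> \<longrightarrow> regular_isotopy A \<Psi>))"
    by (rule exI[of _ P.r], rule exI[of _ P.theta], unfold Let_def V)
      (intro conjI ballI allI impI loop inN hofer osc P.Psi_generates reg)
qed

end
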